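(* For $x\in W$ and $i\in I$, we have, with $\beta=\Lambda_i-x\Lambda_i$, $$\mathrm{Ext}^1_{R(\beta)}\bigl(\widehat M(x\Lambda_i,\Lambda_i),\,M(x\Lambda_i,\Lambda_i)\bigr)=0 .$$
   Context: Root datum. Fix a symmetrizable generalized Cartan matrix $(c_{i,j})_{i,j\in I}$, a free abelian group $P$, linearly independent simple roots $\alpha_i\in P$, simple coroots $h_i\in\mathrm{Hom}_{\mathbb Z}(P,\mathbb Z)$ and a $\mathbb Q$-valued symmetric bilinear form $(\cdot,\cdot)$ on $P$ with $c_{i,j}=\langle h_i,\alpha_j\rangle$, $(\alpha_i,\alpha_i)\in2\mathbb Z_{>0}$, $\langle h_i,\mu\rangle=2(\alpha_i,\mu)/(\alpha_i,\alpha_i)$, and fundamental weights $\Lambda_i\in P$ with $\langle h_j,\Lambda_i\rangle=\delta_{i,j}$. $W$ is the Weyl group with simple reflections $s_i$; $Q_+=\sum_i\mathbb Z_{\ge0}\alpha_i$, $\mathrm{ht}$ is the height. Quiver Hecke algebra. $\mathbf k$ is a field of arbitrary characteristic. Fix $Q_{i,j}(u,v)\in\mathbf k[u,v]$ with $Q_{i,i}=0$, $Q_{i,j}(u,v)=Q_{j,i}(v,u)$, and for $i\ne j$: $Q_{i,j}$ is homogeneous of degree $-2(\alpha_i,\alpha_j)$ when $\deg u=(\alpha_i,\alpha_i),\deg v=(\alpha_j,\alpha_j)$, and $Q_{i,j}(u,0)\neq0\neq Q_{i,j}(0,v)$. For $\beta\in Q_+$ of height $n$, $I^\beta=\{\nu\in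 I^n\mid\sum_k\alpha_{\nu_k}=\beta\}$, and $R(\beta)$ is the $\mathbf k$-algebra with generators $e(\nu)$ ($\nu\in I^\beta$), $x_k$ ($1\le k\le n$), $\tau_k$ ($1\le k<n$) and relations: $e(\nu)e(\nu')=\delta_{\nu,\nu'}e(\nu)$, $\sum_\nu e(\nu)=1$; $x_ke(\nu)=e(\nu)x_k$, $x_kx_m=x_mx_k$; $\tau_ke(\nu)=e(s_k\nu)\tau_k$, $\tau_k\tau_m=\tau_m\tau_k$ if $|k-m|\ge2$, and ($x_m$ commutes with $\tau_k$ for $m\ne k,k+1$); $(\tau_kx_{k+1}-x_k\tau_k)e(\nu)=(x_{k+1}\tau_k-\tau_kx_k)e(\nu)=\delta_{\nu_k,\nu_{k+1}}e(\nu)$; $\tau_k^2e(\nu)=Q_{\nu_k,\nu_{k+1}}(x_k,x_{k+1})e(\nu)$; $(\tau_{k+1}\tau_k\tau_{k+1}-\tau_k\tau_{k+1}\tau_k)e(\nu)=\frac{Q_{\nu_k,\nu_{k+1}}(x_k,x_{k+1})-Q_{\nu_k,\nu_{k+1}}(x_{k+2},x_{k+1})}{x_k-x_{k+2}}e(\nu)$ if $\nu_k=\nu_{k+2}\ne\nu_{k+1}$ and $0$ otherwise. Grading: $\deg e(\nu)=0$, $\deg x_ke(\nu)=(\alpha_{\nu_k},\alpha_{\nu_k})$, $\deg\tau_ke(\nu)=-(\alpha_{\nu_k},\alpha_{\nu_{k+1}})$. Modules are graded left modules; $(q^nM)_d=M_{d-n}$; $\mathrm{Hom}(M,N)=\bigoplus_d\mathrm{hom}(q^dM,N)$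 ($\mathrm{hom}$ = degree-0 maps) and $\mathrm{Ext}^k(M,N)=\bigoplus_d\mathrm{ext}^k(q^dM,N)$, computed in graded $R(\beta)$-modules. $e(\beta,\gamma)=\sum_{\nu\in I^\beta,\nu'\in I^\gamma}e(\nu,\nu')$. A finite-dimensional $M$ is self-dual if isomorphic to $\mathrm{Hom}_{\mathbf k}(M,\mathbf k)$ with $R(\beta)$ acting via the anti-involution fixing all generators. $L(i^n)$ is the self-dual simple $R(n\alpha_i)$-module, $P(i^n)$ its projective cover. Modules $M(x\Lambda_i,\Lambda_i)$, $\widehat M(x\Lambda_i,\Lambda_i)$. For $i\in I$ let $z$ have degree $(\alpha_i,\alpha_i)$ and, for $\mu=\Lambda_i-\gamma$, $\gamma\in Q_+$, $n=\mathrm{ht}\gamma$, let $R_z^{\Lambda_i}(\mu)$ be the quotient of $R(\gamma)\otimes\mathbf k[z]$ by the two-sided ideal generated by $e(\nu)$ ($\nu_n\ne i$) and $(x_n-z)e(\nu)$ ($\nu_n=i$) (and $R_z^{\Lambda_i}(\Lambda_i)=\mathbf k[z]$). Put $F_j^{(a)}X=R_z^{\Lambda_i}(\mu-a\alpha_j)e(a\alpha_j,\gamma)\otimes_{R(a\alpha_j)\otimes R_z^{\Lambda_i}(\mu)}(P(j^a)\otimes X)$ for a graded $R_z^{\Lambda_i}(\mu)$-module $X$. For $x\in W$ with reduced expression $x=s_{k_1}\cdots s_{k_m}$, put $a_t=\langle h_{k_t},s_{k_{t+1}}\cdots s_{k_m}\Lambda_i\rangle$ and $\widehat M(x\Lambda_i,\Lambda_i)=F_{k_1}^{(a_1)}\cdots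 F_{k_m}^{(a_m)}\mathbf k[z]$, a graded $R(\Lambda_i-x\Lambda_i)$-module with endomorphism $z$. $M(x\Lambda_i,\Lambda_i)=\widehat M(x\Lambda_i,\Lambda_i)/z\widehat M(x\Lambda_i,\Lambda_i)$ is a self-dual simple module (the determinantial module). *)

theory Defs
  imports "HOL-Algebra.Algebra" "HOL-Library.Poly_Mapping" "HOL-Library.Product_Plus"
begin

section \<open>Root data and Weyl groups\<close>

text \<open>The lattice \<open>P\<close> is the type \<open>'p\<close>, the index set \<open>I\<close> is the type \<open>'i\<close>.\<close>

record ('i, 'p) root_datum =
  cartan :: "'i \<Rightarrow> 'i \<Rightarrow> int"
  sroot :: "'i \<Rightarrow> 'p"
  coroot :: "'i \<Rightarrow> 'p \<Rightarrow> int"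
  form :: "'p \<Rightarrow> 'p \<Rightarrow> rat"
  fund :: "'i \<Rightarrow> 'p"

definition type_group :: "'p::ab_group_add monoid" where
  "type_group = \<lparr>carrier = UNIV, monoid.mult = (+), one = 0\<rparr>"

definition zscale :: "int \<Rightarrow> 'p::ab_group_add \<Rightarrow> 'p" where
  "zscale n x = x [^]\<^bsub>type_group\<^esub> n"

definition gen_cartan_matrix :: "('i \<Rightarrow> 'i \<Rightarrow> int) \<Rightarrow> bool" where
  "gen_cartan_matrix c \<longleftrightarrow>
     (\<forall>i. c i i = 2) \<and> (\<forall>i j. i \<noteq> j \<longrightarrow> c i j \<le> 0) \<and> (\<forall>i j. c i j = 0 \<longleftrightarrow> c j i = 0)"

definition symmetrizable :: "('i \<Rightarrow> 'i \<Rightarrow> int) \<Rightarrow> bool" where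
  "symmetrizable c \<longleftrightarrow>
     (\<exists>d::'i \<Rightarrow> rat. (\<forall>i. d i > 0) \<and> (\<forall>i j. d i * of_int (c i j) = d j * of_int (c j i)))"

definition is_root_datum :: "('i, 'p::ab_group_add) root_datum \<Rightarrow> bool" where
  "is_root_datum D \<longleftrightarrow>
     gen_cartan_matrix (cartan D) \<and> symmetrizable (cartan D) \<and>
     (\<exists>B::'p set. (type_group :: 'p monoid) \<cong> free_Abelian_group B) \<and>
     (\<forall>S f. finite S \<and> (\<Sum>i\<in>S. zscale (f i) (sroot D i)) = 0 \<longrightarrow> (\<forall>i\<in>S. f i = 0)) \<and>
     (\<forall>i x y. coroot D i (x + y) = coroot D i x + coroot D i y) \<and>
     (\<forall>x y. form D x y = form D y x) \<and>
     (\<forall>x y z. form D (x + y) z = form D x z + form D y z) \<and>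
     (\<forall>i j. cartan D i j = coroot D i (sroot D j)) \<and>
     (\<forall>i. \<exists>n::nat. n > 0 \<and> form D (sroot D i) (sroot D i) = 2 * of_nat n) \<and>
     (\<forall>i x. of_int (coroot D i x) = 2 * form D (sroot D i) x / form D (sroot D i) (sroot D i)) \<and>
     (\<forall>i j. coroot D j (fund D i) = (if i = j then 1 else 0))"

definition simple_refl :: "('i, 'p::ab_group_add) root_datum \<Rightarrow> 'i \<Rightarrow> 'p \<Rightarrow> 'p" where
  "simple_refl D i x = x - zscale (coroot D i x) (sroot D i)"

definition weyl_group :: "('i, 'p::ab_group_add) root_datum \<Rightarrow> ('p \<Rightarrow> 'p) set" where
  "weyl_group D = generate (BijGroup UNIV) (range (simple_refl D))"

definition refl_word :: "('i, 'p::ab_group_add) root_datum \<Rightarrow> 'i list \<Rightarrow> 'p \<Rightarrow> 'p" where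
  "refl_word D ks = foldr (\<lambda>k f. simple_refl D k \<circ> f) ks id"

definition reduced_expression ::
  "('i, 'p::ab_group_add) root_datum \<Rightarrow> ('p \<Rightarrow> 'p) \<Rightarrow> 'i list \<Rightarrow> bool" where
  "reduced_expression D x ks \<longleftrightarrow>
     x = refl_word D ks \<and> (\<forall>ls. x = refl_word D ls \<longrightarrow> length ks \<le> length ls)"

text \<open>For a root datum, \<open>(\<alpha>\<^sub>i, \<alpha>\<^sub>j) = c\<^sub>i\<^sub>j (\<alpha>\<^sub>i, \<alpha>\<^sub>i) / 2\<close> is an integer,
  so the floor only changes the type.\<close>

definition ideg :: "('i, 'p) root_datum \<Rightarrow> 'i \<Rightarrow> 'i \<Rightarrow> int" where
  "ideg D i j = \<lfloor>form D (sroot D i) (sroot D j)\<rfloor>"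

definition seqs :: "('i, 'p::ab_group_add) root_datum \<Rightarrow> 'p \<Rightarrow> 'i list set" where
  "seqs D \<beta> = {\<nu>. (\<Sum>j\<leftarrow>\<nu>. sroot D j) = \<beta>}"

text \<open>Meaningful for \<open>\<beta> \<in> Q\<^sub>+\<close>; the simple roots being linearly independent, all members of
  \<open>I\<^sup>\<beta>\<close> have the same length.\<close>

definition ht :: "('i, 'p::ab_group_add) root_datum \<Rightarrow> 'p \<Rightarrow> nat" where
  "ht D \<beta> = (THE n. \<exists>\<nu>\<in>seqs D \<beta>. length \<nu> = n)"


section \<open>Graded algebras and graded modules\<close>

text \<open>A graded \<open>'k\<close>-algebra is a record over the scalars \<open>'k\<close>. A graded left module over an
  algebra with elements in \<open>'a\<close> is a record over the scalars \<open>'a\<close>; its fields \<open>mult\<close> and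
  \<open>one\<close> are irrelevant.\<close>

record ('a, 'b) graded = "('a, 'b) module" +
  homog :: "int \<Rightarrow> 'b set"

locale left_module = R?: ring R + M?: abelian_group M
  for R :: "('a, 'r) ring_scheme" (structure) and M :: "('a, 'm, 'z) module_scheme" (structure) +
  assumes smult_closed: "\<lbrakk>a \<in> carrier R; x \<in> carrier M\<rbrakk> \<Longrightarrow> a \<odot>\<^bsub>M\<^esub> x \<in> carrier M"
    and smult_l_distr: "\<lbrakk>a \<in> carrier R; b \<in> carrier R; x \<in> carrier M\<rbrakk> \<Longrightarrow>
      (a \<oplus> b) \<odot>\<^bsub>M\<^esub> x = a \<odot>\<^bsub>M\<^esub> x \<oplus>\<^bsub>M\<^esub> b \<odot>\<^bsub>M\<^esub> x"
    and smult_r_distr: "\<lbrakk>a \<in> carrier R; x \<in> carrier M; y \<in> carrier M\<rbrakk> \<Longrightarrow>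
      a \<odot>\<^bsub>M\<^esub> (x \<oplus>\<^bsub>M\<^esub> y) = a \<odot>\<^bsub>M\<^esub> x \<oplus>\<^bsub>M\<^esub> a \<odot>\<^bsub>M\<^esub> y"
    and smult_assoc1: "\<lbrakk>a \<in> carrier R; b \<in> carrier R; x \<in> carrier M\<rbrakk> \<Longrightarrow>
      (a \<otimes> b) \<odot>\<^bsub>M\<^esub> x = a \<odot>\<^bsub>M\<^esub> (b \<odot>\<^bsub>M\<^esub> x)"
    and smult_one: "x \<in> carrier M \<Longrightarrow> \<one> \<odot>\<^bsub>M\<^esub> x = x"

definition graded_module :: "('k, 'a) graded \<Rightarrow> ('a, 'm) graded \<Rightarrow> bool" where
  "graded_module A M \<longleftrightarrow>
     left_module A M \<and>
     (\<forall>d. subgroup (homog M d) (add_monoid M)) \<and>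
     (\<forall>d e. \<forall>a\<in>homog A d. \<forall>m\<in>homog M e. a \<odot>\<^bsub>M\<^esub> m \<in> homog M (d + e)) \<and>
     carrier M = generate (add_monoid M) (\<Union>d. homog M d) \<and>
     (\<forall>f S. finite S \<and> (\<forall>d\<in>S. f d \<in> homog M d) \<and> (\<Oplus>\<^bsub>M\<^esub>d\<in>S. f d) = \<zero>\<^bsub>M\<^esub> \<longrightarrow>
        (\<forall>d\<in>S. f d = \<zero>\<^bsub>M\<^esub>))"

definition graded_submodule :: "('k, 'a) graded \<Rightarrow> ('a, 'm) graded \<Rightarrow> 'm set \<Rightarrow> bool" where
  "graded_submodule A M N \<longleftrightarrow>
     subgroup N (add_monoid M) \<and>
     (\<forall>a\<in>carrier A. \<forall>n\<in>N. a \<odot>\<^bsub>M\<^esub> n \<in> N) \<and>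
     N = generate (add_monoid M) (\<Union>d. N \<inter> homog M d)"

definition graded_shift :: "int \<Rightarrow> ('a, 'm) graded \<Rightarrow> ('a, 'm) graded" where
  "graded_shift n M = M\<lparr>homog := (\<lambda>d. homog M (d - n))\<rparr>"

definition graded_hom ::
  "('k, 'a) graded \<Rightarrow> ('a, 'm) graded \<Rightarrow> ('a, 'n) graded \<Rightarrow> ('m \<Rightarrow> 'n) set" where
  "graded_hom A M N = {f \<in> carrier M \<rightarrow>\<^sub>E carrier N.
     (\<forall>x\<in>carrier M. \<forall>y\<in>carrier M. f (x \<oplus>\<^bsub>M\<^esub> y) = f x \<oplus>\<^bsub>N\<^esub> f y) \<and>
     (\<forall>a\<in>carrier A. \<forall>x\<in>carrier M. f (a \<odot>\<^bsub>M\<^esub> x) = a \<odot>\<^bsub>N\<^esub> f x) \<and>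
     (\<forall>d. f ` homog M d \<subseteq> homog N d)}"

definition graded_isomorphic ::
  "('k, 'a) graded \<Rightarrow> ('a, 'm) graded \<Rightarrow> ('a, 'n) graded \<Rightarrow> bool" where
  "graded_isomorphic A M N \<longleftrightarrow>
     (\<exists>f\<in>graded_hom A M N. bij_betw f (carrier M) (carrier N) \<and>
        (\<forall>d. f ` homog M d = homog N d))"

text \<open>Quotient of an algebra by a two-sided ideal, or of a module by a submodule; on the ring
  part this is \<^const>\<open>FactRing\<close>.\<close>

definition quot :: "('a, 'b) graded \<Rightarrow> 'b set \<Rightarrow> ('a, 'b set) graded" where
  "quot M N = \<lparr>carrier = carrier (M Quot N), monoid.mult = monoid.mult (M Quot N),
     one = monoid.one (M Quot N), ring.zero = ring.zero (M Quot N),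
     ring.add = ring.add (M Quot N),
     module.smult = (\<lambda>a C. \<Union>m\<in>C. N +>\<^bsub>M\<^esub> (a \<odot>\<^bsub>M\<^esub> m)),
     homog = (\<lambda>d. (\<lambda>m. N +>\<^bsub>M\<^esub> m) ` homog M d)\<rparr>"

definition regular_module :: "('k, 'a) graded \<Rightarrow> ('a, 'a) graded" where
  "regular_module A = \<lparr>carrier = carrier A, monoid.mult = monoid.mult A, one = monoid.one A,
     ring.zero = ring.zero A, ring.add = ring.add A,
     module.smult = monoid.mult A, homog = homog A\<rparr>"

definition graded_simple :: "('k, 'a) graded \<Rightarrow> ('a, 'm) graded \<Rightarrow> bool" where
  "graded_simple A M \<longleftrightarrow> graded_module A M \<and> carrier M \<noteq> {\<zero>\<^bsub>M\<^esub>} \<and>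
     (\<forall>N. graded_submodule A M N \<longrightarrow> N = {\<zero>\<^bsub>M\<^esub>} \<or> N = carrier M)"

definition finite_dimensional :: "('k, 'a) graded \<Rightarrow> ('a, 'm) graded \<Rightarrow> bool" where
  "finite_dimensional A M \<longleftrightarrow> (\<exists>B. finite B \<and> B \<subseteq> carrier M \<and>
     carrier M = generate (add_monoid M) {(c \<odot>\<^bsub>A\<^esub> \<one>\<^bsub>A\<^esub>) \<odot>\<^bsub>M\<^esub> b |c b. b \<in> B})"

text \<open>Projectivity in the category of graded modules: lifting along surjections \<open>M \<rightarrow> N\<close>. In
  HOL the test modules have to live on a fixed type; \<open>'p \<Rightarrow> 'a\<close> is large enough to contain a
  copy of \<open>P\<close> and of a graded free module covering \<open>P\<close> (finitely supported functions
  on the homogeneous elements of \<open>P\<close>), so nothing is lost.\<close>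

definition graded_projective :: "('k, 'a) graded \<Rightarrow> ('a, 'p) graded \<Rightarrow> bool" where
  "graded_projective A P \<longleftrightarrow> graded_module A P \<and>
     (\<forall>(M::('a, 'p \<Rightarrow> 'a) graded) (N::('a, 'p \<Rightarrow> 'a) graded) g f.
        graded_module A M \<and> graded_module A N \<and>
        g \<in> graded_hom A M N \<and> g ` carrier M = carrier N \<and> f \<in> graded_hom A P N \<longrightarrow>
        (\<exists>h\<in>graded_hom A P M. \<forall>x\<in>carrier P. g (h x) = f x))"

definition hom_kernel :: "('a, 'm) graded \<Rightarrow> ('a, 'n) graded \<Rightarrow> ('m \<Rightarrow> 'n) \<Rightarrow> 'm set" where
  "hom_kernel M N f = {x \<in> carrier M. f x = \<zero>\<^bsub>N\<^esub>}"

definition projective_cover :: "('k, 'a) graded \<Rightarrow> ('a, 'p) graded \<Rightarrow> ('a, 'l) graded \<Rightarrow> bool" where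
  "projective_cover A P L \<longleftrightarrow> graded_projective A P \<and>
     (\<exists>f\<in>graded_hom A P L. f ` carrier P = carrier L \<and>
        (\<forall>N. graded_submodule A P N \<and> N <+>\<^bsub>P\<^esub> hom_kernel P L f = carrier P \<longrightarrow>
           N = carrier P))"


section \<open>Ext groups of graded modules\<close>

definition projective_resolution ::
  "('k, 'a) graded \<Rightarrow> ('a, 'm) graded \<Rightarrow> (nat \<Rightarrow> ('a, 'p) graded) \<Rightarrow>
     (nat \<Rightarrow> 'p \<Rightarrow> 'p) \<Rightarrow> ('p \<Rightarrow> 'm) \<Rightarrow> bool" where
  "projective_resolution A M P \<delta> \<epsilon> \<longleftrightarrow>
     (\<forall>n. graded_projective A (P n)) \<and>
     (\<forall>n. \<delta> n \<in> graded_hom A (P (Suc n)) (P n)) \<and>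
     \<epsilon> \<in> graded_hom A (P 0) M \<and> \<epsilon> ` carrier (P 0) = carrier M \<and>
     hom_kernel (P 0) M \<epsilon> = \<delta> 0 ` carrier (P (Suc 0)) \<and>
     (\<forall>n. hom_kernel (P (Suc n)) (P n) (\<delta> n) = \<delta> (Suc n) ` carrier (P (Suc (Suc n))))"

definition hom_group ::
  "('k, 'a) graded \<Rightarrow> ('a, 'm) graded \<Rightarrow> ('a, 'n) graded \<Rightarrow> ('m \<Rightarrow> 'n) monoid" where
  "hom_group A M N = \<lparr>carrier = graded_hom A M N,
     monoid.mult = (\<lambda>f g. \<lambda>x\<in>carrier M. f x \<oplus>\<^bsub>N\<^esub> g x), one = (\<lambda>x\<in>carrier M. \<zero>\<^bsub>N\<^esub>)\<rparr>"

definition cocycles ::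
  "('k, 'a) graded \<Rightarrow> (nat \<Rightarrow> ('a, 'p) graded) \<Rightarrow> (nat \<Rightarrow> 'p \<Rightarrow> 'p) \<Rightarrow> ('a, 'n) graded \<Rightarrow>
     nat \<Rightarrow> ('p \<Rightarrow> 'n) set" where
  "cocycles A P \<delta> N k = {f \<in> graded_hom A (P k) N.
     compose (carrier (P (Suc k))) f (\<delta> k) = \<one>\<^bsub>hom_group A (P (Suc k)) N\<^esub>}"

definition coboundaries ::
  "('k, 'a) graded \<Rightarrow> (nat \<Rightarrow> ('a, 'p) graded) \<Rightarrow> (nat \<Rightarrow> 'p \<Rightarrow> 'p) \<Rightarrow> ('a, 'n) graded \<Rightarrow>
     nat \<Rightarrow> ('p \<Rightarrow> 'n) set" where
  "coboundaries A P \<delta> N k = (case k of 0 \<Rightarrow> {\<one>\<^bsub>hom_group A (P 0) N\<^esub>}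
     | Suc j \<Rightarrow> (\<lambda>g. compose (carrier (P (Suc j))) g (\<delta> j)) ` graded_hom A (P j) N)"

text \<open>\<open>ext\<^sup>k(M, N)\<close> and \<open>Ext\<^sup>k(M, N) = \<Oplus>\<^sub>d ext\<^sup>k(q\<^sup>d M, N)\<close>, computed from a projective
  resolution \<open>(P, \<delta>)\<close> of \<open>M\<close>; shifting it by \<open>d\<close> gives one of \<open>q\<^sup>d M\<close>.\<close>

definition ext_group ::
  "('k, 'a) graded \<Rightarrow> (nat \<Rightarrow> ('a, 'p) graded) \<Rightarrow> (nat \<Rightarrow> 'p \<Rightarrow> 'p) \<Rightarrow> ('a, 'n) graded \<Rightarrow>
     nat \<Rightarrow> ('p \<Rightarrow> 'n) set monoid" where
  "ext_group A P \<delta> N k =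
     (hom_group A (P k) N)\<lparr>carrier := cocycles A P \<delta> N k\<rparr> Mod coboundaries A P \<delta> N k"

definition Ext_group ::
  "('k, 'a) graded \<Rightarrow> (nat \<Rightarrow> ('a, 'p) graded) \<Rightarrow> (nat \<Rightarrow> 'p \<Rightarrow> 'p) \<Rightarrow> ('a, 'n) graded \<Rightarrow>
     nat \<Rightarrow> (int \<Rightarrow> ('p \<Rightarrow> 'n) set) monoid" where
  "Ext_group A P \<delta> N k =
     sum_group UNIV (\<lambda>d::int. ext_group A (\<lambda>n. graded_shift d (P n)) \<delta> N k)"


section \<open>Free algebras\<close>

text \<open>Concatenation makes words a monoid, written additively, so that the convolution product of
  \<^theory>\<open>HOL-Library.Poly_Mapping\<close> on \<open>'g list \<Rightarrow>\<^sub>0 'k\<close> is that of the free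
  associative algebra.\<close>

instantiation list :: (type) monoid_add
begin
definition plus_list_def: "xs + ys = xs @ (ys :: 'a list)"
definition zero_list_def: "0 = ([] :: 'a list)"
instance by standard (simp_all add: plus_list_def zero_list_def)
end

type_synonym ('g, 'k) ncpoly = "'g list \<Rightarrow>\<^sub>0 'k"

definition nc_gen :: "'g \<Rightarrow> ('g, 'k::field) ncpoly" where
  "nc_gen g = Poly_Mapping.single [g] 1"

definition nc_const :: "'k::field \<Rightarrow> ('g, 'k) ncpoly" where
  "nc_const c = Poly_Mapping.single [] c"

text \<open>The free algebra on the subset \<open>G\<close> of the type of letters. It is only used through its
  quotients, whose grading is defined separately.\<close>

definition free_algebra :: "'g set \<Rightarrow> ('k::field, ('g, 'k) ncpoly) graded" where
  "free_algebra G = \<lparr>carrier = {f. \<forall>w\<in>Poly_Mapping.keys f. set w \<subseteq> G}, monoid.mult = (*), one = 1,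
     ring.zero = 0, ring.add = (+), module.smult = (\<lambda>c f. nc_const c * f), homog = (\<lambda>_. {})\<rparr>"

text \<open>The additive map from the free algebra to \<open>A\<close> with
  \<open>g\<^sub>1 \<cdots> g\<^sub>r \<mapsto> \<phi> g\<^sub>1 \<cdots> \<phi> g\<^sub>r u\<close>.\<close>

definition nc_eval :: "('k::field, 'a) graded \<Rightarrow> 'a \<Rightarrow> ('g \<Rightarrow> 'a) \<Rightarrow> ('g, 'k) ncpoly \<Rightarrow> 'a" where
  "nc_eval A u \<phi> f = (\<Oplus>\<^bsub>A\<^esub>w\<in>Poly_Mapping.keys f.
     Poly_Mapping.lookup f w \<odot>\<^bsub>A\<^esub> foldr (\<lambda>g r. \<phi> g \<otimes>\<^bsub>A\<^esub> r) w u)"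


section \<open>Quiver Hecke algebras\<close>

text \<open>The coefficient of \<open>u\<^sup>a v\<^sup>b\<close> in \<open>Q\<^sub>i\<^sub>,\<^sub>j(u, v)\<close> is \<open>lookup (Q i j) (a, b)\<close>.\<close>

type_synonym ('i, 'k) qparam = "'i \<Rightarrow> 'i \<Rightarrow> (nat \<times> nat) \<Rightarrow>\<^sub>0 'k"

definition is_qparam :: "('i, 'p::ab_group_add) root_datum \<Rightarrow> ('i, 'k::field) qparam \<Rightarrow> bool" where
  "is_qparam D Q \<longleftrightarrow>
     (\<forall>i. Q i i = 0) \<and>
     (\<forall>i j a b. Poly_Mapping.lookup (Q i j) (a, b) = Poly_Mapping.lookup (Q j i) (b, a)) \<and>
     (\<forall>i j. i \<noteq> j \<longrightarrow>
        (\<forall>(a, b)\<in>Poly_Mapping.keys (Q i j).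
           of_nat a * form D (sroot D i) (sroot D i) + of_nat b * form D (sroot D j) (sroot D j) =
             - 2 * form D (sroot D i) (sroot D j)) \<and>
        (\<exists>a. Poly_Mapping.lookup (Q i j) (a, 0) \<noteq> 0) \<and>
        (\<exists>b. Poly_Mapping.lookup (Q i j) (0, b) \<noteq> 0))"

datatype 'i klr_gen = Gen_e "'i list" | Gen_x nat | Gen_tau nat

type_synonym ('i, 'k) klr_free = "('i klr_gen, 'k) ncpoly"

abbreviation e_gen :: "'i list \<Rightarrow> ('i, 'k::field) klr_free" where
  "e_gen \<nu> \<equiv> nc_gen (Gen_e \<nu>)"
abbreviation x_gen :: "nat \<Rightarrow> ('i, 'k::field) klr_free" where
  "x_gen k \<equiv> nc_gen (Gen_x k)"
abbreviation tau_gen :: "nat \<Rightarrow> ('i, 'k::field) klr_free" where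
  "tau_gen k \<equiv> nc_gen (Gen_tau k)"

text \<open>Positions in \<open>\<nu>\<close> are counted from 1.\<close>

definition pos :: "'i list \<Rightarrow> nat \<Rightarrow> 'i" where
  "pos \<nu> k = \<nu> ! (k - 1)"

definition swap_pos :: "nat \<Rightarrow> 'i list \<Rightarrow> 'i list" where
  "swap_pos k \<nu> = \<nu>[k - 1 := pos \<nu> (k + 1), k := pos \<nu> k]"

definition q_eval :: "((nat \<times> nat) \<Rightarrow>\<^sub>0 'k::field) \<Rightarrow> ('g, 'k) ncpoly \<Rightarrow> ('g, 'k) ncpoly \<Rightarrow>
    ('g, 'k) ncpoly" where
  "q_eval q u v = (\<Sum>(a, b)\<in>Poly_Mapping.keys q.
     nc_const (Poly_Mapping.lookup q (a, b)) * u ^ a * v ^ b)"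

text \<open>The polynomial \<open>(q(u, v) - q(w, v)) / (u - w)\<close>, using
  \<open>(u\<^sup>a - w\<^sup>a) / (u - w) = \<Sum>s<a. u\<^sup>s w\<^bsup>a-1-s\<^esup>\<close>.\<close>

definition q_diff :: "((nat \<times> nat) \<Rightarrow>\<^sub>0 'k::field) \<Rightarrow> ('g, 'k) ncpoly \<Rightarrow> ('g, 'k) ncpoly \<Rightarrow>
    ('g, 'k) ncpoly \<Rightarrow> ('g, 'k) ncpoly" where
  "q_diff q u w v = (\<Sum>(a, b)\<in>Poly_Mapping.keys q.
     nc_const (Poly_Mapping.lookup q (a, b)) * (\<Sum>s<a. u ^ s * w ^ (a - 1 - s)) * v ^ b)"

definition klr_gens :: "('i, 'p::ab_group_add) root_datum \<Rightarrow> 'p \<Rightarrow> 'i klr_gen set" where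
  "klr_gens D \<beta> = Gen_e ` seqs D \<beta> \<union> Gen_x ` {1..ht D \<beta>} \<union> Gen_tau ` {1..<ht D \<beta>}"

inductive_set klr_rels ::
  "('i, 'p::ab_group_add) root_datum \<Rightarrow> ('i, 'k::field) qparam \<Rightarrow> 'p \<Rightarrow> ('i, 'k) klr_free set"
  for D Q \<beta> where
  e_e: "\<lbrakk>\<nu> \<in> seqs D \<beta>; \<nu>' \<in> seqs D \<beta>\<rbrakk> \<Longrightarrow>
    e_gen \<nu> * e_gen \<nu>' - (if \<nu> = \<nu>' then e_gen \<nu> else 0) \<in> klr_rels D Q \<beta>"
| e_sum: "(\<Sum>\<nu>\<in>seqs D \<beta>. e_gen \<nu>) - 1 \<in> klr_rels D Q \<beta>"
| x_e: "\<lbrakk>\<nu> \<in> seqs D \<beta>; k \<in> {1..ht D \<beta>}\<rbrakk> \<Longrightarrow>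
    x_gen k * e_gen \<nu> - e_gen \<nu> * x_gen k \<in> klr_rels D Q \<beta>"
| x_x: "\<lbrakk>k \<in> {1..ht D \<beta>}; m \<in> {1..ht D \<beta>}\<rbrakk> \<Longrightarrow>
    x_gen k * x_gen m - x_gen m * x_gen k \<in> klr_rels D Q \<beta>"
| tau_e: "\<lbrakk>\<nu> \<in> seqs D \<beta>; k \<in> {1..<ht D \<beta>}\<rbrakk> \<Longrightarrow>
    tau_gen k * e_gen \<nu> - e_gen (swap_pos k \<nu>) * tau_gen k \<in> klr_rels D Q \<beta>"
| tau_tau: "\<lbrakk>k \<in> {1..<ht D \<beta>}; m \<in> {1..<ht D \<beta>}; k + 2 \<le> m \<or> m + 2 \<le> k\<rbrakk> \<Longrightarrow>
    tau_gen k * tau_gen m - tau_gen m * tau_gen k \<in> klr_rels D Q \<beta>"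
| x_tau: "\<lbrakk>k \<in> {1..<ht D \<beta>}; m \<in> {1..ht D \<beta>}; m \<noteq> k; m \<noteq> k + 1\<rbrakk> \<Longrightarrow>
    x_gen m * tau_gen k - tau_gen k * x_gen m \<in> klr_rels D Q \<beta>"
| tau_x1: "\<lbrakk>\<nu> \<in> seqs D \<beta>; k \<in> {1..<ht D \<beta>}\<rbrakk> \<Longrightarrow>
    (tau_gen k * x_gen (k + 1) - x_gen k * tau_gen k) * e_gen \<nu>
      - (if pos \<nu> k = pos \<nu> (k + 1) then e_gen \<nu> else 0) \<in> klr_rels D Q \<beta>"
| tau_x2: "\<lbrakk>\<nu> \<in> seqs D \<beta>; k \<in> {1..<ht D \<beta>}\<rbrakk> \<Longrightarrow>
    (x_gen (k + 1) * tau_gen k - tau_gen k * x_gen k) * e_gen \<nu>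
      - (if pos \<nu> k = pos \<nu> (k + 1) then e_gen \<nu> else 0) \<in> klr_rels D Q \<beta>"
| tau_sq: "\<lbrakk>\<nu> \<in> seqs D \<beta>; k \<in> {1..<ht D \<beta>}\<rbrakk> \<Longrightarrow>
    tau_gen k * tau_gen k * e_gen \<nu>
      - q_eval (Q (pos \<nu> k) (pos \<nu> (k + 1))) (x_gen k) (x_gen (k + 1)) * e_gen \<nu>
      \<in> klr_rels D Q \<beta>"
| braid: "\<lbrakk>\<nu> \<in> seqs D \<beta>; 1 \<le> k; k + 2 \<le> ht D \<beta>\<rbrakk> \<Longrightarrow>
    (tau_gen (k + 1) * tau_gen k * tau_gen (k + 1) - tau_gen k * tau_gen (k + 1) * tau_gen k)
        * e_gen \<nu>
      - (if pos \<nu> k = pos \<nu> (k + 2) \<and> pos \<nu> k \<noteq> pos \<nu> (k + 1)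
         then q_diff (Q (pos \<nu> k) (pos \<nu> (k + 1))) (x_gen k) (x_gen (k + 2)) (x_gen (k + 1))
                * e_gen \<nu>
         else 0) \<in> klr_rels D Q \<beta>"

definition klr_ideal ::
  "('i, 'p::ab_group_add) root_datum \<Rightarrow> ('i, 'k::field) qparam \<Rightarrow> 'p \<Rightarrow> ('i, 'k) klr_free set" where
  "klr_ideal D Q \<beta> = genideal (free_algebra (klr_gens D \<beta>)) (klr_rels D Q \<beta>)"

definition klr_class ::
  "('i, 'p::ab_group_add) root_datum \<Rightarrow> ('i, 'k::field) qparam \<Rightarrow> 'p \<Rightarrow> ('i, 'k) klr_free \<Rightarrow>
     ('i, 'k) klr_free set" where
  "klr_class D Q \<beta> f = klr_ideal D Q \<beta> +>\<^bsub>free_algebra (klr_gens D \<beta>)\<^esub> f"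

text \<open>Products \<open>g\<^sub>1 \<cdots> g\<^sub>r\<close> of elements \<open>e(\<nu>)\<close>, \<open>x\<^sub>k e(\<nu>)\<close>, \<open>\<tau>\<^sub>k e(\<nu>)\<close>, with their degree.\<close>

inductive klr_monomial ::
  "('i, 'p::ab_group_add) root_datum \<Rightarrow> 'p \<Rightarrow> ('i, 'k::field) klr_free \<Rightarrow> int \<Rightarrow> bool"
  for D \<beta> where
  one: "klr_monomial D \<beta> 1 0"
| e: "\<lbrakk>klr_monomial D \<beta> f d; \<nu> \<in> seqs D \<beta>\<rbrakk> \<Longrightarrow> klr_monomial D \<beta> (e_gen \<nu> * f) d"
| x: "\<lbrakk>klr_monomial D \<beta> f d; \<nu> \<in> seqs D \<beta>; k \<in> {1..ht D \<beta>}\<rbrakk> \<Longrightarrow>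
    klr_monomial D \<beta> (x_gen k * e_gen \<nu> * f) (ideg D (pos \<nu> k) (pos \<nu> k) + d)"
| tau: "\<lbrakk>klr_monomial D \<beta> f d; \<nu> \<in> seqs D \<beta>; k \<in> {1..<ht D \<beta>}\<rbrakk> \<Longrightarrow>
    klr_monomial D \<beta> (tau_gen k * e_gen \<nu> * f) (- ideg D (pos \<nu> k) (pos \<nu> (k + 1)) + d)"

definition klr_algebra ::
  "('i, 'p::ab_group_add) root_datum \<Rightarrow> ('i, 'k::field) qparam \<Rightarrow> 'p \<Rightarrow>
     ('k, ('i, 'k) klr_free set) graded" where
  "klr_algebra D Q \<beta> =
     (let A = quot (free_algebra (klr_gens D \<beta>)) (klr_ideal D Q \<beta>)
      in A\<lparr>homog := \<lambda>d. generate (add_monoid A)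
             {c \<odot>\<^bsub>A\<^esub> klr_class D Q \<beta> f |c f. klr_monomial D \<beta> f d}\<rparr>)"

text \<open>The (non-unital) maps \<open>R(\<beta>) \<rightarrow> R(\<beta> + \<gamma>)\<close>, \<open>a \<mapsto> a \<otimes> 1\<close>, and \<open>R(\<gamma>) \<rightarrow> R(\<beta> + \<gamma>)\<close>,
  \<open>b \<mapsto> 1 \<otimes> b\<close>, with values in \<open>e(\<beta>, \<gamma>) R(\<beta> + \<gamma>) e(\<beta>, \<gamma>)\<close>. All representatives \<open>f\<close> of a class
  \<open>C\<close> give the same element of \<open>R(\<beta> + \<gamma>)\<close>, so the union is that element.\<close>

definition klr_idem ::
  "('i, 'p::ab_group_add) root_datum \<Rightarrow> ('i, 'k::field) qparam \<Rightarrow> 'p \<Rightarrow> 'p \<Rightarrow>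
     ('i, 'k) klr_free set" where
  "klr_idem D Q \<beta> \<gamma> =
     klr_class D Q (\<beta> + \<gamma>) (\<Sum>\<nu>\<in>seqs D \<beta>. \<Sum>\<nu>'\<in>seqs D \<gamma>. e_gen (\<nu> @ \<nu>'))"

definition klr_left ::
  "('i, 'p::ab_group_add) root_datum \<Rightarrow> ('i, 'k::field) qparam \<Rightarrow> 'p \<Rightarrow> 'p \<Rightarrow>
     ('i, 'k) klr_free set \<Rightarrow> ('i, 'k) klr_free set" where
  "klr_left D Q \<beta> \<gamma> C =
     (\<Union>f\<in>C. nc_eval (klr_algebra D Q (\<beta> + \<gamma>)) (klr_idem D Q \<beta> \<gamma>)
        (\<lambda>g. klr_class D Q (\<beta> + \<gamma>) (case g of
            Gen_e \<nu> \<Rightarrow> (\<Sum>\<nu>'\<in>seqs D \<gamma>. e_gen (\<nu> @ \<nu>'))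
          | Gen_x k \<Rightarrow> x_gen k
          | Gen_tau k \<Rightarrow> tau_gen k)) f)"

definition klr_right ::
  "('i, 'p::ab_group_add) root_datum \<Rightarrow> ('i, 'k::field) qparam \<Rightarrow> 'p \<Rightarrow> 'p \<Rightarrow>
     ('i, 'k) klr_free set \<Rightarrow> ('i, 'k) klr_free set" where
  "klr_right D Q \<beta> \<gamma> C =
     (\<Union>f\<in>C. nc_eval (klr_algebra D Q (\<beta> + \<gamma>)) (klr_idem D Q \<beta> \<gamma>)
        (\<lambda>g. klr_class D Q (\<beta> + \<gamma>) (case g of
            Gen_e \<nu>' \<Rightarrow> (\<Sum>\<nu>\<in>seqs D \<beta>. e_gen (\<nu> @ \<nu>'))
          | Gen_x k \<Rightarrow> x_gen (ht D \<beta> + k)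
          | Gen_tau k \<Rightarrow> tau_gen (ht D \<beta> + k))) f)"

text \<open>The dual \<open>Hom\<^sub>k(M, k)\<close>, on which \<open>R(\<beta>)\<close> acts through the anti-involution fixing all
  generators, that is, induced by reversing words.\<close>

definition klr_anti :: "('i, 'k::field) klr_free set \<Rightarrow> ('i, 'k) klr_free set" where
  "klr_anti C = Poly_Mapping.map_key rev ` C"

definition klr_dual ::
  "('k::field, ('i, 'k) klr_free set) graded \<Rightarrow> (('i, 'k) klr_free set, 'm) graded \<Rightarrow>
     (('i, 'k) klr_free set, 'm \<Rightarrow> 'k) graded" where
  "klr_dual A M =
     (let V = {\<phi> \<in> carrier M \<rightarrow>\<^sub>E UNIV.
            (\<forall>x\<in>carrier M. \<forall>y\<in>carrier M. \<phi> (x \<oplus>\<^bsub>M\<^esub> y) = \<phi> x + \<phi> y) \<and>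
            (\<forall>c. \<forall>x\<in>carrier M. \<phi> ((c \<odot>\<^bsub>A\<^esub> \<one>\<^bsub>A\<^esub>) \<odot>\<^bsub>M\<^esub> x) = c * \<phi> x)}
      in \<lparr>carrier = V, monoid.mult = undefined, one = undefined,
          ring.zero = (\<lambda>x\<in>carrier M. 0), ring.add = (\<lambda>\<phi> \<psi>. \<lambda>x\<in>carrier M. \<phi> x + \<psi> x),
          module.smult = (\<lambda>a \<phi>. \<lambda>x\<in>carrier M. \<phi> (klr_anti a \<odot>\<^bsub>M\<^esub> x)),
          homog = (\<lambda>d. {\<phi> \<in> V. \<forall>d'. d' \<noteq> - d \<longrightarrow> (\<forall>x\<in>homog M d'. \<phi> x = 0)})\<rparr>)"

definition self_dual ::
  "('k::field, ('i, 'k) klr_free set) graded \<Rightarrow> (('i, 'k) klr_free set, 'm) graded \<Rightarrow> bool" where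
  "self_dual A M \<longleftrightarrow> finite_dimensional A M \<and> graded_isomorphic A M (klr_dual A M)"


section \<open>Deformed cyclotomic quotients\<close>

text \<open>\<open>R(\<gamma>) \<otimes> k[z]\<close> is the polynomial ring \<open>R(\<gamma>)[z]\<close>.\<close>

definition klr_poly ::
  "('i, 'p::ab_group_add) root_datum \<Rightarrow> ('i, 'k::field) qparam \<Rightarrow> 'i \<Rightarrow> 'p \<Rightarrow>
     ('k, nat \<Rightarrow> ('i, 'k) klr_free set) graded" where
  "klr_poly D Q i \<gamma> = (let A = klr_algebra D Q \<gamma> in
     \<lparr>carrier = carrier (UP A), monoid.mult = monoid.mult (UP A), one = monoid.one (UP A),
      ring.zero = ring.zero (UP A), ring.add = ring.add (UP A),
      module.smult = (\<lambda>c p n. c \<odot>\<^bsub>A\<^esub> p n),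
      homog = (\<lambda>d. {p \<in> carrier (UP A). \<forall>n. p n \<in> homog A (d - int n * ideg D i i)})\<rparr>)"

definition cyc_ideal ::
  "('i, 'p::ab_group_add) root_datum \<Rightarrow> ('i, 'k::field) qparam \<Rightarrow> 'i \<Rightarrow> 'p \<Rightarrow>
     (nat \<Rightarrow> ('i, 'k) klr_free set) set" where
  "cyc_ideal D Q i \<gamma> =
     (let U = UP (klr_algebra D Q \<gamma>); cl = klr_class D Q \<gamma>; n = ht D \<gamma> in
      genideal (klr_poly D Q i \<gamma>)
        ({monom U (cl (e_gen \<nu>)) 0 |\<nu>. \<nu> \<in> seqs D \<gamma> \<and> n \<ge> 1 \<and> pos \<nu> n \<noteq> i} \<union>
         {monom U (cl (x_gen n * e_gen \<nu>)) 0 \<ominus>\<^bsub>U\<^esub> monom U (cl (e_gen \<nu>)) 1 |\<nu>.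
            \<nu> \<in> seqs D \<gamma> \<and> n \<ge> 1 \<and> pos \<nu> n = i}))"

text \<open>\<open>R\<^sub>z\<close> with parameters \<open>i\<close> and \<open>\<gamma>\<close> at the weight \<open>\<mu> = \<Lambda>\<^sub>i - \<gamma>\<close>; for \<open>\<gamma> = 0\<close> nothing is divided
  out and this is \<open>k[z]\<close>.\<close>

type_synonym ('i, 'k) rz = "(nat \<Rightarrow> ('i, 'k) klr_free set) set"

definition Rz ::
  "('i, 'p::ab_group_add) root_datum \<Rightarrow> ('i, 'k::field) qparam \<Rightarrow> 'i \<Rightarrow> 'p \<Rightarrow>
     ('k, ('i, 'k) rz) graded" where
  "Rz D Q i \<gamma> = quot (klr_poly D Q i \<gamma>) (cyc_ideal D Q i \<gamma>)"

definition Rz_class ::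
  "('i, 'p::ab_group_add) root_datum \<Rightarrow> ('i, 'k::field) qparam \<Rightarrow> 'i \<Rightarrow> 'p \<Rightarrow>
     (nat \<Rightarrow> ('i, 'k) klr_free set) \<Rightarrow> ('i, 'k) rz" where
  "Rz_class D Q i \<gamma> p = cyc_ideal D Q i \<gamma> +>\<^bsub>klr_poly D Q i \<gamma>\<^esub> p"

definition Rz_of_klr ::
  "('i, 'p::ab_group_add) root_datum \<Rightarrow> ('i, 'k::field) qparam \<Rightarrow> 'i \<Rightarrow> 'p \<Rightarrow>
     ('i, 'k) klr_free set \<Rightarrow> ('i, 'k) rz" where
  "Rz_of_klr D Q i \<gamma> a = Rz_class D Q i \<gamma> (monom (UP (klr_algebra D Q \<gamma>)) a 0)"

definition Rz_z ::
  "('i, 'p::ab_group_add) root_datum \<Rightarrow> ('i, 'k::field) qparam \<Rightarrow> 'i \<Rightarrow> 'p \<Rightarrow> ('i, 'k) rz" where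
  "Rz_z D Q i \<gamma> = Rz_class D Q i \<gamma> (monom (UP (klr_algebra D Q \<gamma>)) \<one>\<^bsub>klr_algebra D Q \<gamma>\<^esub> 1)"


section \<open>The functors \<open>F\<^sub>j\<^sup>(\<^sup>a\<^sup>)\<close>\<close>

text \<open>For a right module \<open>E\<close> over \<open>A \<otimes> B\<close> (a subset of the algebra \<open>C\<close>, with action
  \<open>r \<cdot> (a \<otimes> b) = act r a b\<close>), a left \<open>A\<close>-module \<open>P\<close> and a left \<open>B\<close>-module \<open>M\<close>,
  \<open>E \<otimes>\<^bsub>A \<otimes> B\<^esub> (P \<otimes> M)\<close> is the free abelian group on \<open>E \<times> P \<times> M\<close> modulo these elements.
  Balancing over scalars, including that of \<open>P \<otimes> M\<close> over \<open>k\<close>, is contained in the last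
  family, as \<open>k\<close> lies in \<open>A\<close> and in \<open>B\<close>.\<close>

definition tensor_rels ::
  "'c set \<Rightarrow> ('k, 'c) graded \<Rightarrow> ('c \<Rightarrow> 'a \<Rightarrow> 'b \<Rightarrow> 'c) \<Rightarrow> ('k, 'a) graded \<Rightarrow> ('k, 'b) graded \<Rightarrow>
     ('a, 'p) graded \<Rightarrow> ('b, 'x) graded \<Rightarrow> (('c \<times> 'p \<times> 'x) \<Rightarrow>\<^sub>0 int) set" where
  "tensor_rels E C act A B P M =
     {frag_of (r \<oplus>\<^bsub>C\<^esub> r', p, x) - frag_of (r, p, x) - frag_of (r', p, x) |r r' p x.
        r \<in> E \<and> r' \<in> E \<and> p \<in> carrier P \<and> x \<in> carrier M} \<union>
     {frag_of (r, p \<oplus>\<^bsub>P\<^esub> p', x) - frag_of (r, p, x) - frag_of (r, p', x) |r p p' x.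
        r \<in> E \<and> p \<in> carrier P \<and> p' \<in> carrier P \<and> x \<in> carrier M} \<union>
     {frag_of (r, p, x \<oplus>\<^bsub>M\<^esub> x') - frag_of (r, p, x) - frag_of (r, p, x') |r p x x'.
        r \<in> E \<and> p \<in> carrier P \<and> x \<in> carrier M \<and> x' \<in> carrier M} \<union>
     {frag_of (act r a b, p, x) - frag_of (r, a \<odot>\<^bsub>P\<^esub> p, b \<odot>\<^bsub>M\<^esub> x) |r a b p x.
        r \<in> E \<and> a \<in> carrier A \<and> b \<in> carrier B \<and> p \<in> carrier P \<and> x \<in> carrier M}"

definition tensor_module ::
  "'c set \<Rightarrow> ('k, 'c) graded \<Rightarrow> ('c \<Rightarrow> 'a \<Rightarrow> 'b \<Rightarrow> 'c) \<Rightarrow> ('k, 'a) graded \<Rightarrow> ('k, 'b) graded \<Rightarrow>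
     ('a, 'p) graded \<Rightarrow> ('b, 'x) graded \<Rightarrow> ('c, (('c \<times> 'p \<times> 'x) \<Rightarrow>\<^sub>0 int) set) graded" where
  "tensor_module E C act A B P M =
     (let G = free_Abelian_group (E \<times> carrier P \<times> carrier M);
          V = \<lparr>carrier = carrier G, monoid.mult = undefined, one = undefined, ring.zero = 0,
               ring.add = (+),
               module.smult = (\<lambda>c. frag_extend (\<lambda>(r, p, x). frag_of (c \<otimes>\<^bsub>C\<^esub> r, p, x))),
               homog = (\<lambda>d. {f \<in> carrier G. \<forall>(r, p, x)\<in>Poly_Mapping.keys f.
                  \<exists>d1 d2 d3. r \<in> homog C d1 \<and> p \<in> homog P d2 \<and> x \<in> homog M d3 \<and>
                    d1 + d2 + d3 = d})\<rparr>
      in quot V (generate G (tensor_rels E C act A B P M)))"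

text \<open>\<open>F\<^sub>j\<^sup>(\<^sup>a\<^sup>) M\<close> for an \<open>R\<^sub>z\<close>-module \<open>M\<close> at \<open>\<Lambda>\<^sub>i - \<gamma>\<close>, where \<open>P\<close> is the projective cover
  \<open>P(j\<^sup>a)\<close>.\<close>

definition F_div ::
  "('i, 'p::ab_group_add) root_datum \<Rightarrow> ('i, 'k::field) qparam \<Rightarrow> 'i \<Rightarrow> 'i \<Rightarrow> nat \<Rightarrow> 'p \<Rightarrow>
     (('i, 'k) klr_free set, 'c) graded \<Rightarrow> (('i, 'k) rz, 'x) graded \<Rightarrow>
     (('i, 'k) rz, ((('i, 'k) rz \<times> 'c \<times> 'x) \<Rightarrow>\<^sub>0 int) set) graded" where
  "F_div D Q i j a \<gamma> P M =
     (let \<beta> = zscale (int a) (sroot D j);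
          C = Rz D Q i (\<beta> + \<gamma>);
          E = {r \<otimes>\<^bsub>C\<^esub> Rz_of_klr D Q i (\<beta> + \<gamma>) (klr_idem D Q \<beta> \<gamma>) |r. r \<in> carrier C};
          left = (\<lambda>y. Rz_of_klr D Q i (\<beta> + \<gamma>) (klr_left D Q \<beta> \<gamma> y));
          right = (\<lambda>Y. \<Union>p\<in>Y. Rz_class D Q i (\<beta> + \<gamma>) (\<lambda>n. klr_right D Q \<beta> \<gamma> (p n)))
      in tensor_module E C (\<lambda>r y Y. r \<otimes>\<^bsub>C\<^esub> left y \<otimes>\<^bsub>C\<^esub> right Y)
           (klr_algebra D Q \<beta>) (Rz D Q i \<gamma>) P M)"


section \<open>Determinantial modules\<close>

text \<open>\<open>\<Lambda>\<^sub>i - s\<^bsub>k\<^sub>1\<^esub> \<cdots> s\<^bsub>k\<^sub>m\<^esub> \<Lambda>\<^sub>i\<close>\<close>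

definition word_defect :: "('i, 'p::ab_group_add) root_datum \<Rightarrow> 'i \<Rightarrow> 'i list \<Rightarrow> 'p" where
  "word_defect D i ks = fund D i - refl_word D ks (fund D i)"

text \<open>The \<open>R\<^sub>z\<close>-modules isomorphic to \<open>F\<^bsub>k\<^sub>1\<^esub>\<^bsup>(a\<^sub>1)\<^esup> \<cdots> F\<^bsub>k\<^sub>m\<^esub>\<^bsup>(a\<^sub>m)\<^esup> k[z]\<close>, where \<open>P j n\<close> is the projective
  cover \<open>P(j\<^sup>n)\<close>. Each tensor product lives on a larger type than its arguments, so it is
  transported back to the type \<open>'x\<close> along an isomorphism.\<close>

inductive det_hat ::
  "('i, 'p::ab_group_add) root_datum \<Rightarrow> ('i, 'k::field) qparam \<Rightarrow>
     ('i \<Rightarrow> nat \<Rightarrow> (('i, 'k) klr_free set, 'c) graded) \<Rightarrow> 'i \<Rightarrow>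
     'i list \<Rightarrow> (('i, 'k) rz, 'x) graded \<Rightarrow> bool"
  for D Q P i where
  Nil: "\<lbrakk>graded_module (Rz D Q i 0) M;
         graded_isomorphic (Rz D Q i 0) M (regular_module (Rz D Q i 0))\<rbrakk> \<Longrightarrow>
    det_hat D Q P i [] M"
| Cons: "\<lbrakk>det_hat D Q P i ks M;
          a = nat (coroot D k (refl_word D ks (fund D i)));
          graded_module (Rz D Q i (word_defect D i (k # ks))) Y;
          graded_isomorphic (Rz D Q i (word_defect D i (k # ks))) Y
            (F_div D Q i k a (word_defect D i ks) (P k a) M)\<rbrakk> \<Longrightarrow>
    det_hat D Q P i (k # ks) Y"

definition restrict_klr ::
  "('i, 'p::ab_group_add) root_datum \<Rightarrow> ('i, 'k::field) qparam \<Rightarrow> 'i \<Rightarrow> 'p \<Rightarrow>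
     (('i, 'k) rz, 'x) graded \<Rightarrow> (('i, 'k) klr_free set, 'x) graded" where
  "restrict_klr D Q i \<gamma> M =
     \<lparr>carrier = carrier M, monoid.mult = monoid.mult M, one = monoid.one M,
      ring.zero = ring.zero M, ring.add = ring.add M,
      module.smult = (\<lambda>a x. Rz_of_klr D Q i \<gamma> a \<odot>\<^bsub>M\<^esub> x), homog = homog M\<rparr>"

definition mod_z ::
  "('i, 'p::ab_group_add) root_datum \<Rightarrow> ('i, 'k::field) qparam \<Rightarrow> 'i \<Rightarrow> 'p \<Rightarrow>
     (('i, 'k) rz, 'x) graded \<Rightarrow> (('i, 'k) klr_free set, 'x set) graded" where
  "mod_z D Q i \<gamma> M =
     quot (restrict_klr D Q i \<gamma> M) ((\<lambda>x. Rz_z D Q i \<gamma> \<odot>\<^bsub>M\<^esub> x) ` carrier M)"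

end

theory Submission
  imports Defs
begin

text \<open>Write \<open>R\<^sub>z\<close> for the deformed cyclotomic quotient. The divided power functors are tensor products with
  a projective module, and their right adjoints are exact, so by induction on the reduced word
  \<open>Mhat\<close> has the lifting property of a projective \<open>R\<^sub>z\<close>-module. Let
  \<open>C\<^sub>1 \<rightarrow> C\<^sub>0 \<rightarrow> Mhat\<close> be the start of a projective resolution over \<open>R(\<beta>)\<close> and \<open>J \<subseteq> C\<^sub>0\<close> the submodule
  generated by the idempotents \<open>e(\<nu>)\<close> that vanish in \<open>R\<^sub>z\<close>. On \<open>C\<^sub>0 / J\<close> the last \<open>\<tau>\<close> acts by zero, so
  the last \<open>x\<close> is central and \<open>C\<^sub>0 / J\<close> is an \<open>R\<^sub>z\<close>-module; hence \<open>C\<^sub>0 / J \<rightarrow> Mhat\<close> splits. A cocycle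
  \<open>C\<^sub>1 \<rightarrow> M\<close> vanishes over \<open>J\<close>, because these idempotents kill \<open>M\<close>, and so extends to \<open>C\<^sub>0\<close> along the
  splitting. If \<open>\<beta> = 0\<close> there is no last \<open>x\<close>, and a lift of \<open>z\<close> to \<open>C\<^sub>0\<close> takes its place.\<close>

section \<open>Dominance along reduced words\<close>

text \<open>The lifting property holds over \<open>R_z\<close>, while the resolution and Ext live
  over R(\<beta>). The gap closes because, for \<beta> \<noteq> 0, passing from R(\<beta>) to
  \<open>R_z\<close> amounts to killing idempotents, with the last x becoming z. An ideal generated
  by idempotents equals its square, so an extension of two modules killed by it is killed again, and
  Ext^1 does not change. In terms of cocycles: if \<delta> y = b c with b such an idempotent, then y
  may be replaced by b y.

  Besides the \<open>e(\<nu>)\<close> whose last letter is not i, those ending in i i must be killed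
  too: on them \<tau> x_n - x_{n-1} \<tau> = 1 and \<tau>^2 = 0, which is impossible for a central
  x_n unless they vanish.

  Two obstacles shape the rest. The exponents of the divided powers have to be nonnegative, which is
  the dominance theorem for reduced words. And projectivity is defined by test modules on one fixed
  type, whereas the right adjoints produce modules of functions, so it has to be extended to test
  modules on arbitrary types.\<close>

lemma comm_group_type_group: "comm_group (type_group :: 'p::ab_group_add monoid)"
proof (rule comm_groupI)
  fix x :: 'p
  show "\<exists>y\<in>carrier type_group. y \<otimes>\<^bsub>type_group\<^esub> x = \<one>\<^bsub>type_group\<^esub>"
    by (rule bexI[of _ "- x"]) (auto simp: type_group_def)
qed (auto simp: type_group_def algebra_simps)

lemma zscale_simps [simp]:
  fixes x y :: "'p::ab_group_add"
  shows "zscale 0 x = 0" "zscale 1 x = x" "zscale n (0::'p) = 0"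
  and zscale_add_left: "zscale (m + n) x = zscale m x + zscale n x"
  and zscale_add_right: "zscale n (x + y) = zscale n x + zscale n y"
  and zscale_minus_left: "zscale (- n) x = - zscale n x"
proof -
  interpret comm_group "type_group :: 'p monoid" by (rule comm_group_type_group)
  have c: "carrier (type_group :: 'p monoid) = UNIV" "\<one>\<^bsub>type_group\<^esub> = (0::'p)"
    "\<And>a b::'p. a \<otimes>\<^bsub>type_group\<^esub> b = a + b"
    by (auto simp: type_group_def)
  show "zscale 0 x = 0" "zscale 1 x = x" "zscale n (0::'p) = 0"
    using int_pow_0 int_pow_1 int_pow_one by (auto simp: zscale_def c)
  show add: "zscale (m + n) x = zscale m x + zscale n x" for m n and x :: 'p
    using int_pow_mult[of x m n] by (simp add: zscale_def c)
  show "zscale n (x + y) = zscale n x + zscale n y"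
    using int_pow_distrib[of x y n] by (simp add: zscale_def c)
  have z: "zscale 0 x = 0"
    using int_pow_0 by (auto simp: zscale_def c)
  show "zscale (- n) x = - zscale n x"
    using add[of "- n" n x] z by (simp add: eq_neg_iff_add_eq_0)
qed

lemma zscale_diff_left: "zscale (m - n) x = zscale m x - zscale n x"
  using zscale_add_left[of m "- n" x] by (simp add: zscale_minus_left)

lemma additive_zscale:
  fixes f :: "'p::ab_group_add \<Rightarrow> int"
  assumes add: "\<And>x y. f (x + y) = f x + f y"
  shows "f (zscale n x) = n * f x"
proof -
  have f0: "f 0 = 0" using add[of 0 0] by simp
  have pos: "f (zscale (int k) x) = int k * f x" for k
    by (induction k) (auto simp: f0 add zscale_add_left algebra_simps)
  have neg: "f (- y) = - f y" for y
    using add[of y "- y"] f0 by simp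
  show ?thesis
    by (cases n) (auto simp: pos zscale_minus_left neg simp del: of_nat_Suc)
qed

locale rdatum =
  fixes D :: "('i, 'p::ab_group_add) root_datum"
  assumes D: "is_root_datum D"
begin

lemma coroot_add: "coroot D k (x + y) = coroot D k x + coroot D k y"
  using D by (simp add: is_root_datum_def)

lemma coroot_zscale: "coroot D k (zscale n x) = n * coroot D k x"
  by (rule additive_zscale) (rule coroot_add)

lemma coroot_minus: "coroot D k (- x) = - coroot D k x"
  using coroot_zscale[of k "- 1" x] by (simp add: zscale_minus_left)

lemma coroot_diff: "coroot D k (x - y) = coroot D k x - coroot D k y"
  using coroot_add[of k x "- y"] by (simp add: coroot_minus)

lemma coroot_sroot: "coroot D k (sroot D j) = cartan D k j"
  using D by (simp add: is_root_datum_def)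

lemma cartan_diag: "cartan D k k = 2"
  using D by (simp add: is_root_datum_def gen_cartan_matrix_def)

lemma cartan_nonpos: "k \<noteq> j \<Longrightarrow> cartan D k j \<le> 0"
  using D unfolding is_root_datum_def gen_cartan_matrix_def by blast

lemma cartan_zero_iff: "cartan D k j = 0 \<longleftrightarrow> cartan D j k = 0"
proof -
  have "\<forall>i j. cartan D i j = 0 \<longleftrightarrow> cartan D j i = 0"
    using D unfolding is_root_datum_def gen_cartan_matrix_def by (elim conjE)
  then show ?thesis by blast
qed

lemmas coroot_simps = coroot_add coroot_diff coroot_minus coroot_zscale coroot_sroot cartan_diag

lemma coroot_simple_refl:
  "coroot D j (simple_refl D k y) = coroot D j y - coroot D k y * cartan D j k"
  by (simp add: simple_refl_def coroot_simps)

lemma simple_refl_invol [simp]: "simple_refl D k (simple_refl D k y) = y"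
  by (simp add: simple_refl_def coroot_simps zscale_diff_left[symmetric] zscale_minus_left)

lemma refl_word_Nil [simp]: "refl_word D [] y = y"
  by (simp add: refl_word_def)

lemma refl_word_Cons [simp]: "refl_word D (k # ks) y = simple_refl D k (refl_word D ks y)"
  by (simp add: refl_word_def)

lemma refl_word_append: "refl_word D (as @ bs) y = refl_word D as (refl_word D bs y)"
  by (induction as) auto

section \<open>Subgroups generated by two simple reflections\<close>

primrec alt :: "'i \<Rightarrow> 'i \<Rightarrow> nat \<Rightarrow> 'i list" where
  "alt s t 0 = []"
| "alt s t (Suc n) = s # alt t s n"

lemma length_alt [simp]: "length (alt s t n) = n"
  by (induction n arbitrary: s t) auto

lemma alt_add: "alt s t (m + n) = alt s t m @ (if even m then alt s t n else alt t s n)"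
  by (induction m arbitrary: s t) auto

text \<open>The reflections in \<open>\<langle>s, t\<rangle>\<close> move \<open>y\<close> inside \<open>y - \<int> \<alpha>\<^sub>s - \<int> \<alpha>\<^sub>t\<close>; these are the coefficients.\<close>

fun coef2 :: "'i \<Rightarrow> 'i \<Rightarrow> int \<Rightarrow> int \<Rightarrow> 'i list \<Rightarrow> int \<times> int" where
  "coef2 s t p q [] = (0, 0)"
| "coef2 s t p q (x # a) = (let (c, d) = coef2 s t p q a in
     if x = s then (p - c - d * cartan D s t, d) else (c, q - d - c * cartan D t s))"

text \<open>Turns an equality between two words in s and t into an equality of integer pairs,
  because \<open>coef2\<close> sees y only through its two coroot values. This makes the braid
  relations of the finite dihedral types a computation.\<close>

lemma refl_word_coef2:
  assumes "set a \<subseteq> {s, t}" "s \<noteq> t" "coef2 s t (coroot D s y) (coroot D t y) a = (c, d)"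
  shows "refl_word D a y = y - zscale c (sroot D s) - zscale d (sroot D t)"
  using assms
proof (induction a arbitrary: c d)
  case (Cons x a)
  obtain c' d' where cd: "coef2 s t (coroot D s y) (coroot D t y) a = (c', d')"
    by fastforce
  have IH: "refl_word D a y = y - zscale c' (sroot D s) - zscale d' (sroot D t)"
    using Cons cd by auto
  show ?case
  proof (cases "x = s")
    case True
    then have *: "c = coroot D s y - c' - d' * cartan D s t" "d = d'"
      using Cons.prems cd by auto
    have "simple_refl D s (refl_word D a y) = refl_word D a y
        - zscale (coroot D s y - 2 * c' - d' * cartan D s t) (sroot D s)"
      by (simp add: simple_refl_def IH coroot_simps mult.commute)
    also have "\<dots> = y - zscale (c' + (coroot D s y - 2 * c' - d' * cartan D s t)) (sroot D s)
        - zscale d' (sroot D t)"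
      unfolding IH zscale_add_left by simp
    also have "c' + (coroot D s y - 2 * c' - d' * cartan D s t) = c" using * by simp
    finally show ?thesis using True * by simp
  next
    case False
    then have *: "d = coroot D t y - d' - c' * cartan D t s" "c = c'" "x = t"
      using Cons.prems cd by auto
    have "simple_refl D t (refl_word D a y) = refl_word D a y
        - zscale (coroot D t y - 2 * d' - c' * cartan D t s) (sroot D t)"
      by (simp add: simple_refl_def IH coroot_simps algebra_simps)
    also have "\<dots> = y - zscale c' (sroot D s)
        - zscale (d' + (coroot D t y - 2 * d' - c' * cartan D t s)) (sroot D t)"
      unfolding IH zscale_add_left by simp
    also have "d' + (coroot D t y - 2 * d' - c' * cartan D t s) = d" using * by simp
    finally show ?thesis using * by simp
  qed
qed auto

lemma set_alt: "set (alt s t n) \<subseteq> {s, t}"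
  by (induction n arbitrary: s t) auto

text \<open>The third conjunct is the invariant that carries the induction: it bounds the ratio of
  the two coroot values, and it survives a further reflection, with s and t exchanged, exactly
  because the product of the Cartan integers is at least 4. The first conjunct is what the dominance
  argument uses.\<close>

lemma rank_two_infinite:
  assumes "s \<noteq> t" "cartan D s t * cartan D t s \<ge> 4" "coroot D s y \<ge> 0" "coroot D t y \<ge> 0"
  shows "coroot D s (refl_word D (alt t s (Suc n)) y) \<ge> 0 \<and>
    coroot D t (refl_word D (alt t s (Suc n)) y) \<le> 0 \<and>
    2 * coroot D s (refl_word D (alt t s (Suc n)) y) \<ge>
      cartan D s t * coroot D t (refl_word D (alt t s (Suc n)) y)"
  using assms
proof (induction n arbitrary: s t)
  case 0
  have "cartan D s t \<le> 0" using 0 cartan_nonpos by auto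
  moreover have "coroot D t y * cartan D s t \<le> 0"
    using 0 calculation by (simp add: mult_nonneg_nonpos)
  ultimately show ?case using 0
    by (simp add: coroot_simple_refl cartan_diag algebra_simps)
next
  case (Suc n)
  let ?w = "refl_word D (alt s t (Suc n)) y"
  define X' Y' where "X' = coroot D s ?w" and "Y' = coroot D t ?w"
  have IH: "Y' \<ge> 0" "X' \<le> 0" "2 * Y' \<ge> cartan D t s * X'"
    using Suc.IH[of t s] Suc.prems by (auto simp: X'_def Y'_def mult.commute)
  have neg: "cartan D s t \<le> 0" "cartan D t s \<le> 0" using Suc.prems cartan_nonpos by auto
  have X: "coroot D s (refl_word D (alt t s (Suc (Suc n))) y) = X' - Y' * cartan D s t"
    and Y: "coroot D t (refl_word D (alt t s (Suc (Suc n))) y) = - Y'"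
    by (simp_all add: X'_def Y'_def coroot_simple_refl cartan_diag)
  \<comment> \<open>The invariant is multiplied by a nonpositive Cartan integer and then compared
    with 4. The result gives the sign of the new value at s as well as the new invariant.\<close>
  have "cartan D s t * (2 * Y') \<le> cartan D s t * (cartan D t s * X')"
    using IH(3) neg(1) by (rule mult_left_mono_neg)
  also have "\<dots> = (cartan D s t * cartan D t s) * X'" by simp
  also have "\<dots> \<le> 4 * X'" using Suc.prems(2) IH(2) by (rule mult_right_mono_neg)
  finally have "2 * (- X') \<le> - (cartan D s t * Y')" by (simp add: mult.commute)
  then show ?case unfolding X Y using IH by (auto simp: algebra_simps)
qed

text \<open>Only the types A1 x A1, A2, B2 and G2 are possible, so everything can be checked by
  cases: the braid relation on coefficient pairs, and the sign of the coroot value for each word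
  shorter than it.\<close>

lemma rank_two_finite:
  assumes "s \<noteq> t" "cartan D s t * cartan D t s < 4"
  shows "\<exists>m>0. (\<forall>y. refl_word D (alt s t m) y = refl_word D (alt t s m) y) \<and>
    (\<forall>n y. n < m \<longrightarrow> coroot D s y \<ge> 0 \<longrightarrow> coroot D t y \<ge> 0 \<longrightarrow>
       coroot D s (refl_word D (alt t s n) y) \<ge> 0)"
proof -
  define a b where "a = - cartan D s t" and "b = - cartan D t s"
  have ab: "a \<ge> 0" "b \<ge> 0" "a * b < 4" "a = 0 \<longleftrightarrow> b = 0"
    using assms cartan_nonpos[of s t] cartan_nonpos[of t s] cartan_zero_iff[of s t]
    by (auto simp: a_def b_def)
  have "a \<le> 3" if "a \<noteq> 0"
    using ab that mult_left_mono[of 1 b a] by linarith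
  moreover have "b \<le> 3" if "a \<noteq> 0"
    using ab that mult_right_mono[of 1 a b] by linarith
  ultimately have "(a = 0 \<or> a = 1 \<or> a = 2 \<or> a = 3) \<and> (b = 0 \<or> b = 1 \<or> b = 2 \<or> b = 3)"
    using ab by (cases "a = 0") linarith+
  then have "(a, b) \<in> {(0, 0), (1, 1), (1, 2), (2, 1), (1, 3), (3, 1)}"
    using ab by (auto elim!: disjE)
  then have c: "(cartan D s t, cartan D t s) \<in>
      {(0, 0), (- 1, - 1), (- 1, - 2), (- 2, - 1), (- 1, - 3), (- 3, - 1)}"
    unfolding a_def b_def by auto
  \<comment> \<open>The order of the product of the two reflections: 2, 3, 4 or 6 as the product of
    the Cartan integers is 0, 1, 2 or 3.\<close>
  define m :: nat where "m = (if cartan D s t * cartan D t s = 0 then 2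
    else if cartan D s t * cartan D t s = 1 then 3
    else if cartan D s t * cartan D t s = 2 then 4 else 6)"
  have st: "(t = s) = False" "(s = t) = False" using assms by auto
  \<comment> \<open>Equality for arbitrary integers p and q is the braid relation, valid at every
    y.\<close>
  have "coef2 s t p q (alt s t m) = coef2 s t p q (alt t s m)" for p q
    using c by (auto simp: m_def st Let_def eval_nat_numeral)
  moreover have "set (alt s t m) \<subseteq> {s, t}" "set (alt t s m) \<subseteq> {s, t}"
    using set_alt[of s t m] set_alt[of t s m] by auto
  ultimately have "refl_word D (alt s t m) y = refl_word D (alt t s m) y" for y
    using refl_word_coef2[OF _ assms(1)] by (metis surj_pair)
  moreover have "coroot D s (refl_word D (alt t s n) y) \<ge> 0"
    if "n < m" "coroot D s y \<ge> 0" "coroot D t y \<ge> 0" for n y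
  proof -
    have "n = 0 \<or> n = 1 \<or> n = 2 \<or> n = 3 \<or> n = 4 \<or> n = 5"
      using that(1) by (auto simp: m_def split: if_splits)
    then show ?thesis
      using c that
      by (elim disjE insertE emptyE;
          simp add: m_def coroot_simple_refl cartan_diag eval_nat_numeral)
  qed
  moreover have "m > 0" by (simp add: m_def)
  ultimately show ?thesis by blast
qed

section \<open>Reduced words and the dominance argument\<close>

definition reduced :: "'i list \<Rightarrow> bool" where
  "reduced ks \<longleftrightarrow> (\<forall>ls. refl_word D ks = refl_word D ls \<longrightarrow> length ks \<le> length ls)"

lemma reduced_appendD:
  assumes "reduced (as @ bs)"
  shows "reduced as" "reduced bs"
proof -
  show "reduced as"
    unfolding reduced_def
  proof (intro allI impI)
    fix ls assume "refl_word D as = refl_word D ls"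
    then have "refl_word D (as @ bs) = refl_word D (ls @ bs)"
      by (auto simp: refl_word_append)
    then show "length as \<le> length ls" using assms unfolding reduced_def by fastforce
  qed
  show "reduced bs"
    unfolding reduced_def
  proof (intro allI impI)
    fix ls assume "refl_word D bs = refl_word D ls"
    then have "refl_word D (as @ bs) = refl_word D (as @ ls)"
      by (auto simp: refl_word_append)
    then show "length bs \<le> length ls" using assms unfolding reduced_def by fastforce
  qed
qed

text \<open>Two equal neighbouring letters cancel, so a reduced word in two letters has to alternate
  and is determined by its first letter and its length.\<close>

lemma reduced_alt:
  assumes "reduced a" "set a \<subseteq> {s, t}" "a = [] \<or> hd a = t"
  shows "a = alt t s (length a)"
  using assms
proof (induction a arbitrary: s t)
  case (Cons x a)
  have x: "x = t" using Cons.prems by simp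
  have red: "reduced a" using Cons.prems reduced_appendD(2)[of "[x]" a] by simp
  have "a = [] \<or> hd a = s"
  proof (rule ccontr)
    assume "\<not> ?thesis"
    then obtain a' where "a = t # a'" using Cons.prems(2) by (cases a) auto
    then have "refl_word D (x # a) = refl_word D a'" using x by auto
    then show False using Cons.prems(1) \<open>a = t # a'\<close> unfolding reduced_def by fastforce
  qed
  then show ?case using Cons.IH[of t s] Cons.prems red x by auto
qed auto

text \<open>The argument of Deodhar and Humphreys: split off the longest prefix from the rank two
  subgroup generated by \<open>k\<close> and the first letter, and treat that prefix by hand.\<close>

lemma coroot_nonneg_aux:
  assumes dom: "\<And>j. coroot D j \<Lambda> \<ge> 0"
  shows "\<lbrakk>reduced ws; \<And>ls. (\<And>y. refl_word D ls y = refl_word D (k # ws) y) \<Longrightarrow> length ws \<le> length ls\<rbrakk>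
    \<Longrightarrow> coroot D k (refl_word D ws \<Lambda>) \<ge> 0"
proof (induction "length ws" arbitrary: ws k rule: less_induct)
  case less
  show ?case
  proof (cases ws)
    case Nil
    then show ?thesis using dom by simp
  next
    case (Cons t ws')
    have tk: "t \<noteq> k" using less.prems(2)[of ws'] Cons by auto
    \<comment> \<open>The factorisations of the element into a word in k and t and a remainder, with
      lengths adding up. Splitting off only the first letter gives one of them, so a factorisation
      with shortest remainder has a remainder shorter than \<open>ws\<close>.\<close>
    define S where "S = {(a, b). set a \<subseteq> {k, t} \<and> length a + length b = length ws \<and>
      (\<forall>y. refl_word D (a @ b) y = refl_word D ws y)}"
    have "([t], ws') \<in> S" unfolding S_def by (auto simp: Cons)
    then obtain a b where ab: "(a, b) \<in> S"
      and min: "\<And>a' b'. (a', b') \<in> S \<Longrightarrow> length b \<le> length b'"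
      using arg_min_natI[of "\<lambda>x. x \<in> S" "([t], ws')" "length \<circ> snd"]
        arg_min_nat_le[of "\<lambda>x. x \<in> S" _ "length \<circ> snd"]
      by (metis comp_apply prod.collapse snd_conv)
    have a: "set a \<subseteq> {k, t}" and len: "length a + length b = length ws"
      and eq: "\<And>y. refl_word D (a @ b) y = refl_word D ws y"
      using ab by (auto simp: S_def)
    have lb: "length b < length ws"
      using min[OF \<open>([t], ws') \<in> S\<close>] Cons by simp
    have redab: "reduced (a @ b)"
      using less.prems(1) eq len unfolding reduced_def by (metis ext length_append)
    \<comment> \<open>The second hypothesis of the induction for the remainder \<open>b\<close>: if
      u times b had a word shorter than b, then u could be moved into the prefix, and the remainder
      would not have been shortest.\<close>
    have prem: "length b \<le> length ls"
      if u: "u \<in> {k, t}" and ls: "\<And>y. refl_word D ls y = refl_word D (u # b) y" for u ls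
    proof (rule ccontr)
      assume short: "\<not> length b \<le> length ls"
      have e: "refl_word D ((a @ [u]) @ ls) y = refl_word D ws y" for y
        using ls by (simp add: refl_word_append eq[symmetric])
      then have "length ws \<le> length ((a @ [u]) @ ls)"
        using less.prems(1) unfolding reduced_def by (metis ext)
      then have "length (a @ [u]) + length ls = length ws" using short len by simp
      then have "(a @ [u], ls) \<in> S" using a u e by (auto simp: S_def)
      then show False using min short by blast
    qed
    have p: "coroot D k (refl_word D b \<Lambda>) \<ge> 0" and q: "coroot D t (refl_word D b \<Lambda>) \<ge> 0"
      using less.hyps[OF lb reduced_appendD(2)[OF redab]] prem by blast+
    \<comment> \<open>If the prefix could be written with k in front, dropping that k would give a
      word for \<open>k # ws\<close> shorter than \<open>ws\<close>.\<close>
    have nohd: False if "\<And>y. refl_word D a y = refl_word D (k # a') y" "length a = Suc (length a')"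
      for a'
      using less.prems(2)[of "a' @ b"] that len eq[symmetric]
      by (auto simp: refl_word_append)
    have "a = [] \<or> hd a = t"
      using nohd a by (cases a) auto
    then have alt: "a = alt t k (length a)"
      using reduced_alt[OF reduced_appendD(1)[OF redab] a] by blast
    have "coroot D k (refl_word D (alt t k (length a)) (refl_word D b \<Lambda>)) \<ge> 0"
    proof (cases "cartan D k t * cartan D t k < 4")
      case True
      then obtain m where "m > 0" and
        m: "\<And>y. refl_word D (alt k t m) y = refl_word D (alt t k m) y" and
        pos: "\<And>n y. \<lbrakk>n < m; coroot D k y \<ge> 0; coroot D t y \<ge> 0\<rbrakk> \<Longrightarrow>
          coroot D k (refl_word D (alt t k n) y) \<ge> 0"
        using rank_two_finite[of k t] tk by blast
      \<comment> \<open>An alternating word of length at least m can be rewritten by the braid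
        relation so that it starts with k, which \<open>nohd\<close> excludes.\<close>
      have "length a < m"
      proof (rule ccontr)
        assume "\<not> ?thesis"
        then obtain l where l: "length a = m + l"
          by (metis le_Suc_ex linorder_not_less)
        obtain m' where m': "m = Suc m'" using \<open>m > 0\<close> by (cases m) auto
        have "a = alt t k m @ (if even m then alt t k l else alt k t l)"
          using alt alt_add[of t k m l] l by simp
        then have "refl_word D a y =
            refl_word D (alt k t m @ (if even m then alt t k l else alt k t l)) y" for y
          using m by (simp add: refl_word_append)
        then show False
          using nohd[of "alt t k m' @ (if even m then alt t k l else alt k t l)"] l m'
          by (cases "even m") auto
      qed
      then show ?thesis using pos p q by blast
    next
      case False
      show ?thesis
      proof (cases "length a")
        case 0
        then show ?thesis using p by simp
      next
        case (Suc n)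
        then show ?thesis using rank_two_infinite[of k t _ n] False tk p q by auto
      qed
    qed
    then show ?thesis using alt eq[of \<Lambda>] by (simp add: refl_word_append)
  qed
qed

lemma reduced_coroot_nonneg:
  assumes "reduced (k # ks)" "\<And>j. coroot D j \<Lambda> \<ge> 0"
  shows "coroot D k (refl_word D ks \<Lambda>) \<ge> 0"
proof (rule coroot_nonneg_aux[OF assms(2)])
  show "reduced ks" using reduced_appendD(2)[of "[k]" ks] assms(1) by simp
  fix ls assume "\<And>y. refl_word D ls y = refl_word D (k # ks) y"
  then have "length (k # ks) \<le> length ls" using assms(1) unfolding reduced_def by (metis ext)
  then show "length ks \<le> length ls" by simp
qed

end


section \<open>Graded modules\<close>

text \<open>The span of all homogeneous parts of degree other than d. Directness of the grading
  becomes the statement that it meets degree d only in zero, which avoids finite sums and passes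
  easily to submodules, quotients and shifts.\<close>

definition offdeg :: "('a, 'm) graded \<Rightarrow> int \<Rightarrow> 'm set" where
  "offdeg M d = generate (add_monoid M) (\<Union>e\<in>- {d}. homog M e)"

definition graded_group :: "('a, 'm) graded \<Rightarrow> bool" where
  "graded_group M \<longleftrightarrow> abelian_group M \<and> (\<forall>d. subgroup (homog M d) (add_monoid M)) \<and>
     carrier M = generate (add_monoid M) (\<Union>d. homog M d) \<and>
     (\<forall>d. homog M d \<inter> offdeg M d \<subseteq> {\<zero>\<^bsub>M\<^esub>})"

context abelian_group
begin

lemma subgroup_add_closed:
  "subgroup S (add_monoid G) \<Longrightarrow> x \<in> S \<Longrightarrow> y \<in> S \<Longrightarrow> x \<oplus> y \<in> S"
  using subgroup.m_closed by fastforce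

lemma subgroup_zero: "subgroup S (add_monoid G) \<Longrightarrow> \<zero> \<in> S"
  using subgroup.one_closed by fastforce

lemma subgroup_neg: "subgroup S (add_monoid G) \<Longrightarrow> x \<in> S \<Longrightarrow> \<ominus> x \<in> S"
  unfolding a_inv_def using subgroup.m_inv_closed by fastforce

lemma subgroup_minus:
  "subgroup S (add_monoid G) \<Longrightarrow> x \<in> S \<Longrightarrow> y \<in> S \<Longrightarrow> x \<ominus> y \<in> S"
  unfolding minus_eq by (intro subgroup_add_closed subgroup_neg)

lemma subgroup_carrier: "subgroup S (add_monoid G) \<Longrightarrow> x \<in> S \<Longrightarrow> x \<in> carrier G"
  using subgroup.subset by fastforce

lemma subgroupI':
  assumes "S \<subseteq> carrier G" "\<zero> \<in> S" "\<And>x y. x \<in> S \<Longrightarrow> y \<in> S \<Longrightarrow> x \<oplus> y \<in> S"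
    "\<And>x. x \<in> S \<Longrightarrow> \<ominus> x \<in> S"
  shows "subgroup S (add_monoid G)"
  using assms by (intro subgroup.intro) (auto simp: a_inv_def)

lemma generate_subgroup: "H \<subseteq> carrier G \<Longrightarrow> subgroup (generate (add_monoid G) H) (add_monoid G)"
  using add.generate_is_subgroup by simp

lemma generate_least:
  "subgroup S (add_monoid G) \<Longrightarrow> H \<subseteq> S \<Longrightarrow> generate (add_monoid G) H \<subseteq> S"
  using add.generate_subgroup_incl by blast

lemma generate_mono': "H \<subseteq> K \<Longrightarrow> K \<subseteq> carrier G \<Longrightarrow>
   generate (add_monoid G) H \<subseteq> generate (add_monoid G) K"
  using add.mono_generate by blast

lemma generate_gen: "x \<in> H \<Longrightarrow> x \<in> generate (add_monoid G) H"
  by (rule generate.incl)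

lemma generate_induct [consumes 2, case_names zero gen add]:
  assumes "x \<in> generate (add_monoid G) H" "H \<subseteq> carrier G"
    and "P \<zero>" "\<And>h. h \<in> H \<Longrightarrow> P h \<and> P (\<ominus> h)"
    and "\<And>x y. x \<in> generate (add_monoid G) H \<Longrightarrow> y \<in> generate (add_monoid G) H \<Longrightarrow> P x \<Longrightarrow> P y \<Longrightarrow> P (x \<oplus> y)"
  shows "P x"
  using assms(1)
  by (induction rule: generate.induct) (use assms in \<open>auto simp: a_inv_def\<close>)

lemma minus_add_minus:
  "\<lbrakk>x \<in> carrier G; y \<in> carrier G; a \<in> carrier G; b \<in> carrier G\<rbrakk> \<Longrightarrow>
    (x \<oplus> y) \<ominus> (a \<oplus> b) = (x \<ominus> a) \<oplus> (y \<ominus> b)"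
  by (simp add: minus_eq minus_add a_ac)

lemma minus_swap: "\<lbrakk>x \<in> carrier G; y \<in> carrier G\<rbrakk> \<Longrightarrow> \<ominus> (x \<ominus> y) = y \<ominus> x"
  by (simp add: minus_eq minus_add a_ac)

lemma minus_self: "x \<in> carrier G \<Longrightarrow> x \<ominus> x = \<zero>"
  by (simp add: minus_eq r_neg)

lemma minus_zero_right: "x \<in> carrier G \<Longrightarrow> x \<ominus> \<zero> = x"
  by (simp add: minus_eq)

lemma add_minus_cancel: "\<lbrakk>x \<in> carrier G; y \<in> carrier G\<rbrakk> \<Longrightarrow> (x \<ominus> y) \<oplus> y = x"
  by (simp add: minus_eq a_assoc l_neg)

end

locale additive_map = M: abelian_group M + N: abelian_group N
  for M :: "('a, 'm, 'z) module_scheme" and N :: "('b, 'n, 'y) module_scheme" +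
  fixes f
  assumes closed: "x \<in> carrier M \<Longrightarrow> f x \<in> carrier N"
    and add: "x \<in> carrier M \<Longrightarrow> y \<in> carrier M \<Longrightarrow> f (x \<oplus>\<^bsub>M\<^esub> y) = f x \<oplus>\<^bsub>N\<^esub> f y"
begin

lemma zero: "f \<zero>\<^bsub>M\<^esub> = \<zero>\<^bsub>N\<^esub>"
proof -
  have "f \<zero>\<^bsub>M\<^esub> \<oplus>\<^bsub>N\<^esub> f \<zero>\<^bsub>M\<^esub> = f \<zero>\<^bsub>M\<^esub>" using add[of "\<zero>\<^bsub>M\<^esub>" "\<zero>\<^bsub>M\<^esub>"] by simp
  then show ?thesis using closed N.add.l_cancel_one by (metis M.zero_closed)
qed

lemma neg: "x \<in> carrier M \<Longrightarrow> f (\<ominus>\<^bsub>M\<^esub> x) = \<ominus>\<^bsub>N\<^esub> f x"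
proof -
  assume x: "x \<in> carrier M"
  have "f (\<ominus>\<^bsub>M\<^esub> x) \<oplus>\<^bsub>N\<^esub> f x = \<zero>\<^bsub>N\<^esub>"
    using add[of "\<ominus>\<^bsub>M\<^esub> x" x] x by (simp add: M.l_neg zero)
  then show ?thesis using x closed by (metis M.a_inv_closed N.minus_equality)
qed

lemma minus: "x \<in> carrier M \<Longrightarrow> y \<in> carrier M \<Longrightarrow> f (x \<ominus>\<^bsub>M\<^esub> y) = f x \<ominus>\<^bsub>N\<^esub> f y"
  by (simp add: M.minus_eq N.minus_eq add neg)

text \<open>The tool by which statements about a span are reduced to its generators: homogeneous
  elements, monomials, or generators of a submodule.\<close>

lemma generate_into:
  assumes "H \<subseteq> carrier M" "subgroup S (add_monoid N)" "\<And>h. h \<in> H \<Longrightarrow> f h \<in> S"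
    and "x \<in> generate (add_monoid M) H"
  shows "f x \<in> S"
  using assms(4,1)
proof (induction rule: M.generate_induct)
  case zero
  then show ?case using N.subgroup_zero[OF assms(2)] zero by (simp add: additive_map.zero[OF additive_map_axioms])
next
  case (gen h)
  then show ?case using assms neg[of h] N.subgroup_neg[OF assms(2)] by auto
next
  case (add x y)
  have "x \<in> carrier M" "y \<in> carrier M"
    using add M.add.generate_in_carrier assms(1) by auto
  then show ?case using add N.subgroup_add_closed[OF assms(2)] by (simp add: additive_map.add[OF additive_map_axioms])
qed

end

locale ggroup =
  fixes M :: "('a, 'm) graded"
  assumes gg: "graded_group M"
begin

sublocale abelian_group M using gg by (simp add: graded_group_def)

lemma homog_subgroup: "subgroup (homog M d) (add_monoid M)"
  using gg by (simp add: graded_group_def)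

lemmas homog_add = subgroup_add_closed[OF homog_subgroup]
  and homog_zero = subgroup_zero[OF homog_subgroup]
  and homog_neg = subgroup_neg[OF homog_subgroup]
  and homog_minus = subgroup_minus[OF homog_subgroup]
  and homog_closed = subgroup_carrier[OF homog_subgroup]

lemma Un_homog_subset: "(\<Union>d\<in>E. homog M d) \<subseteq> carrier M"
  using homog_closed by blast

lemma offdeg_subgroup: "subgroup (offdeg M d) (add_monoid M)"
  unfolding offdeg_def by (rule generate_subgroup[OF Un_homog_subset])

lemma homog_offdeg: "h \<in> homog M e \<Longrightarrow> e \<noteq> d \<Longrightarrow> h \<in> offdeg M d"
  unfolding offdeg_def by (rule generate_gen) auto

lemma homog_Int_offdeg: "h \<in> homog M d \<Longrightarrow> h \<in> offdeg M d \<Longrightarrow> h = \<zero>\<^bsub>M\<^esub>"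
  using gg unfolding graded_group_def by blast

lemma carrier_eq: "carrier M = generate (add_monoid M) (\<Union>d. homog M d)"
  using gg unfolding graded_group_def by blast

lemma induct [consumes 1, case_names homog add]:
  assumes "m \<in> carrier M" "\<And>d h. h \<in> homog M d \<Longrightarrow> P h"
    and "\<And>x y. x \<in> carrier M \<Longrightarrow> y \<in> carrier M \<Longrightarrow> P x \<Longrightarrow> P y \<Longrightarrow> P (x \<oplus>\<^bsub>M\<^esub> y)"
  shows "P m"
proof -
  have "m \<in> generate (add_monoid M) (\<Union>d. homog M d)" using assms(1) carrier_eq by simp
  from this Un_homog_subset show ?thesis
  proof (induction rule: generate_induct)
    case zero
    then show ?case using assms(2)[OF homog_zero] .
  next
    case (gen h)
    then show ?case using assms(2) homog_neg by blast
  next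
    case (add x y)
    then show ?case using assms(3) carrier_eq by simp
  qed
qed

text \<open>Homogeneous components are additive, and for a homogeneous element they are the element
  itself or zero. Existence is therefore an induction, and no decomposition has to be
  chosen.\<close>

lemma component:
  assumes "m \<in> carrier M"
  shows "\<exists>h\<in>homog M d. m \<ominus>\<^bsub>M\<^esub> h \<in> offdeg M d"
  using assms
proof (induction rule: induct)
  case (homog e h)
  show ?case
  proof (cases "e = d")
    case True
    then show ?thesis
      using homog subgroup_zero[OF offdeg_subgroup] homog_closed
      by (auto intro!: bexI[of _ h] simp: minus_self)
  next
    case False
    then show ?thesis
      using homog homog_offdeg homog_closed
      by (intro bexI[of _ "\<zero>\<^bsub>M\<^esub>"] homog_zero) (auto simp: minus_zero_right)
  qed
next
  case (add x y)
  then obtain h k where hk: "h \<in> homog M d" "x \<ominus>\<^bsub>M\<^esub> h \<in> offdeg M d"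
    "k \<in> homog M d" "y \<ominus>\<^bsub>M\<^esub> k \<in> offdeg M d" by blast
  have "(x \<oplus>\<^bsub>M\<^esub> y) \<ominus>\<^bsub>M\<^esub> (h \<oplus>\<^bsub>M\<^esub> k) = (x \<ominus>\<^bsub>M\<^esub> h) \<oplus>\<^bsub>M\<^esub> (y \<ominus>\<^bsub>M\<^esub> k)"
    using add hk homog_closed by (intro minus_add_minus) auto
  then show ?case using hk homog_add subgroup_add_closed[OF offdeg_subgroup] by metis
qed

end

text \<open>Links the finite sums in \<open>graded_module\<close> with \<open>offdeg\<close>. An
  element of a span of homogeneous parts can be collected into one term per degree; an element of
  degree d that is also such a sum over other degrees then gives a vanishing sum with distinct
  degrees.\<close>

lemma graded_module_graded_group:
  assumes "graded_module A M"
  shows "graded_group M"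
proof -
  interpret left_module A M using assms by (simp add: graded_module_def)
  have sg: "subgroup (homog M d) (add_monoid M)" for d
    using assms by (simp add: graded_module_def)
  have hc: "homog M d \<subseteq> carrier M" for d using subgroup.subset[OF sg[of d]] by simp
  have fs: "\<exists>S f. finite S \<and> S \<subseteq> E \<and> (\<forall>d\<in>S. f d \<in> homog M d) \<and> m = (\<Oplus>\<^bsub>M\<^esub>d\<in>S. f d)"
    if "m \<in> generate (add_monoid M) (\<Union>e\<in>E. homog M e)" for m E
  proof -
    have sub: "(\<Union>e\<in>E. homog M e) \<subseteq> carrier M" using hc by blast
    have one: "\<exists>S f. finite S \<and> S \<subseteq> E \<and> (\<forall>d\<in>S. f d \<in> homog M d) \<and> h = (\<Oplus>\<^bsub>M\<^esub>d\<in>S. f d)"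
      if "h \<in> homog M e" "e \<in> E" for h e
    proof -
      have "h \<in> carrier M" using that hc by blast
      then have "(\<Oplus>\<^bsub>M\<^esub>d\<in>{e}. h) = h" using M.finsum_insert[of "{}" e "\<lambda>_. h"] by simp
      then show ?thesis using that by (intro exI[of _ "{e}"] exI[of _ "\<lambda>_. h"]) auto
    qed
    from that sub show ?thesis
    proof (induction rule: M.generate_induct)
      case zero
      then show ?case by (intro exI[of _ "{}"]) auto
    next
      case (gen h)
      then show ?case using one M.subgroup_neg[OF sg] by blast
    next
      case (add x y)
      then obtain S f T g where S: "finite S" "S \<subseteq> E" "\<forall>d\<in>S. f d \<in> homog M d" "x = (\<Oplus>\<^bsub>M\<^esub>d\<in>S. f d)"
        and T: "finite T" "T \<subseteq> E" "\<forall>d\<in>T. g d \<in> homog M d" "y = (\<Oplus>\<^bsub>M\<^esub>d\<in>T. g d)" by metis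
      \<comment> \<open>Extended by zero, both families are summed over the union of the two sets of
        degrees, so the terms can be added degree by degree.\<close>
      define f' g' where "f' d = (if d \<in> S then f d else \<zero>\<^bsub>M\<^esub>)" and "g' d = (if d \<in> T then g d else \<zero>\<^bsub>M\<^esub>)" for d
      have f': "f' d \<in> homog M d" for d using S M.subgroup_zero[OF sg] by (auto simp: f'_def)
      then have f'c: "f' d \<in> carrier M" for d using hc by blast
      have fc: "f d \<in> carrier M" if "d \<in> S" for d using S(3) hc that by blast
      have g': "g' d \<in> homog M d" for d using T M.subgroup_zero[OF sg] by (auto simp: g'_def)
      then have g'c: "g' d \<in> carrier M" for d using hc by blast
      have gc: "g d \<in> carrier M" if "d \<in> T" for d using T(3) hc that by blast
      have "x = (\<Oplus>\<^bsub>M\<^esub>d\<in>S \<union> T. f' d)"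
        unfolding S(4) using S T f'c fc
        by (intro M.add.finprod_mono_neutral_cong_left) (auto simp: f'_def)
      moreover have "y = (\<Oplus>\<^bsub>M\<^esub>d\<in>S \<union> T. g' d)"
        unfolding T(4) using S T g'c gc
        by (intro M.add.finprod_mono_neutral_cong_left) (auto simp: g'_def)
      ultimately have "x \<oplus>\<^bsub>M\<^esub> y = (\<Oplus>\<^bsub>M\<^esub>d\<in>S \<union> T. f' d \<oplus>\<^bsub>M\<^esub> g' d)"
        using f'c g'c by (simp add: M.finsum_addf)
      then show ?case
        using S T f' g' M.subgroup_add_closed[OF sg]
        by (intro exI[of _ "S \<union> T"] exI[of _ "\<lambda>d. f' d \<oplus>\<^bsub>M\<^esub> g' d"]) auto
    qed
  qed
  have ind: "finite S \<Longrightarrow> \<forall>d\<in>S. f d \<in> homog M d \<Longrightarrow> (\<Oplus>\<^bsub>M\<^esub>d\<in>S. f d) = \<zero>\<^bsub>M\<^esub> \<Longrightarrow> d \<in> S \<Longrightarrow> f d = \<zero>\<^bsub>M\<^esub>"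
    for S f d
    using assms unfolding graded_module_def by blast
  have "h = \<zero>\<^bsub>M\<^esub>" if h: "h \<in> homog M d" "h \<in> offdeg M d" for h d
  proof -
    obtain S f where S: "finite S" "S \<subseteq> - {d}" "\<forall>d\<in>S. f d \<in> homog M d" "h = (\<Oplus>\<^bsub>M\<^esub>d\<in>S. f d)"
      using fs h(2) unfolding offdeg_def by meson
    \<comment> \<open>The decomposition of h over the other degrees, completed by - h in degree d,
      sums to zero.\<close>
    define f' where "f' = f(d := \<ominus>\<^bsub>M\<^esub> h)"
    have f': "f' e \<in> homog M e" if "e \<in> insert d S" for e
      using that S h M.subgroup_neg[OF sg] by (auto simp: f'_def)
    have fc: "f e \<in> carrier M" if "e \<in> S" for e using S(3) hc that by blast
    have "(\<Oplus>\<^bsub>M\<^esub>d\<in>S. f' d) = (\<Oplus>\<^bsub>M\<^esub>d\<in>S. f d)"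
      using S fc by (intro M.finsum_cong') (auto simp: f'_def)
    moreover have "(\<Oplus>\<^bsub>M\<^esub>d\<in>insert d S. f' d) = f' d \<oplus>\<^bsub>M\<^esub> (\<Oplus>\<^bsub>M\<^esub>d\<in>S. f' d)"
      using S fc h hc by (intro M.finsum_insert) (auto simp: f'_def)
    ultimately have "(\<Oplus>\<^bsub>M\<^esub>d\<in>insert d S. f' d) = \<zero>\<^bsub>M\<^esub>"
      using M.l_neg[OF subsetD[OF hc h(1)]] unfolding S(4)[symmetric] by (simp add: f'_def)
    then have "f' d = \<zero>\<^bsub>M\<^esub>" using ind[of "insert d S" f' d] S f' by auto
    then have "\<ominus>\<^bsub>M\<^esub> h = \<zero>\<^bsub>M\<^esub>" by (simp add: f'_def)
    then show ?thesis using M.r_neg[OF subsetD[OF hc h(1)]] M.r_zero[OF subsetD[OF hc h(1)]] by metis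
  qed
  then have "homog M d \<inter> offdeg M d \<subseteq> {\<zero>\<^bsub>M\<^esub>}" for d by blast
  moreover have "carrier M = generate (add_monoid M) (\<Union>d. homog M d)"
    using assms unfolding graded_module_def by (elim conjE)
  ultimately show ?thesis
    unfolding graded_group_def using sg M.abelian_group_axioms by (intro conjI allI)
qed

text \<open>The way back to finite sums: in a vanishing sum the term of degree d is minus the sum of
  the others, so it lies in \<open>offdeg\<close> and must be zero.\<close>

lemma graded_moduleI:
  assumes "left_module A M" "graded_group M"
    and "\<And>d e a m. a \<in> homog A d \<Longrightarrow> m \<in> homog M e \<Longrightarrow> a \<odot>\<^bsub>M\<^esub> m \<in> homog M (d + e)"
  shows "graded_module A M"
proof -
  interpret left_module A M by fact
  interpret ggroup M using assms(2) by unfold_locales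
  have "f d = \<zero>\<^bsub>M\<^esub>"
    if S: "finite S" "\<forall>d\<in>S. f d \<in> homog M d" "(\<Oplus>\<^bsub>M\<^esub>d\<in>S. f d) = \<zero>\<^bsub>M\<^esub>" "d \<in> S" for f S d
  proof -
    have fc: "f e \<in> carrier M" if "e \<in> S" for e using S that homog_closed by blast
    have off: "(\<Oplus>\<^bsub>M\<^esub>d\<in>T. f d) \<in> offdeg M d" if "T \<subseteq> S - {d}" for T
    proof -
      have "finite T" using that S by (meson finite_Diff finite_subset)
      then show ?thesis using that
      proof (induction T rule: finite_induct)
        case empty
        then show ?case using subgroup_zero[OF offdeg_subgroup] by simp
      next
        case (insert e T)
        have e: "e \<in> S" "e \<noteq> d" using insert by auto
        have "(\<Oplus>\<^bsub>M\<^esub>d\<in>insert e T. f d) = f e \<oplus>\<^bsub>M\<^esub> (\<Oplus>\<^bsub>M\<^esub>d\<in>T. f d)"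
          using insert fc by (intro finsum_insert) auto
        moreover have "f e \<in> offdeg M d" using homog_offdeg S e by blast
        ultimately show ?case
          using insert subgroup_add_closed[OF offdeg_subgroup] by auto
      qed
    qed
    have "(\<Oplus>\<^bsub>M\<^esub>d\<in>S. f d) = f d \<oplus>\<^bsub>M\<^esub> (\<Oplus>\<^bsub>M\<^esub>d\<in>S - {d}. f d)"
      using S fc insert_Diff[OF S(4)] finsum_insert[of "S - {d}" d f] by auto
    then have "f d = \<ominus>\<^bsub>M\<^esub> (\<Oplus>\<^bsub>M\<^esub>d\<in>S - {d}. f d)"
      using S fc by (metis DiffD1 Pi_I finsum_closed minus_equality)
    then have "f d \<in> offdeg M d"
      using off[of "S - {d}"] subgroup_neg[OF offdeg_subgroup] by auto
    then show ?thesis using homog_Int_offdeg S by blast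
  qed
  then show ?thesis
    unfolding graded_module_def using assms homog_subgroup carrier_eq
    by (intro conjI allI ballI impI) (assumption | elim conjE; blast)+
qed


lemma (in abelian_group) minus_eq_zero:
  assumes "x \<in> carrier G" "y \<in> carrier G" "x \<ominus> y = \<zero>"
  shows "x = y"
  using add_minus_cancel[OF assms(1,2)] l_zero[OF assms(2)] assms(3) by simp

lemma left_moduleI:
  assumes "ring A" "abelian_group M"
    and "\<And>a x. a \<in> carrier A \<Longrightarrow> x \<in> carrier M \<Longrightarrow> a \<odot>\<^bsub>M\<^esub> x \<in> carrier M"
    and "\<And>a b x. a \<in> carrier A \<Longrightarrow> b \<in> carrier A \<Longrightarrow> x \<in> carrier M \<Longrightarrow>
      (a \<oplus>\<^bsub>A\<^esub> b) \<odot>\<^bsub>M\<^esub> x = a \<odot>\<^bsub>M\<^esub> x \<oplus>\<^bsub>M\<^esub> b \<odot>\<^bsub>M\<^esub> x"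
    and "\<And>a x y. a \<in> carrier A \<Longrightarrow> x \<in> carrier M \<Longrightarrow> y \<in> carrier M \<Longrightarrow>
      a \<odot>\<^bsub>M\<^esub> (x \<oplus>\<^bsub>M\<^esub> y) = a \<odot>\<^bsub>M\<^esub> x \<oplus>\<^bsub>M\<^esub> a \<odot>\<^bsub>M\<^esub> y"
    and "\<And>a b x. a \<in> carrier A \<Longrightarrow> b \<in> carrier A \<Longrightarrow> x \<in> carrier M \<Longrightarrow>
      (a \<otimes>\<^bsub>A\<^esub> b) \<odot>\<^bsub>M\<^esub> x = a \<odot>\<^bsub>M\<^esub> (b \<odot>\<^bsub>M\<^esub> x)"
    and "\<And>x. x \<in> carrier M \<Longrightarrow> \<one>\<^bsub>A\<^esub> \<odot>\<^bsub>M\<^esub> x = x"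
  shows "left_module A M"
  using assms by (simp add: left_module_def left_module_axioms_def)

context left_module
begin

lemma smult_additive: "a \<in> carrier R \<Longrightarrow> additive_map M M (\<lambda>x. a \<odot>\<^bsub>M\<^esub> x)"
  by unfold_locales (auto simp: smult_closed smult_r_distr)

lemma smult_zero: "a \<in> carrier R \<Longrightarrow> a \<odot>\<^bsub>M\<^esub> \<zero>\<^bsub>M\<^esub> = \<zero>\<^bsub>M\<^esub>"
  by (rule additive_map.zero[OF smult_additive])

lemma smult_neg: "a \<in> carrier R \<Longrightarrow> x \<in> carrier M \<Longrightarrow> a \<odot>\<^bsub>M\<^esub> (\<ominus>\<^bsub>M\<^esub> x) = \<ominus>\<^bsub>M\<^esub> (a \<odot>\<^bsub>M\<^esub> x)"
  by (rule additive_map.neg[OF smult_additive])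

lemma smult_minus: "a \<in> carrier R \<Longrightarrow> x \<in> carrier M \<Longrightarrow> y \<in> carrier M \<Longrightarrow>
    a \<odot>\<^bsub>M\<^esub> (x \<ominus>\<^bsub>M\<^esub> y) = a \<odot>\<^bsub>M\<^esub> x \<ominus>\<^bsub>M\<^esub> a \<odot>\<^bsub>M\<^esub> y"
  by (rule additive_map.minus[OF smult_additive])

lemma smult_l_zero: "x \<in> carrier M \<Longrightarrow> \<zero>\<^bsub>R\<^esub> \<odot>\<^bsub>M\<^esub> x = \<zero>\<^bsub>M\<^esub>"
  using smult_l_distr[of "\<zero>\<^bsub>R\<^esub>" "\<zero>\<^bsub>R\<^esub>" x] smult_closed[of "\<zero>\<^bsub>R\<^esub>" x]
  by simp

lemma smult_l_neg: "a \<in> carrier R \<Longrightarrow> x \<in> carrier M \<Longrightarrow> (\<ominus>\<^bsub>R\<^esub> a) \<odot>\<^bsub>M\<^esub> x = \<ominus>\<^bsub>M\<^esub> (a \<odot>\<^bsub>M\<^esub> x)"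
proof -
  assume ax: "a \<in> carrier R" "x \<in> carrier M"
  then have "(\<ominus>\<^bsub>R\<^esub> a) \<odot>\<^bsub>M\<^esub> x \<oplus>\<^bsub>M\<^esub> a \<odot>\<^bsub>M\<^esub> x = \<zero>\<^bsub>M\<^esub>"
    using smult_l_distr[of "\<ominus>\<^bsub>R\<^esub> a" a x] smult_l_zero[of x] by (simp add: R.l_neg)
  then show ?thesis using ax by (intro M.minus_equality[symmetric]) (simp_all add: smult_closed)
qed

end

locale gmodule =
  fixes A :: "('k, 'a) graded" and M :: "('a, 'm) graded"
  assumes gm: "graded_module A M"
begin

sublocale left_module A M using gm by (simp add: graded_module_def)

sublocale ggroup M by unfold_locales (rule graded_module_graded_group[OF gm])

lemma smult_homog: "a \<in> homog A d \<Longrightarrow> m \<in> homog M e \<Longrightarrow> a \<odot>\<^bsub>M\<^esub> m \<in> homog M (d + e)"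
  using gm by (simp add: graded_module_def)

end

lemma gmoduleI: "graded_module A M \<Longrightarrow> gmodule A M"
  by unfold_locales

subsection \<open>Homomorphisms\<close>

lemma graded_homI:
  assumes "\<And>x. x \<in> carrier M \<Longrightarrow> f x \<in> carrier N" "\<And>x. x \<notin> carrier M \<Longrightarrow> f x = undefined"
    and "\<And>x y. x \<in> carrier M \<Longrightarrow> y \<in> carrier M \<Longrightarrow> f (x \<oplus>\<^bsub>M\<^esub> y) = f x \<oplus>\<^bsub>N\<^esub> f y"
    and "\<And>a x. a \<in> carrier A \<Longrightarrow> x \<in> carrier M \<Longrightarrow> f (a \<odot>\<^bsub>M\<^esub> x) = a \<odot>\<^bsub>N\<^esub> f x"
    and "\<And>d x. x \<in> homog M d \<Longrightarrow> f x \<in> homog N d"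
  shows "f \<in> graded_hom A M N"
  unfolding graded_hom_def
  by (intro CollectI conjI ballI allI PiE_I image_subsetI) (fact assms)+

lemma graded_homD:
  assumes "f \<in> graded_hom A M N"
  shows "x \<in> carrier M \<Longrightarrow> f x \<in> carrier N" "x \<notin> carrier M \<Longrightarrow> f x = undefined"
    and "x \<in> carrier M \<Longrightarrow> y \<in> carrier M \<Longrightarrow> f (x \<oplus>\<^bsub>M\<^esub> y) = f x \<oplus>\<^bsub>N\<^esub> f y"
    and "a \<in> carrier A \<Longrightarrow> x \<in> carrier M \<Longrightarrow> f (a \<odot>\<^bsub>M\<^esub> x) = a \<odot>\<^bsub>N\<^esub> f x"
    and "x \<in> homog M d \<Longrightarrow> f x \<in> homog N d"
proof -
  note * = assms[unfolded graded_hom_def mem_Collect_eq]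
  note f = *[THEN conjunct1]
    and add = *[THEN conjunct2, THEN conjunct1]
    and smult = *[THEN conjunct2, THEN conjunct2, THEN conjunct1]
    and homog = *[THEN conjunct2, THEN conjunct2, THEN conjunct2]
  show "x \<in> carrier M \<Longrightarrow> f x \<in> carrier N" "x \<notin> carrier M \<Longrightarrow> f x = undefined"
    by (erule PiE_mem[OF f], erule PiE_arb[OF f])
  show "x \<in> carrier M \<Longrightarrow> y \<in> carrier M \<Longrightarrow> f (x \<oplus>\<^bsub>M\<^esub> y) = f x \<oplus>\<^bsub>N\<^esub> f y"
    using add by blast
  show "a \<in> carrier A \<Longrightarrow> x \<in> carrier M \<Longrightarrow> f (a \<odot>\<^bsub>M\<^esub> x) = a \<odot>\<^bsub>N\<^esub> f x"
    using smult by blast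
  show "x \<in> homog M d \<Longrightarrow> f x \<in> homog N d"
    using homog by blast
qed

lemma graded_hom_additive:
  assumes "f \<in> graded_hom A M N" "abelian_group M" "abelian_group N"
  shows "additive_map M N f"
  using assms(2,3) graded_homD(1,3)[OF assms(1)] by (simp add: additive_map_def additive_map_axioms_def)

text \<open>Any preimage can be replaced by its component of degree d. The rest maps off degree d,
  while v minus the image of the component has degree d, so this difference vanishes.\<close>

lemma graded_hom_lift_homog:
  assumes M: "graded_group M" and N: "graded_group N" and f: "f \<in> graded_hom A M N"
    and "f ` carrier M = carrier N" "v \<in> homog N d"
  shows "\<exists>u\<in>homog M d. f u = v"
proof -
  interpret M: ggroup M by unfold_locales fact
  interpret N: ggroup N by unfold_locales fact
  interpret f: additive_map M N f
    by (rule graded_hom_additive[OF f M.abelian_group_axioms N.abelian_group_axioms])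
  have v: "v \<in> carrier N" by (rule N.homog_closed[OF assms(5)])
  then obtain u where u: "u \<in> carrier M" "f u = v" using assms(4) by (metis imageE)
  obtain h where h: "h \<in> homog M d" "u \<ominus>\<^bsub>M\<^esub> h \<in> offdeg M d" using M.component[OF u(1)] by blast
  have hc: "h \<in> carrier M" using h M.homog_closed by blast
  have "f (u \<ominus>\<^bsub>M\<^esub> h) \<in> offdeg N d"
    using h(2) unfolding offdeg_def[of M]
  proof (rule f.generate_into[rotated -1])
    show "(\<Union>e\<in>- {d}. homog M e) \<subseteq> carrier M" by (rule M.Un_homog_subset)
    show "f x \<in> offdeg N d" if x: "x \<in> (\<Union>e\<in>- {d}. homog M e)" for x
    proof -
      obtain e where "e \<noteq> d" "x \<in> homog M e" using x by auto
      then show ?thesis by (intro N.homog_offdeg[OF graded_homD(5)[OF f]])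
    qed
  qed (rule N.offdeg_subgroup)
  moreover have "f (u \<ominus>\<^bsub>M\<^esub> h) = v \<ominus>\<^bsub>N\<^esub> f h" using u hc by (simp add: f.minus)
  moreover have fh: "f h \<in> homog N d" by (rule graded_homD(5)[OF f h(1)])
  ultimately have "v \<ominus>\<^bsub>N\<^esub> f h = \<zero>\<^bsub>N\<^esub>"
    using N.homog_Int_offdeg[OF N.homog_minus[OF assms(5) fh]] by simp
  then have "f h = v" using N.minus_eq_zero[OF v N.homog_closed[OF fh]] by simp
  then show ?thesis using h by blast
qed

subsection \<open>Shifts, submodules, transport and quotients\<close>

lemma abelian_group_cong:
  fixes M N :: "('a, 'm) graded"
  assumes "carrier M = carrier N" "ring.add M = ring.add N" "ring.zero M = ring.zero N"
  shows "abelian_group M \<longleftrightarrow> abelian_group N"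
  using assms by (simp add: abelian_group_def abelian_monoid_def abelian_group_axioms_def)

lemma graded_shift_simps [simp]:
  "carrier (graded_shift n M) = carrier M" "ring.add (graded_shift n M) = ring.add M"
  "ring.zero (graded_shift n M) = ring.zero M" "module.smult (graded_shift n M) = module.smult M"
  "homog (graded_shift n M) d = homog M (d - n)"
  by (simp_all add: graded_shift_def)

lemma offdeg_shift: "offdeg (graded_shift n M) d = offdeg M (d - n)"
proof -
  have "(\<Union>e\<in>- {d}. homog M (e - n)) = (\<Union>e\<in>- {d - n}. homog M e)"
  proof (intro equalityI subsetI)
    fix x assume "x \<in> (\<Union>e\<in>- {d - n}. homog M e)"
    then obtain e where "e \<noteq> d - n" "x \<in> homog M e" by blast
    then show "x \<in> (\<Union>e\<in>- {d}. homog M (e - n))" by (intro UN_I[of "e + n"]) auto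
  qed auto
  then show ?thesis by (simp add: offdeg_def)
qed

lemma graded_group_shift:
  assumes "graded_group M"
  shows "graded_group (graded_shift n M)"
proof -
  have "(\<Union>d. homog M (d - n)) = (\<Union>d. homog M d)"
  proof (intro equalityI subsetI)
    fix x assume "x \<in> (\<Union>d. homog M d)"
    then obtain e where "x \<in> homog M e" by blast
    then show "x \<in> (\<Union>d. homog M (d - n))" by (intro UN_I[of "e + n"]) auto
  qed auto
  moreover have "abelian_group (graded_shift n M) = abelian_group M"
    by (rule abelian_group_cong) auto
  ultimately show ?thesis using assms by (simp add: graded_group_def offdeg_shift)
qed

lemma graded_module_shift:
  assumes "graded_module A M"
  shows "graded_module A (graded_shift n M)"
proof -
  interpret gmodule A M by (rule gmoduleI) fact
  have "abelian_group (graded_shift n M) = abelian_group M"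
    by (rule abelian_group_cong) auto
  then have "left_module A (graded_shift n M)"
    using left_module_axioms by (simp add: left_module_def left_module_axioms_def)
  then show ?thesis
    by (rule graded_moduleI[OF _ graded_group_shift[OF gg]])
      (use smult_homog in \<open>auto simp: add_diff_eq[symmetric]\<close>)
qed

text \<open>The action is a parameter and may belong to another ring than that of the original
  module. The construction then serves for submodules, for corners and for the passage from
  R(\<gamma>) to \<open>R_z\<close>.\<close>

definition sub_module :: "('a, 'm) graded \<Rightarrow> 'm set \<Rightarrow> ('b \<Rightarrow> 'm \<Rightarrow> 'm) \<Rightarrow> ('b, 'm) graded" where
  "sub_module M S act = \<lparr>carrier = S, monoid.mult = undefined, one = undefined,
     ring.zero = \<zero>\<^bsub>M\<^esub>, ring.add = ring.add M, module.smult = act, homog = (\<lambda>d. S \<inter> homog M d)\<rparr>"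

lemma sub_module_simps [simp]:
  "carrier (sub_module M S act) = S" "ring.add (sub_module M S act) = ring.add M"
  "ring.zero (sub_module M S act) = \<zero>\<^bsub>M\<^esub>" "module.smult (sub_module M S act) = act"
  "homog (sub_module M S act) d = S \<inter> homog M d"
  by (simp_all add: sub_module_def)

lemma (in abelian_group) abelian_subgroup_restrict:
  assumes "subgroup S (add_monoid G)" "carrier N = S" "ring.add N = ring.add G" "ring.zero N = \<zero>"
  shows "abelian_group N"
proof (rule abelian_groupI)
  note [simp] = assms(2-4)
  fix x y z assume "x \<in> carrier N" "y \<in> carrier N" "z \<in> carrier N"
  then have S: "x \<in> S" "y \<in> S" "z \<in> S" by auto
  then have c: "x \<in> carrier G" "y \<in> carrier G" "z \<in> carrier G"
    using subgroup_carrier[OF assms(1)] by blast+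
  show "x \<oplus>\<^bsub>N\<^esub> y \<in> carrier N" using S subgroup_add_closed[OF assms(1)] by simp
  show "x \<oplus>\<^bsub>N\<^esub> y \<oplus>\<^bsub>N\<^esub> z = x \<oplus>\<^bsub>N\<^esub> (y \<oplus>\<^bsub>N\<^esub> z)" "x \<oplus>\<^bsub>N\<^esub> y = y \<oplus>\<^bsub>N\<^esub> x"
    "\<zero>\<^bsub>N\<^esub> \<oplus>\<^bsub>N\<^esub> x = x" using c by (simp_all add: a_ac)
  show "\<exists>y\<in>carrier N. y \<oplus>\<^bsub>N\<^esub> x = \<zero>\<^bsub>N\<^esub>"
    using S c subgroup_neg[OF assms(1)] by (intro bexI[of _ "\<ominus> x"]) (auto simp: l_neg)
qed (use subgroup_zero[OF assms(1)] assms in auto)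

text \<open>The only operation that could differ is the inverse, and inverses in the smaller group
  agree with those of the larger one by uniqueness.\<close>

lemma generate_cong_sub:
  assumes G: "abelian_group G" and N: "abelian_group N" and "carrier N \<subseteq> carrier G"
    and [simp]: "ring.add N = ring.add G" "ring.zero N = ring.zero G"
    and "H \<subseteq> carrier N"
  shows "generate (add_monoid N) H = generate (add_monoid G) H"
proof -
  interpret G: abelian_group G by fact
  interpret N: abelian_group N by fact
  have inv: "\<ominus>\<^bsub>N\<^esub> x = \<ominus>\<^bsub>G\<^esub> x" if "x \<in> carrier N" for x
    using that N.l_neg[of x] assms(3) by (metis N.a_inv_closed G.minus_equality assms(4,5) subsetD)
  have HG: "H \<subseteq> carrier G" using assms by blast
  have "x \<in> generate (add_monoid G) H" if "x \<in> generate (add_monoid N) H" for x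
    using that assms(6)
  proof (induction rule: N.generate_induct)
    case zero
    show ?case using G.subgroup_zero[OF G.generate_subgroup[OF HG]] by simp
  next
    case (gen h)
    have "h \<in> generate (add_monoid G) H" by (rule G.generate_gen[OF gen])
    moreover have "\<ominus>\<^bsub>N\<^esub> h = \<ominus>\<^bsub>G\<^esub> h" by (rule inv[OF subsetD[OF assms(6) gen]])
    ultimately show ?case using G.subgroup_neg[OF G.generate_subgroup[OF HG]] by simp
  next
    case (add x y)
    then show ?case using G.subgroup_add_closed[OF G.generate_subgroup[OF HG]] by simp
  qed
  moreover have "x \<in> generate (add_monoid N) H" if "x \<in> generate (add_monoid G) H" for x
    using that HG
  proof (induction rule: G.generate_induct)
    case zero
    show ?case using N.subgroup_zero[OF N.generate_subgroup[OF assms(6)]] by simp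
  next
    case (gen h)
    have h: "h \<in> generate (add_monoid N) H" by (rule N.generate_gen[OF gen])
    have "\<ominus>\<^bsub>G\<^esub> h = \<ominus>\<^bsub>N\<^esub> h" by (rule inv[OF subsetD[OF assms(6) gen], symmetric])
    then show ?case using h N.subgroup_neg[OF N.generate_subgroup[OF assms(6)] h] by simp
  next
    case (add x y)
    then show ?case using N.subgroup_add_closed[OF N.generate_subgroup[OF assms(6)]] by simp
  qed
  ultimately show ?thesis by blast
qed

lemma graded_group_sub:
  assumes M: "graded_group M" and S: "subgroup S (add_monoid M)"
    and gen: "S \<subseteq> generate (add_monoid M) (\<Union>d. S \<inter> homog M d)"
  shows "graded_group (sub_module M S act)"
proof -
  interpret M: ggroup M by unfold_locales fact
  interpret N: abelian_group "sub_module M S act"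
    by (rule M.abelian_subgroup_restrict[OF S]) auto
  have gc: "generate (add_monoid (sub_module M S act)) H = generate (add_monoid M) H" if "H \<subseteq> S" for H
    by (rule generate_cong_sub)
      (use that M.subgroup_carrier[OF S] M.abelian_group_axioms N.abelian_group_axioms in auto)
  have "S = generate (add_monoid (sub_module M S act)) (\<Union>d. S \<inter> homog M d)"
    using gen M.generate_least[OF S, of "\<Union>d. S \<inter> homog M d"] by (subst gc) blast+
  moreover have "subgroup (S \<inter> homog M d) (add_monoid (sub_module M S act))" for d
  proof (rule N.subgroupI')
    fix x assume x: "x \<in> S \<inter> homog M d"
    have "\<ominus>\<^bsub>sub_module M S act\<^esub> x = \<ominus>\<^bsub>M\<^esub> x"
      using x N.l_neg[of x] M.subgroup_carrier[OF S]
      by (metis IntE N.a_inv_closed M.minus_equality sub_module_simps(1-3))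
    then show "\<ominus>\<^bsub>sub_module M S act\<^esub> x \<in> S \<inter> homog M d"
      using x M.subgroup_neg[OF S] M.homog_neg by auto
  qed (use M.subgroup_zero[OF S] M.homog_zero M.subgroup_add_closed[OF S] M.homog_add in auto)
  moreover have "x = \<zero>\<^bsub>M\<^esub>" if "x \<in> S" "x \<in> homog M d" "x \<in> offdeg (sub_module M S act) d" for x d
  proof -
    have "x \<in> generate (add_monoid M) (\<Union>e\<in>- {d}. S \<inter> homog M e)"
      using that(3) unfolding offdeg_def by (subst (asm) gc) auto
    then have "x \<in> offdeg M d" unfolding offdeg_def
      using M.generate_mono'[of "\<Union>e\<in>- {d}. S \<inter> homog M e" "\<Union>e\<in>- {d}. homog M e"] M.Un_homog_subset
      by blast
    then show ?thesis using M.homog_Int_offdeg that by blast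
  qed
  ultimately show ?thesis
    unfolding graded_group_def using N.abelian_group_axioms by auto
qed

text \<open>Moves a module to another type along an injection. It is needed to bring test modules to
  the one type on which \<open>graded_projective\<close> tests.\<close>

definition transport :: "('m \<Rightarrow> 'n) \<Rightarrow> ('a, 'm) graded \<Rightarrow> ('a, 'n) graded" where
  "transport j M = \<lparr>carrier = j ` carrier M, monoid.mult = undefined, one = undefined,
     ring.zero = j \<zero>\<^bsub>M\<^esub>,
     ring.add = (\<lambda>x y. j (inv_into (carrier M) j x \<oplus>\<^bsub>M\<^esub> inv_into (carrier M) j y)),
     module.smult = (\<lambda>a x. j (a \<odot>\<^bsub>M\<^esub> inv_into (carrier M) j x)),
     homog = (\<lambda>d. j ` homog M d)\<rparr>"

lemma transport_simps:
  assumes "inj_on j (carrier M)"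
  shows "carrier (transport j M) = j ` carrier M" "ring.zero (transport j M) = j \<zero>\<^bsub>M\<^esub>"
    "x \<in> carrier M \<Longrightarrow> y \<in> carrier M \<Longrightarrow> j x \<oplus>\<^bsub>transport j M\<^esub> j y = j (x \<oplus>\<^bsub>M\<^esub> y)"
    "x \<in> carrier M \<Longrightarrow> a \<odot>\<^bsub>transport j M\<^esub> j x = j (a \<odot>\<^bsub>M\<^esub> x)"
    "homog (transport j M) d = j ` homog M d"
  using assms by (simp_all add: transport_def)

lemma graded_module_transport:
  assumes M: "graded_module A M" and inj: "inj_on j (carrier M)"
  shows "graded_module A (transport j M)"
proof -
  interpret gmodule A M by (rule gmoduleI) fact
  note [simp] = transport_simps[OF inj]
  let ?T = "transport j M"
  interpret T: abelian_group ?T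
  proof (rule abelian_groupI)
    fix x assume "x \<in> carrier ?T"
    then show "\<exists>y\<in>carrier ?T. y \<oplus>\<^bsub>?T\<^esub> x = \<zero>\<^bsub>?T\<^esub>"
      by (auto intro!: bexI[of _ "\<ominus>\<^bsub>M\<^esub> _"] simp: M.l_neg)
  qed (auto simp: a_ac)
  have "left_module A ?T"
    using R.ring_axioms T.abelian_group_axioms
    by (rule left_moduleI) (auto simp: smult_closed smult_l_distr smult_r_distr smult_assoc1 smult_one)
  moreover have j: "additive_map M ?T j" by unfold_locales auto
  interpret j: additive_map M ?T j by (rule j)
  have hs: "subgroup (j ` homog M d) (add_monoid ?T)" for d
  proof (rule T.subgroupI')
    show "j ` homog M d \<subseteq> carrier ?T" using homog_closed by auto
    show "\<zero>\<^bsub>?T\<^esub> \<in> j ` homog M d" using homog_zero by auto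
    show "x \<oplus>\<^bsub>?T\<^esub> y \<in> j ` homog M d" if "x \<in> j ` homog M d" "y \<in> j ` homog M d" for x y
      using that homog_add homog_closed by auto
    show "\<ominus>\<^bsub>?T\<^esub> x \<in> j ` homog M d" if "x \<in> j ` homog M d" for x
      using that homog_neg homog_closed by (auto simp: j.neg[symmetric])
  qed
  have gen: "j ` generate (add_monoid M) (\<Union>e\<in>E. homog M e)
      = generate (add_monoid ?T) (\<Union>e\<in>E. j ` homog M e)" for E
  proof -
    have sub: "(\<Union>e\<in>E. homog M e) \<subseteq> carrier M" by (rule Un_homog_subset)
    have sub': "(\<Union>e\<in>E. j ` homog M e) \<subseteq> carrier ?T" using sub by auto
    have "j x \<in> generate (add_monoid ?T) (\<Union>e\<in>E. j ` homog M e)"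
      if "x \<in> generate (add_monoid M) (\<Union>e\<in>E. homog M e)" for x
      using sub T.generate_subgroup[OF sub'] _ that
      by (rule j.generate_into) (rule T.generate_gen, blast)
    moreover have "y \<in> j ` generate (add_monoid M) (\<Union>e\<in>E. homog M e)"
      if "y \<in> generate (add_monoid ?T) (\<Union>e\<in>E. j ` homog M e)" for y
      using that sub'
    proof (induction rule: T.generate_induct)
      case zero
      show ?case using subgroup_zero[OF generate_subgroup[OF sub]] by auto
    next
      case (gen h)
      then obtain e x where x: "e \<in> E" "x \<in> homog M e" "h = j x" by auto
      then have "x \<in> generate (add_monoid M) (\<Union>e\<in>E. homog M e)" by (intro generate_gen) auto
      then show ?case
        using x subgroup_neg[OF generate_subgroup[OF sub]] homog_closed
        by (auto simp: j.neg[symmetric])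
    next
      case (add x y)
      then show ?case
        using subgroup_add_closed[OF generate_subgroup[OF sub]]
          subgroup_carrier[OF generate_subgroup[OF sub]] by auto
    qed
    ultimately show ?thesis by blast
  qed
  have "graded_group ?T"
    unfolding graded_group_def
  proof (intro conjI allI subsetI)
    show "carrier ?T = generate (add_monoid ?T) (\<Union>d. homog ?T d)"
      using gen[of UNIV] carrier_eq by simp
    fix d y assume "y \<in> homog ?T d \<inter> offdeg ?T d"
    then have "y \<in> j ` homog M d" "y \<in> j ` offdeg M d"
      using gen[of "- {d}"] by (auto simp: offdeg_def)
    then obtain x x' where x: "y = j x" "x \<in> homog M d" "y = j x'" "x' \<in> offdeg M d" by blast
    then have "x = x'"
      using inj_onD[OF inj] homog_closed subgroup_carrier[OF offdeg_subgroup] by metis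
    then show "y \<in> {\<zero>\<^bsub>?T\<^esub>}" using x homog_Int_offdeg by auto
  qed (use hs T.abelian_group_axioms in simp_all)
  ultimately show ?thesis
    by (rule graded_moduleI) (use smult_homog homog_closed in auto)
qed


text \<open>Cosets of a subgroup, in the shape in which \<^const>\<open>quot\<close> uses them.\<close>

locale ag_quot = abelian_group M for M :: "('a, 'm) graded" (structure) +
  fixes N
  assumes N: "subgroup N (add_monoid M)"
begin

sublocale Q: abelian_subgroup N M
  using N by (intro abelian_subgroupI3 additive_subgroup.intro abelian_group_axioms)

abbreviation cl :: "'m \<Rightarrow> 'm set" where "cl m \<equiv> N +>\<^bsub>M\<^esub> m"

lemma quot_carrier: "carrier (quot M N) = cl ` carrier M"
  by (auto simp: quot_def FactRing_def A_RCOSETS_defs a_r_coset_def)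

lemma quot_carrierE:
  assumes "C \<in> carrier (quot M N)"
  obtains m where "m \<in> carrier M" "C = cl m"
  using assms by (auto simp: quot_carrier)

lemma quot_add: "x \<in> carrier M \<Longrightarrow> y \<in> carrier M \<Longrightarrow> cl x \<oplus>\<^bsub>quot M N\<^esub> cl y = cl (x \<oplus> y)"
  by (simp add: quot_def FactRing_def Q.a_rcos_sum)

lemma quot_zero: "\<zero>\<^bsub>quot M N\<^esub> = cl \<zero>"
proof -
  have "N \<subseteq> carrier M" using subgroup_carrier[OF N] by blast
  then show ?thesis by (simp add: quot_def FactRing_def a_coset_add_zero)
qed

lemma mem_cl_iff:
  assumes "m \<in> carrier M" "x \<in> carrier M"
  shows "x \<in> cl m \<longleftrightarrow> x \<ominus> m \<in> N"
proof
  assume "x \<in> cl m"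
  then obtain n where "n \<in> N" "x = n \<oplus> m" by (auto simp: a_r_coset_def')
  moreover have "(n \<oplus> m) \<ominus> m = n"
    using subgroup_carrier[OF N \<open>n \<in> N\<close>] assms by (simp add: minus_eq a_assoc r_neg)
  ultimately show "x \<ominus> m \<in> N" by simp
next
  assume "x \<ominus> m \<in> N"
  moreover have "x = (x \<ominus> m) \<oplus> m" using add_minus_cancel assms by simp
  ultimately show "x \<in> cl m" unfolding a_r_coset_def' by blast
qed

lemma cl_subset: "m \<in> carrier M \<Longrightarrow> cl m \<subseteq> carrier M"
  using subgroup_carrier[OF N] by (auto simp: a_r_coset_def')

lemma cl_self: "m \<in> carrier M \<Longrightarrow> m \<in> cl m"
  using subgroup_zero[OF N] by (simp add: mem_cl_iff minus_self)

lemma cl_eq_iff: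
  assumes "x \<in> carrier M" "y \<in> carrier M"
  shows "cl x = cl y \<longleftrightarrow> x \<ominus> y \<in> N"
proof
  assume "cl x = cl y"
  then show "x \<ominus> y \<in> N" using cl_self[OF assms(1)] mem_cl_iff assms by simp
next
  assume "x \<ominus> y \<in> N"
  then have "x \<in> cl y" using mem_cl_iff assms by simp
  then show "cl x = cl y" using a_repr_independence[of x N y] assms(2) N by simp
qed

lemma quot_abelian_group: "abelian_group (quot M N)"
proof (rule abelian_groupI)
  fix x y z assume "x \<in> carrier (quot M N)" "y \<in> carrier (quot M N)" "z \<in> carrier (quot M N)"
  then obtain a b c where abc: "a \<in> carrier M" "x = cl a" "b \<in> carrier M" "y = cl b"
    "c \<in> carrier M" "z = cl c" by (metis quot_carrierE)
  show "x \<oplus>\<^bsub>quot M N\<^esub> y \<in> carrier (quot M N)" using abc by (auto simp: quot_carrier quot_add)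
  show "x \<oplus>\<^bsub>quot M N\<^esub> y \<oplus>\<^bsub>quot M N\<^esub> z = x \<oplus>\<^bsub>quot M N\<^esub> (y \<oplus>\<^bsub>quot M N\<^esub> z)"
    using abc by (simp add: quot_add a_assoc)
  show "x \<oplus>\<^bsub>quot M N\<^esub> y = y \<oplus>\<^bsub>quot M N\<^esub> x" using abc by (simp add: quot_add a_comm)
  show "\<zero>\<^bsub>quot M N\<^esub> \<oplus>\<^bsub>quot M N\<^esub> x = x" using abc by (simp add: quot_add quot_zero)
  show "\<exists>y\<in>carrier (quot M N). y \<oplus>\<^bsub>quot M N\<^esub> x = \<zero>\<^bsub>quot M N\<^esub>"
    using abc by (intro bexI[of _ "cl (\<ominus> a)"]) (auto simp: quot_add quot_zero quot_carrier l_neg)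
qed (auto simp: quot_carrier quot_zero)

lemma cl_additive: "additive_map M (quot M N) cl"
  using abelian_group_axioms quot_abelian_group
  by (auto simp: additive_map_def additive_map_axioms_def quot_carrier quot_add)

lemma quot_homog: "homog (quot M N) d = cl ` homog M d"
  by (simp add: quot_def)

lemma quot_smult:
  assumes m: "m \<in> carrier M" and a: "additive_map M M (\<lambda>x. a \<odot>\<^bsub>M\<^esub> x)"
    and N': "\<And>n. n \<in> N \<Longrightarrow> a \<odot>\<^bsub>M\<^esub> n \<in> N"
  shows "a \<odot>\<^bsub>quot M N\<^esub> cl m = cl (a \<odot>\<^bsub>M\<^esub> m)"
proof -
  interpret a: additive_map M M "\<lambda>x. a \<odot>\<^bsub>M\<^esub> x" by fact
  have "cl (a \<odot>\<^bsub>M\<^esub> x) = cl (a \<odot>\<^bsub>M\<^esub> m)" if "x \<in> cl m" for x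
  proof -
    have x: "x \<in> carrier M" "x \<ominus> m \<in> N" using that cl_subset[OF m] mem_cl_iff[OF m] by auto
    then have "a \<odot>\<^bsub>M\<^esub> x \<ominus> a \<odot>\<^bsub>M\<^esub> m \<in> N" using N'[OF x(2)] a.minus[of x m] m by simp
    then show ?thesis using cl_eq_iff a.closed x m by simp
  qed
  then have "(\<Union>x\<in>cl m. cl (a \<odot>\<^bsub>M\<^esub> x)) = cl (a \<odot>\<^bsub>M\<^esub> m)" using cl_self[OF m] by blast
  then show ?thesis by (simp add: quot_def)
qed

end

locale gg_quot = ggroup M for M :: "('a, 'm) graded" +
  fixes N
  assumes N: "subgroup N (add_monoid M)"
    and N_graded: "N \<subseteq> generate (add_monoid M) (\<Union>d. N \<inter> homog M d)"
begin

sublocale ag_quot M N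
  by (intro ag_quot.intro ag_quot_axioms.intro abelian_group_axioms N)

text \<open>As N is spanned by its homogeneous elements it is a graded group itself, and a component
  taken inside N is also a component in M, because spans and differences agree in both.\<close>

lemma N_component:
  assumes "n \<in> N"
  shows "\<exists>h\<in>N \<inter> homog M d. n \<ominus>\<^bsub>M\<^esub> h \<in> offdeg M d"
proof -
  let ?S = "sub_module M N (\<lambda>(_::'a) x. x)"
  interpret S: ggroup ?S
    by unfold_locales (rule graded_group_sub[OF gg N N_graded])

  have sub: "(\<Union>e\<in>- {d}. N \<inter> homog M e) \<subseteq> N" by blast
  have "offdeg (?S) d \<subseteq> offdeg M d"
  proof -
    have "generate (add_monoid (?S)) (\<Union>e\<in>- {d}. N \<inter> homog M e)
        = generate (add_monoid M) (\<Union>e\<in>- {d}. N \<inter> homog M e)"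
      by (rule generate_cong_sub)
        (use subgroup_carrier[OF N] abelian_group_axioms S.abelian_group_axioms in auto)
    also have "\<dots> \<subseteq> offdeg M d"
      unfolding offdeg_def using Un_homog_subset by (intro generate_mono') blast+
    finally show ?thesis by (simp add: offdeg_def)
  qed
  moreover have "n \<in> carrier ?S" using assms by simp
  then obtain h where "h \<in> homog ?S d" and h3: "n \<ominus>\<^bsub>?S\<^esub> h \<in> offdeg ?S d"
    using S.component by blast
  then have h: "h \<in> N" "h \<in> homog M d" by simp_all
  have c: "n \<in> carrier M" "h \<in> carrier M" using subgroup_carrier[OF N] assms h by blast+
  have "n \<ominus>\<^bsub>?S\<^esub> h = n \<ominus>\<^bsub>M\<^esub> h"
  proof -
    have e: "(n \<ominus>\<^bsub>?S\<^esub> h) \<oplus>\<^bsub>M\<^esub> h = n"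
      using S.add_minus_cancel[of n h] assms h by simp
    have "n \<ominus>\<^bsub>?S\<^esub> h \<in> carrier ?S"
      using S.minus_closed[of n h] assms h by simp
    then have k: "n \<ominus>\<^bsub>?S\<^esub> h \<in> carrier M" using subgroup_carrier[OF N] by simp
    show ?thesis
      using k c add_minus_cancel[OF c] e by (metis add.r_cancel minus_closed)
  qed
  ultimately have "n \<ominus>\<^bsub>M\<^esub> h \<in> offdeg M d" using h3 by (metis subsetD)
  then show ?thesis using h by (intro bexI[of _ h] IntI)
qed

lemma graded_group_quot: "graded_group (quot M N)"
proof -
  interpret T: abelian_group "quot M N" by (rule quot_abelian_group)
  interpret cl: additive_map M "quot M N" cl by (rule cl_additive)
  have hs: "subgroup (cl ` homog M d) (add_monoid (quot M N))" for d
  proof (rule T.subgroupI')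
    show "cl ` homog M d \<subseteq> carrier (quot M N)" using homog_closed by (auto simp: quot_carrier)
    show "\<zero>\<^bsub>quot M N\<^esub> \<in> cl ` homog M d" using homog_zero by (auto simp: quot_zero)
    show "x \<oplus>\<^bsub>quot M N\<^esub> y \<in> cl ` homog M d" if xy: "x \<in> cl ` homog M d" "y \<in> cl ` homog M d" for x y
      using xy homog_add homog_closed by (auto simp: quot_add)
    show "\<ominus>\<^bsub>quot M N\<^esub> x \<in> cl ` homog M d" if x: "x \<in> cl ` homog M d" for x
      using x homog_neg homog_closed by (auto simp: cl.neg[symmetric])
  qed
  have gen: "cl ` generate (add_monoid M) (\<Union>e\<in>E. homog M e)
      = generate (add_monoid (quot M N)) (\<Union>e\<in>E. cl ` homog M e)" for E
  proof -
    have sub: "(\<Union>e\<in>E. homog M e) \<subseteq> carrier M" by (rule Un_homog_subset)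
    have sub': "(\<Union>e\<in>E. cl ` homog M e) \<subseteq> carrier (quot M N)"
      using sub by (auto simp: quot_carrier)
    have "cl x \<in> generate (add_monoid (quot M N)) (\<Union>e\<in>E. cl ` homog M e)"
      if x: "x \<in> generate (add_monoid M) (\<Union>e\<in>E. homog M e)" for x
      using sub T.generate_subgroup[OF sub'] _ x
      by (rule cl.generate_into) (rule T.generate_gen, blast)
    moreover have "y \<in> cl ` generate (add_monoid M) (\<Union>e\<in>E. homog M e)"
      if y: "y \<in> generate (add_monoid (quot M N)) (\<Union>e\<in>E. cl ` homog M e)" for y
      using y sub'
    proof (induction rule: T.generate_induct)
      case zero
      show ?case using subgroup_zero[OF generate_subgroup[OF sub]] by (auto simp: quot_zero)
    next
      case (gen h)
      then obtain e x where x: "e \<in> E" "x \<in> homog M e" "h = cl x" by auto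
      then have "x \<in> generate (add_monoid M) (\<Union>e\<in>E. homog M e)" by (intro generate_gen) auto
      then show ?case
        using x subgroup_neg[OF generate_subgroup[OF sub]] homog_closed
        by (auto simp: cl.neg[symmetric])
    next
      case (add x y)
      then show ?case
        using subgroup_add_closed[OF generate_subgroup[OF sub]]
          subgroup_carrier[OF generate_subgroup[OF sub]] by (auto simp: quot_add)
    qed
    ultimately show ?thesis by blast
  qed
  show ?thesis
    unfolding graded_group_def quot_homog
  proof (intro conjI allI subsetI)
    show "carrier (quot M N) = generate (add_monoid (quot M N)) (\<Union>d. cl ` homog M d)"
      using gen[of UNIV] carrier_eq by (simp add: quot_carrier)
    fix d y assume "y \<in> cl ` homog M d \<inter> offdeg (quot M N) d"
    then have "y \<in> cl ` homog M d" "y \<in> cl ` offdeg M d"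
      using gen[of "- {d}"] by (auto simp: offdeg_def quot_homog)
    then obtain x x' where x: "y = cl x" "x \<in> homog M d" "y = cl x'" "x' \<in> offdeg M d" by blast
    have c: "x \<in> carrier M" "x' \<in> carrier M"
      using homog_closed[OF x(2)] subgroup_carrier[OF offdeg_subgroup x(4)] .
    have "cl x = cl x'" using x(1) x(3) by (rule subst)
    then have "x \<ominus>\<^bsub>M\<^esub> x' \<in> N" unfolding cl_eq_iff[OF c] .
    \<comment> \<open>Here x has degree d, x' lies off degree d, and x - x' is in N. The degree d
      component of x - x' inside N can only be x, so the class of x is zero.\<close>
    from N_component[OF this, of d]
    obtain h where h: "h \<in> N" "h \<in> homog M d" "(x \<ominus>\<^bsub>M\<^esub> x') \<ominus>\<^bsub>M\<^esub> h \<in> offdeg M d"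
      by (elim bexE IntE)
    have hc: "h \<in> carrier M" using homog_closed[OF h(2)] .
    have "x \<ominus>\<^bsub>M\<^esub> h = ((x \<ominus>\<^bsub>M\<^esub> x') \<ominus>\<^bsub>M\<^esub> h) \<oplus>\<^bsub>M\<^esub> x'"
    proof -
      have "((x \<ominus>\<^bsub>M\<^esub> x') \<ominus>\<^bsub>M\<^esub> h) \<oplus>\<^bsub>M\<^esub> x' = ((x \<ominus>\<^bsub>M\<^esub> x') \<oplus>\<^bsub>M\<^esub> x') \<ominus>\<^bsub>M\<^esub> h"
        using c hc by (simp add: minus_eq a_ac)
      then show ?thesis using add_minus_cancel[OF c] by simp
    qed
    then have "x \<ominus>\<^bsub>M\<^esub> h \<in> offdeg M d"
      using subgroup_add_closed[OF offdeg_subgroup h(3) x(4)] by simp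
    then have "x \<ominus>\<^bsub>M\<^esub> h = \<zero>\<^bsub>M\<^esub>" using homog_Int_offdeg[OF homog_minus[OF x(2) h(2)]] by simp
    then have "x = h" by (rule minus_eq_zero[OF c(1) hc])
    then have "cl x = cl \<zero>\<^bsub>M\<^esub>" using h(1) c by (subst cl_eq_iff) (auto simp: minus_zero_right)
    then show "y \<in> {\<zero>\<^bsub>quot M N\<^esub>}" using x by (simp add: quot_zero)
  qed (auto simp: hs T.abelian_group_axioms)
qed

end

text \<open>The spanning condition is what allows induction over homogeneous ring elements. It
  enters whenever a submodule generated by homogeneous elements is to be closed under the whole
  ring.\<close>

locale gring =
  fixes A :: "('k, 'a) graded"
  assumes ring: "ring A"
    and homog_carrier: "a \<in> homog A d \<Longrightarrow> a \<in> carrier A"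
    and spanned: "carrier A \<subseteq> generate (add_monoid A) (\<Union>d. homog A d)"
begin

sublocale ring A by (rule ring)

lemma span_induct [consumes 1, case_names homog add neg zero]:
  assumes "a \<in> carrier A" "\<And>d h. h \<in> homog A d \<Longrightarrow> P h"
    and "\<And>x y. x \<in> carrier A \<Longrightarrow> y \<in> carrier A \<Longrightarrow> P x \<Longrightarrow> P y \<Longrightarrow> P (x \<oplus>\<^bsub>A\<^esub> y)"
    and "\<And>x. x \<in> carrier A \<Longrightarrow> P x \<Longrightarrow> P (\<ominus>\<^bsub>A\<^esub> x)" "P \<zero>\<^bsub>A\<^esub>"
  shows "P a"
proof -
  have sub: "(\<Union>d. homog A d) \<subseteq> carrier A" using homog_carrier by blast
  have "a \<in> generate (add_monoid A) (\<Union>d. homog A d)" using assms(1) spanned by blast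
  from this sub show ?thesis
  proof (induction rule: generate_induct)
    case zero
    then show ?case by (rule assms(5))
  next
    case (gen h)
    then obtain d where "h \<in> homog A d" by blast
    then show ?case using assms(2,4) homog_carrier by blast
  next
    case (add x y)
    then show ?case using assms(3) subgroup_carrier[OF generate_subgroup[OF sub]] by blast
  qed
qed

end

lemma graded_module_quot:
  assumes A: "gring A" and M: "graded_module A M" and N: "graded_submodule A M N"
  shows "graded_module A (quot M N)"
proof -
  interpret gmodule A M by (rule gmoduleI) fact
  have Ns: "subgroup N (add_monoid M)" "\<And>a n. a \<in> carrier A \<Longrightarrow> n \<in> N \<Longrightarrow> a \<odot>\<^bsub>M\<^esub> n \<in> N"
    "N = generate (add_monoid M) (\<Union>d. N \<inter> homog M d)"
    using N by (auto simp: graded_submodule_def)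
  interpret gg_quot M N
    using Ns(1,3) by (intro gg_quot.intro gg_quot_axioms.intro ggroup_axioms) simp_all
  have sm: "a \<odot>\<^bsub>quot M N\<^esub> cl m = cl (a \<odot>\<^bsub>M\<^esub> m)" if "a \<in> carrier A" "m \<in> carrier M" for a m
    using quot_smult smult_additive Ns(2) that by blast
  have "left_module A (quot M N)"
  proof (rule left_moduleI[OF R.ring_axioms quot_abelian_group])
    fix a b x y assume ab: "a \<in> carrier A" "b \<in> carrier A"
      and "x \<in> carrier (quot M N)" "y \<in> carrier (quot M N)"
    then obtain m n where mn: "m \<in> carrier M" "x = cl m" "n \<in> carrier M" "y = cl n"
      by (metis quot_carrierE)
    note [simp] = sm quot_add mn ab smult_closed
    show "a \<odot>\<^bsub>quot M N\<^esub> x \<in> carrier (quot M N)" by (auto simp: quot_carrier)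
    show "(a \<oplus>\<^bsub>A\<^esub> b) \<odot>\<^bsub>quot M N\<^esub> x = a \<odot>\<^bsub>quot M N\<^esub> x \<oplus>\<^bsub>quot M N\<^esub> b \<odot>\<^bsub>quot M N\<^esub> x"
      by (simp add: smult_l_distr)
    show "a \<odot>\<^bsub>quot M N\<^esub> (x \<oplus>\<^bsub>quot M N\<^esub> y) = a \<odot>\<^bsub>quot M N\<^esub> x \<oplus>\<^bsub>quot M N\<^esub> a \<odot>\<^bsub>quot M N\<^esub> y"
      by (simp add: smult_r_distr)
    show "(a \<otimes>\<^bsub>A\<^esub> b) \<odot>\<^bsub>quot M N\<^esub> x = a \<odot>\<^bsub>quot M N\<^esub> (b \<odot>\<^bsub>quot M N\<^esub> x)"
      by (simp add: smult_assoc1)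
  next
    fix x assume "x \<in> carrier (quot M N)"
    then show "\<one>\<^bsub>A\<^esub> \<odot>\<^bsub>quot M N\<^esub> x = x"
      by (auto elim!: quot_carrierE simp: sm smult_one)
  qed
  moreover have "a \<odot>\<^bsub>quot M N\<^esub> x \<in> homog (quot M N) (d + e)"
    if a: "a \<in> homog A d" and x: "x \<in> homog (quot M N) e" for a x d e
  proof -
    obtain m where m: "m \<in> homog M e" "x = cl m" using x by (auto simp: quot_homog)
    have "a \<odot>\<^bsub>quot M N\<^esub> x = cl (a \<odot>\<^bsub>M\<^esub> m)"
      using m sm[OF gring.homog_carrier[OF A a] homog_closed[OF m(1)]] by simp
    then show ?thesis using smult_homog[OF a m(1)] by (simp add: quot_homog)
  qed
  ultimately show ?thesis using graded_group_quot by (intro graded_moduleI)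
qed


lemma (in additive_map) finsum:
  assumes "finite S" "\<And>i. i \<in> S \<Longrightarrow> t i \<in> carrier M"
  shows "f (\<Oplus>\<^bsub>M\<^esub>i\<in>S. t i) = (\<Oplus>\<^bsub>N\<^esub>i\<in>S. f (t i))"
  using assms
proof (induction S rule: finite_induct)
  case (insert i S)
  have t: "t \<in> S \<rightarrow> carrier M" "t i \<in> carrier M" using insert.prems by auto
  have ft: "(\<lambda>i. f (t i)) \<in> S \<rightarrow> carrier N" "f (t i) \<in> carrier N" using t closed by auto
  have "f (\<Oplus>\<^bsub>M\<^esub>i\<in>S. t i) = (\<Oplus>\<^bsub>N\<^esub>i\<in>S. f (t i))" using insert by simp
  then show ?case
    using insert.hyps t ft by (simp add: add[OF t(2) M.finsum_closed[OF t(1)]])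
qed (simp add: zero)

lemma (in abelian_group) subgroup_finsum:
  assumes "subgroup H (add_monoid G)" "finite S" "\<And>i. i \<in> S \<Longrightarrow> t i \<in> H"
  shows "(\<Oplus>i\<in>S. t i) \<in> H"
  using assms(2,3)
proof (induction S rule: finite_induct)
  case (insert i S)
  then have "t \<in> S \<rightarrow> carrier G" "t i \<in> carrier G" using subgroup_carrier[OF assms(1)] by auto
  then show ?case using insert subgroup_add_closed[OF assms(1)] by simp
qed (simp add: subgroup_zero[OF assms(1)])

lemma graded_hom_compose:
  assumes f: "f \<in> graded_hom A B Y" and g: "g \<in> graded_hom A Y Z"
    and B: "graded_module A B"
  shows "(\<lambda>x\<in>carrier B. g (f x)) \<in> graded_hom A B Z"
proof -
  interpret B: gmodule A B by (rule gmoduleI) fact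
  show ?thesis
  proof (rule graded_homI)
    fix d x assume x: "x \<in> homog B d"
    show "(\<lambda>x\<in>carrier B. g (f x)) x \<in> homog Z d"
      using B.homog_closed[OF x] graded_homD(5)[OF g graded_homD(5)[OF f x]] by simp
  next
    fix x y assume "x \<in> carrier B" "y \<in> carrier B"
    then show "(\<lambda>x\<in>carrier B. g (f x)) (x \<oplus>\<^bsub>B\<^esub> y)
        = (\<lambda>x\<in>carrier B. g (f x)) x \<oplus>\<^bsub>Z\<^esub> (\<lambda>x\<in>carrier B. g (f x)) y"
      by (simp add: graded_homD[OF f] graded_homD(1,3)[OF g])
  next
    fix a x assume "a \<in> carrier A" "x \<in> carrier B"
    then show "(\<lambda>x\<in>carrier B. g (f x)) (a \<odot>\<^bsub>B\<^esub> x) = a \<odot>\<^bsub>Z\<^esub> (\<lambda>x\<in>carrier B. g (f x)) x"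
      by (simp add: graded_homD[OF f] graded_homD(1,4)[OF g] B.smult_closed)
  qed (simp_all add: graded_homD(1)[OF f] graded_homD(1)[OF g])
qed

text \<open>Moves a shift from the source to the target. The degree d part of Ext can then be
  treated with the original resolution and a shifted coefficient module.\<close>

lemma graded_hom_shift:
  "f \<in> graded_hom A (graded_shift d M) N \<longleftrightarrow> f \<in> graded_hom A M (graded_shift (- d) N)"
proof -
  have "(\<forall>e. f ` homog M (e - d) \<subseteq> homog N e) \<longleftrightarrow> (\<forall>e. f ` homog M e \<subseteq> homog N (e + d))"
    by (metis add_diff_cancel diff_add_cancel)
  then show ?thesis by (simp add: graded_hom_def)
qed

lemma graded_module_sub:
  assumes A: "gring A" and M: "graded_module A M" and S: "subgroup S (add_monoid M)"
    and closed: "\<And>a s. a \<in> carrier A \<Longrightarrow> s \<in> S \<Longrightarrow> a \<odot>\<^bsub>M\<^esub> s \<in> S"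
    and gen: "S \<subseteq> generate (add_monoid M) (\<Union>d. S \<inter> homog M d)"
  shows "graded_module A (sub_module M S (module.smult M))"
proof -
  interpret M: gmodule A M by (rule gmoduleI) fact
  note gg = graded_group_sub[OF M.gg S gen, of "module.smult M"]
  interpret S: ggroup "sub_module M S (module.smult M)" by unfold_locales (rule gg)
  have sc: "s \<in> carrier M" if "s \<in> S" for s using M.subgroup_carrier[OF S that] .
  have "left_module A (sub_module M S (module.smult M))"
    using M.R.ring_axioms S.abelian_group_axioms
    by (rule left_moduleI)
      (simp_all add: closed sc M.smult_l_distr M.smult_r_distr M.smult_assoc1 M.smult_one)
  then show ?thesis
    by (rule graded_moduleI[OF _ gg])
      (simp add: closed M.smult_homog gring.homog_carrier[OF A])
qed

section \<open>Spans of homogeneous elements and modules of functions\<close>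

definition span_module :: "('a, 'm) graded \<Rightarrow> ('a, 'm) graded" where
  "span_module F = F\<lparr>carrier := generate (add_monoid F) (\<Union>d. homog F d)\<rparr>"

lemma span_module_simps [simp]:
  "carrier (span_module F) = generate (add_monoid F) (\<Union>d. homog F d)"
  "ring.add (span_module F) = ring.add F" "ring.zero (span_module F) = ring.zero F"
  "module.smult (span_module F) = module.smult F" "homog (span_module F) = homog F"
  by (simp_all add: span_module_def)

lemma graded_module_span:
  assumes A: "gring A" and F: "left_module A F"
    and sub: "\<And>d. subgroup (homog F d) (add_monoid F)"
    and disj: "\<And>d h. h \<in> homog F d \<Longrightarrow> h \<in> offdeg F d \<Longrightarrow> h = \<zero>\<^bsub>F\<^esub>"
    and smult: "\<And>a d h e. a \<in> homog A d \<Longrightarrow> h \<in> homog F e \<Longrightarrow> a \<odot>\<^bsub>F\<^esub> h \<in> homog F (d + e)"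
  shows "graded_module A (span_module F)"
proof -
  interpret A: gring A by fact
  interpret F: left_module A F by fact
  define S where "S = generate (add_monoid F) (\<Union>d. homog F d)"
  have hc: "(\<Union>d\<in>E. homog F d) \<subseteq> carrier F" for E
    using F.subgroup_carrier[OF sub] by blast
  have S: "subgroup S (add_monoid F)" unfolding S_def by (rule F.generate_subgroup[OF hc])
  have hS: "h \<in> S" if "h \<in> homog F d" for h d
    unfolding S_def using that by (intro F.generate_gen) blast
  have sc: "s \<in> carrier F" if "s \<in> S" for s using F.subgroup_carrier[OF S that] .
  have closed: "a \<odot>\<^bsub>F\<^esub> s \<in> S" if "a \<in> carrier A" "s \<in> S" for a s
    using that
  proof (induction a arbitrary: s rule: A.span_induct)
    case (homog d a)
    interpret a: additive_map F F "\<lambda>x. a \<odot>\<^bsub>F\<^esub> x"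
      using F.smult_additive A.homog_carrier[OF homog(1)] .
    show ?case
    proof (rule a.generate_into[OF hc S _ homog(2)[unfolded S_def]])
      fix h assume "h \<in> (\<Union>d. homog F d)"
      then obtain e where "h \<in> homog F e" by blast
      then show "a \<odot>\<^bsub>F\<^esub> h \<in> S" using hS[OF smult[OF homog(1)]] by blast
    qed
  next
    case (add x y)
    then show ?case using F.smult_l_distr[OF _ _ sc] F.subgroup_add_closed[OF S] by simp
  next
    case (neg x)
    then show ?case using F.smult_l_neg[OF _ sc] F.subgroup_neg[OF S] by simp
  next
    case zero
    then show ?case using F.smult_l_zero[OF sc] F.subgroup_zero[OF S] by simp
  qed
  interpret T: abelian_group "span_module F"
    by (rule F.abelian_subgroup_restrict[OF S]) (simp_all add: S_def)
  have gc: "generate (add_monoid (span_module F)) (\<Union>d\<in>E. homog F d)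
      = generate (add_monoid F) (\<Union>d\<in>E. homog F d)" for E
    by (rule generate_cong_sub[OF F.abelian_group_axioms T.abelian_group_axioms])
      (use sc hS in \<open>auto simp: S_def\<close>)
  have neg: "\<ominus>\<^bsub>span_module F\<^esub> x = \<ominus>\<^bsub>F\<^esub> x" if "x \<in> S" for x
  proof -
    have x: "x \<in> carrier (span_module F)" using that by (simp add: S_def)
    have "\<ominus>\<^bsub>span_module F\<^esub> x \<in> S" using T.a_inv_closed[OF x] by (simp add: S_def)
    moreover have "\<ominus>\<^bsub>span_module F\<^esub> x \<oplus>\<^bsub>F\<^esub> x = \<zero>\<^bsub>F\<^esub>" using T.l_neg[OF x] by simp
    ultimately show ?thesis using F.minus_equality[OF _ sc[OF that] sc] by simp
  qed
  have "subgroup (homog F d) (add_monoid (span_module F))" for d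
  proof (rule T.subgroupI')
    show "homog F d \<subseteq> carrier (span_module F)" using hS by (auto simp: S_def)
    show "\<ominus>\<^bsub>span_module F\<^esub> x \<in> homog F d" if "x \<in> homog F d" for x
      using neg[OF hS[OF that]] F.subgroup_neg[OF sub that] by simp
  qed (simp_all add: F.subgroup_zero[OF sub] F.subgroup_add_closed[OF sub])
  then have "graded_group (span_module F)"
    unfolding graded_group_def
  proof (intro conjI allI subsetI)
    have od: "offdeg (span_module F) d = offdeg F d" for d
      unfolding offdeg_def using gc[of "- {d}"] by (simp only: span_module_simps)
    show "carrier (span_module F) = generate (add_monoid (span_module F)) (\<Union>d. homog (span_module F) d)"
      using gc[of UNIV] by (simp only: span_module_simps)
    fix d x assume "x \<in> homog (span_module F) d \<inter> offdeg (span_module F) d"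
    then have "x \<in> homog F d" "x \<in> offdeg F d" unfolding od by simp_all
    then show "x \<in> {\<zero>\<^bsub>span_module F\<^esub>}" using disj[of x d] by simp
  qed (simp_all only: T.abelian_group_axioms span_module_simps(5))
  moreover have "left_module A (span_module F)"
    using A.ring T.abelian_group_axioms
    by (rule left_moduleI)
      (simp_all add: S_def[symmetric] closed sc F.smult_l_distr F.smult_r_distr F.smult_assoc1
        F.smult_one)
  ultimately show ?thesis
    by (intro graded_moduleI) (simp_all add: smult)
qed

text \<open>The homogeneous sets are left open, and \<open>span_module\<close> afterwards cuts out
  the finite sums of homogeneous functions. The full space of functions is in general larger than
  the direct sum of its degrees.\<close>

definition fun_module :: "'x set \<Rightarrow> ('a, 'u) graded \<Rightarrow> (int \<Rightarrow> ('x \<Rightarrow> 'u) set) \<Rightarrow>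
    ('a, 'x \<Rightarrow> 'u) graded" where
  "fun_module B U H = \<lparr>carrier = B \<rightarrow>\<^sub>E carrier U, monoid.mult = undefined, one = undefined,
     ring.zero = (\<lambda>x\<in>B. \<zero>\<^bsub>U\<^esub>), ring.add = (\<lambda>f g. \<lambda>x\<in>B. f x \<oplus>\<^bsub>U\<^esub> g x),
     module.smult = (\<lambda>a f. \<lambda>x\<in>B. a \<odot>\<^bsub>U\<^esub> f x), homog = H\<rparr>"

lemma fun_module_simps [simp]:
  "carrier (fun_module B U H) = B \<rightarrow>\<^sub>E carrier U"
  "\<zero>\<^bsub>fun_module B U H\<^esub> = (\<lambda>x\<in>B. \<zero>\<^bsub>U\<^esub>)"
  "f \<oplus>\<^bsub>fun_module B U H\<^esub> g = (\<lambda>x\<in>B. f x \<oplus>\<^bsub>U\<^esub> g x)"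
  "a \<odot>\<^bsub>fun_module B U H\<^esub> f = (\<lambda>x\<in>B. a \<odot>\<^bsub>U\<^esub> f x)"
  "homog (fun_module B U H) = H"
  by (simp_all add: fun_module_def)

lemma left_module_fun_module:
  assumes "left_module A U"
  shows "left_module A (fun_module B U H)"
proof -
  interpret U: left_module A U by fact
  let ?F = "fun_module B U H"
  have eqI: "f = g" if "f \<in> B \<rightarrow>\<^sub>E carrier U" "g \<in> B \<rightarrow>\<^sub>E carrier U" "\<And>x. x \<in> B \<Longrightarrow> f x = g x" for f g
    using that by (metis PiE_ext)
  have mem: "f x \<in> carrier U" if "f \<in> B \<rightarrow>\<^sub>E carrier U" "x \<in> B" for f x
    using that by (rule PiE_mem)
  have restr: "(\<lambda>x\<in>B. f x) = f" if "f \<in> B \<rightarrow>\<^sub>E carrier U" for f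
    using that by (simp add: PiE_iff extensional_restrict)
  have "abelian_group ?F"
  proof (rule abelian_groupI)
    fix f g h assume "f \<in> carrier ?F" "g \<in> carrier ?F" "h \<in> carrier ?F"
    then have fgh: "f \<in> B \<rightarrow>\<^sub>E carrier U" "g \<in> B \<rightarrow>\<^sub>E carrier U" "h \<in> B \<rightarrow>\<^sub>E carrier U" by simp_all
    note m = mem[OF fgh(1)] mem[OF fgh(2)] mem[OF fgh(3)]
    show "f \<oplus>\<^bsub>?F\<^esub> g \<in> carrier ?F" using m by simp
    show "f \<oplus>\<^bsub>?F\<^esub> g \<oplus>\<^bsub>?F\<^esub> h = f \<oplus>\<^bsub>?F\<^esub> (g \<oplus>\<^bsub>?F\<^esub> h)"
      using m by (auto simp: U.a_assoc intro!: restrict_ext)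
    show "f \<oplus>\<^bsub>?F\<^esub> g = g \<oplus>\<^bsub>?F\<^esub> f"
      using m by (auto simp: U.a_comm intro!: restrict_ext)
    show "\<zero>\<^bsub>?F\<^esub> \<oplus>\<^bsub>?F\<^esub> f = f"
      using m fgh by (intro eqI) simp_all
    show "\<exists>g\<in>carrier ?F. g \<oplus>\<^bsub>?F\<^esub> f = \<zero>\<^bsub>?F\<^esub>"
      using m by (intro bexI[of _ "\<lambda>x\<in>B. \<ominus>\<^bsub>U\<^esub> f x"]) (auto simp: U.l_neg intro!: restrict_ext)
  qed simp
  with U.R.ring_axioms show ?thesis
  proof (rule left_moduleI)
    fix a b f g assume ab: "a \<in> carrier A" "b \<in> carrier A" and "f \<in> carrier ?F" "g \<in> carrier ?F"
    then have fg: "f \<in> B \<rightarrow>\<^sub>E carrier U" "g \<in> B \<rightarrow>\<^sub>E carrier U" by simp_all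
    note m = mem[OF fg(1)] mem[OF fg(2)]
    show "a \<odot>\<^bsub>?F\<^esub> f \<in> carrier ?F" using m ab by (simp add: U.smult_closed)
    show "(a \<oplus>\<^bsub>A\<^esub> b) \<odot>\<^bsub>?F\<^esub> f = a \<odot>\<^bsub>?F\<^esub> f \<oplus>\<^bsub>?F\<^esub> b \<odot>\<^bsub>?F\<^esub> f"
      using m ab by (auto simp: U.smult_l_distr intro!: restrict_ext)
    show "a \<odot>\<^bsub>?F\<^esub> (f \<oplus>\<^bsub>?F\<^esub> g) = a \<odot>\<^bsub>?F\<^esub> f \<oplus>\<^bsub>?F\<^esub> a \<odot>\<^bsub>?F\<^esub> g"
      using m ab by (auto simp: U.smult_r_distr intro!: restrict_ext)
    show "(a \<otimes>\<^bsub>A\<^esub> b) \<odot>\<^bsub>?F\<^esub> f = a \<odot>\<^bsub>?F\<^esub> (b \<odot>\<^bsub>?F\<^esub> f)"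
      using m ab by (auto simp: U.smult_assoc1 intro!: restrict_ext)
  next
    fix f assume "f \<in> carrier ?F"
    then have f: "f \<in> B \<rightarrow>\<^sub>E carrier U" by simp
    show "\<one>\<^bsub>A\<^esub> \<odot>\<^bsub>?F\<^esub> f = f"
      using f mem[OF f] by (intro eqI) (simp_all add: U.smult_one)
  qed
qed

text \<open>\<open>Bh e\<close> is the set of points of degree \<open>e\<close>, by which homogeneous functions are determined.\<close>

lemma graded_module_fun_span:
  assumes A: "gring A" and U: "graded_module A U"
    and H: "\<And>d h. h \<in> H d \<Longrightarrow> h \<in> B \<rightarrow>\<^sub>E carrier U"
    and Bh: "\<And>e. Bh e \<subseteq> B"
    and deg: "\<And>d e h x. h \<in> H d \<Longrightarrow> x \<in> Bh e \<Longrightarrow> h x \<in> homog U (d + e)"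
    and sep: "\<And>d h. h \<in> H d \<Longrightarrow> (\<And>e x. x \<in> Bh e \<Longrightarrow> h x = \<zero>\<^bsub>U\<^esub>) \<Longrightarrow> h = (\<lambda>x\<in>B. \<zero>\<^bsub>U\<^esub>)"
    and zero: "\<And>d. (\<lambda>x\<in>B. \<zero>\<^bsub>U\<^esub>) \<in> H d"
    and add: "\<And>d h k. h \<in> H d \<Longrightarrow> k \<in> H d \<Longrightarrow> (\<lambda>x\<in>B. h x \<oplus>\<^bsub>U\<^esub> k x) \<in> H d"
    and neg: "\<And>d h. h \<in> H d \<Longrightarrow> (\<lambda>x\<in>B. \<ominus>\<^bsub>U\<^esub> h x) \<in> H d"
    and smult: "\<And>a d h e. a \<in> homog A d \<Longrightarrow> h \<in> H e \<Longrightarrow> (\<lambda>x\<in>B. a \<odot>\<^bsub>U\<^esub> h x) \<in> H (d + e)"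
  shows "graded_module A (span_module (fun_module B U H))"
proof -
  interpret U: gmodule A U by (rule gmoduleI) fact
  let ?F = "fun_module B U H"
  interpret F: left_module A ?F by (rule left_module_fun_module) (rule U.left_module_axioms)
  have negF: "\<ominus>\<^bsub>?F\<^esub> h = (\<lambda>x\<in>B. \<ominus>\<^bsub>U\<^esub> h x)" if h: "h \<in> B \<rightarrow>\<^sub>E carrier U" for h
  proof (rule F.minus_equality)
    show "(\<lambda>x\<in>B. \<ominus>\<^bsub>U\<^esub> h x) \<oplus>\<^bsub>?F\<^esub> h = \<zero>\<^bsub>?F\<^esub>"
      using PiE_mem[OF h] by (auto simp: U.l_neg intro!: restrict_ext)
  qed (use h PiE_mem[OF h] in simp_all)
  show ?thesis
  proof (rule graded_module_span[OF A F.left_module_axioms])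
    show "subgroup (homog ?F d) (add_monoid ?F)" for d
    proof (rule F.subgroupI')
      show "homog ?F d \<subseteq> carrier ?F" using H by auto
      show "\<ominus>\<^bsub>?F\<^esub> h \<in> homog ?F d" if "h \<in> homog ?F d" for h
        using that neg negF[OF H] by simp
    qed (simp_all add: zero add)
    show "a \<odot>\<^bsub>?F\<^esub> h \<in> homog ?F (d + e)" if "a \<in> homog A d" "h \<in> homog ?F e" for a d h e
      using that smult by simp
    fix d h assume h: "h \<in> homog ?F d" "h \<in> offdeg ?F d"
    \<comment> \<open>Evaluation at a point of degree e raises degrees by e. So h x is homogeneous
      of degree d + e and at the same time a sum of elements of other degrees.\<close>
    have "h x = \<zero>\<^bsub>U\<^esub>" if x: "x \<in> Bh e" for x e
    proof -
      have xX: "x \<in> B" using x Bh by blast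
      interpret ev: additive_map ?F U "\<lambda>h. h x"
        by unfold_locales (use xX in \<open>auto simp: PiE_mem\<close>)
      have "h x \<in> offdeg U (d + e)"
      proof (rule ev.generate_into[OF _ U.offdeg_subgroup _ h(2)[unfolded offdeg_def]])
        show "(\<Union>e\<in>- {d}. homog ?F e) \<subseteq> carrier ?F" using H by auto
        fix k assume "k \<in> (\<Union>e\<in>- {d}. homog ?F e)"
        then obtain d' where d': "d' \<noteq> d" "k \<in> H d'" by auto
        have "d' + e \<noteq> d + e" using d' by simp
        then show "k x \<in> offdeg U (d + e)" by (rule U.homog_offdeg[OF deg[OF d'(2) x]])
      qed
      then show ?thesis using U.homog_Int_offdeg deg[OF _ x, of h d] h(1) by simp
    qed
    then show "h = \<zero>\<^bsub>?F\<^esub>" using sep[of h d] h(1) by simp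
  qed
qed

text \<open>The lifting property for one given pair of test modules. The pair is an argument because
  a definition by quantification would fix the types of the test modules, and several types
  occur.\<close>

definition lifts :: "('k, 'a) graded \<Rightarrow> ('a, 'm) graded \<Rightarrow> ('a, 'u) graded \<Rightarrow> ('a, 'v) graded \<Rightarrow> bool" where
  "lifts A M U V \<longleftrightarrow> (\<forall>g f. g \<in> graded_hom A U V \<and> g ` carrier U = carrier V \<and>
     f \<in> graded_hom A M V \<longrightarrow> (\<exists>h\<in>graded_hom A M U. \<forall>x\<in>carrier M. g (h x) = f x))"

lemma transport_hom:
  assumes inj: "inj_on j (carrier M)" and h: "h \<in> graded_hom A B M" and B: "graded_module A B"
  shows "(\<lambda>x\<in>carrier B. j (h x)) \<in> graded_hom A B (transport j M)"
proof -
  interpret B: gmodule A B by (rule gmoduleI) fact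
  show ?thesis
  proof (rule graded_homI)
    fix d x assume x: "x \<in> homog B d"
    show "(\<lambda>x\<in>carrier B. j (h x)) x \<in> homog (transport j M) d"
      using B.homog_closed[OF x] graded_homD(5)[OF h x] by (simp add: transport_simps[OF inj])
  qed (simp_all add: graded_homD(1,3,4)[OF h] transport_simps[OF inj] B.smult_closed)
qed

lemma transport_inv_hom:
  assumes inj: "inj_on j (carrier M)" and M: "graded_module A M"
  shows "(\<lambda>y\<in>j ` carrier M. inv_into (carrier M) j y) \<in> graded_hom A (transport j M) M"
proof -
  interpret M: gmodule A M by (rule gmoduleI) fact
  note [simp] = transport_simps[OF inj] inv_into_f_f[OF inj] inj_on_eq_iff[OF inj]
  show ?thesis
    by (rule graded_homI) (auto simp: M.smult_closed M.homog_closed)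
qed


text \<open>In \<^const>\<open>graded_projective\<close> the test modules live on a fixed type. Arbitrary test modules
  reduce to these: replace the target by the image of \<open>P\<close> and the source by the submodule spanned
  by homogeneous lifts of the images of the homogeneous \<open>b \<in> P\<close>, whose elements are determined by
  coefficient functions \<open>'p \<Rightarrow> 'a\<close>.\<close>

theorem projective_lifts:
  fixes A :: "('k, 'a) graded" and P :: "('a, 'p) graded"
  assumes A: "gring A" and P: "graded_projective A P"
    and U: "graded_module A U" and V: "graded_module A V"
  shows "lifts A P U V"
  unfolding lifts_def
proof (intro allI impI, elim conjE)
  fix g f
  assume g: "g \<in> graded_hom A U V" and surj: "g ` carrier U = carrier V" and f: "f \<in> graded_hom A P V"
  interpret A: gring A by fact
  have PP: "graded_module A P" using P by (simp add: graded_projective_def)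
  interpret P: gmodule A P by (rule gmoduleI[OF PP])
  interpret U: gmodule A U by (rule gmoduleI) fact
  interpret V: gmodule A V by (rule gmoduleI) fact
  interpret f: additive_map P V f
    by (rule graded_hom_additive[OF f P.abelian_group_axioms V.abelian_group_axioms])
  interpret g: additive_map U V g
    by (rule graded_hom_additive[OF g U.abelian_group_axioms V.abelian_group_axioms])
  define Bs where "Bs = (\<Union>d. homog P d)"
  have "\<exists>u. \<exists>d. b \<in> homog P d \<and> u \<in> homog U d \<and> g u = f b" if b: "b \<in> Bs" for b
  proof -
    obtain d where d: "b \<in> homog P d" using b by (auto simp: Bs_def)
    show ?thesis
      using graded_hom_lift_homog[OF U.gg V.gg g surj graded_homD(5)[OF f d]] d by blast
  qed
  then obtain m where m: "\<And>b. b \<in> Bs \<Longrightarrow> \<exists>d. b \<in> homog P d \<and> m b \<in> homog U d \<and> g (m b) = f b"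
    by metis
  have mU: "m b \<in> carrier U" and gm: "g (m b) = f b" if "b \<in> Bs" for b
    using m[OF that] U.homog_closed by blast+
  have BsP: "b \<in> carrier P" if "b \<in> Bs" for b using m[OF that] P.homog_closed by blast
  define comb where "comb c S = (\<Oplus>\<^bsub>U\<^esub>b\<in>S. c b \<odot>\<^bsub>U\<^esub> m b)" for c S
  \<comment> \<open>A finitely supported coefficient function on \<open>'p\<close> with values in
    the ring is an element of \<open>'p \<Rightarrow> 'a\<close>, the type on which projectivity
    tests. Several functions may represent the same u, but a function represents at most one
    u.\<close>
  define rep where "rep c u \<longleftrightarrow> (\<exists>S. finite S \<and> S \<subseteq> Bs \<and> (\<forall>b\<in>S. c b \<in> carrier A) \<and>
    (\<forall>b. b \<notin> S \<longrightarrow> c b = \<zero>\<^bsub>A\<^esub>) \<and> u = comb c S)" for c :: "'p \<Rightarrow> 'a" and u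
  have trm: "c b \<odot>\<^bsub>U\<^esub> m b \<in> carrier U" if "b \<in> Bs" "c b \<in> carrier A" for c b
    using U.smult_closed mU that by blast
  have comb_ext: "comb c S = comb c T"
    if "finite T" "S \<subseteq> T" "T \<subseteq> Bs" "\<And>b. b \<in> S \<Longrightarrow> c b \<in> carrier A" "\<And>b. b \<notin> S \<Longrightarrow> c b = \<zero>\<^bsub>A\<^esub>" for c S T
    unfolding comb_def
  proof (rule U.add.finprod_mono_neutral_cong_left)
    show "c b \<odot>\<^bsub>U\<^esub> m b = \<zero>\<^bsub>U\<^esub>" if b: "b \<in> T - S" for b
      using b \<open>T \<subseteq> Bs\<close> \<open>\<And>b. b \<notin> S \<Longrightarrow> c b = \<zero>\<^bsub>A\<^esub>\<close> mU by (auto intro!: U.smult_l_zero)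
    show "(\<lambda>b. c b \<odot>\<^bsub>U\<^esub> m b) \<in> T \<rightarrow> carrier U"
    proof
      fix b assume b: "b \<in> T"
      have "c b \<in> carrier A" using that(4,5) A.zero_closed by (cases "b \<in> S") auto
      then show "c b \<odot>\<^bsub>U\<^esub> m b \<in> carrier U" using trm b that(3) by auto
    qed
  qed (use that in auto)
  have repD: "\<exists>S. finite S \<and> T \<subseteq> S \<and> S \<subseteq> Bs \<and> u = comb c S" and repc: "c b \<in> carrier A"
    if r: "rep c u" and T: "finite T" "T \<subseteq> Bs" for c u T b
  proof -
    obtain S where S: "finite S" "S \<subseteq> Bs" "\<forall>b\<in>S. c b \<in> carrier A" "\<forall>b. b \<notin> S \<longrightarrow> c b = \<zero>\<^bsub>A\<^esub>"
      "u = comb c S" using r by (auto simp: rep_def)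
    show "c b \<in> carrier A" using S A.zero_closed by (cases "b \<in> S") auto
    have "comb c S = comb c (S \<union> T)" using S T by (intro comb_ext) auto
    then show "\<exists>S. finite S \<and> T \<subseteq> S \<and> S \<subseteq> Bs \<and> u = comb c S"
      using S T by (intro exI[of _ "S \<union> T"]) auto
  qed
  have rep2: "\<exists>S. finite S \<and> S \<subseteq> Bs \<and> u = comb c S \<and> u' = comb c' S \<and>
      (\<forall>b. b \<notin> S \<longrightarrow> c b = \<zero>\<^bsub>A\<^esub> \<and> c' b = \<zero>\<^bsub>A\<^esub>)" if r: "rep c u" "rep c' u'" for c c' u u'
  proof -
    obtain S where S: "finite S" "S \<subseteq> Bs" "\<forall>b\<in>S. c b \<in> carrier A" "\<forall>b. b \<notin> S \<longrightarrow> c b = \<zero>\<^bsub>A\<^esub>"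
      "u = comb c S" using r(1) by (auto simp: rep_def)
    obtain S' where S': "finite S'" "S' \<subseteq> Bs" "\<forall>b\<in>S'. c' b \<in> carrier A" "\<forall>b. b \<notin> S' \<longrightarrow> c' b = \<zero>\<^bsub>A\<^esub>"
      "u' = comb c' S'" using r(2) by (auto simp: rep_def)
    have "comb c S = comb c (S \<union> S')" "comb c' S' = comb c' (S \<union> S')"
      using S S' by (auto intro!: comb_ext)
    then show ?thesis using S S' by (intro exI[of _ "S \<union> S'"]) auto
  qed
  have rep_fun: "u = u'" if "rep c u" "rep c u'" for c u u' using rep2[OF that] by auto
  define U' where "U' = {u. \<exists>c. rep c u}"
  have repU: "u \<in> carrier U" if r: "rep c u" for c u
  proof -
    obtain S where "finite S" "S \<subseteq> Bs" "u = comb c S" using repD[OF r, of "{}"] by auto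
    then show ?thesis unfolding comb_def using trm repc[OF r, of "{}"]
      by (auto intro!: U.finsum_closed)
  qed
  have U'c: "u \<in> carrier U" if "u \<in> U'" for u using that repU by (auto simp: U'_def)
  have U'smult: "a \<odot>\<^bsub>U\<^esub> u \<in> U'" if a: "a \<in> carrier A" and u: "u \<in> U'" for a u
  proof -
    obtain c where c: "rep c u" using u by (auto simp: U'_def)
    obtain S where S: "finite S" "S \<subseteq> Bs" "\<forall>b\<in>S. c b \<in> carrier A" "\<forall>b. b \<notin> S \<longrightarrow> c b = \<zero>\<^bsub>A\<^esub>"
      "u = comb c S" using c by (auto simp: rep_def)
    interpret a: additive_map U U "\<lambda>x. a \<odot>\<^bsub>U\<^esub> x" by (rule U.smult_additive[OF a])
    have "a \<odot>\<^bsub>U\<^esub> u = (\<Oplus>\<^bsub>U\<^esub>b\<in>S. a \<odot>\<^bsub>U\<^esub> (c b \<odot>\<^bsub>U\<^esub> m b))"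
      unfolding S(5) comb_def using S trm by (intro a.finsum) auto
    also have "\<dots> = comb (\<lambda>b. a \<otimes>\<^bsub>A\<^esub> c b) S"
      unfolding comb_def using S a mU
      by (intro U.finsum_cong') (auto simp: U.smult_assoc1 intro!: trm U.smult_closed)
    finally have "rep (\<lambda>b. a \<otimes>\<^bsub>A\<^esub> c b) (a \<odot>\<^bsub>U\<^esub> u)"
      unfolding rep_def using S a by (intro exI[of _ S]) auto
    then show ?thesis by (auto simp: U'_def)
  qed
  have U'gen: "a \<odot>\<^bsub>U\<^esub> m b \<in> U'" if "a \<in> carrier A" "b \<in> Bs" for a b
  proof -
    have "rep (\<lambda>x. if x = b then a else \<zero>\<^bsub>A\<^esub>) (a \<odot>\<^bsub>U\<^esub> m b)"
      unfolding rep_def comb_def using that trm[of b "\<lambda>_. a"] U.finsum_insert[of "{}" b]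
      by (intro exI[of _ "{b}"]) auto
    then show ?thesis by (auto simp: U'_def)
  qed
  have U': "subgroup U' (add_monoid U)"
  proof (rule U.subgroupI')
    show "U' \<subseteq> carrier U" using U'c by blast
    have "rep (\<lambda>_. \<zero>\<^bsub>A\<^esub>) \<zero>\<^bsub>U\<^esub>" unfolding rep_def comb_def by (intro exI[of _ "{}"]) auto
    then show "\<zero>\<^bsub>U\<^esub> \<in> U'" by (auto simp: U'_def)
    show "\<ominus>\<^bsub>U\<^esub> u \<in> U'" if u: "u \<in> U'" for u
    proof -
      have "(\<ominus>\<^bsub>A\<^esub> \<one>\<^bsub>A\<^esub>) \<odot>\<^bsub>U\<^esub> u \<in> U'" using u by (intro U'smult) auto
      then show ?thesis using U'c[OF u] by (simp add: U.smult_l_neg U.smult_one)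
    qed
    fix u u' assume "u \<in> U'" "u' \<in> U'"
    then obtain c c' where cc: "rep c u" "rep c' u'" by (auto simp: U'_def)
    from rep2[OF this] obtain S where S: "finite S" "S \<subseteq> Bs" "u = comb c S" "u' = comb c' S"
      "\<forall>b. b \<notin> S \<longrightarrow> c b = \<zero>\<^bsub>A\<^esub> \<and> c' b = \<zero>\<^bsub>A\<^esub>" by auto
    have c: "c b \<in> carrier A" "c' b \<in> carrier A" for b
      using repc[OF cc(1), of "{}"] repc[OF cc(2), of "{}"] by auto
    have "u \<oplus>\<^bsub>U\<^esub> u' = (\<Oplus>\<^bsub>U\<^esub>b\<in>S. c b \<odot>\<^bsub>U\<^esub> m b \<oplus>\<^bsub>U\<^esub> c' b \<odot>\<^bsub>U\<^esub> m b)"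
      unfolding S(3,4) comb_def using S c trm by (intro U.finsum_addf[symmetric]) auto
    also have "\<dots> = comb (\<lambda>b. c b \<oplus>\<^bsub>A\<^esub> c' b) S"
      unfolding comb_def using S c mU
      by (intro U.finsum_cong') (auto simp: U.smult_l_distr intro!: U.smult_closed)
    finally have "rep (\<lambda>b. c b \<oplus>\<^bsub>A\<^esub> c' b) (u \<oplus>\<^bsub>U\<^esub> u')"
      unfolding rep_def using S c by (intro exI[of _ S]) auto
    then show "u \<oplus>\<^bsub>U\<^esub> u' \<in> U'" by (auto simp: U'_def)
  qed
  have spanU: "U' \<subseteq> generate (add_monoid U) (\<Union>d. U' \<inter> homog U d)"
  proof
    have sub: "(\<Union>d. U' \<inter> homog U d) \<subseteq> carrier U" using U'c by blast
    note G = U.generate_subgroup[OF sub]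
    have gen: "a \<odot>\<^bsub>U\<^esub> m b \<in> generate (add_monoid U) (\<Union>d. U' \<inter> homog U d)"
      if a: "a \<in> carrier A" and b: "b \<in> Bs" for a b
      using a
    proof (induction rule: A.span_induct)
      case (homog d h)
      obtain e where e: "m b \<in> homog U e" using m[OF b] by blast
      have "h \<odot>\<^bsub>U\<^esub> m b \<in> U' \<inter> homog U (d + e)"
        using U'gen[OF A.homog_carrier[OF homog] b] U.smult_homog[OF homog e] by blast
      then show ?case by (intro U.generate_gen) blast
    next
      case (add x y)
      then show ?case using U.smult_l_distr[OF _ _ mU[OF b]] U.subgroup_add_closed[OF G] by simp
    next
      case (neg x)
      then show ?case using U.smult_l_neg[OF _ mU[OF b]] U.subgroup_neg[OF G] by simp
    next
      case zero
      then show ?case using U.smult_l_zero[OF mU[OF b]] U.subgroup_zero[OF G] by simp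
    qed
    fix u assume "u \<in> U'"
    then obtain c where c: "rep c u" by (auto simp: U'_def)
    obtain S where S: "finite S" "S \<subseteq> Bs" "u = comb c S" using repD[OF c, of "{}"] by auto
    show "u \<in> generate (add_monoid U) (\<Union>d. U' \<inter> homog U d)"
      unfolding S(3) comb_def
      by (rule U.subgroup_finsum[OF G S(1)]) (use S gen repc[OF c, of "{}"] in auto)
  qed
  define V' where "V' = f ` carrier P"
  have V'c: "v \<in> carrier V" if "v \<in> V'" for v using that f.closed by (auto simp: V'_def)
  have V'smult: "a \<odot>\<^bsub>V\<^esub> v \<in> V'" if "a \<in> carrier A" "v \<in> V'" for a v
    using that P.smult_closed by (auto simp: V'_def graded_homD(4)[OF f, symmetric])
  have V': "subgroup V' (add_monoid V)"
  proof (rule V.subgroupI')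
    show "V' \<subseteq> carrier V" using V'c by blast
    show "\<zero>\<^bsub>V\<^esub> \<in> V'" unfolding V'_def using f.zero P.zero_closed by (metis imageI)
    show "x \<oplus>\<^bsub>V\<^esub> y \<in> V'" if "x \<in> V'" "y \<in> V'" for x y
      using that by (auto simp: V'_def f.add[symmetric])
    show "\<ominus>\<^bsub>V\<^esub> x \<in> V'" if "x \<in> V'" for x
      using that by (auto simp: V'_def f.neg[symmetric])
  qed
  have spanV: "V' \<subseteq> generate (add_monoid V) (\<Union>d. V' \<inter> homog V d)"
  proof
    have sub: "(\<Union>d. V' \<inter> homog V d) \<subseteq> carrier V" using V'c by blast
    fix v assume "v \<in> V'"
    then obtain p where p: "p \<in> carrier P" "v = f p" by (auto simp: V'_def)
    have "f p \<in> generate (add_monoid V) (\<Union>d. V' \<inter> homog V d)"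
      using p(1)
    proof (induction rule: P.induct)
      case (homog d h)
      have "f h \<in> V' \<inter> homog V d"
        using graded_homD(5)[OF f homog] P.homog_closed[OF homog] by (auto simp: V'_def)
      then show ?case by (intro V.generate_gen) blast
    next
      case (add x y)
      then show ?case using f.add V.subgroup_add_closed[OF V.generate_subgroup[OF sub]] by simp
    qed
    then show "v \<in> generate (add_monoid V) (\<Union>d. V' \<inter> homog V d)" using p by simp
  qed
  have gU': "g u \<in> V'" if "u \<in> U'" for u
  proof -
    obtain c where c: "rep c u" using \<open>u \<in> U'\<close> by (auto simp: U'_def)
    obtain S where S: "finite S" "S \<subseteq> Bs" "u = comb c S" using repD[OF c, of "{}"] by auto
    have cA: "c b \<in> carrier A" for b using repc[OF c, of "{}"] by auto
    have "g u = (\<Oplus>\<^bsub>V\<^esub>b\<in>S. g (c b \<odot>\<^bsub>U\<^esub> m b))"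
      unfolding S(3) comb_def using S trm cA by (intro g.finsum) auto
    also have "\<dots> \<in> V'"
    proof (rule V.subgroup_finsum[OF V' S(1)])
      fix b assume "b \<in> S"
      then have b: "b \<in> Bs" using S by blast
      then have "g (c b \<odot>\<^bsub>U\<^esub> m b) = c b \<odot>\<^bsub>V\<^esub> f b"
        using graded_homD(4)[OF g cA mU[OF b]] gm[OF b] by simp
      then show "g (c b \<odot>\<^bsub>U\<^esub> m b) \<in> V'" using V'smult[OF cA] BsP[OF b] by (auto simp: V'_def)
    qed
    finally show ?thesis .
  qed
  have V'U': "\<exists>u\<in>U'. g u = v" if v: "v \<in> V'" for v
  proof -
    obtain p where p: "p \<in> carrier P" "v = f p" using v by (auto simp: V'_def)
    have "\<exists>u\<in>U'. g u = f p" using p(1)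
    proof (induction rule: P.induct)
      case (homog d h)
      then have h: "h \<in> Bs" by (auto simp: Bs_def)
      have "m h \<in> U'" using U'gen[of "\<one>\<^bsub>A\<^esub>" h] h mU[OF h] by (simp add: U.smult_one)
      then show ?case using gm[OF h] by blast
    next
      case (add x y)
      then obtain u u' where "u \<in> U'" "g u = f x" "u' \<in> U'" "g u' = f y" by blast
      then show ?case using add U.subgroup_add_closed[OF U'] U'c
        by (intro bexI[of _ "u \<oplus>\<^bsub>U\<^esub> u'"]) (simp_all add: g.add f.add)
    qed
    then show ?thesis using p by simp
  qed
  have gimg: "g ` U' = V'" using gU' V'U' by blast
  \<comment> \<open>One representing function is chosen for every u. This is injective because the
    function determines its combination.\<close>
  define j where "j u = (SOME c. rep c u)" for u
  have j: "inj_on j U'"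
  proof (rule inj_onI)
    have r: "rep (j u) u" if "u \<in> U'" for u
      using that unfolding j_def U'_def mem_Collect_eq by (rule someI_ex)
    fix u u' assume "u \<in> U'" "u' \<in> U'" "j u = j u'"
    then show "u = u'" using r[of u] r[of u'] rep_fun by metis
  qed
  \<comment> \<open>The image of P has no coefficient functions of its own, so it is moved to the
    same type through a chosen preimage in \<open>U'\<close>.\<close>
  define jV where "jV v = j (inv_into U' g v)" for v
  have invV: "inv_into U' g v \<in> U'" "g (inv_into U' g v) = v" if "v \<in> V'" for v
    using that gimg by (auto intro: inv_into_into f_inv_into_f)
  have jV: "inj_on jV V'"
  proof (rule inj_onI)
    fix v v' assume v: "v \<in> V'" "v' \<in> V'" "jV v = jV v'"
    then have "inv_into U' g v = inv_into U' g v'"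
      using inj_onD[OF j] invV(1) by (auto simp: jV_def)
    then show "v = v'" using invV(2) v by metis
  qed
  define M1 where "M1 = sub_module U U' (module.smult U)"
  define N1 where "N1 = sub_module V V' (module.smult V)"
  have M1: "graded_module A M1" unfolding M1_def by (rule graded_module_sub[OF A U U' U'smult spanU])
  have N1: "graded_module A N1" unfolding N1_def by (rule graded_module_sub[OF A V V' V'smult spanV])
  have injM: "inj_on j (carrier M1)" using j by (simp add: M1_def)
  have injN: "inj_on jV (carrier N1)" using jV by (simp add: N1_def)
  let ?M = "transport j M1" and ?N = "transport jV N1"
  note M2 = graded_module_transport[OF M1 injM] and N2 = graded_module_transport[OF N1 injN]
  have f1: "f \<in> graded_hom A P N1"
    unfolding N1_def
    by (rule graded_homI)
      (use P.homog_closed in \<open>auto simp: graded_homD[OF f] V'_def\<close>)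
  have g1: "(\<lambda>u\<in>U'. g u) \<in> graded_hom A M1 N1"
    unfolding N1_def M1_def
    by (rule graded_homI)
      (auto simp: gU' U'c graded_homD[OF g] U'smult U.subgroup_add_closed[OF U'])
  define f2 where "f2 = (\<lambda>x\<in>carrier P. jV (f x))"
  have f2: "f2 \<in> graded_hom A P ?N" unfolding f2_def by (rule transport_hom[OF injN f1 PP])
  define g2 where "g2 = (\<lambda>x\<in>carrier ?M. jV ((\<lambda>y\<in>carrier ?M. (\<lambda>u\<in>U'. g u) ((\<lambda>y\<in>j ` carrier M1. inv_into (carrier M1) j y) y)) x))"
  have g2: "g2 \<in> graded_hom A ?M ?N"
    unfolding g2_def
    by (rule transport_hom[OF injN graded_hom_compose[OF transport_inv_hom[OF injM M1] g1 M2] M2])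
  have g2j: "g2 (j u) = jV (g u)" if "u \<in> U'" for u
    using that by (simp add: g2_def transport_def M1_def inv_into_f_f[OF j])
  have "g2 ` carrier ?M = carrier ?N"
  proof -
    have "g2 ` j ` U' = jV ` g ` U'" using g2j by (auto simp: image_image)
    then show ?thesis by (simp add: gimg M1_def N1_def transport_def)
  qed
  then obtain h where h: "h \<in> graded_hom A P ?M" and hf: "\<forall>x\<in>carrier P. g2 (h x) = f2 x"
    using P M2 N2 g2 f2 unfolding graded_projective_def by blast
  define h' where "h' = (\<lambda>x\<in>carrier P. (\<lambda>y\<in>j ` carrier M1. inv_into (carrier M1) j y) (h x))"
  have h': "h' \<in> graded_hom A P M1"
    unfolding h'_def by (rule graded_hom_compose[OF h transport_inv_hom[OF injM M1] PP])
  have "h' \<in> graded_hom A P U"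
  proof (rule graded_homI)
    show "h' x \<in> carrier U" if "x \<in> carrier P" for x
      using graded_homD(1)[OF h' that] U'c by (simp add: M1_def)
    show "h' x \<in> homog U d" if "x \<in> homog P d" for x d
      using graded_homD(5)[OF h' that] by (simp add: M1_def)
  qed (simp_all add: graded_homD(2)[OF h'] graded_homD(3,4)[OF h', unfolded M1_def, simplified])
  moreover have "g (h' x) = f x" if x: "x \<in> carrier P" for x
  proof -
    have hx: "h x \<in> j ` U'" using graded_homD(1)[OF h x] by (simp add: transport_def M1_def)
    then obtain u where u: "u \<in> U'" "h x = j u" by blast
    then have h'x: "h' x = u" using x by (simp add: h'_def M1_def inv_into_f_f[OF j])
    have "jV (g u) = jV (f x)" using bspec[OF hf x] x u(2) g2j[OF u(1)] by (simp add: f2_def)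
    moreover have "f x \<in> V'" unfolding V'_def using x by (rule imageI)
    ultimately have "g u = f x" by (rule inj_onD[OF jV _ gU'[OF u(1)]])
    then show ?thesis using h'x by simp
  qed
  ultimately show "\<exists>h\<in>graded_hom A P U. \<forall>x\<in>carrier P. g (h x) = f x" by blast
qed

text \<open>The homogeneous homomorphisms \<open>M \<rightarrow> U\<close> of \<open>B\<close>-modules span a graded \<open>A\<close>-module, if \<open>A\<close> acts on
  \<open>U\<close> too and commutes with \<open>B\<close>.\<close>

definition hom_module :: "('k, 'b) graded \<Rightarrow> ('b, 'm) graded \<Rightarrow> ('b, 'u) graded \<Rightarrow> ('a, 'u) graded \<Rightarrow>
    ('a, 'm \<Rightarrow> 'u) graded" where
  "hom_module B M UB UA = span_module (fun_module (carrier M) UA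
     (\<lambda>d. graded_hom B M (graded_shift (- d) UB)))"

text \<open>A map of degree d is a degree 0 map into the target shifted by - d. The two actions live
  on the same graded group; since they commute, the pointwise action of A preserves
  B-linearity.\<close>

lemma graded_module_hom_module:
  assumes A: "gring A" and B: "gring B" and UA: "graded_module A UA" and UB: "graded_module B UB"
    and M: "graded_module B M"
    and [simp]: "carrier UB = carrier UA" "ring.add UB = ring.add UA" "\<zero>\<^bsub>UB\<^esub> = \<zero>\<^bsub>UA\<^esub>" "homog UB = homog UA"
    and comm: "\<And>a b u. \<lbrakk>a \<in> carrier A; b \<in> carrier B; u \<in> carrier UA\<rbrakk> \<Longrightarrow>
      a \<odot>\<^bsub>UA\<^esub> (b \<odot>\<^bsub>UB\<^esub> u) = b \<odot>\<^bsub>UB\<^esub> (a \<odot>\<^bsub>UA\<^esub> u)"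
  shows "graded_module A (hom_module B M UB UA)"
proof -
  interpret UA: gmodule A UA by (rule gmoduleI) fact
  interpret UB: gmodule B UB by (rule gmoduleI) fact
  interpret M: gmodule B M by (rule gmoduleI) fact
  have negB: "\<ominus>\<^bsub>UB\<^esub> u = \<ominus>\<^bsub>UA\<^esub> u" if "u \<in> carrier UA" for u
    using that UB.a_inv_closed[of u] UB.l_neg[of u] UA.minus_equality[of "\<ominus>\<^bsub>UB\<^esub> u" u] by simp
  note hD = graded_homD(1)[where N = "graded_shift _ UB", simplified]
    graded_homD(2)
    graded_homD(3,4,5)[where N = "graded_shift _ UB", simplified]
  show ?thesis
    unfolding hom_module_def
  proof (rule graded_module_fun_span[OF A UA, where Bh = "homog M"])
    fix d h assume h: "h \<in> graded_hom B M (graded_shift (- d) UB)"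
    note hD = graded_homD(1)[OF h, simplified] graded_homD(2)[OF h]
      graded_homD(3,4,5)[OF h, simplified]
    show "h \<in> carrier M \<rightarrow>\<^sub>E carrier UA" using hD(1,2) by (auto simp: PiE_iff extensional_def)
    show "h x \<in> homog UA (d + e)" if "x \<in> homog M e" for x e
      using hD(5)[OF that] by (simp add: add.commute)
    show "h = (\<lambda>x\<in>carrier M. \<zero>\<^bsub>UA\<^esub>)" if z: "\<And>e x. x \<in> homog M e \<Longrightarrow> h x = \<zero>\<^bsub>UA\<^esub>"
    proof -
      have "h x = \<zero>\<^bsub>UA\<^esub>" if "x \<in> carrier M" for x
        using that by (induction rule: M.induct) (simp_all add: z hD(3))
      then show ?thesis using hD(2) by (auto simp: restrict_def)
    qed
    show "(\<lambda>x\<in>carrier M. \<ominus>\<^bsub>UA\<^esub> h x) \<in> graded_hom B M (graded_shift (- d) UB)"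
    proof (rule graded_homI)
      fix e x assume x: "x \<in> homog M e"
      show "(\<lambda>x\<in>carrier M. \<ominus>\<^bsub>UA\<^esub> h x) x \<in> homog (graded_shift (- d) UB) e"
        using hD(5)[OF x] M.homog_closed[OF x] UA.homog_neg by simp
    next
      fix b x assume "b \<in> carrier B" "x \<in> carrier M"
      then show "(\<lambda>x\<in>carrier M. \<ominus>\<^bsub>UA\<^esub> h x) (b \<odot>\<^bsub>M\<^esub> x)
          = b \<odot>\<^bsub>graded_shift (- d) UB\<^esub> (\<lambda>x\<in>carrier M. \<ominus>\<^bsub>UA\<^esub> h x) x"
        using UB.smult_neg[of b "h x"] hD(1)[of x] UB.smult_closed[of b "h x"]
        by (simp add: hD(4) M.smult_closed negB)
    qed (simp_all add: hD(1,3) UA.minus_add)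
    show "(\<lambda>x\<in>carrier M. a \<odot>\<^bsub>UA\<^esub> h x) \<in> graded_hom B M (graded_shift (- (e + d)) UB)"
      if a: "a \<in> homog A e" for a e
    proof (rule graded_homI)
      note aA = gring.homog_carrier[OF A a]
      fix e' x assume x: "x \<in> homog M e'"
      show "(\<lambda>x\<in>carrier M. a \<odot>\<^bsub>UA\<^esub> h x) x \<in> homog (graded_shift (- (e + d)) UB) e'"
        using UA.smult_homog[OF a hD(5)[OF x]] M.homog_closed[OF x] by (simp add: algebra_simps)
    next
      note aA = gring.homog_carrier[OF A a]
      fix b x assume "b \<in> carrier B" "x \<in> carrier M"
      then show "(\<lambda>x\<in>carrier M. a \<odot>\<^bsub>UA\<^esub> h x) (b \<odot>\<^bsub>M\<^esub> x)
          = b \<odot>\<^bsub>graded_shift (- (e + d)) UB\<^esub> (\<lambda>x\<in>carrier M. a \<odot>\<^bsub>UA\<^esub> h x) x"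
        using comm[OF aA, of b "h x"] by (simp add: hD(1,4) M.smult_closed)
    qed (simp_all add: hD(1,3) UA.smult_closed UA.smult_r_distr gring.homog_carrier[OF A a])
    fix k assume k: "k \<in> graded_hom B M (graded_shift (- d) UB)"
    note kD = graded_homD(1)[OF k, simplified] graded_homD(2)[OF k]
      graded_homD(3,4,5)[OF k, simplified]
    show "(\<lambda>x\<in>carrier M. h x \<oplus>\<^bsub>UA\<^esub> k x) \<in> graded_hom B M (graded_shift (- d) UB)"
    proof (rule graded_homI)
      fix e x assume x: "x \<in> homog M e"
      show "(\<lambda>x\<in>carrier M. h x \<oplus>\<^bsub>UA\<^esub> k x) x \<in> homog (graded_shift (- d) UB) e"
        using hD(5)[OF x] kD(5)[OF x] M.homog_closed[OF x] UA.homog_add by simp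
    next
      fix b x assume "b \<in> carrier B" "x \<in> carrier M"
      then show "(\<lambda>x\<in>carrier M. h x \<oplus>\<^bsub>UA\<^esub> k x) (b \<odot>\<^bsub>M\<^esub> x)
          = b \<odot>\<^bsub>graded_shift (- d) UB\<^esub> (\<lambda>x\<in>carrier M. h x \<oplus>\<^bsub>UA\<^esub> k x) x"
        using UB.smult_r_distr[of b "h x" "k x"] hD(1)[of x] kD(1)[of x]
        by (simp add: hD(4) kD(4) M.smult_closed)
    qed (simp_all add: hD(1,3) kD(1,3) UA.a_ac)
  next
    fix d
    show "(\<lambda>x\<in>carrier M. \<zero>\<^bsub>UA\<^esub>) \<in> graded_hom B M (graded_shift (- d) UB)"
      using UB.smult_zero UA.homog_zero M.homog_closed
      by (intro graded_homI) (simp_all add: M.smult_closed)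
    show "homog M e \<subseteq> carrier M" for e using M.homog_closed by blast
  qed
qed


section \<open>Quiver Hecke algebras\<close>

lemma poly_mapping_sum_single:
  "f = (\<Sum>w\<in>Poly_Mapping.keys f. Poly_Mapping.single w (Poly_Mapping.lookup f w))"
  by (rule poly_mapping_eqI)
    (auto simp: lookup_sum lookup_single when_def in_keys_iff sum.delta' if_distrib cong: if_cong)

lemma poly_mapping_keys_induct [consumes 1, case_names zero single add]:
  fixes f :: "'a \<Rightarrow>\<^sub>0 'b::comm_monoid_add"
  assumes "Poly_Mapping.keys f \<subseteq> K" "P 0" "\<And>w c. w \<in> K \<Longrightarrow> P (Poly_Mapping.single w c)"
    and "\<And>f g. \<lbrakk>Poly_Mapping.keys f \<subseteq> K; Poly_Mapping.keys g \<subseteq> K; P f; P g\<rbrakk> \<Longrightarrow> P (f + g)"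
  shows "P f"
proof -
  let ?s = "\<lambda>w. Poly_Mapping.single w (Poly_Mapping.lookup f w)"
  have "Poly_Mapping.keys (\<Sum>w\<in>S. ?s w) \<subseteq> K \<and> P (\<Sum>w\<in>S. ?s w)" if "finite S" "S \<subseteq> K" for S
    using that
  proof (induction S rule: finite_induct)
    case (insert w S)
    have "Poly_Mapping.keys (?s w) \<subseteq> K" using insert by simp
    then show ?case
      using insert assms(3)[of w] assms(4)[of "?s w" "\<Sum>w\<in>S. ?s w"]
        order_trans[OF keys_add[of "?s w" "\<Sum>w\<in>S. ?s w"]] by auto
  qed (simp add: assms)
  from this[OF finite_keys assms(1)] show ?thesis using poly_mapping_sum_single[of f] by simp
qed

lemma ring_quot:
  assumes "ring M" "ideal N M"
  shows "ring (quot M N)"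
    and "x \<in> carrier M \<Longrightarrow> y \<in> carrier M \<Longrightarrow>
      (N +>\<^bsub>M\<^esub> x) \<otimes>\<^bsub>quot M N\<^esub> (N +>\<^bsub>M\<^esub> y) = N +>\<^bsub>M\<^esub> (x \<otimes>\<^bsub>M\<^esub> y)"
    and "\<one>\<^bsub>quot M N\<^esub> = N +>\<^bsub>M\<^esub> \<one>\<^bsub>M\<^esub>"
proof -
  interpret ring M by fact
  interpret N: ideal N M by fact
  interpret ag_quot M N
    by (intro ag_quot.intro ag_quot_axioms.intro abelian_group_axioms) (rule N.a_subgroup)
  have mult: "cl x \<otimes>\<^bsub>quot M N\<^esub> cl y = cl (x \<otimes>\<^bsub>M\<^esub> y)" if "x \<in> carrier M" "y \<in> carrier M" for x y
    using N.rcoset_mult_add[OF that] by (simp add: quot_def FactRing_def)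
  have one: "\<one>\<^bsub>quot M N\<^esub> = cl \<one>\<^bsub>M\<^esub>" by (simp add: quot_def FactRing_def)
  show "x \<in> carrier M \<Longrightarrow> y \<in> carrier M \<Longrightarrow> cl x \<otimes>\<^bsub>quot M N\<^esub> cl y = cl (x \<otimes>\<^bsub>M\<^esub> y)"
    "\<one>\<^bsub>quot M N\<^esub> = cl \<one>\<^bsub>M\<^esub>" by (rule mult one; assumption)+
  show "ring (quot M N)"
  proof (rule ringI[OF quot_abelian_group monoidI])
    fix x y z assume "x \<in> carrier (quot M N)" "y \<in> carrier (quot M N)" "z \<in> carrier (quot M N)"
    then obtain a b c where abc: "a \<in> carrier M" "x = cl a" "b \<in> carrier M" "y = cl b"
      "c \<in> carrier M" "z = cl c" by (metis quot_carrierE)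
    show "x \<otimes>\<^bsub>quot M N\<^esub> y \<in> carrier (quot M N)" using abc by (auto simp: mult quot_carrier)
    show "x \<otimes>\<^bsub>quot M N\<^esub> y \<otimes>\<^bsub>quot M N\<^esub> z = x \<otimes>\<^bsub>quot M N\<^esub> (y \<otimes>\<^bsub>quot M N\<^esub> z)"
      using abc by (simp add: mult m_assoc)
    show "\<one>\<^bsub>quot M N\<^esub> \<otimes>\<^bsub>quot M N\<^esub> x = x" "x \<otimes>\<^bsub>quot M N\<^esub> \<one>\<^bsub>quot M N\<^esub> = x"
      using abc by (simp_all add: mult one)
    show "(x \<oplus>\<^bsub>quot M N\<^esub> y) \<otimes>\<^bsub>quot M N\<^esub> z = x \<otimes>\<^bsub>quot M N\<^esub> z \<oplus>\<^bsub>quot M N\<^esub> y \<otimes>\<^bsub>quot M N\<^esub> z"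
      using abc by (simp add: mult quot_add l_distr)
    show "z \<otimes>\<^bsub>quot M N\<^esub> (x \<oplus>\<^bsub>quot M N\<^esub> y) = z \<otimes>\<^bsub>quot M N\<^esub> x \<oplus>\<^bsub>quot M N\<^esub> z \<otimes>\<^bsub>quot M N\<^esub> y"
      using abc by (simp add: mult quot_add r_distr)
  qed (auto simp: one quot_carrier)
qed

definition free_carrier :: "'g set \<Rightarrow> ('g, 'k::field) ncpoly set" where
  "free_carrier G = {f. \<forall>w\<in>Poly_Mapping.keys f. set w \<subseteq> G}"

lemma free_carrier_zero: "0 \<in> free_carrier G"
  and free_carrier_one: "1 \<in> free_carrier G"
  and free_carrier_const: "nc_const c \<in> free_carrier G"
  and free_carrier_gen: "g \<in> G \<Longrightarrow> nc_gen g \<in> free_carrier G"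
  by (auto simp: free_carrier_def nc_const_def nc_gen_def single_one[symmetric] zero_list_def
      simp del: single_one)

lemma free_carrier_add: "f \<in> free_carrier G \<Longrightarrow> g \<in> free_carrier G \<Longrightarrow> f + g \<in> free_carrier G"
  using keys_add[of f g] unfolding free_carrier_def by blast

lemma free_carrier_uminus: "f \<in> free_carrier G \<Longrightarrow> - f \<in> free_carrier G"
  by (simp add: free_carrier_def)

lemma free_carrier_diff: "f \<in> free_carrier G \<Longrightarrow> g \<in> free_carrier G \<Longrightarrow> f - g \<in> free_carrier G"
  using keys_diff[of f g] unfolding free_carrier_def by blast

lemma free_carrier_mult: "f \<in> free_carrier G \<Longrightarrow> g \<in> free_carrier G \<Longrightarrow> f * g \<in> free_carrier G"
  using keys_mult[of f g] by (fastforce simp: plus_list_def free_carrier_def)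

lemma free_carrier_sum: "(\<And>i. i \<in> S \<Longrightarrow> f i \<in> free_carrier G) \<Longrightarrow> (\<Sum>i\<in>S. f i) \<in> free_carrier G"
  by (induction S rule: infinite_finite_induct) (simp_all add: free_carrier_add free_carrier_zero)

lemma free_carrier_power: "f \<in> free_carrier G \<Longrightarrow> f ^ n \<in> free_carrier G"
  by (induction n) (simp_all add: free_carrier_one free_carrier_mult)

lemma free_carrier_if: "f \<in> free_carrier G \<Longrightarrow> g \<in> free_carrier G \<Longrightarrow> (if b then f else g) \<in> free_carrier G"
  by simp

lemma free_carrier_q_eval:
  "u \<in> free_carrier G \<Longrightarrow> v \<in> free_carrier G \<Longrightarrow> q_eval q u v \<in> free_carrier G"
  unfolding q_eval_def case_prod_unfold
  by (intro free_carrier_sum free_carrier_mult free_carrier_const free_carrier_power)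

lemma free_carrier_q_diff:
  "u \<in> free_carrier G \<Longrightarrow> v \<in> free_carrier G \<Longrightarrow> w \<in> free_carrier G \<Longrightarrow> q_diff q u w v \<in> free_carrier G"
  unfolding q_diff_def case_prod_unfold
  by (intro free_carrier_sum free_carrier_mult free_carrier_const free_carrier_power)

lemmas free_carrier_intros = free_carrier_zero free_carrier_one free_carrier_const free_carrier_gen
  free_carrier_add free_carrier_diff free_carrier_mult free_carrier_sum free_carrier_power
  free_carrier_if free_carrier_q_eval free_carrier_q_diff

lemma free_algebra_simps [simp]:
  "carrier (free_algebra G) = free_carrier G" "\<zero>\<^bsub>free_algebra G\<^esub> = 0" "\<one>\<^bsub>free_algebra G\<^esub> = 1"
  "f \<oplus>\<^bsub>free_algebra G\<^esub> g = f + g" "f \<otimes>\<^bsub>free_algebra G\<^esub> g = f * g"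
  "c \<odot>\<^bsub>free_algebra G\<^esub> f = nc_const c * f"
  by (simp_all add: free_algebra_def free_carrier_def)

lemma ring_free_algebra: "ring (free_algebra G)"
proof (rule ringI[OF abelian_groupI monoidI])
  fix x assume "x \<in> carrier (free_algebra G)"
  then show "\<exists>y\<in>carrier (free_algebra G). y \<oplus>\<^bsub>free_algebra G\<^esub> x = \<zero>\<^bsub>free_algebra G\<^esub>"
    by (intro bexI[of _ "- x"]) (simp_all add: free_carrier_uminus)
qed (simp_all add: algebra_simps free_carrier_add free_carrier_mult free_carrier_one free_carrier_zero)

lemma free_algebra_neg: "f \<in> free_carrier G \<Longrightarrow> \<ominus>\<^bsub>free_algebra G\<^esub> f = - f"
proof -
  interpret ring "free_algebra G" by (rule ring_free_algebra)
  assume "f \<in> free_carrier G"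
  then show ?thesis by (intro minus_equality) (simp_all add: free_carrier_uminus)
qed

lemma free_algebra_minus:
  "f \<in> free_carrier G \<Longrightarrow> g \<in> free_carrier G \<Longrightarrow> f \<ominus>\<^bsub>free_algebra G\<^esub> g = f - g"
  using free_algebra_neg[of g G] by (simp add: a_minus_def)

lemma nc_const_simps:
  "nc_const (a + b) = nc_const a + nc_const b" "nc_const (a * b) = nc_const a * nc_const b"
  "nc_const 1 = 1" "nc_const 0 = 0" "nc_const (- a) = - nc_const a"
  by (simp_all add: nc_const_def single_add mult_single plus_list_def single_uminus
      single_one[symmetric] zero_list_def)

lemma nc_const_comm: "nc_const c * f = f * nc_const c"
proof -
  have "Poly_Mapping.keys f \<subseteq> UNIV" by simp
  then show ?thesis
    by (induction rule: poly_mapping_keys_induct)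
      (simp_all add: nc_const_def mult_single plus_list_def mult.commute algebra_simps)
qed

section \<open>Sequences of simple roots with a given sum\<close>

context rdatum
begin

lemma sum_list_sroot:
  assumes "set \<nu> \<subseteq> S" "finite S"
  shows "(\<Sum>j\<leftarrow>\<nu>. sroot D j) = (\<Sum>j\<in>S. zscale (int (count_list \<nu> j)) (sroot D j))"
  using assms(1)
proof (induction \<nu>)
  case (Cons k \<nu>)
  have "(\<Sum>j\<in>S. zscale (int (count_list (k # \<nu>) j)) (sroot D j))
      = (\<Sum>j\<in>S. zscale (int (count_list \<nu> j)) (sroot D j) + (if j = k then sroot D k else 0))"
    by (intro sum.cong) (auto simp: zscale_add_left)
  then show ?case using Cons assms(2) by (simp add: sum.distrib add.commute)
qed simp

text \<open>By linear independence of the simple roots the sum determines how often each letter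
  occurs. The height is therefore well defined, and there are only finitely many sequences.\<close>

lemma seqs_mset:
  assumes "\<nu> \<in> seqs D \<beta>" "\<nu>' \<in> seqs D \<beta>"
  shows "mset \<nu> = mset \<nu>'"
proof -
  let ?S = "set \<nu> \<union> set \<nu>'"
  have "(\<Sum>i\<in>?S. zscale (int (count_list \<nu> i) - int (count_list \<nu>' i)) (sroot D i)) = 0"
    using assms sum_list_sroot[of \<nu> ?S] sum_list_sroot[of \<nu>' ?S]
    by (simp add: zscale_diff_left sum_subtractf seqs_def)
  moreover have lin: "\<forall>S f. finite S \<and> (\<Sum>i\<in>S. zscale (f i) (sroot D i)) = 0 \<longrightarrow> (\<forall>i\<in>S. f i = 0)"
    using D unfolding is_root_datum_def by (elim conjE)
  note lin[THEN spec[of _ ?S], THEN spec[of _ "\<lambda>i. int (count_list \<nu> i) - int (count_list \<nu>' i)"]]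
  ultimately have "\<forall>i\<in>?S. int (count_list \<nu> i) - int (count_list \<nu>' i) = 0"
    by simp
  then have "count_list \<nu> i = count_list \<nu>' i" for i
    by (cases "i \<in> ?S") (auto simp: count_list_0_iff)
  then show ?thesis by (intro multiset_eqI) (simp add: count_mset)
qed

lemma length_seqs: "\<nu> \<in> seqs D \<beta> \<Longrightarrow> length \<nu> = ht D \<beta>"
  unfolding ht_def
  by (rule the_equality[symmetric]) (auto dest: seqs_mset mset_eq_length)

lemma finite_seqs: "finite (seqs D \<beta>)"
proof (cases "seqs D \<beta> = {}")
  case False
  then obtain \<nu> where \<nu>: "\<nu> \<in> seqs D \<beta>" by blast
  have "seqs D \<beta> \<subseteq> {\<nu>'. set \<nu>' \<subseteq> set \<nu> \<and> length \<nu>' = length \<nu>}"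
  proof
    fix \<nu>' assume "\<nu>' \<in> seqs D \<beta>"
    then have "mset \<nu>' = mset \<nu>" using seqs_mset \<nu> by blast
    then show "\<nu>' \<in> {\<nu>'. set \<nu>' \<subseteq> set \<nu> \<and> length \<nu>' = length \<nu>}"
      using mset_eq_setD[of \<nu>' \<nu>] mset_eq_length[of \<nu>' \<nu>] by simp
  qed
  then show ?thesis using finite_lists_length_eq[of "set \<nu>" "length \<nu>"] finite_subset by blast
qed simp

lemma seqs_append: "\<nu> \<in> seqs D \<beta> \<Longrightarrow> \<nu>' \<in> seqs D \<gamma> \<Longrightarrow> \<nu> @ \<nu>' \<in> seqs D (\<beta> + \<gamma>)"
  by (simp add: seqs_def)

lemma ht_add:
  assumes "seqs D \<beta> \<noteq> {}" "seqs D \<gamma> \<noteq> {}"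
  shows "ht D (\<beta> + \<gamma>) = ht D \<beta> + ht D \<gamma>"
proof -
  obtain \<nu> \<nu>' where "\<nu> \<in> seqs D \<beta>" "\<nu>' \<in> seqs D \<gamma>" using assms by auto
  then show ?thesis
    using length_seqs[of \<nu> \<beta>] length_seqs[of \<nu>' \<gamma>] length_seqs[OF seqs_append, of \<nu> \<beta> \<nu>' \<gamma>]
    by simp
qed

lemma mset_swap_pos: "1 \<le> k \<Longrightarrow> k < length \<nu> \<Longrightarrow> mset (swap_pos k \<nu>) = mset \<nu>"
  using mset_swap[of "k" \<nu> "k - 1"] unfolding swap_pos_def pos_def
  by (simp add: list_update_swap)

lemma swap_pos_seqs:
  assumes "\<nu> \<in> seqs D \<beta>" "k \<in> {1..<ht D \<beta>}"
  shows "swap_pos k \<nu> \<in> seqs D \<beta>"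
proof -
  have "mset (swap_pos k \<nu>) = mset \<nu>" using assms(2) mset_swap_pos[of k \<nu>] length_seqs[OF assms(1)] by simp
  then have "mset (map (sroot D) (swap_pos k \<nu>)) = mset (map (sroot D) \<nu>)" by simp
  then have "sum_list (map (sroot D) (swap_pos k \<nu>)) = sum_list (map (sroot D) \<nu>)"
    unfolding sum_mset_sum_list[symmetric] by (rule arg_cong)
  then show ?thesis using assms(1) by (simp add: seqs_def)
qed

lemma swap_pos_invol:
  assumes "1 \<le> k" "k < length \<nu>"
  shows "swap_pos k (swap_pos k \<nu>) = \<nu>"
  using assms by (auto simp: swap_pos_def pos_def nth_list_update intro!: nth_equalityI)

lemma length_swap_pos [simp]: "length (swap_pos k \<nu>) = length \<nu>"
  by (simp add: swap_pos_def)

lemma pos_append: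
  assumes "1 \<le> k" "k \<le> length \<nu>"
  shows "pos (\<mu> @ \<nu> @ \<mu>') (length \<mu> + k) = pos \<nu> k"
  using assms by (auto simp: pos_def nth_append)

lemma swap_pos_append:
  assumes "1 \<le> k" "k < length \<nu>"
  shows "swap_pos (length \<mu> + k) (\<mu> @ \<nu> @ \<mu>') = \<mu> @ swap_pos k \<nu> @ \<mu>'"
proof -
  have "pos (\<mu> @ \<nu> @ \<mu>') (length \<mu> + k + 1) = pos \<nu> (k + 1)"
    "pos (\<mu> @ \<nu> @ \<mu>') (length \<mu> + k) = pos \<nu> k"
    using assms pos_append[of k \<nu> \<mu> \<mu>'] pos_append[of "k + 1" \<nu> \<mu> \<mu>'] by simp_all
  moreover obtain l where "k = Suc l" using assms by (cases k) auto
  ultimately show ?thesis using assms by (simp add: swap_pos_def list_update_append)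
qed

end


section \<open>The quiver Hecke algebra as a quotient of a free algebra\<close>

locale klr = rdatum D for D :: "('i, 'p::ab_group_add) root_datum" +
  fixes Q :: "('i, 'k::field) qparam"
begin

abbreviation FC :: "'p \<Rightarrow> ('i, 'k) klr_free set" where "FC \<beta> \<equiv> free_carrier (klr_gens D \<beta>)"
abbreviation KI :: "'p \<Rightarrow> ('i, 'k) klr_free set" where "KI \<beta> \<equiv> klr_ideal D Q \<beta>"
abbreviation KA :: "'p \<Rightarrow> ('k, ('i, 'k) klr_free set) graded" where "KA \<beta> \<equiv> klr_algebra D Q \<beta>"
abbreviation KC :: "'p \<Rightarrow> ('i, 'k) klr_free \<Rightarrow> ('i, 'k) klr_free set" where "KC \<beta> \<equiv> klr_class D Q \<beta>"

lemma e_FC: "\<nu> \<in> seqs D \<beta> \<Longrightarrow> e_gen \<nu> \<in> FC \<beta>"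
  and x_FC: "k \<in> {1..ht D \<beta>} \<Longrightarrow> x_gen k \<in> FC \<beta>"
  and tau_FC: "k \<in> {1..<ht D \<beta>} \<Longrightarrow> tau_gen k \<in> FC \<beta>"
  by (rule free_carrier_gen; simp add: klr_gens_def)+

lemmas FC_intros = free_carrier_zero free_carrier_one free_carrier_const
  free_carrier_add free_carrier_diff free_carrier_mult free_carrier_sum free_carrier_power
  free_carrier_if free_carrier_q_eval free_carrier_q_diff e_FC x_FC tau_FC

lemma rels_FC: "klr_rels D Q \<beta> \<subseteq> FC \<beta>"
proof
  fix r assume "r \<in> klr_rels D Q \<beta>"
  then show "r \<in> FC \<beta>"
    by cases (simp only:, intro FC_intros swap_pos_seqs; (assumption | simp))+
qed

lemma KI_ideal: "ideal (KI \<beta>) (free_algebra (klr_gens D \<beta>))"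
  unfolding klr_ideal_def by (rule ring.genideal_ideal[OF ring_free_algebra]) (simp add: rels_FC)

lemma KI_rel: "r \<in> klr_rels D Q \<beta> \<Longrightarrow> r \<in> KI \<beta>"
  unfolding klr_ideal_def using ring.genideal_self[OF ring_free_algebra, of "klr_rels D Q \<beta>"] rels_FC
  by auto

lemma KI_subgroup: "subgroup (KI \<beta>) (add_monoid (free_algebra (klr_gens D \<beta>)))"
proof -
  interpret I: ideal "KI \<beta>" "free_algebra (klr_gens D \<beta>)" by (rule KI_ideal)
  show ?thesis by (rule I.a_subgroup)
qed

lemma KI_FC: "f \<in> KI \<beta> \<Longrightarrow> f \<in> FC \<beta>"
  using subgroup.subset[OF KI_subgroup] by auto

lemma KI_zero: "0 \<in> KI \<beta>"
  using subgroup.one_closed[OF KI_subgroup] by simp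

lemma KI_add: "f \<in> KI \<beta> \<Longrightarrow> g \<in> KI \<beta> \<Longrightarrow> f + g \<in> KI \<beta>"
  using subgroup.m_closed[OF KI_subgroup] by simp

lemma KI_mult: "f \<in> KI \<beta> \<Longrightarrow> g \<in> FC \<beta> \<Longrightarrow> g * f \<in> KI \<beta>" "f \<in> KI \<beta> \<Longrightarrow> g \<in> FC \<beta> \<Longrightarrow> f * g \<in> KI \<beta>"
proof -
  interpret I: ideal "KI \<beta>" "free_algebra (klr_gens D \<beta>)" by (rule KI_ideal)
  show "f \<in> KI \<beta> \<Longrightarrow> g \<in> FC \<beta> \<Longrightarrow> g * f \<in> KI \<beta>" "f \<in> KI \<beta> \<Longrightarrow> g \<in> FC \<beta> \<Longrightarrow> f * g \<in> KI \<beta>"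
    using I.I_l_closed[of f g] I.I_r_closed[of f g] by simp_all
qed

text \<open>Negation is multiplication by the scalar - 1, so the absorption property of the ideal
  suffices.\<close>

lemma KI_uminus: "f \<in> KI \<beta> \<Longrightarrow> - f \<in> KI \<beta>"
  using KI_mult(1)[of f \<beta> "nc_const (- 1)"] free_carrier_const[of "- 1" "klr_gens D \<beta>"] by (simp add: nc_const_simps)

lemma KI_diff: "f \<in> KI \<beta> \<Longrightarrow> g \<in> KI \<beta> \<Longrightarrow> f - g \<in> KI \<beta>"
  using KI_add[of f \<beta> "- g"] KI_uminus[of g] by simp

lemma KI_sum: "(\<And>i. i \<in> S \<Longrightarrow> f i \<in> KI \<beta>) \<Longrightarrow> (\<Sum>i\<in>S. f i) \<in> KI \<beta>"
  by (induction S rule: infinite_finite_induct) (simp_all add: KI_zero KI_add)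

lemma KI_minimal:
  assumes "ideal J (free_algebra (klr_gens D \<beta>))" "klr_rels D Q \<beta> \<subseteq> J"
  shows "KI \<beta> \<subseteq> J"
  unfolding klr_ideal_def using ring.genideal_minimal[OF ring_free_algebra assms] .

lemma ag_quot_KI: "ag_quot (free_algebra (klr_gens D \<beta>)) (KI \<beta>)"
  by (intro ag_quot.intro ag_quot_axioms.intro ring.is_abelian_group[OF ring_free_algebra] KI_subgroup)

lemma KA_carrier: "carrier (KA \<beta>) = KC \<beta> ` FC \<beta>"
  using ag_quot.quot_carrier[OF ag_quot_KI[of \<beta>]] by (simp add: klr_algebra_def klr_class_def Let_def)

lemma KC_closed: "f \<in> FC \<beta> \<Longrightarrow> KC \<beta> f \<in> carrier (KA \<beta>)"
  by (simp add: KA_carrier)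

lemma KA_carrierE:
  assumes "a \<in> carrier (KA \<beta>)" obtains f where "f \<in> FC \<beta>" "a = KC \<beta> f"
  using assms by (auto simp: KA_carrier)

lemma KC_add: "f \<in> FC \<beta> \<Longrightarrow> g \<in> FC \<beta> \<Longrightarrow> KC \<beta> f \<oplus>\<^bsub>KA \<beta>\<^esub> KC \<beta> g = KC \<beta> (f + g)"
  using ag_quot.quot_add[OF ag_quot_KI[of \<beta>], of f g] by (simp add: klr_algebra_def klr_class_def Let_def)

lemma KC_zero: "\<zero>\<^bsub>KA \<beta>\<^esub> = KC \<beta> 0"
  using ag_quot.quot_zero[OF ag_quot_KI[of \<beta>]] by (simp add: klr_algebra_def klr_class_def Let_def)

lemma KC_eq: "f \<in> FC \<beta> \<Longrightarrow> g \<in> FC \<beta> \<Longrightarrow> KC \<beta> f = KC \<beta> g \<longleftrightarrow> f - g \<in> KI \<beta>"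
  using ag_quot.cl_eq_iff[OF ag_quot_KI[of \<beta>], of f g]
  by (simp add: klr_class_def free_algebra_minus)

lemma KC_mem: "f \<in> FC \<beta> \<Longrightarrow> f \<in> KC \<beta> f" and KC_memD: "f \<in> FC \<beta> \<Longrightarrow> g \<in> KC \<beta> f \<Longrightarrow> g \<in> FC \<beta> \<and> KC \<beta> g = KC \<beta> f"
proof -
  interpret ag_quot "free_algebra (klr_gens D \<beta>)" "KI \<beta>" by (rule ag_quot_KI)
  show "f \<in> FC \<beta> \<Longrightarrow> f \<in> KC \<beta> f" using cl_self[of f] by (simp add: klr_class_def)
  assume f: "f \<in> FC \<beta>" and g: "g \<in> KC \<beta> f"
  then have gF: "g \<in> FC \<beta>" using cl_subset[of f] by (auto simp: klr_class_def)
  then show "g \<in> FC \<beta> \<and> KC \<beta> g = KC \<beta> f"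
    using f g mem_cl_iff[of f g] by (simp add: KC_eq klr_class_def[symmetric] free_algebra_minus)
qed

lemma KC_mult: "f \<in> FC \<beta> \<Longrightarrow> g \<in> FC \<beta> \<Longrightarrow> KC \<beta> f \<otimes>\<^bsub>KA \<beta>\<^esub> KC \<beta> g = KC \<beta> (f * g)"
  using ring_quot(2)[OF ring_free_algebra KI_ideal[of \<beta>], of f g]
  by (simp add: klr_algebra_def klr_class_def Let_def)

lemma KC_one: "\<one>\<^bsub>KA \<beta>\<^esub> = KC \<beta> 1"
  using ring_quot(3)[OF ring_free_algebra KI_ideal[of \<beta>]]
  by (simp add: klr_algebra_def klr_class_def Let_def)

lemma KA_ring: "ring (KA \<beta>)"
proof -
  let ?Q = "quot (free_algebra (klr_gens D \<beta>)) (KI \<beta>)"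
  interpret Q: ring ?Q by (rule ring_quot(1)[OF ring_free_algebra KI_ideal])
  have [simp]: "carrier (KA \<beta>) = carrier ?Q" "ring.add (KA \<beta>) = ring.add ?Q" "\<zero>\<^bsub>KA \<beta>\<^esub> = \<zero>\<^bsub>?Q\<^esub>"
    "monoid.mult (KA \<beta>) = monoid.mult ?Q" "\<one>\<^bsub>KA \<beta>\<^esub> = \<one>\<^bsub>?Q\<^esub>"
    by (simp_all add: klr_algebra_def Let_def)
  have "abelian_group (KA \<beta>)" using abelian_group_cong[of "KA \<beta>" ?Q] Q.abelian_group_axioms by simp
  then show ?thesis
    by (rule ringI[OF _ monoidI]) (simp_all add: Q.m_assoc Q.l_distr Q.r_distr)
qed

lemma KC_smult: "f \<in> FC \<beta> \<Longrightarrow> c \<odot>\<^bsub>KA \<beta>\<^esub> KC \<beta> f = KC \<beta> (nc_const c * f)"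
proof -
  assume f: "f \<in> FC \<beta>"
  interpret ag_quot "free_algebra (klr_gens D \<beta>)" "KI \<beta>" by (rule ag_quot_KI)
  have "additive_map (free_algebra (klr_gens D \<beta>)) (free_algebra (klr_gens D \<beta>))
      (\<lambda>x. c \<odot>\<^bsub>free_algebra (klr_gens D \<beta>)\<^esub> x)"
    by unfold_locales (simp_all add: free_carrier_mult free_carrier_const distrib_left)
  then show ?thesis
    using f quot_smult[of f c] KI_mult(1)[OF _ free_carrier_const, of _ \<beta>]
    by (simp add: klr_algebra_def klr_class_def Let_def)
qed

lemma KC_additive: "additive_map (free_algebra (klr_gens D \<beta>)) (KA \<beta>) (KC \<beta>)"
proof -
  interpret K: ring "KA \<beta>" by (rule KA_ring)
  interpret F: ring "free_algebra (klr_gens D \<beta>)" by (rule ring_free_algebra)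
  show ?thesis by unfold_locales (simp_all add: KC_closed KC_add)
qed

lemma KC_neg: "f \<in> FC \<beta> \<Longrightarrow> \<ominus>\<^bsub>KA \<beta>\<^esub> KC \<beta> f = KC \<beta> (- f)"
  using additive_map.neg[OF KC_additive, of f \<beta>] by (simp add: free_algebra_neg)

lemma KC_minus: "f \<in> FC \<beta> \<Longrightarrow> g \<in> FC \<beta> \<Longrightarrow> KC \<beta> f \<ominus>\<^bsub>KA \<beta>\<^esub> KC \<beta> g = KC \<beta> (f - g)"
  using additive_map.minus[OF KC_additive, of f \<beta> g] by (simp add: free_algebra_minus)

lemma KC_finsum:
  assumes "finite S" "\<And>i. i \<in> S \<Longrightarrow> f i \<in> FC \<beta>"
  shows "(\<Oplus>\<^bsub>KA \<beta>\<^esub>i\<in>S. KC \<beta> (f i)) = KC \<beta> (\<Sum>i\<in>S. f i)"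
proof -
  interpret K: ring "KA \<beta>" by (rule KA_ring)
  show ?thesis using assms
  proof (induction S rule: finite_induct)
    case (insert i S)
    have "(\<Oplus>\<^bsub>KA \<beta>\<^esub>j\<in>insert i S. KC \<beta> (f j)) = KC \<beta> (f i) \<oplus>\<^bsub>KA \<beta>\<^esub> (\<Oplus>\<^bsub>KA \<beta>\<^esub>j\<in>S. KC \<beta> (f j))"
      using insert KC_closed by (intro K.finsum_insert) auto
    then show ?case using insert free_carrier_sum[of S f] by (simp add: KC_add)
  qed (simp add: KC_zero)
qed

subsection \<open>Grading\<close>

lemma monomial_FC: "klr_monomial D \<beta> f d \<Longrightarrow> f \<in> FC \<beta>"
  by (induction rule: klr_monomial.induct) (auto intro!: free_carrier_mult free_carrier_one e_FC x_FC tau_FC)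

lemma KA_homog:
  "homog (KA \<beta>) d = generate (add_monoid (KA \<beta>)) {KC \<beta> (nc_const c * f) |c f. klr_monomial D \<beta> f d}"
proof -
  have *: "{c \<odot>\<^bsub>KA \<beta>\<^esub> KC \<beta> f |c f. klr_monomial D \<beta> f d}
      = {KC \<beta> (nc_const c * f) |c f. klr_monomial D \<beta> f d}"
    by (intro Collect_cong ex_cong1) (auto simp: KC_smult[OF monomial_FC])
  show ?thesis unfolding *[symmetric] by (simp add: klr_algebra_def Let_def)
qed

lemma monomial_homog: "klr_monomial D \<beta> f d \<Longrightarrow> KC \<beta> (nc_const c * f) \<in> homog (KA \<beta>) d"
  unfolding KA_homog by (rule generate.incl) blast

lemma monomials_sub: "{KC \<beta> (nc_const c * f) |c f. klr_monomial D \<beta> f d} \<subseteq> carrier (KA \<beta>)"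
  using KC_closed free_carrier_mult[OF free_carrier_const monomial_FC] by blast

lemma homog_KA_subgroup: "subgroup (homog (KA \<beta>) d) (add_monoid (KA \<beta>))"
proof -
  interpret K: ring "KA \<beta>" by (rule KA_ring)
  show ?thesis unfolding KA_homog by (rule K.generate_subgroup[OF monomials_sub])
qed

lemma homog_KA_induct [consumes 1, case_names monomial add zero]:
  assumes "a \<in> homog (KA \<beta>) d"
    and mon: "\<And>c f. klr_monomial D \<beta> f d \<Longrightarrow> P (nc_const c * f)"
    and add: "\<And>f g. f \<in> FC \<beta> \<Longrightarrow> g \<in> FC \<beta> \<Longrightarrow> P f \<Longrightarrow> P g \<Longrightarrow> P (f + g)"
    and zero: "P 0"
  shows "\<exists>f\<in>FC \<beta>. a = KC \<beta> f \<and> P f"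
proof -
  interpret K: ring "KA \<beta>" by (rule KA_ring)
  from assms(1) monomials_sub show ?thesis unfolding KA_homog
  proof (induction rule: K.generate_induct)
    case zero
    then show ?case using assms(4) KC_zero free_carrier_zero by blast
  next
    case (gen h)
    then obtain c f where f: "h = KC \<beta> (nc_const c * f)" "klr_monomial D \<beta> f d" by blast
    have F: "nc_const c' * f \<in> FC \<beta>" for c' by (intro free_carrier_mult free_carrier_const monomial_FC[OF f(2)])
    have "\<ominus>\<^bsub>KA \<beta>\<^esub> h = KC \<beta> (nc_const (- c) * f)"
      using f F KC_neg[OF F] by (simp add: nc_const_simps)
    then show ?case using f F mon by blast
  next
    case (add x y)
    then obtain f g where "f \<in> FC \<beta>" "x = KC \<beta> f" "P f" "g \<in> FC \<beta>" "y = KC \<beta> g" "P g" by blast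
    then show ?case using assms(3) KC_add free_carrier_add by (intro bexI[of _ "f + g"]) auto
  qed
qed

text \<open>The unit, written as the sum of all \<open>e(\<nu>)\<close>, is inserted between two
  factors. This breaks a bare generator, whose degree depends on \<nu>, into homogeneous
  pieces.\<close>

lemma insert_e:
  assumes "f \<in> FC \<beta>" "g \<in> FC \<beta>"
  shows "KC \<beta> (f * g) = KC \<beta> (\<Sum>\<nu>\<in>seqs D \<beta>. f * e_gen \<nu> * g)"
proof -
  have "(\<Sum>\<nu>\<in>seqs D \<beta>. e_gen \<nu>) - 1 \<in> KI \<beta>" by (rule KI_rel) (rule klr_rels.e_sum)
  then have "- (f * ((\<Sum>\<nu>\<in>seqs D \<beta>. e_gen \<nu>) - 1) * g) \<in> KI \<beta>"
    using KI_mult assms KI_uminus by blast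
  moreover have "- (f * ((\<Sum>\<nu>\<in>seqs D \<beta>. e_gen \<nu>) - 1) * g) = f * g - (\<Sum>\<nu>\<in>seqs D \<beta>. f * e_gen \<nu> * g)"
    by (simp add: algebra_simps sum_distrib_left sum_distrib_right)
  ultimately show ?thesis using assms by (subst KC_eq) (simp_all add: FC_intros)
qed

lemma homog_KA_mult:
  assumes a: "a \<in> homog (KA \<beta>) d" and y: "y \<in> FC \<beta>"
    and mon: "\<And>f. klr_monomial D \<beta> f d \<Longrightarrow> klr_monomial D \<beta> (y * f) d'"
  shows "KC \<beta> y \<otimes>\<^bsub>KA \<beta>\<^esub> a \<in> homog (KA \<beta>) d'"
proof -
  interpret K: ring "KA \<beta>" by (rule KA_ring)
  interpret m: additive_map "KA \<beta>" "KA \<beta>" "\<lambda>a. KC \<beta> y \<otimes>\<^bsub>KA \<beta>\<^esub> a"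
    by unfold_locales (simp_all add: KC_closed y K.r_distr)
  show ?thesis
  proof (rule m.generate_into[OF monomials_sub homog_KA_subgroup _ a[unfolded KA_homog]])
    fix h assume "h \<in> {KC \<beta> (nc_const c * f) |c f. klr_monomial D \<beta> f d}"
    then obtain c f where f: "h = KC \<beta> (nc_const c * f)" "klr_monomial D \<beta> f d" by blast
    have "y * (nc_const c * f) = nc_const c * (y * f)"
      by (metis mult.assoc nc_const_comm)
    then have "KC \<beta> y \<otimes>\<^bsub>KA \<beta>\<^esub> h = KC \<beta> (nc_const c * (y * f))"
      using f y free_carrier_mult[OF free_carrier_const monomial_FC[OF f(2)]] by (simp add: KC_mult)
    then show "KC \<beta> y \<otimes>\<^bsub>KA \<beta>\<^esub> h \<in> homog (KA \<beta>) d'"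
      using monomial_homog[OF mon[OF f(2)]] by simp
  qed
qed

lemma e_homog_mult: "a \<in> homog (KA \<beta>) d \<Longrightarrow> \<nu> \<in> seqs D \<beta> \<Longrightarrow>
    KC \<beta> (e_gen \<nu>) \<otimes>\<^bsub>KA \<beta>\<^esub> a \<in> homog (KA \<beta>) d"
  by (erule homog_KA_mult, erule e_FC, rule klr_monomial.e)

lemma x_homog_mult: "a \<in> homog (KA \<beta>) d \<Longrightarrow> \<nu> \<in> seqs D \<beta> \<Longrightarrow> k \<in> {1..ht D \<beta>} \<Longrightarrow>
    KC \<beta> (x_gen k * e_gen \<nu>) \<otimes>\<^bsub>KA \<beta>\<^esub> a \<in> homog (KA \<beta>) (ideg D (pos \<nu> k) (pos \<nu> k) + d)"
  by (erule homog_KA_mult, intro FC_intros, assumption+, rule klr_monomial.x)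

lemma tau_homog_mult: "a \<in> homog (KA \<beta>) d \<Longrightarrow> \<nu> \<in> seqs D \<beta> \<Longrightarrow> k \<in> {1..<ht D \<beta>} \<Longrightarrow>
    KC \<beta> (tau_gen k * e_gen \<nu>) \<otimes>\<^bsub>KA \<beta>\<^esub> a \<in> homog (KA \<beta>) (- ideg D (pos \<nu> k) (pos \<nu> (k + 1)) + d)"
  by (erule homog_KA_mult, intro FC_intros, assumption+, rule klr_monomial.tau)

lemma homog_KA_smult:
  assumes a: "a \<in> homog (KA \<beta>) d"
  shows "c \<odot>\<^bsub>KA \<beta>\<^esub> a \<in> homog (KA \<beta>) d"
proof -
  interpret K: ring "KA \<beta>" by (rule KA_ring)
  have eq: "c \<odot>\<^bsub>KA \<beta>\<^esub> b = KC \<beta> (nc_const c) \<otimes>\<^bsub>KA \<beta>\<^esub> b" if "b \<in> carrier (KA \<beta>)" for b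
    using that by (auto elim!: KA_carrierE simp: KC_smult KC_mult free_carrier_const)
  interpret m: additive_map "KA \<beta>" "KA \<beta>" "\<lambda>a. KC \<beta> (nc_const c) \<otimes>\<^bsub>KA \<beta>\<^esub> a"
    by unfold_locales (simp_all add: KC_closed free_carrier_const K.r_distr)
  have "KC \<beta> (nc_const c) \<otimes>\<^bsub>KA \<beta>\<^esub> a \<in> homog (KA \<beta>) d"
  proof (rule m.generate_into[OF monomials_sub homog_KA_subgroup _ a[unfolded KA_homog]])
    fix h assume "h \<in> {KC \<beta> (nc_const c * f) |c f. klr_monomial D \<beta> f d}"
    then obtain c' f where f: "h = KC \<beta> (nc_const c' * f)" "klr_monomial D \<beta> f d" by blast
    then have "KC \<beta> (nc_const c) \<otimes>\<^bsub>KA \<beta>\<^esub> h = KC \<beta> (nc_const (c * c') * f)"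
      using free_carrier_mult[OF free_carrier_const monomial_FC[OF f(2)]]
      by (simp add: KC_mult free_carrier_const nc_const_simps mult.assoc)
    then show "KC \<beta> (nc_const c) \<otimes>\<^bsub>KA \<beta>\<^esub> h \<in> homog (KA \<beta>) d" using monomial_homog[OF f(2)] by simp
  qed
  then show ?thesis using eq K.subgroup_carrier[OF homog_KA_subgroup a] by simp
qed

lemma one_homog: "\<one>\<^bsub>KA \<beta>\<^esub> \<in> homog (KA \<beta>) 0"
  using monomial_homog[OF klr_monomial.one, where c = 1] by (simp add: KC_one nc_const_simps)

text \<open>The homogeneous span contains the scalars, and left multiplication by a letter preserves
  it. For an idempotent this is direct; x_k and \<tau>_k alone are not homogeneous and are first
  split by inserting the idempotents.\<close>

lemma KA_gring: "gring (KA \<beta>)"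
proof -
  interpret K: ring "KA \<beta>" by (rule KA_ring)
  have hc: "a \<in> carrier (KA \<beta>)" if "a \<in> homog (KA \<beta>) d" for a d
    using K.subgroup_carrier[OF homog_KA_subgroup that] .
  define S where "S = generate (add_monoid (KA \<beta>)) (\<Union>d. homog (KA \<beta>) d)"
  have sub: "(\<Union>d. homog (KA \<beta>) d) \<subseteq> carrier (KA \<beta>)" using hc by blast
  have S: "subgroup S (add_monoid (KA \<beta>))" unfolding S_def by (rule K.generate_subgroup[OF sub])
  have hS: "a \<in> S" if "a \<in> homog (KA \<beta>) d" for a d
    unfolding S_def by (rule K.generate_gen) (use that in blast)
  have Sc: "a \<in> carrier (KA \<beta>)" if "a \<in> S" for a using K.subgroup_carrier[OF S that] .
  have ye: "KC \<beta> (y * e_gen \<nu>) \<otimes>\<^bsub>KA \<beta>\<^esub> a \<in> S" if "y \<in> {1} \<union> x_gen ` {1..ht D \<beta>} \<union> tau_gen ` {1..<ht D \<beta>}"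
    "\<nu> \<in> seqs D \<beta>" "a \<in> homog (KA \<beta>) d" for y \<nu> a d
    using that hS[OF e_homog_mult] hS[OF x_homog_mult] hS[OF tau_homog_mult] by auto
  have letter: "KC \<beta> (nc_gen g) \<otimes>\<^bsub>KA \<beta>\<^esub> a \<in> S" if g: "g \<in> klr_gens D \<beta>" and a: "a \<in> S" for g a
  proof -
    have gF: "nc_gen g \<in> FC \<beta>" using g by (rule free_carrier_gen)
    interpret m: additive_map "KA \<beta>" "KA \<beta>" "\<lambda>a. KC \<beta> (nc_gen g) \<otimes>\<^bsub>KA \<beta>\<^esub> a"
      by unfold_locales (simp_all add: KC_closed gF K.r_distr)
    show ?thesis
    proof (rule m.generate_into[OF sub S _ a[unfolded S_def]])
      fix h assume "h \<in> (\<Union>d. homog (KA \<beta>) d)"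
      then obtain d where d: "h \<in> homog (KA \<beta>) d" by blast
      then obtain f where f: "f \<in> FC \<beta>" "h = KC \<beta> f" using hc KA_carrierE by metis
      consider (e) \<nu> where "g = Gen_e \<nu>" "\<nu> \<in> seqs D \<beta>"
        | (xt) "(nc_gen g :: ('i, 'k) klr_free) \<in> {1} \<union> x_gen ` {1..ht D \<beta>} \<union> tau_gen ` {1..<ht D \<beta>}"
        using g by (auto simp: klr_gens_def)
      then show "KC \<beta> (nc_gen g) \<otimes>\<^bsub>KA \<beta>\<^esub> h \<in> S"
      proof cases
        case e
        then show ?thesis using hS[OF e_homog_mult[OF d]] by simp
      next
        case xt
        have "KC \<beta> (nc_gen g) \<otimes>\<^bsub>KA \<beta>\<^esub> h = KC \<beta> (\<Sum>\<nu>\<in>seqs D \<beta>. nc_gen g * e_gen \<nu> * f)"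
          using f gF by (simp add: KC_mult insert_e)
        also have "\<dots> = (\<Oplus>\<^bsub>KA \<beta>\<^esub>\<nu>\<in>seqs D \<beta>. KC \<beta> (nc_gen g * e_gen \<nu> * f))"
          using f gF by (intro KC_finsum[symmetric] finite_seqs FC_intros)
        also have "\<dots> \<in> S"
        proof (rule K.subgroup_finsum[OF S finite_seqs])
          fix \<nu> assume "\<nu> \<in> seqs D \<beta>"
          then show "KC \<beta> (nc_gen g * e_gen \<nu> * f) \<in> S"
            using ye[OF xt _ d] f gF by (simp add: KC_mult FC_intros)
        qed
        finally show ?thesis .
      qed
    qed
  qed
  have word: "KC \<beta> (Poly_Mapping.single w c) \<in> S" if "set w \<subseteq> klr_gens D \<beta>" for w and c :: 'k
    using that
  proof (induction w)
    case Nil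
    show ?case
      using hS[OF monomial_homog[OF klr_monomial.one, where c = c]] by (simp add: nc_const_def)
  next
    case (Cons g w)
    have "Poly_Mapping.single (g # w) c = nc_gen g * Poly_Mapping.single w c"
      by (simp add: nc_gen_def mult_single plus_list_def)
    moreover have "nc_gen g \<in> FC \<beta>" using Cons.prems by (intro free_carrier_gen) simp
    moreover have "Poly_Mapping.single w c \<in> FC \<beta>" using Cons.prems by (simp add: free_carrier_def)
    ultimately have "KC \<beta> (Poly_Mapping.single (g # w) c) = KC \<beta> (nc_gen g) \<otimes>\<^bsub>KA \<beta>\<^esub> KC \<beta> (Poly_Mapping.single w c)"
      by (simp add: KC_mult)
    then show ?case using letter[of g] Cons by simp
  qed
  have "KC \<beta> f \<in> S" if f: "f \<in> FC \<beta>" for f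
  proof -
    have "Poly_Mapping.keys f \<subseteq> {w. set w \<subseteq> klr_gens D \<beta>}" using f by (auto simp: free_carrier_def)
    then show ?thesis
    proof (induction rule: poly_mapping_keys_induct)
      case zero
      show ?case using K.subgroup_zero[OF S] by (simp add: KC_zero)
    next
      case (single w c)
      then show ?case using word by simp
    next
      case (add f g)
      then have "f \<in> FC \<beta>" "g \<in> FC \<beta>" by (auto simp: free_carrier_def)
      then show ?case using K.subgroup_add_closed[OF S add(3,4)] by (simp add: KC_add)
    qed
  qed
  then have "carrier (KA \<beta>) \<subseteq> S" by (auto simp: KA_carrier)
  then show ?thesis
    using hc by (intro gring.intro KA_ring) (simp_all add: S_def)
qed

end


section \<open>Congruence and commutation modulo the relations\<close>

context klr
begin

text \<open>Membership of both sides in the free algebra on the allowed letters is part of the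
  relation, so chains of congruences carry their own side conditions.\<close>

definition eqv :: "'p \<Rightarrow> ('i, 'k) klr_free \<Rightarrow> ('i, 'k) klr_free \<Rightarrow> bool" where
  "eqv \<delta> f g \<longleftrightarrow> f \<in> FC \<delta> \<and> g \<in> FC \<delta> \<and> f - g \<in> KI \<delta>"

lemma eqv_FC: "eqv \<delta> f g \<Longrightarrow> f \<in> FC \<delta>" "eqv \<delta> f g \<Longrightarrow> g \<in> FC \<delta>"
  by (simp_all add: eqv_def)

lemma eqv_refl: "f \<in> FC \<delta> \<Longrightarrow> eqv \<delta> f f"
  by (simp add: eqv_def KI_zero)

lemma eqv_sym: "eqv \<delta> f g \<Longrightarrow> eqv \<delta> g f"
  using KI_uminus[of "f - g" \<delta>] by (simp add: eqv_def)

lemma eqv_trans [trans]: "eqv \<delta> f g \<Longrightarrow> eqv \<delta> g h \<Longrightarrow> eqv \<delta> f h"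
  using KI_add[of "f - g" \<delta> "g - h"] by (simp add: eqv_def)

lemma eqv_add: "eqv \<delta> f f' \<Longrightarrow> eqv \<delta> g g' \<Longrightarrow> eqv \<delta> (f + g) (f' + g')"
  using KI_add[of "f - f'" \<delta> "g - g'"] by (simp add: eqv_def free_carrier_add add_diff_add)

lemma eqv_mult:
  assumes "eqv \<delta> f f'" "eqv \<delta> g g'"
  shows "eqv \<delta> (f * g) (f' * g')"
proof -
  have "f * (g - g') + (f - f') * g' \<in> KI \<delta>"
    using assms KI_mult KI_add unfolding eqv_def by blast
  then show ?thesis using assms by (simp add: eqv_def free_carrier_mult algebra_simps)
qed

lemmas eqv_mult_left = eqv_mult[OF eqv_refl]

lemma eqv_sum: "(\<And>i. i \<in> S \<Longrightarrow> eqv \<delta> (f i) (g i)) \<Longrightarrow> eqv \<delta> (\<Sum>i\<in>S. f i) (\<Sum>i\<in>S. g i)"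
  by (induction S rule: infinite_finite_induct) (simp_all add: eqv_refl free_carrier_zero eqv_add)

lemma eqv_KC: "eqv \<delta> f g \<Longrightarrow> KC \<delta> f = KC \<delta> g"
  using KC_eq[of f \<delta> g] by (simp add: eqv_def)

lemma eqv_rel: "r - s \<in> klr_rels D Q \<delta> \<Longrightarrow> r \<in> FC \<delta> \<Longrightarrow> s \<in> FC \<delta> \<Longrightarrow> eqv \<delta> r s"
  by (simp add: eqv_def KI_rel)

definition comm :: "'p \<Rightarrow> ('i, 'k) klr_free \<Rightarrow> ('i, 'k) klr_free \<Rightarrow> bool" where
  "comm \<delta> f g \<longleftrightarrow> f \<in> FC \<delta> \<and> g \<in> FC \<delta> \<and> eqv \<delta> (f * g) (g * f)"

lemma comm_sym: "comm \<delta> f g \<Longrightarrow> comm \<delta> g f"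
  using eqv_sym by (simp add: comm_def)

lemma comm_const: "g \<in> FC \<delta> \<Longrightarrow> comm \<delta> (nc_const c) g"
  using nc_const_comm[of c g] by (simp add: comm_def eqv_refl free_carrier_const free_carrier_mult)

lemma comm_one: "g \<in> FC \<delta> \<Longrightarrow> comm \<delta> 1 g"
  using comm_const[of g \<delta> 1] by (simp add: nc_const_simps)

lemma comm_add: "comm \<delta> f g \<Longrightarrow> comm \<delta> f' g \<Longrightarrow> comm \<delta> (f + f') g"
  by (simp add: comm_def free_carrier_add distrib_left distrib_right eqv_add)

lemma comm_zero: "g \<in> FC \<delta> \<Longrightarrow> comm \<delta> 0 g"
  by (simp add: comm_def free_carrier_zero eqv_refl)

lemma comm_sum: "g \<in> FC \<delta> \<Longrightarrow> (\<And>i. i \<in> S \<Longrightarrow> comm \<delta> (f i) g) \<Longrightarrow> comm \<delta> (\<Sum>i\<in>S. f i) g"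
  by (induction S rule: infinite_finite_induct) (simp_all add: comm_zero comm_add)

lemma comm_mult:
  assumes "comm \<delta> f g" "comm \<delta> f' g"
  shows "comm \<delta> (f * f') g"
proof -
  have F: "f \<in> FC \<delta>" "f' \<in> FC \<delta>" "g \<in> FC \<delta>" and e: "eqv \<delta> (f * g) (g * f)" "eqv \<delta> (f' * g) (g * f')"
    using assms by (auto simp: comm_def)
  have "eqv \<delta> (f * (f' * g)) (f * (g * f'))" by (rule eqv_mult[OF eqv_refl[OF F(1)] e(2)])
  also have "eqv \<delta> (f * (g * f')) (g * (f * f'))"
    using eqv_mult[OF e(1) eqv_refl[OF F(2)]] by (simp add: mult.assoc)
  finally show ?thesis using F by (simp add: comm_def free_carrier_mult mult.assoc)
qed

end

text \<open>The map \<open>R(\<beta>) \<rightarrow> R(\<delta>)\<close>, \<open>e(\<nu>) \<mapsto> \<Sum> e(\<mu> \<nu> \<mu>')\<close> over \<open>(\<mu>, \<mu>') \<in> T\<close>, where all \<open>\<mu>\<close> have length \<open>off\<close>.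
  Both \<open>a \<mapsto> a \<otimes> 1\<close> and \<open>b \<mapsto> 1 \<otimes> b\<close> are of this form.\<close>

locale klr_emb = klr D Q for D :: "('i, 'p::ab_group_add) root_datum" and Q :: "('i, 'k::field) qparam" +
  fixes \<beta> \<delta> :: 'p and T :: "('i list \<times> 'i list) set" and off :: nat
  assumes T: "finite T" and T_len: "(\<mu>, \<mu>') \<in> T \<Longrightarrow> length \<mu> = off"
    and T_seqs: "(\<mu>, \<mu>') \<in> T \<Longrightarrow> \<nu> \<in> seqs D \<beta> \<Longrightarrow> \<mu> @ \<nu> @ \<mu>' \<in> seqs D \<delta>"
    and ht_le: "off + ht D \<beta> \<le> ht D \<delta>"
begin

definition E :: "'i list \<Rightarrow> ('i, 'k) klr_free" where
  "E \<nu> = (\<Sum>t\<in>T. e_gen (fst t @ \<nu> @ snd t))"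

definition u :: "('i, 'k) klr_free" where "u = (\<Sum>\<nu>\<in>seqs D \<beta>. E \<nu>)"

definition \<phi> :: "'i klr_gen \<Rightarrow> ('i, 'k) klr_free" where
  "\<phi> g = (case g of Gen_e \<nu> \<Rightarrow> E \<nu> | Gen_x k \<Rightarrow> x_gen (off + k) | Gen_tau k \<Rightarrow> tau_gen (off + k))"

definition W :: "'i klr_gen list \<Rightarrow> ('i, 'k) klr_free" where "W w = prod_list (map \<phi> w)"

text \<open>A unital homomorphism of free algebras. It cannot respect the relation that the
  idempotents sum to 1, because their images sum to \<open>u\<close>. The map that descends to the
  quotients is f \<mapsto> \<open>L f * u\<close>.\<close>

definition L :: "('i, 'k) klr_free \<Rightarrow> ('i, 'k) klr_free" where
  "L f = (\<Sum>w\<in>Poly_Mapping.keys f. nc_const (Poly_Mapping.lookup f w) * W w)"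

lemma e_seqs: "t \<in> T \<Longrightarrow> \<nu> \<in> seqs D \<beta> \<Longrightarrow> fst t @ \<nu> @ snd t \<in> seqs D \<delta>"
  using T_seqs[of "fst t" "snd t"] by simp

lemma E_FC: "\<nu> \<in> seqs D \<beta> \<Longrightarrow> E \<nu> \<in> FC \<delta>"
  unfolding E_def by (intro FC_intros e_seqs)

lemma u_FC: "u \<in> FC \<delta>"
  unfolding u_def by (intro free_carrier_sum E_FC)

lemma range: "k \<in> {1..ht D \<beta>} \<Longrightarrow> off + k \<in> {1..ht D \<delta>}" "k \<in> {1..<ht D \<beta>} \<Longrightarrow> off + k \<in> {1..<ht D \<delta>}"
  using ht_le by auto

lemma klr_gensE:
  assumes "g \<in> klr_gens D \<beta>"
  obtains \<nu> where "g = Gen_e \<nu>" "\<nu> \<in> seqs D \<beta>" | k where "g = Gen_x k" "k \<in> {1..ht D \<beta>}"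
    | k where "g = Gen_tau k" "k \<in> {1..<ht D \<beta>}"
  using assms unfolding klr_gens_def by blast

lemma phi_FC: "g \<in> klr_gens D \<beta> \<Longrightarrow> \<phi> g \<in> FC \<delta>"
  by (erule klr_gensE) (simp_all only: \<phi>_def klr_gen.case E_FC x_FC[OF range(1)] tau_FC[OF range(2)])

lemma W_FC: "set w \<subseteq> klr_gens D \<beta> \<Longrightarrow> W w \<in> FC \<delta>"
  by (induction w) (simp_all add: W_def free_carrier_one free_carrier_mult phi_FC)

lemma W_append: "W (v @ w) = W v * W w"
  by (simp add: W_def)

lemma L_FC: "f \<in> FC \<beta> \<Longrightarrow> L f \<in> FC \<delta>"
  unfolding L_def by (intro FC_intros W_FC) (auto simp: free_carrier_def)

lemma L_supset: "finite K \<Longrightarrow> Poly_Mapping.keys f \<subseteq> K \<Longrightarrow>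
    L f = (\<Sum>w\<in>K. nc_const (Poly_Mapping.lookup f w) * W w)"
  unfolding L_def by (rule sum.mono_neutral_left) (auto simp: in_keys_iff nc_const_simps)

lemma L_add: "L (f + g) = L f + L g"
proof -
  let ?K = "Poly_Mapping.keys f \<union> Poly_Mapping.keys g"
  have "L (f + g) = (\<Sum>w\<in>?K. nc_const (Poly_Mapping.lookup (f + g) w) * W w)"
    by (rule L_supset) (use keys_add[of f g] in auto)
  then show ?thesis
    using L_supset[of ?K f] L_supset[of ?K g]
    by (simp add: lookup_add nc_const_simps distrib_right sum.distrib)
qed

lemma L_zero: "L 0 = 0"
  by (simp add: L_def)

lemma L_single: "L (Poly_Mapping.single w c) = nc_const c * W w"
  using L_supset[of "{w}" "Poly_Mapping.single w c"] by simp

lemma L_const: "L (nc_const c) = nc_const c"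
  using L_single[of "[]" c] by (simp add: nc_const_def[of c] W_def)

lemma L_one: "L 1 = 1"
  using L_const[of 1] by (simp add: nc_const_simps)

lemma L_gen: "L (nc_gen g) = \<phi> g"
  by (simp add: nc_gen_def L_single W_def nc_const_simps)

lemma L_mult: "L (f * g) = L f * L g"
proof -
  have s: "L (Poly_Mapping.single v a * g) = L (Poly_Mapping.single v a) * L g" for v a
  proof -
    have "Poly_Mapping.keys g \<subseteq> UNIV" by simp
    then show ?thesis
    proof (induction rule: poly_mapping_keys_induct)
      case (single w c)
      have "nc_const a * (nc_const c * (W v * W w)) = nc_const a * (W v * (nc_const c * W w))"
        by (metis mult.assoc nc_const_comm)
      then show ?case by (simp add: mult_single plus_list_def L_single W_append nc_const_simps mult.assoc)
    qed (simp_all add: L_zero L_add distrib_left)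
  qed
  have "Poly_Mapping.keys f \<subseteq> UNIV" by simp
  then show ?thesis
    by (induction rule: poly_mapping_keys_induct) (simp_all add: L_zero L_add distrib_right s)
qed

lemma L_uminus: "L (- f) = - L f"
  using L_add[of f "- f"] by (simp add: L_zero eq_neg_iff_add_eq_0 add.commute)

lemma L_diff: "L (f - g) = L f - L g"
  using L_add[of f "- g"] by (simp add: L_uminus)

lemma L_sum: "L (\<Sum>i\<in>S. f i) = (\<Sum>i\<in>S. L (f i))"
  by (induction S rule: infinite_finite_induct) (simp_all add: L_zero L_add)

lemma L_power: "L (f ^ n) = L f ^ n"
  by (induction n) (simp_all add: L_one L_mult)

lemma L_q_eval: "L (q_eval q f g) = q_eval q (L f) (L g)"
  by (simp add: q_eval_def L_sum case_prod_unfold L_mult L_power L_const)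

lemma L_q_diff: "L (q_diff q f g h) = q_diff q (L f) (L g) (L h)"
  by (simp add: q_diff_def L_sum case_prod_unfold L_mult L_power L_const)

lemma L_letters: "L (e_gen \<nu>) = E \<nu>" "L (x_gen k) = x_gen (off + k)" "L (tau_gen k) = tau_gen (off + k)"
  by (simp_all add: L_gen \<phi>_def)

lemmas L_simps = L_add L_diff L_mult L_zero L_one L_letters L_q_eval L_q_diff

lemma pos_T:
  assumes "t \<in> T" "\<nu> \<in> seqs D \<beta>" "k \<in> {1..ht D \<beta>}"
  shows "pos (fst t @ \<nu> @ snd t) (off + k) = pos \<nu> k"
proof -
  have "length (fst t) = off" using T_len[of "fst t" "snd t"] assms(1) by simp
  then show ?thesis using pos_append[of k \<nu> "fst t" "snd t"] assms length_seqs[OF assms(2)] by simp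
qed

lemma swap_T:
  assumes "t \<in> T" "\<nu> \<in> seqs D \<beta>" "k \<in> {1..<ht D \<beta>}"
  shows "swap_pos (off + k) (fst t @ \<nu> @ snd t) = fst t @ swap_pos k \<nu> @ snd t"
proof -
  have "length (fst t) = off" using T_len[of "fst t" "snd t"] assms(1) by simp
  then show ?thesis
    using swap_pos_append[of k \<nu> "fst t" "snd t"] assms length_seqs[OF assms(2)] by simp
qed

text \<open>All prefixes in T have length \<open>off\<close> and all sequences in
  \<open>seqs D \<beta>\<close> have equal length, so the concatenation determines \<nu> and the
  pair in T. The double sum of products of idempotents then collapses to its diagonal.\<close>

lemma E_E:
  assumes "\<nu> \<in> seqs D \<beta>" "\<nu>' \<in> seqs D \<beta>"
  shows "E \<nu> * E \<nu>' - (if \<nu> = \<nu>' then E \<nu> else 0) \<in> KI \<delta>"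
proof -
  let ?m = "\<lambda>\<nu> t. fst t @ \<nu> @ snd t"
  have len: "length (fst t) = off" if "t \<in> T" for t using T_len[of "fst t" "snd t"] that by simp
  have inj: "?m \<nu> t = ?m \<nu>' t' \<longleftrightarrow> \<nu> = \<nu>' \<and> t = t'" if "t \<in> T" "t' \<in> T" for t t'
    using len[OF that(1)] len[OF that(2)] length_seqs[OF assms(1)] length_seqs[OF assms(2)]
    by (auto simp: append_eq_append_conv prod_eq_iff)
  have "E \<nu> * E \<nu>' - (if \<nu> = \<nu>' then E \<nu> else 0)
      = (\<Sum>t\<in>T. \<Sum>t'\<in>T. e_gen (?m \<nu> t) * e_gen (?m \<nu>' t')
          - (if ?m \<nu> t = ?m \<nu>' t' then e_gen (?m \<nu> t) else 0))"
  proof -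
    have "(\<Sum>t\<in>T. \<Sum>t'\<in>T. if ?m \<nu> t = ?m \<nu>' t' then e_gen (?m \<nu> t) else 0 :: ('i, 'k) klr_free)
        = (\<Sum>t\<in>T. \<Sum>t'\<in>T. if t = t' then (if \<nu> = \<nu>' then e_gen (?m \<nu> t) else 0) else 0)"
      by (intro sum.cong refl) (auto simp: inj)
    also have "\<dots> = (if \<nu> = \<nu>' then E \<nu> else 0)"
      using T by (simp add: E_def)
    finally show ?thesis by (simp add: sum_subtractf E_def sum_product)
  qed
  also have "\<dots> \<in> KI \<delta>"
    using assms by (intro KI_sum KI_rel klr_rels.e_e e_seqs)
  finally show ?thesis .
qed

text \<open>Each relation involves only neighbouring positions and their letters, and inside a
  longer sequence these positions are merely shifted by \<open>off\<close>. The image is thus a sum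
  over T of relations of the same kind in R(\<delta>). The excluded relation goes to
  \<open>u - 1\<close>.\<close>

lemma L_rel:
  assumes "r \<in> klr_rels D Q \<beta>" "r \<noteq> (\<Sum>\<nu>\<in>seqs D \<beta>. e_gen \<nu>) - 1"
  shows "L r \<in> KI \<delta>"
  using assms(1)
proof cases
  case (e_e \<nu> \<nu>')
  have "L r = E \<nu> * E \<nu>' - (if \<nu> = \<nu>' then E \<nu> else 0)" unfolding e_e(1) by (simp add: L_simps)
  then show ?thesis using E_E[OF e_e(2,3)] by simp
next
  case e_sum
  then show ?thesis using assms(2) by simp
next
  case (x_e \<nu> k)
  have "L r = (\<Sum>t\<in>T. x_gen (off + k) * e_gen (fst t @ \<nu> @ snd t) - e_gen (fst t @ \<nu> @ snd t) * x_gen (off + k))"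
    unfolding x_e(1) by (simp add: L_simps E_def sum_distrib_left sum_distrib_right sum_subtractf)
  also have "\<dots> \<in> KI \<delta>"
    using x_e by (intro KI_sum KI_rel klr_rels.x_e e_seqs range)
  finally show ?thesis .
next
  case (x_x k m)
  then show ?thesis unfolding x_x(1) L_simps by (intro KI_rel klr_rels.x_x range)
next
  case (tau_e \<nu> k)
  have "L r = (\<Sum>t\<in>T. tau_gen (off + k) * e_gen (fst t @ \<nu> @ snd t)
      - e_gen (swap_pos (off + k) (fst t @ \<nu> @ snd t)) * tau_gen (off + k))"
    unfolding tau_e(1) using tau_e(2,3)
    by (simp add: L_simps E_def sum_distrib_left sum_distrib_right sum_subtractf swap_T cong: sum.cong)
  also have "\<dots> \<in> KI \<delta>"
    using tau_e by (intro KI_sum KI_rel klr_rels.tau_e e_seqs range)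
  finally show ?thesis .
next
  case (tau_tau k m)
  then have "off + k + 2 \<le> off + m \<or> off + m + 2 \<le> off + k" by auto
  then show ?thesis using tau_tau unfolding tau_tau(1) L_simps by (intro KI_rel klr_rels.tau_tau range)
next
  case (x_tau k m)
  then show ?thesis using range unfolding x_tau(1) L_simps by (intro KI_rel klr_rels.x_tau) auto
next
  case (tau_x1 \<nu> k)
  have p: "pos (fst t @ \<nu> @ snd t) (off + k) = pos \<nu> k"
    "pos (fst t @ \<nu> @ snd t) (off + k + 1) = pos \<nu> (k + 1)" if "t \<in> T" for t
    using pos_T[OF that tau_x1(2), of k] pos_T[OF that tau_x1(2), of "k + 1"] tau_x1(3) by auto
  have "L r = (\<Sum>t\<in>T. (tau_gen (off + k) * x_gen (off + k + 1) - x_gen (off + k) * tau_gen (off + k))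
        * e_gen (fst t @ \<nu> @ snd t)
      - (if pos (fst t @ \<nu> @ snd t) (off + k) = pos (fst t @ \<nu> @ snd t) (off + k + 1)
         then e_gen (fst t @ \<nu> @ snd t) else 0))"
    unfolding tau_x1(1) using p
    by (simp add: L_simps E_def sum_distrib_left sum_subtractf if_distrib[of L] cong: sum.cong if_cong)
  also have "\<dots> \<in> KI \<delta>"
    using tau_x1 by (intro KI_sum KI_rel klr_rels.tau_x1 e_seqs range)
  finally show ?thesis .
next
  case (tau_x2 \<nu> k)
  have p: "pos (fst t @ \<nu> @ snd t) (off + k) = pos \<nu> k"
    "pos (fst t @ \<nu> @ snd t) (off + k + 1) = pos \<nu> (k + 1)" if "t \<in> T" for t
    using pos_T[OF that tau_x2(2), of k] pos_T[OF that tau_x2(2), of "k + 1"] tau_x2(3) by auto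
  have "L r = (\<Sum>t\<in>T. (x_gen (off + k + 1) * tau_gen (off + k) - tau_gen (off + k) * x_gen (off + k))
        * e_gen (fst t @ \<nu> @ snd t)
      - (if pos (fst t @ \<nu> @ snd t) (off + k) = pos (fst t @ \<nu> @ snd t) (off + k + 1)
         then e_gen (fst t @ \<nu> @ snd t) else 0))"
    unfolding tau_x2(1) using p
    by (simp add: L_simps E_def sum_distrib_left sum_subtractf if_distrib[of L] cong: sum.cong if_cong)
  also have "\<dots> \<in> KI \<delta>"
    using tau_x2 by (intro KI_sum KI_rel klr_rels.tau_x2 e_seqs range)
  finally show ?thesis .
next
  case (tau_sq \<nu> k)
  have p: "pos (fst t @ \<nu> @ snd t) (off + k) = pos \<nu> k"
    "pos (fst t @ \<nu> @ snd t) (off + k + 1) = pos \<nu> (k + 1)" if "t \<in> T" for t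
    using pos_T[OF that tau_sq(2), of k] pos_T[OF that tau_sq(2), of "k + 1"] tau_sq(3) by auto
  have "L r = (\<Sum>t\<in>T. tau_gen (off + k) * tau_gen (off + k) * e_gen (fst t @ \<nu> @ snd t)
      - q_eval (Q (pos (fst t @ \<nu> @ snd t) (off + k)) (pos (fst t @ \<nu> @ snd t) (off + k + 1)))
          (x_gen (off + k)) (x_gen (off + k + 1)) * e_gen (fst t @ \<nu> @ snd t))"
    unfolding tau_sq(1) using p
    by (simp add: L_simps E_def sum_distrib_left sum_subtractf cong: sum.cong)
  also have "\<dots> \<in> KI \<delta>"
    using tau_sq by (intro KI_sum KI_rel klr_rels.tau_sq e_seqs range)
  finally show ?thesis .
next
  case (braid \<nu> k)
  have p: "pos (fst t @ \<nu> @ snd t) (off + k) = pos \<nu> k"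
    "pos (fst t @ \<nu> @ snd t) (off + k + 1) = pos \<nu> (k + 1)"
    "pos (fst t @ \<nu> @ snd t) (off + k + 2) = pos \<nu> (k + 2)" if "t \<in> T" for t
    using pos_T[OF that braid(2), of k] pos_T[OF that braid(2), of "k + 1"]
      pos_T[OF that braid(2), of "k + 2"] braid(3,4) by auto
  \<comment> \<open>The condition and the right-hand side depend only on letters of \<nu>, so they
    are the same for every member of T and can be taken out of the sum.\<close>
  define b where "b \<longleftrightarrow> pos \<nu> k = pos \<nu> (k + 2) \<and> pos \<nu> k \<noteq> pos \<nu> (k + 1)"
  define a :: "('i, 'k) klr_free" where "a = tau_gen (off + k + 1) * tau_gen (off + k) * tau_gen (off + k + 1)
    - tau_gen (off + k) * tau_gen (off + k + 1) * tau_gen (off + k)"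
  define q :: "('i, 'k) klr_free" where "q = q_diff (Q (pos \<nu> k) (pos \<nu> (k + 1))) (x_gen (off + k))
    (x_gen (off + k + 2)) (x_gen (off + k + 1))"
  have "L r = a * E \<nu> - (if b then q * E \<nu> else 0)"
    unfolding braid(1) a_def q_def b_def[symmetric]
    by (simp only: L_simps if_distrib[of L] add.assoc)
  also have "\<dots> = (\<Sum>t\<in>T. a * e_gen (fst t @ \<nu> @ snd t) - (if b then q * e_gen (fst t @ \<nu> @ snd t) else 0))"
    by (cases b) (simp_all add: E_def sum_distrib_left sum_subtractf)
  also have "\<dots> \<in> KI \<delta>"
  proof (rule KI_sum)
    fix t assume t: "t \<in> T"
    have "1 \<le> off + k" "off + k + 2 \<le> ht D \<delta>" using braid ht_le by auto
    from KI_rel[OF klr_rels.braid[OF e_seqs[OF t braid(2)] this, of Q]]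
    show "a * e_gen (fst t @ \<nu> @ snd t) - (if b then q * e_gen (fst t @ \<nu> @ snd t) else 0) \<in> KI \<delta>"
      unfolding a_def q_def b_def p[OF t] .
  qed
  finally show ?thesis .
qed

lemma E_u: assumes "\<nu> \<in> seqs D \<beta>" shows "eqv \<delta> (E \<nu> * u) (E \<nu>)" "eqv \<delta> (u * E \<nu>) (E \<nu>)"
proof -
  have "E \<nu> * u - E \<nu> = (\<Sum>\<nu>'\<in>seqs D \<beta>. E \<nu> * E \<nu>' - (if \<nu> = \<nu>' then E \<nu> else 0))"
    using assms finite_seqs by (simp add: sum_subtractf u_def sum_distrib_left)
  also have "\<dots> \<in> KI \<delta>" using assms by (intro KI_sum E_E)
  finally show "eqv \<delta> (E \<nu> * u) (E \<nu>)" using assms by (simp add: eqv_def E_FC u_FC free_carrier_mult)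
  have "u * E \<nu> - E \<nu> = (\<Sum>\<nu>'\<in>seqs D \<beta>. E \<nu>' * E \<nu> - (if \<nu>' = \<nu> then E \<nu>' else 0))"
    using assms finite_seqs by (simp add: sum_subtractf u_def sum_distrib_right)
  also have "\<dots> \<in> KI \<delta>" using assms by (intro KI_sum E_E)
  finally show "eqv \<delta> (u * E \<nu>) (E \<nu>)" using assms by (simp add: eqv_def E_FC u_FC free_carrier_mult)
qed

lemma u_u: "eqv \<delta> (u * u) u"
proof -
  have "eqv \<delta> (\<Sum>\<nu>\<in>seqs D \<beta>. E \<nu> * u) (\<Sum>\<nu>\<in>seqs D \<beta>. E \<nu>)"
    by (intro eqv_sum E_u)
  then show ?thesis by (simp add: u_def sum_distrib_right)
qed

lemma x_comm_e: "\<nu> \<in> seqs D \<delta> \<Longrightarrow> k \<in> {1..ht D \<delta>} \<Longrightarrow> comm \<delta> (x_gen k) (e_gen \<nu>)"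
  unfolding comm_def by (intro conjI eqv_rel klr_rels.x_e FC_intros)

lemma x_comm_E: "\<nu> \<in> seqs D \<beta> \<Longrightarrow> k \<in> {1..ht D \<delta>} \<Longrightarrow> comm \<delta> (x_gen k) (E \<nu>)"
  unfolding E_def by (intro comm_sym[OF comm_sum] comm_sym[OF x_comm_e] e_seqs x_FC)

lemma x_comm_u: "k \<in> {1..ht D \<delta>} \<Longrightarrow> comm \<delta> (x_gen k) u"
  unfolding u_def by (intro comm_sym[OF comm_sum] comm_sym[OF x_comm_E] x_FC)

text \<open>Moving \<tau> past the image of \<open>e(\<nu>)\<close> swaps two letters of \<nu>. The
  swap is an involution of the sequences, so the sum over all of them is unchanged.\<close>

lemma tau_comm_u: assumes "k \<in> {1..<ht D \<beta>}" shows "comm \<delta> (tau_gen (off + k)) u"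
proof -
  let ?\<tau> = "tau_gen (off + k) :: ('i, 'k) klr_free"
  have \<tau>F: "?\<tau> \<in> FC \<delta>" using range(2)[OF assms] by (rule tau_FC)
  have "eqv \<delta> (?\<tau> * E \<nu>) (E (swap_pos k \<nu>) * ?\<tau>)" if \<nu>: "\<nu> \<in> seqs D \<beta>" for \<nu>
  proof -
    have "eqv \<delta> (\<Sum>t\<in>T. ?\<tau> * e_gen (fst t @ \<nu> @ snd t))
        (\<Sum>t\<in>T. e_gen (swap_pos (off + k) (fst t @ \<nu> @ snd t)) * ?\<tau>)"
      using assms \<nu> range(2)[OF assms]
      by (intro eqv_sum eqv_rel klr_rels.tau_e FC_intros e_seqs swap_pos_seqs)
    then show ?thesis using swap_T[OF _ \<nu> assms] by (simp add: E_def sum_distrib_left sum_distrib_right)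
  qed
  then have "eqv \<delta> (\<Sum>\<nu>\<in>seqs D \<beta>. ?\<tau> * E \<nu>) (\<Sum>\<nu>\<in>seqs D \<beta>. E (swap_pos k \<nu>) * ?\<tau>)"
    by (rule eqv_sum)
  moreover have "(\<Sum>\<nu>\<in>seqs D \<beta>. E (swap_pos k \<nu>) * ?\<tau>) = (\<Sum>\<nu>\<in>seqs D \<beta>. E \<nu> * ?\<tau>)"
  proof (rule sum.reindex_bij_witness[where i = "swap_pos k" and j = "swap_pos k"])
    fix \<nu> assume \<nu>: "\<nu> \<in> seqs D \<beta>"
    show "swap_pos k (swap_pos k \<nu>) = \<nu>" "swap_pos k \<nu> \<in> seqs D \<beta>"
      using swap_pos_invol[of k \<nu>] swap_pos_seqs[OF \<nu> assms] length_seqs[OF \<nu>] assms by auto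
    then show "swap_pos k (swap_pos k \<nu>) = \<nu>" "swap_pos k \<nu> \<in> seqs D \<beta>" by simp_all
  qed simp
  ultimately show ?thesis
    using \<tau>F u_FC by (simp add: comm_def u_def sum_distrib_left sum_distrib_right)
qed

lemma phi_comm_u: "g \<in> klr_gens D \<beta> \<Longrightarrow> comm \<delta> (\<phi> g) u"
proof -
  assume "g \<in> klr_gens D \<beta>"
  then show ?thesis
  proof (cases rule: klr_gensE)
    case (1 \<nu>)
    then show ?thesis using eqv_trans[OF E_u(1) eqv_sym[OF E_u(2)]] E_FC u_FC by (simp add: \<phi>_def comm_def)
  next
    case (2 k)
    then show ?thesis using x_comm_u[OF range(1)] by (simp add: \<phi>_def)
  next
    case (3 k)
    then show ?thesis using tau_comm_u by (simp add: \<phi>_def)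
  qed
qed

lemma comm_W:
  assumes "set w \<subseteq> klr_gens D \<beta>" "g \<in> FC \<delta>" "\<And>l. l \<in> klr_gens D \<beta> \<Longrightarrow> comm \<delta> (\<phi> l) g"
  shows "comm \<delta> (W w) g"
  using assms(1) by (induction w) (simp_all add: W_def comm_one assms(2,3) comm_mult)

lemma comm_L:
  assumes "f \<in> FC \<beta>" "g \<in> FC \<delta>" "\<And>l. l \<in> klr_gens D \<beta> \<Longrightarrow> comm \<delta> (\<phi> l) g"
  shows "comm \<delta> (L f) g"
  unfolding L_def
proof (intro comm_sum comm_mult comm_const comm_W assms)
  fix w assume "w \<in> Poly_Mapping.keys f"
  then show "set w \<subseteq> klr_gens D \<beta>" using assms(1) by (auto simp: free_carrier_def)
qed

lemma L_comm_u: "f \<in> FC \<beta> \<Longrightarrow> comm \<delta> (L f) u"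
  by (rule comm_L[OF _ u_FC phi_comm_u])

text \<open>The elements f for which \<open>L f * u\<close> lies in the ideal form an ideal
  themselves, and this ideal contains all defining relations. Hence it contains the ideal that they
  generate.\<close>

lemma L_KI: assumes "f \<in> KI \<beta>" shows "L f * u \<in> KI \<delta>"
proof -
  let ?J = "{f \<in> FC \<beta>. L f * u \<in> KI \<delta>}"
  interpret F: ring "free_algebra (klr_gens D \<beta>)" by (rule ring_free_algebra)
  have "ideal ?J (free_algebra (klr_gens D \<beta>))"
  proof (rule idealI[OF ring_free_algebra])
    show "subgroup ?J (add_monoid (free_algebra (klr_gens D \<beta>)))"
      by (rule F.subgroupI')
        (auto simp: free_carrier_zero KI_zero free_carrier_add L_simps distrib_right KI_add
          free_algebra_neg free_carrier_uminus L_uminus KI_uminus)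
    fix a g :: "('i, 'k) klr_free"
    assume a: "a \<in> ?J" and "g \<in> carrier (free_algebra (klr_gens D \<beta>))"
    then have g: "g \<in> FC \<beta>" by simp
    show "g \<otimes>\<^bsub>free_algebra (klr_gens D \<beta>)\<^esub> a \<in> ?J"
      using a g KI_mult(1)[of "L a * u" \<delta> "L g"] L_FC by (simp add: L_mult free_carrier_mult mult.assoc)
    \<comment> \<open>Closure under multiplication from the right is where commutation is needed: u
      has to pass L g before it meets L a.\<close>
    have "eqv \<delta> (L a * (L g * u)) (L a * (u * L g))"
      using L_comm_u[OF g] a L_FC by (intro eqv_mult_left) (simp_all add: comm_def)
    moreover have "L a * (u * L g) \<in> KI \<delta>"
      using KI_mult(2)[of "L a * u" \<delta> "L g"] a L_FC[OF g] by (simp add: mult.assoc)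
    ultimately have "L a * L g * u \<in> KI \<delta>"
      using KI_add[of "L a * (L g * u) - L a * (u * L g)" \<delta> "L a * (u * L g)"]
      by (simp add: eqv_def mult.assoc)
    then show "a \<otimes>\<^bsub>free_algebra (klr_gens D \<beta>)\<^esub> g \<in> ?J" using a g by (simp add: L_mult free_carrier_mult)
  qed
  moreover have "klr_rels D Q \<beta> \<subseteq> ?J"
  proof
    fix r assume r: "r \<in> klr_rels D Q \<beta>"
    have "L r * u \<in> KI \<delta>"
    proof (cases "r = (\<Sum>\<nu>\<in>seqs D \<beta>. e_gen \<nu>) - 1")
      case True
      \<comment> \<open>The one relation that L alone does not respect; multiplied by u it holds
        because u is idempotent.\<close>
      have "L r = u - 1" unfolding True by (simp add: L_simps L_sum u_def)
      then have "L r * u = u * u - u" by (simp add: left_diff_distrib)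
      then show ?thesis using u_u by (simp add: eqv_def)
    next
      case False
      then show ?thesis using KI_mult(2)[OF L_rel[OF r] u_FC] by simp
    qed
    then show "r \<in> ?J" using rels_FC r by blast
  qed
  ultimately have "KI \<beta> \<subseteq> ?J" by (rule KI_minimal)
  then show ?thesis using assms by blast
qed

definition emb :: "('i, 'k) klr_free set \<Rightarrow> ('i, 'k) klr_free set" where
  "emb C = (\<Union>f\<in>C. nc_eval (KA \<delta>) (KC \<delta> u) (\<lambda>g. KC \<delta> (\<phi> g)) f)"

lemma nc_eval_eq:
  assumes "f \<in> FC \<beta>"
  shows "nc_eval (KA \<delta>) (KC \<delta> u) (\<lambda>g. KC \<delta> (\<phi> g)) f = KC \<delta> (L f * u)"
proof -
  have w: "set w \<subseteq> klr_gens D \<beta>" if "w \<in> Poly_Mapping.keys f" for w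
    using assms that by (auto simp: free_carrier_def)
  have fold: "foldr (\<lambda>g r. KC \<delta> (\<phi> g) \<otimes>\<^bsub>KA \<delta>\<^esub> r) w (KC \<delta> u) = KC \<delta> (W w * u)" if "set w \<subseteq> klr_gens D \<beta>" for w
    using that
  proof (induction w)
    case (Cons g w)
    then have "W w * u \<in> FC \<delta>" using W_FC[of w] u_FC free_carrier_mult by auto
    then show ?case using Cons phi_FC[of g] by (simp add: KC_mult W_def mult.assoc)
  qed (simp add: W_def)
  interpret K: ring "KA \<delta>" by (rule KA_ring)
  have "nc_eval (KA \<delta>) (KC \<delta> u) (\<lambda>g. KC \<delta> (\<phi> g)) f
      = (\<Oplus>\<^bsub>KA \<delta>\<^esub>w\<in>Poly_Mapping.keys f. KC \<delta> (nc_const (Poly_Mapping.lookup f w) * (W w * u)))"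
    unfolding nc_eval_def
    by (intro K.finsum_cong')
      (auto simp: fold w KC_smult W_FC u_FC free_carrier_mult free_carrier_const KC_closed)
  also have "\<dots> = KC \<delta> (\<Sum>w\<in>Poly_Mapping.keys f. nc_const (Poly_Mapping.lookup f w) * (W w * u))"
    using w by (intro KC_finsum) (auto intro!: free_carrier_mult free_carrier_const W_FC u_FC)
  finally show ?thesis by (simp add: L_def sum_distrib_right mult.assoc)
qed

text \<open>By \<open>L_KI\<close> all representatives of a class evaluate to the same element, so
  the union in \<open>emb\<close> is a single class.\<close>

lemma emb_KC: assumes "f \<in> FC \<beta>" shows "emb (KC \<beta> f) = KC \<delta> (L f * u)"
proof -
  have "nc_eval (KA \<delta>) (KC \<delta> u) (\<lambda>g. KC \<delta> (\<phi> g)) g = KC \<delta> (L f * u)" if "g \<in> KC \<beta> f" for g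
  proof -
    have g: "g \<in> FC \<beta>" "KC \<beta> g = KC \<beta> f" using KC_memD[OF assms that] by auto
    then have "L (g - f) * u \<in> KI \<delta>" using L_KI KC_eq[OF g(1) assms] by blast
    then have "KC \<delta> (L g * u) = KC \<delta> (L f * u)"
      using L_FC g(1) assms u_FC by (subst KC_eq) (auto simp: free_carrier_mult L_diff algebra_simps)
    then show ?thesis using nc_eval_eq[OF g(1)] by simp
  qed
  then show ?thesis unfolding emb_def using KC_mem[OF assms] by blast
qed

lemma emb_closed: "a \<in> carrier (KA \<beta>) \<Longrightarrow> emb a \<in> carrier (KA \<delta>)"
  by (auto elim!: KA_carrierE simp: emb_KC L_FC u_FC free_carrier_mult intro!: KC_closed)

lemma emb_add: "a \<in> carrier (KA \<beta>) \<Longrightarrow> b \<in> carrier (KA \<beta>) \<Longrightarrow> emb (a \<oplus>\<^bsub>KA \<beta>\<^esub> b) = emb a \<oplus>\<^bsub>KA \<delta>\<^esub> emb b"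
  by (auto elim!: KA_carrierE simp: emb_KC KC_add L_FC u_FC free_carrier_mult free_carrier_add L_add distrib_right)

text \<open>As u is idempotent and commutes with L g, the factor u between L f and L g is absorbed
  by the one at the end.\<close>

lemma emb_mult:
  assumes "a \<in> carrier (KA \<beta>)" "b \<in> carrier (KA \<beta>)"
  shows "emb (a \<otimes>\<^bsub>KA \<beta>\<^esub> b) = emb a \<otimes>\<^bsub>KA \<delta>\<^esub> emb b"
proof -
  obtain f g where fg: "f \<in> FC \<beta>" "a = KC \<beta> f" "g \<in> FC \<beta>" "b = KC \<beta> g"
    using assms KA_carrierE by metis
  have e1: "eqv \<delta> (L g * (u * u)) (L g * u)" by (rule eqv_mult_left[OF L_FC[OF fg(3)] u_u])
  have e2: "eqv \<delta> ((L g * u) * u) ((u * L g) * u)"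
    using L_comm_u[OF fg(3)] by (intro eqv_mult[OF _ eqv_refl[OF u_FC]]) (simp add: comm_def)
  have "eqv \<delta> (L g * u) (u * (L g * u))"
    by (rule eqv_trans[OF eqv_sym[OF e1] e2[unfolded mult.assoc]])
  then have "KC \<delta> (L f * (L g * u)) = KC \<delta> (L f * (u * (L g * u)))"
    by (intro eqv_KC eqv_mult_left L_FC fg)
  then show ?thesis using fg L_FC u_FC
    by (simp add: emb_KC KC_mult free_carrier_mult L_mult mult.assoc)
qed

lemma emb_one: "emb \<one>\<^bsub>KA \<beta>\<^esub> = KC \<delta> u"
  by (simp add: KC_one emb_KC free_carrier_one L_one)

text \<open>Degrees depend only on the letters at the positions concerned, and those are kept by the
  shift by \<open>off\<close>. A monomial goes to a sum over T of elements of its own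
  degree.\<close>

lemma emb_homog: assumes "a \<in> homog (KA \<beta>) d" shows "emb a \<in> homog (KA \<delta>) d"
proof -
  interpret K: ring "KA \<delta>" by (rule KA_ring)
  interpret KB: ring "KA \<beta>" by (rule KA_ring)
  interpret emb: additive_map "KA \<beta>" "KA \<delta>" emb
    by unfold_locales (simp_all add: emb_closed emb_add)
  have sum_in: "KC \<delta> (\<Sum>i\<in>S. f i) \<in> homog (KA \<delta>) d"
    if "finite S" "\<And>i. i \<in> S \<Longrightarrow> f i \<in> FC \<delta>" "\<And>i. i \<in> S \<Longrightarrow> KC \<delta> (f i) \<in> homog (KA \<delta>) d"
    for S :: "'s set" and f d
    using K.subgroup_finsum[OF homog_KA_subgroup that(1,3)] KC_finsum[OF that(1,2)] by simp
  have mon: "KC \<delta> (L f * u) \<in> homog (KA \<delta>) d" if "klr_monomial D \<beta> f d" for f d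
    using that
  proof (induction rule: klr_monomial.induct)
    case one
    have "KC \<delta> (e_gen \<nu>) \<in> homog (KA \<delta>) 0" if "\<nu> \<in> seqs D \<delta>" for \<nu>
      using e_homog_mult[OF one_homog that] that by (simp add: KC_one KC_mult e_FC free_carrier_one)
    then have "KC \<delta> (E \<nu>) \<in> homog (KA \<delta>) 0" if "\<nu> \<in> seqs D \<beta>" for \<nu>
      unfolding E_def using that T e_seqs by (intro sum_in e_FC) auto
    then show ?case unfolding L_one u_def by (simp add: sum_in finite_seqs E_FC)
  next
    case (e f d \<nu>)
    have F: "L f * u \<in> FC \<delta>" using L_FC[OF monomial_FC[OF e(1)]] u_FC by (rule free_carrier_mult)
    have "KC \<delta> (\<Sum>t\<in>T. e_gen (fst t @ \<nu> @ snd t) * (L f * u)) \<in> homog (KA \<delta>) d"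
      using e_homog_mult[OF e(3) e_seqs[OF _ e(2)]] F e_seqs[OF _ e(2)]
      by (intro sum_in T) (auto simp: KC_mult e_FC free_carrier_mult)
    then show ?case by (simp add: L_simps E_def sum_distrib_right mult.assoc)
  next
    case (x f d \<nu> k)
    have F: "L f * u \<in> FC \<delta>" using L_FC[OF monomial_FC[OF x(1)]] u_FC by (rule free_carrier_mult)
    have k: "off + k \<in> {1..ht D \<delta>}" using range(1)[OF x(3)] .
    have "KC \<delta> (\<Sum>t\<in>T. (x_gen (off + k) * e_gen (fst t @ \<nu> @ snd t)) * (L f * u))
        \<in> homog (KA \<delta>) (ideg D (pos \<nu> k) (pos \<nu> k) + d)"
    proof (intro sum_in T)
      fix t assume t: "t \<in> T"
      note s = e_seqs[OF t x(2)]
      show "(x_gen (off + k) * e_gen (fst t @ \<nu> @ snd t)) * (L f * u) \<in> FC \<delta>"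
        by (rule free_carrier_mult[OF _ F], intro FC_intros s k)
      show "KC \<delta> ((x_gen (off + k) * e_gen (fst t @ \<nu> @ snd t)) * (L f * u))
          \<in> homog (KA \<delta>) (ideg D (pos \<nu> k) (pos \<nu> k) + d)"
        using x_homog_mult[OF x(4) s k] pos_T[OF t x(2,3)] F s k by (simp add: KC_mult FC_intros)
    qed
    then show ?case by (simp add: L_simps E_def sum_distrib_right sum_distrib_left mult.assoc)
  next
    case (tau f d \<nu> k)
    have F: "L f * u \<in> FC \<delta>" using L_FC[OF monomial_FC[OF tau(1)]] u_FC by (rule free_carrier_mult)
    have k: "off + k \<in> {1..<ht D \<delta>}" using range(2)[OF tau(3)] .
    have "KC \<delta> (\<Sum>t\<in>T. (tau_gen (off + k) * e_gen (fst t @ \<nu> @ snd t)) * (L f * u))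
        \<in> homog (KA \<delta>) (- ideg D (pos \<nu> k) (pos \<nu> (k + 1)) + d)"
    proof (intro sum_in T)
      fix t assume t: "t \<in> T"
      note s = e_seqs[OF t tau(2)]
      have p: "pos (fst t @ \<nu> @ snd t) (off + k) = pos \<nu> k"
        "pos (fst t @ \<nu> @ snd t) (off + k + 1) = pos \<nu> (k + 1)"
        using pos_T[OF t tau(2), of k] pos_T[OF t tau(2), of "k + 1"] tau(3) by auto
      show "(tau_gen (off + k) * e_gen (fst t @ \<nu> @ snd t)) * (L f * u) \<in> FC \<delta>"
        by (rule free_carrier_mult[OF _ F], intro FC_intros s k)
      show "KC \<delta> ((tau_gen (off + k) * e_gen (fst t @ \<nu> @ snd t)) * (L f * u))
          \<in> homog (KA \<delta>) (- ideg D (pos \<nu> k) (pos \<nu> (k + 1)) + d)"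
        using tau_homog_mult[OF tau(4) s k] p F s k by (simp add: KC_mult FC_intros)
    qed
    then show ?case by (simp add: L_simps E_def sum_distrib_right sum_distrib_left mult.assoc)
  qed
  show ?thesis
  proof (rule emb.generate_into[OF monomials_sub homog_KA_subgroup _ assms[unfolded KA_homog]])
    fix h assume "h \<in> {KC \<beta> (nc_const c * f) |c f. klr_monomial D \<beta> f d}"
    then obtain c f where f: "h = KC \<beta> (nc_const c * f)" "klr_monomial D \<beta> f d" by blast
    have F: "L f * u \<in> FC \<delta>" using L_FC[OF monomial_FC[OF f(2)]] u_FC by (rule free_carrier_mult)
    have "emb h = c \<odot>\<^bsub>KA \<delta>\<^esub> KC \<delta> (L f * u)"
      using f F monomial_FC[OF f(2)]
      by (simp add: emb_KC free_carrier_mult free_carrier_const L_mult L_const KC_smult mult.assoc)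
    then show "emb h \<in> homog (KA \<delta>) d" using homog_KA_smult[OF mon[OF f(2)]] by simp
  qed
qed

end


section \<open>Polynomials acting through an operator\<close>

lemma UP_ring_intro: "ring A \<Longrightarrow> UP_ring A"
  by (simp add: UP_ring_def)

lemma UP_coeff: "p \<in> carrier (UP A) \<Longrightarrow> coeff (UP A) p n = p n"
  by (simp add: UP_def)

lemma UP_closed: "p \<in> carrier (UP A) \<Longrightarrow> p n \<in> carrier A"
  by (auto simp: UP_def)

lemma UP_add: "p \<in> carrier (UP A) \<Longrightarrow> q \<in> carrier (UP A) \<Longrightarrow> (p \<oplus>\<^bsub>UP A\<^esub> q) n = p n \<oplus>\<^bsub>A\<^esub> q n"
  by (simp add: UP_def)

lemma UP_zero: "\<zero>\<^bsub>UP A\<^esub> n = \<zero>\<^bsub>A\<^esub>"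
  by (simp add: UP_def)

lemma UP_monom: "a \<in> carrier A \<Longrightarrow> up_ring.monom (UP A) a n k = (if k = n then a else \<zero>\<^bsub>A\<^esub>)"
  by (simp add: UP_def)

lemma UP_finite: "p \<in> carrier (UP A) \<Longrightarrow> finite {k. p k \<noteq> \<zero>\<^bsub>A\<^esub>}"
proof -
  assume "p \<in> carrier (UP A)"
  then obtain n where n: "bound \<zero>\<^bsub>A\<^esub> n p" by (auto simp: UP_def up_def)
  have "{k. p k \<noteq> \<zero>\<^bsub>A\<^esub>} \<subseteq> {..n}" using bound.bound[OF n] by (auto simp: not_less[symmetric])
  then show ?thesis by (rule finite_subset) simp
qed

lemma UP_memI:
  assumes "\<And>n. p n \<in> carrier A" "finite {k. p k \<noteq> \<zero>\<^bsub>A\<^esub>}"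
  shows "p \<in> carrier (UP A)"
proof -
  obtain n where "\<forall>k\<in>{k. p k \<noteq> \<zero>\<^bsub>A\<^esub>}. k \<le> n" using finite_nat_set_iff_bounded_le assms(2) by metis
  then have "bound \<zero>\<^bsub>A\<^esub> n p" by (intro bound.intro) (meson mem_Collect_eq not_less)
  then show ?thesis using assms(1) by (auto simp: UP_def)
qed

lemma UP_induct [consumes 2, case_names monom add]:
  assumes A: "ring A" and p: "p \<in> carrier (UP A)"
    and mon: "\<And>a n. a \<in> carrier A \<Longrightarrow> P (up_ring.monom (UP A) a n)"
    and add: "\<And>p q. p \<in> carrier (UP A) \<Longrightarrow> q \<in> carrier (UP A) \<Longrightarrow> P p \<Longrightarrow> P q \<Longrightarrow> P (p \<oplus>\<^bsub>UP A\<^esub> q)"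
  shows "P p"
proof -
  interpret UP_ring A "UP A" by (rule UP_ring_intro[OF A]) 
  have mc: "up_ring.monom (UP A) (p k) k \<in> carrier (UP A)" for k by (simp add: UP_closed[OF p])
  have "(\<Oplus>\<^bsub>UP A\<^esub>k\<in>S. up_ring.monom (UP A) (p k) k) \<in> carrier (UP A) \<and> P (\<Oplus>\<^bsub>UP A\<^esub>k\<in>S. up_ring.monom (UP A) (p k) k)"
    if "finite S" for S
    using that
  proof (induction S rule: finite_induct)
    case empty
    have "P (up_ring.monom (UP A) \<zero>\<^bsub>A\<^esub> 0)" by (rule mon) simp
    then show ?case by simp
  next
    case (insert k S)
    have "(\<Oplus>\<^bsub>UP A\<^esub>k\<in>insert k S. up_ring.monom (UP A) (p k) k)
        = up_ring.monom (UP A) (p k) k \<oplus>\<^bsub>UP A\<^esub> (\<Oplus>\<^bsub>UP A\<^esub>k\<in>S. up_ring.monom (UP A) (p k) k)"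
      using insert mc by (intro P.finsum_insert) auto
    then show ?case using insert mc[of k] add[of "up_ring.monom (UP A) (p k) k"] mon[OF UP_closed[OF p]] by simp
  qed
  from this[of "{..deg A p}"] show ?thesis using up_repr[OF p] by (simp add: UP_coeff[OF p])
qed

lemma UP_var_central:
  assumes "ring A" "p \<in> carrier (UP A)"
  shows "up_ring.monom (UP A) \<one>\<^bsub>A\<^esub> 1 \<otimes>\<^bsub>UP A\<^esub> p = p \<otimes>\<^bsub>UP A\<^esub> up_ring.monom (UP A) \<one>\<^bsub>A\<^esub> 1"
  using assms
proof (induction rule: UP_induct)
  case (monom a n)
  interpret UP_ring A "UP A" by (rule UP_ring_intro[OF assms(1)])
  have "up_ring.monom (UP A) \<one>\<^bsub>A\<^esub> 1 \<otimes>\<^bsub>UP A\<^esub> up_ring.monom (UP A) a n = up_ring.monom (UP A) (\<one>\<^bsub>A\<^esub> \<otimes>\<^bsub>A\<^esub> a) (1 + n)"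
    using monom by (intro monom_mult[symmetric]) simp_all
  also have "\<dots> = up_ring.monom (UP A) (a \<otimes>\<^bsub>A\<^esub> \<one>\<^bsub>A\<^esub>) (n + 1)" using monom by simp
  also have "\<dots> = up_ring.monom (UP A) a n \<otimes>\<^bsub>UP A\<^esub> up_ring.monom (UP A) \<one>\<^bsub>A\<^esub> 1"
    using monom by (intro monom_mult) simp_all
  finally show ?case .
next
  case (add p q)
  interpret UP_ring A "UP A" by (rule UP_ring_intro[OF assms(1)])
  show ?case using add by (simp add: P.l_distr P.r_distr)
qed

text \<open>An A-linear operator T turns U into a module over A[z] with z acting by T. The
  coefficients need not commute with each other, but the variable is central, and this is why T must
  commute with A.\<close>

locale poly_action = gmodule A U for A :: "('k, 'a) graded" and U :: "('a, 'u) graded" +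
  fixes T :: "'u \<Rightarrow> 'u"
  assumes T_closed: "u \<in> carrier U \<Longrightarrow> T u \<in> carrier U"
    and T_add: "u \<in> carrier U \<Longrightarrow> v \<in> carrier U \<Longrightarrow> T (u \<oplus>\<^bsub>U\<^esub> v) = T u \<oplus>\<^bsub>U\<^esub> T v"
    and T_smult: "a \<in> carrier A \<Longrightarrow> u \<in> carrier U \<Longrightarrow> T (a \<odot>\<^bsub>U\<^esub> u) = a \<odot>\<^bsub>U\<^esub> T u"
begin

definition act :: "(nat \<Rightarrow> 'a) \<Rightarrow> 'u \<Rightarrow> 'u" where
  "act p u = (\<Oplus>\<^bsub>U\<^esub>k\<in>{k. p k \<noteq> \<zero>\<^bsub>A\<^esub>}. p k \<odot>\<^bsub>U\<^esub> (T ^^ k) u)"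

lemma T_pow_closed: "u \<in> carrier U \<Longrightarrow> (T ^^ k) u \<in> carrier U"
  by (induction k) (simp_all add: T_closed)

lemma T_pow_add: "u \<in> carrier U \<Longrightarrow> v \<in> carrier U \<Longrightarrow> (T ^^ k) (u \<oplus>\<^bsub>U\<^esub> v) = (T ^^ k) u \<oplus>\<^bsub>U\<^esub> (T ^^ k) v"
  by (induction k) (simp_all add: T_add T_pow_closed)

lemma T_pow_smult: "a \<in> carrier A \<Longrightarrow> u \<in> carrier U \<Longrightarrow> (T ^^ k) (a \<odot>\<^bsub>U\<^esub> u) = a \<odot>\<^bsub>U\<^esub> (T ^^ k) u"
  by (induction k) (simp_all add: T_smult T_pow_closed)

lemma act_superset:
  assumes "p \<in> carrier (UP A)" "u \<in> carrier U" "finite K" "{k. p k \<noteq> \<zero>\<^bsub>A\<^esub>} \<subseteq> K"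
  shows "act p u = (\<Oplus>\<^bsub>U\<^esub>k\<in>K. p k \<odot>\<^bsub>U\<^esub> (T ^^ k) u)"
  unfolding act_def using assms
  by (intro M.add.finprod_mono_neutral_cong_left)
    (auto simp: smult_l_zero T_pow_closed UP_closed smult_closed)

lemma act_closed: "p \<in> carrier (UP A) \<Longrightarrow> u \<in> carrier U \<Longrightarrow> act p u \<in> carrier U"
  unfolding act_def by (intro M.finsum_closed) (auto simp: smult_closed T_pow_closed UP_closed)

lemma act_monom: "a \<in> carrier A \<Longrightarrow> u \<in> carrier U \<Longrightarrow> act (up_ring.monom (UP A) a n) u = a \<odot>\<^bsub>U\<^esub> (T ^^ n) u"
proof -
  assume a: "a \<in> carrier A" and u: "u \<in> carrier U"
  interpret UP_ring A "UP A" by (rule UP_ring_intro[OF R.ring_axioms])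
  have "act (up_ring.monom (UP A) a n) u = (\<Oplus>\<^bsub>U\<^esub>k\<in>{n}. up_ring.monom (UP A) a n k \<odot>\<^bsub>U\<^esub> (T ^^ k) u)"
    using a u by (intro act_superset) (auto simp: UP_monom)
  also have "\<dots> = a \<odot>\<^bsub>U\<^esub> (T ^^ n) u"
    using a u M.finsum_insert[of "{}" n] by (simp add: UP_monom smult_closed T_pow_closed)
  finally show ?thesis .
qed

lemma act_add_left:
  assumes p: "p \<in> carrier (UP A)" and q: "q \<in> carrier (UP A)" and u: "u \<in> carrier U"
  shows "act (p \<oplus>\<^bsub>UP A\<^esub> q) u = act p u \<oplus>\<^bsub>U\<^esub> act q u"
proof -
  interpret UP_ring A "UP A" by (rule UP_ring_intro[OF R.ring_axioms])
  let ?K = "{k. p k \<noteq> \<zero>\<^bsub>A\<^esub>} \<union> {k. q k \<noteq> \<zero>\<^bsub>A\<^esub>}"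
  have K: "finite ?K" using UP_finite p q by blast
  have "{k. (p \<oplus>\<^bsub>UP A\<^esub> q) k \<noteq> \<zero>\<^bsub>A\<^esub>} \<subseteq> ?K" using p q by (auto simp: UP_add)
  then have "act (p \<oplus>\<^bsub>UP A\<^esub> q) u = (\<Oplus>\<^bsub>U\<^esub>k\<in>?K. (p \<oplus>\<^bsub>UP A\<^esub> q) k \<odot>\<^bsub>U\<^esub> (T ^^ k) u)"
    using p q u K by (intro act_superset) auto
  also have "\<dots> = (\<Oplus>\<^bsub>U\<^esub>k\<in>?K. p k \<odot>\<^bsub>U\<^esub> (T ^^ k) u \<oplus>\<^bsub>U\<^esub> q k \<odot>\<^bsub>U\<^esub> (T ^^ k) u)"
    using p q u by (intro M.finsum_cong')
      (auto simp: UP_add smult_l_distr UP_closed T_pow_closed smult_closed)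
  also have "\<dots> = (\<Oplus>\<^bsub>U\<^esub>k\<in>?K. p k \<odot>\<^bsub>U\<^esub> (T ^^ k) u) \<oplus>\<^bsub>U\<^esub> (\<Oplus>\<^bsub>U\<^esub>k\<in>?K. q k \<odot>\<^bsub>U\<^esub> (T ^^ k) u)"
    using p q u by (intro M.finsum_addf) (auto simp: UP_closed T_pow_closed smult_closed)
  also have "\<dots> = act p u \<oplus>\<^bsub>U\<^esub> act q u"
    using act_superset[OF p u K] act_superset[OF q u K] by simp
  finally show ?thesis .
qed

lemma act_add_right:
  assumes p: "p \<in> carrier (UP A)" and u: "u \<in> carrier U" and v: "v \<in> carrier U"
  shows "act p (u \<oplus>\<^bsub>U\<^esub> v) = act p u \<oplus>\<^bsub>U\<^esub> act p v"
  using R.ring_axioms p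
proof (induction rule: UP_induct)
  case (monom a n)
  then show ?case using u v by (simp add: act_monom T_pow_add smult_r_distr T_pow_closed)
next
  case (add p q)
  then show ?case using u v by (simp add: act_add_left act_closed M.a_ac)
qed

lemma act_one: "u \<in> carrier U \<Longrightarrow> act \<one>\<^bsub>UP A\<^esub> u = u"
proof -
  assume u: "u \<in> carrier U"
  interpret UP_ring A "UP A" by (rule UP_ring_intro[OF R.ring_axioms])
  show ?thesis using act_monom[OF R.one_closed u, of 0] u by (simp add: smult_one)
qed

text \<open>Both sides are additive in p and q, and on monomials the claim is that powers of T pass
  scalars.\<close>

lemma act_mult:
  assumes p: "p \<in> carrier (UP A)" and q: "q \<in> carrier (UP A)" and u: "u \<in> carrier U"
  shows "act (p \<otimes>\<^bsub>UP A\<^esub> q) u = act p (act q u)"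
  using R.ring_axioms p
proof (induction rule: UP_induct)
  case (monom a n)
  interpret UP_ring A "UP A" by (rule UP_ring_intro[OF R.ring_axioms])
  show ?case
    using R.ring_axioms q
  proof (induction rule: UP_induct)
    case (monom b m)
    have "up_ring.monom (UP A) a n \<otimes>\<^bsub>UP A\<^esub> up_ring.monom (UP A) b m = up_ring.monom (UP A) (a \<otimes>\<^bsub>A\<^esub> b) (n + m)"
      using \<open>a \<in> carrier A\<close> monom by (intro monom_mult[symmetric])
    then show ?case using \<open>a \<in> carrier A\<close> monom u
      by (simp add: act_monom smult_closed T_pow_closed T_pow_smult smult_assoc1 funpow_add
          del: monom_mult)
  next
    case (add p q)
    then show ?case using \<open>a \<in> carrier A\<close> u
      by (simp add: P.r_distr act_add_left act_add_right act_closed)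
  qed
next
  case (add p' q')
  interpret UP_ring A "UP A" by (rule UP_ring_intro[OF R.ring_axioms])
  show ?case using add q u by (simp add: P.l_distr act_add_left act_closed)
qed

lemma act_zero: "u \<in> carrier U \<Longrightarrow> act \<zero>\<^bsub>UP A\<^esub> u = \<zero>\<^bsub>U\<^esub>"
  by (simp add: act_def UP_zero)

lemma act_zero_right: "p \<in> carrier (UP A) \<Longrightarrow> act p \<zero>\<^bsub>U\<^esub> = \<zero>\<^bsub>U\<^esub>"
  using act_add_right[of p "\<zero>\<^bsub>U\<^esub>" "\<zero>\<^bsub>U\<^esub>"] act_closed[of p "\<zero>\<^bsub>U\<^esub>"] by simp

lemma act_neg:
  assumes "p \<in> carrier (UP A)" "u \<in> carrier U"
  shows "act (\<ominus>\<^bsub>UP A\<^esub> p) u = \<ominus>\<^bsub>U\<^esub> act p u"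
proof -
  interpret UP_ring A "UP A" by (rule UP_ring_intro[OF R.ring_axioms])
  have "act (\<ominus>\<^bsub>UP A\<^esub> p \<oplus>\<^bsub>UP A\<^esub> p) u = \<zero>\<^bsub>U\<^esub>"
    using assms by (simp add: P.l_neg act_zero)
  then have "act (\<ominus>\<^bsub>UP A\<^esub> p) u \<oplus>\<^bsub>U\<^esub> act p u = \<zero>\<^bsub>U\<^esub>" using assms by (simp add: act_add_left)
  then show ?thesis using assms by (intro M.minus_equality[symmetric]) (simp_all add: act_closed)
qed

end

section \<open>Deformed cyclotomic quotients\<close>

locale rz = klr D Q for D :: "('i, 'p::ab_group_add) root_datum" and Q :: "('i, 'k::field) qparam" +
  fixes i :: 'i
begin

abbreviation UK :: "'p \<Rightarrow> (('i, 'k) klr_free set, nat \<Rightarrow> ('i, 'k) klr_free set) up_ring" where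
  "UK \<gamma> \<equiv> UP (KA \<gamma>)"
abbreviation KP :: "'p \<Rightarrow> ('k, nat \<Rightarrow> ('i, 'k) klr_free set) graded" where "KP \<gamma> \<equiv> klr_poly D Q i \<gamma>"
abbreviation CI :: "'p \<Rightarrow> (nat \<Rightarrow> ('i, 'k) klr_free set) set" where "CI \<gamma> \<equiv> cyc_ideal D Q i \<gamma>"
abbreviation RA :: "'p \<Rightarrow> ('k, ('i, 'k) rz) graded" where "RA \<gamma> \<equiv> Rz D Q i \<gamma>"
abbreviation RC :: "'p \<Rightarrow> (nat \<Rightarrow> ('i, 'k) klr_free set) \<Rightarrow> ('i, 'k) rz" where "RC \<gamma> \<equiv> Rz_class D Q i \<gamma>"
abbreviation RK :: "'p \<Rightarrow> ('i, 'k) klr_free set \<Rightarrow> ('i, 'k) rz" where "RK \<gamma> \<equiv> Rz_of_klr D Q i \<gamma>"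
abbreviation RZ :: "'p \<Rightarrow> ('i, 'k) rz" where "RZ \<gamma> \<equiv> Rz_z D Q i \<gamma>"
abbreviation dz :: int where "dz \<equiv> ideg D i i"

lemma UKr: "UP_ring (KA \<gamma>)" by (rule UP_ring_intro[OF KA_ring])

lemma KP_simps [simp]:
  "carrier (KP \<gamma>) = carrier (UK \<gamma>)" "ring.add (KP \<gamma>) = ring.add (UK \<gamma>)" "\<zero>\<^bsub>KP \<gamma>\<^esub> = \<zero>\<^bsub>UK \<gamma>\<^esub>"
  "monoid.mult (KP \<gamma>) = monoid.mult (UK \<gamma>)" "\<one>\<^bsub>KP \<gamma>\<^esub> = \<one>\<^bsub>UK \<gamma>\<^esub>"
  "homog (KP \<gamma>) d = {p \<in> carrier (UK \<gamma>). \<forall>n. p n \<in> homog (KA \<gamma>) (d - int n * dz)}"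
  by (simp_all add: klr_poly_def Let_def)

lemma KP_ring: "ring (KP \<gamma>)"
proof -
  interpret UP_ring "KA \<gamma>" "UK \<gamma>" by (rule UKr)
  have "abelian_group (KP \<gamma>)"
  proof (rule abelian_groupI)
    fix x assume "x \<in> carrier (KP \<gamma>)"
    then show "\<exists>y\<in>carrier (KP \<gamma>). y \<oplus>\<^bsub>KP \<gamma>\<^esub> x = \<zero>\<^bsub>KP \<gamma>\<^esub>"
      by (intro bexI[of _ "\<ominus>\<^bsub>UK \<gamma>\<^esub> x"]) (simp_all add: P.l_neg)
  qed (simp_all add: P.a_ac)
  then show ?thesis by (rule ringI[OF _ monoidI]) (simp_all add: P.m_assoc P.l_distr P.r_distr)
qed

lemma KP_neg: "p \<in> carrier (UK \<gamma>) \<Longrightarrow> \<ominus>\<^bsub>KP \<gamma>\<^esub> p = \<ominus>\<^bsub>UK \<gamma>\<^esub> p"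
proof -
  interpret UP_ring "KA \<gamma>" "UK \<gamma>" by (rule UKr)
  interpret KP: ring "KP \<gamma>" by (rule KP_ring)
  assume "p \<in> carrier (UK \<gamma>)"
  then show ?thesis by (intro KP.minus_equality) (simp_all add: P.l_neg)
qed

lemma KP_minus: "p \<in> carrier (UK \<gamma>) \<Longrightarrow> q \<in> carrier (UK \<gamma>) \<Longrightarrow> p \<ominus>\<^bsub>KP \<gamma>\<^esub> q = p \<ominus>\<^bsub>UK \<gamma>\<^esub> q"
  by (simp add: a_minus_def KP_neg)

abbreviation mon :: "'p \<Rightarrow> ('i, 'k) klr_free set \<Rightarrow> nat \<Rightarrow> nat \<Rightarrow> ('i, 'k) klr_free set" where
  "mon \<gamma> \<equiv> up_ring.monom (UK \<gamma>)"

definition cyc_gens :: "'p \<Rightarrow> (nat \<Rightarrow> ('i, 'k) klr_free set) set" where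
  "cyc_gens \<gamma> = {mon \<gamma> (KC \<gamma> (e_gen \<nu>)) 0 |\<nu>. \<nu> \<in> seqs D \<gamma> \<and> ht D \<gamma> \<ge> 1 \<and> pos \<nu> (ht D \<gamma>) \<noteq> i} \<union>
    {mon \<gamma> (KC \<gamma> (x_gen (ht D \<gamma>) * e_gen \<nu>)) 0 \<ominus>\<^bsub>UK \<gamma>\<^esub> mon \<gamma> (KC \<gamma> (e_gen \<nu>)) 1 |\<nu>.
      \<nu> \<in> seqs D \<gamma> \<and> ht D \<gamma> \<ge> 1 \<and> pos \<nu> (ht D \<gamma>) = i}"

lemma CI_eq: "CI \<gamma> = genideal (KP \<gamma>) (cyc_gens \<gamma>)"
  by (simp add: cyc_ideal_def cyc_gens_def Let_def)

lemma last_x_FC: "ht D \<gamma> \<ge> 1 \<Longrightarrow> x_gen (ht D \<gamma>) \<in> FC \<gamma>"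
  by (intro x_FC) simp

lemma cyc_gens_sub: "cyc_gens \<gamma> \<subseteq> carrier (UK \<gamma>)"
proof -
  interpret UP_ring "KA \<gamma>" "UK \<gamma>" by (rule UKr)
  show ?thesis
    unfolding cyc_gens_def
    by (auto intro!: monom_closed P.minus_closed KC_closed e_FC free_carrier_mult last_x_FC)
qed

lemma CI_ideal: "ideal (CI \<gamma>) (KP \<gamma>)"
  unfolding CI_eq by (rule ring.genideal_ideal[OF KP_ring]) (simp add: cyc_gens_sub)

lemma CI_gen: "p \<in> cyc_gens \<gamma> \<Longrightarrow> p \<in> CI \<gamma>"
  unfolding CI_eq using ring.genideal_self[OF KP_ring, of "cyc_gens \<gamma>"] cyc_gens_sub by auto

lemma CI_minimal: "ideal J (KP \<gamma>) \<Longrightarrow> cyc_gens \<gamma> \<subseteq> J \<Longrightarrow> CI \<gamma> \<subseteq> J"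
  unfolding CI_eq by (rule ring.genideal_minimal[OF KP_ring])

lemma CI_subgroup: "subgroup (CI \<gamma>) (add_monoid (KP \<gamma>))"
proof -
  interpret I: ideal "CI \<gamma>" "KP \<gamma>" by (rule CI_ideal)
  show ?thesis by (rule I.a_subgroup)
qed

lemma ag_quot_CI: "ag_quot (KP \<gamma>) (CI \<gamma>)"
  by (intro ag_quot.intro ag_quot_axioms.intro ring.is_abelian_group[OF KP_ring] CI_subgroup)

lemma RA_carrier: "carrier (RA \<gamma>) = RC \<gamma> ` carrier (UK \<gamma>)"
  using ag_quot.quot_carrier[OF ag_quot_CI[of \<gamma>]] by (simp add: Rz_def Rz_class_def)

lemma RC_closed: "p \<in> carrier (UK \<gamma>) \<Longrightarrow> RC \<gamma> p \<in> carrier (RA \<gamma>)"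
  by (simp add: RA_carrier)

lemma RA_carrierE:
  assumes "Y \<in> carrier (RA \<gamma>)" obtains p where "p \<in> carrier (UK \<gamma>)" "Y = RC \<gamma> p"
  using assms by (auto simp: RA_carrier)

lemma RC_add: "p \<in> carrier (UK \<gamma>) \<Longrightarrow> q \<in> carrier (UK \<gamma>) \<Longrightarrow>
    RC \<gamma> p \<oplus>\<^bsub>RA \<gamma>\<^esub> RC \<gamma> q = RC \<gamma> (p \<oplus>\<^bsub>UK \<gamma>\<^esub> q)"
  using ag_quot.quot_add[OF ag_quot_CI[of \<gamma>], of p q] by (simp add: Rz_def Rz_class_def)

lemma RC_zero: "\<zero>\<^bsub>RA \<gamma>\<^esub> = RC \<gamma> \<zero>\<^bsub>UK \<gamma>\<^esub>"
  using ag_quot.quot_zero[OF ag_quot_CI[of \<gamma>]] by (simp add: Rz_def Rz_class_def)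

lemma RC_mult: "p \<in> carrier (UK \<gamma>) \<Longrightarrow> q \<in> carrier (UK \<gamma>) \<Longrightarrow>
    RC \<gamma> p \<otimes>\<^bsub>RA \<gamma>\<^esub> RC \<gamma> q = RC \<gamma> (p \<otimes>\<^bsub>UK \<gamma>\<^esub> q)"
  using ring_quot(2)[OF KP_ring CI_ideal[of \<gamma>], of p q] by (simp add: Rz_def Rz_class_def)

lemma RC_one: "\<one>\<^bsub>RA \<gamma>\<^esub> = RC \<gamma> \<one>\<^bsub>UK \<gamma>\<^esub>"
  using ring_quot(3)[OF KP_ring CI_ideal[of \<gamma>]] by (simp add: Rz_def Rz_class_def)

lemma RA_ring: "ring (RA \<gamma>)"
  unfolding Rz_def by (rule ring_quot(1)[OF KP_ring CI_ideal])

lemma RC_eq: "p \<in> carrier (UK \<gamma>) \<Longrightarrow> q \<in> carrier (UK \<gamma>) \<Longrightarrow> RC \<gamma> p = RC \<gamma> q \<longleftrightarrow> p \<ominus>\<^bsub>UK \<gamma>\<^esub> q \<in> CI \<gamma>"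
  using ag_quot.cl_eq_iff[OF ag_quot_CI[of \<gamma>], of p q] by (simp add: Rz_class_def KP_minus)

lemma RC_mem: "p \<in> carrier (UK \<gamma>) \<Longrightarrow> p \<in> RC \<gamma> p"
  and RC_memD: "p \<in> carrier (UK \<gamma>) \<Longrightarrow> q \<in> RC \<gamma> p \<Longrightarrow> q \<in> carrier (UK \<gamma>) \<and> q \<ominus>\<^bsub>UK \<gamma>\<^esub> p \<in> CI \<gamma>"
proof -
  interpret ag_quot "KP \<gamma>" "CI \<gamma>" by (rule ag_quot_CI)
  show "p \<in> carrier (UK \<gamma>) \<Longrightarrow> p \<in> RC \<gamma> p" using cl_self[of p] by (simp add: Rz_class_def)
  assume p: "p \<in> carrier (UK \<gamma>)" and q: "q \<in> RC \<gamma> p"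
  then have qU: "q \<in> carrier (UK \<gamma>)" using cl_subset[of p] by (auto simp: Rz_class_def)
  then show "q \<in> carrier (UK \<gamma>) \<and> q \<ominus>\<^bsub>UK \<gamma>\<^esub> p \<in> CI \<gamma>"
    using p q mem_cl_iff[of p q] by (simp add: Rz_class_def KP_minus)
qed

lemma RC_KI: "p \<in> CI \<gamma> \<Longrightarrow> RC \<gamma> p = \<zero>\<^bsub>RA \<gamma>\<^esub>"
proof -
  interpret UP_ring "KA \<gamma>" "UK \<gamma>" by (rule UKr)
  assume p: "p \<in> CI \<gamma>"
  then have "p \<in> carrier (UK \<gamma>)" using subgroup.subset[OF CI_subgroup] by auto
  then show ?thesis using p by (simp add: RC_zero RC_eq P.minus_eq)
qed

lemma mon_closed: "a \<in> carrier (KA \<gamma>) \<Longrightarrow> mon \<gamma> a n \<in> carrier (UK \<gamma>)"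
proof -
  interpret UP_ring "KA \<gamma>" "UK \<gamma>" by (rule UKr)
  show "a \<in> carrier (KA \<gamma>) \<Longrightarrow> mon \<gamma> a n \<in> carrier (UK \<gamma>)" by simp
qed

lemma mon_mult: "a \<in> carrier (KA \<gamma>) \<Longrightarrow> b \<in> carrier (KA \<gamma>) \<Longrightarrow>
    mon \<gamma> a n \<otimes>\<^bsub>UK \<gamma>\<^esub> mon \<gamma> b m = mon \<gamma> (a \<otimes>\<^bsub>KA \<gamma>\<^esub> b) (n + m)"
proof -
  interpret UP_ring "KA \<gamma>" "UK \<gamma>" by (rule UKr)
  show "a \<in> carrier (KA \<gamma>) \<Longrightarrow> b \<in> carrier (KA \<gamma>) \<Longrightarrow> ?thesis" by (rule monom_mult[symmetric])
qed

lemma mon_add: "a \<in> carrier (KA \<gamma>) \<Longrightarrow> b \<in> carrier (KA \<gamma>) \<Longrightarrow>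
    mon \<gamma> a n \<oplus>\<^bsub>UK \<gamma>\<^esub> mon \<gamma> b n = mon \<gamma> (a \<oplus>\<^bsub>KA \<gamma>\<^esub> b) n"
proof -
  interpret UP_ring "KA \<gamma>" "UK \<gamma>" by (rule UKr)
  show "a \<in> carrier (KA \<gamma>) \<Longrightarrow> b \<in> carrier (KA \<gamma>) \<Longrightarrow> ?thesis" by (rule monom_add[symmetric])
qed

lemma RK_closed: "a \<in> carrier (KA \<gamma>) \<Longrightarrow> RK \<gamma> a \<in> carrier (RA \<gamma>)"
  unfolding Rz_of_klr_def by (intro RC_closed mon_closed)

lemma RK_add: "a \<in> carrier (KA \<gamma>) \<Longrightarrow> b \<in> carrier (KA \<gamma>) \<Longrightarrow>
    RK \<gamma> (a \<oplus>\<^bsub>KA \<gamma>\<^esub> b) = RK \<gamma> a \<oplus>\<^bsub>RA \<gamma>\<^esub> RK \<gamma> b"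
  by (simp add: Rz_of_klr_def RC_add mon_closed mon_add)

lemma RK_mult: "a \<in> carrier (KA \<gamma>) \<Longrightarrow> b \<in> carrier (KA \<gamma>) \<Longrightarrow>
    RK \<gamma> (a \<otimes>\<^bsub>KA \<gamma>\<^esub> b) = RK \<gamma> a \<otimes>\<^bsub>RA \<gamma>\<^esub> RK \<gamma> b"
  by (simp add: Rz_of_klr_def RC_mult mon_closed mon_mult)

lemma RK_one: "RK \<gamma> \<one>\<^bsub>KA \<gamma>\<^esub> = \<one>\<^bsub>RA \<gamma>\<^esub>"
proof -
  interpret UP_ring "KA \<gamma>" "UK \<gamma>" by (rule UKr)
  show ?thesis by (simp add: Rz_of_klr_def RC_one)
qed

lemma RZ_closed: "RZ \<gamma> \<in> carrier (RA \<gamma>)"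
  unfolding Rz_z_def using KC_closed[OF free_carrier_one] by (intro RC_closed mon_closed) (simp add: KC_one)

lemma RZ_central: "Y \<in> carrier (RA \<gamma>) \<Longrightarrow> RZ \<gamma> \<otimes>\<^bsub>RA \<gamma>\<^esub> Y = Y \<otimes>\<^bsub>RA \<gamma>\<^esub> RZ \<gamma>"
proof -
  interpret K: ring "KA \<gamma>" by (rule KA_ring)
  assume "Y \<in> carrier (RA \<gamma>)"
  then obtain p where "p \<in> carrier (UK \<gamma>)" "Y = RC \<gamma> p" by (rule RA_carrierE)
  then show ?thesis
    using UP_var_central[OF KA_ring, of p \<gamma>] mon_closed[OF K.one_closed, of 1]
    by (simp add: Rz_z_def RC_mult)
qed

lemma RC_monom_Suc:
  assumes "a \<in> carrier (KA \<gamma>)"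
  shows "RC \<gamma> (mon \<gamma> a (Suc n)) = RZ \<gamma> \<otimes>\<^bsub>RA \<gamma>\<^esub> RC \<gamma> (mon \<gamma> a n)"
proof -
  interpret K: ring "KA \<gamma>" by (rule KA_ring)
  show ?thesis using assms by (simp add: Rz_z_def RC_mult mon_closed mon_mult)
qed

lemma RK_e_zero: "\<nu> \<in> seqs D \<gamma> \<Longrightarrow> ht D \<gamma> \<ge> 1 \<Longrightarrow> pos \<nu> (ht D \<gamma>) \<noteq> i \<Longrightarrow> RK \<gamma> (KC \<gamma> (e_gen \<nu>)) = \<zero>\<^bsub>RA \<gamma>\<^esub>"
  unfolding Rz_of_klr_def by (intro RC_KI CI_gen) (auto simp: cyc_gens_def)

lemma RK_x:
  assumes "\<nu> \<in> seqs D \<gamma>" "ht D \<gamma> \<ge> 1" "pos \<nu> (ht D \<gamma>) = i"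
  shows "RK \<gamma> (KC \<gamma> (x_gen (ht D \<gamma>) * e_gen \<nu>)) = RZ \<gamma> \<otimes>\<^bsub>RA \<gamma>\<^esub> RK \<gamma> (KC \<gamma> (e_gen \<nu>))"
proof -
  have c: "KC \<gamma> (e_gen \<nu>) \<in> carrier (KA \<gamma>)" "KC \<gamma> (x_gen (ht D \<gamma>) * e_gen \<nu>) \<in> carrier (KA \<gamma>)"
    using assms by (auto intro!: KC_closed e_FC free_carrier_mult last_x_FC)
  have "mon \<gamma> (KC \<gamma> (x_gen (ht D \<gamma>) * e_gen \<nu>)) 0 \<ominus>\<^bsub>UK \<gamma>\<^esub> mon \<gamma> (KC \<gamma> (e_gen \<nu>)) 1 \<in> CI \<gamma>"
    using assms by (intro CI_gen) (auto simp: cyc_gens_def)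
  then have "RC \<gamma> (mon \<gamma> (KC \<gamma> (x_gen (ht D \<gamma>) * e_gen \<nu>)) 0) = RC \<gamma> (mon \<gamma> (KC \<gamma> (e_gen \<nu>)) (Suc 0))"
    using RC_eq[OF mon_closed[OF c(2)] mon_closed[OF c(1)]] by simp
  then show ?thesis unfolding RC_monom_Suc[OF c(1)] by (simp add: Rz_of_klr_def)
qed

lemma RA_homog: "homog (RA \<gamma>) d = RC \<gamma> ` {p \<in> carrier (UK \<gamma>). \<forall>n. p n \<in> homog (KA \<gamma>) (d - int n * dz)}"
  by (simp add: Rz_def quot_def Rz_class_def)

lemma mon_homog: assumes "a \<in> homog (KA \<gamma>) d" shows "RC \<gamma> (mon \<gamma> a n) \<in> homog (RA \<gamma>) (d + int n * dz)"
proof -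
  interpret K: ring "KA \<gamma>" by (rule KA_ring)
  have a: "a \<in> carrier (KA \<gamma>)" by (rule gring.homog_carrier[OF KA_gring assms])
  show ?thesis
    unfolding RA_homog using a assms K.subgroup_zero[OF homog_KA_subgroup]
    by (intro imageI CollectI conjI allI mon_closed) (simp_all add: UP_monom)
qed

lemma RK_homog: "a \<in> homog (KA \<gamma>) d \<Longrightarrow> RK \<gamma> a \<in> homog (RA \<gamma>) d"
  using mon_homog[of a \<gamma> d 0] by (simp add: Rz_of_klr_def)

lemma RZ_homog: "RZ \<gamma> \<in> homog (RA \<gamma>) dz"
  using mon_homog[OF one_homog, of \<gamma> 1] by (simp add: Rz_z_def)

text \<open>Every polynomial is a sum of monomials, and the coefficient of a monomial is a sum of
  homogeneous elements of R(\<gamma>).\<close>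

lemma RA_gring: "gring (RA \<gamma>)"
proof -
  interpret RR: ring "RA \<gamma>" by (rule RA_ring)
  interpret UP_ring "KA \<gamma>" "UK \<gamma>" by (rule UKr)
  have hc: "Y \<in> carrier (RA \<gamma>)" if "Y \<in> homog (RA \<gamma>) d" for Y d
    using that by (auto simp: RA_homog intro: RC_closed)
  define S where "S = generate (add_monoid (RA \<gamma>)) (\<Union>d. homog (RA \<gamma>) d)"
  have sub: "(\<Union>d. homog (RA \<gamma>) d) \<subseteq> carrier (RA \<gamma>)" using hc by blast
  have S: "subgroup S (add_monoid (RA \<gamma>))" unfolding S_def by (rule RR.generate_subgroup[OF sub])
  have hS: "Y \<in> S" if "Y \<in> homog (RA \<gamma>) d" for Y d
    unfolding S_def by (rule RR.generate_gen) (use that in blast)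
  have monS: "RC \<gamma> (mon \<gamma> a n) \<in> S" if "a \<in> carrier (KA \<gamma>)" for a n
    using that
  proof (induction rule: gring.span_induct[OF KA_gring, consumes 1, case_names homog add neg zero])
    case (homog d h)
    then show ?case using hS[OF mon_homog] by blast
  next
    case (add x y)
    then show ?case using RR.subgroup_add_closed[OF S] by (simp add: mon_add[symmetric] RC_add[symmetric] mon_closed del: monom_add)
  next
    case (neg x)
    have "RC \<gamma> (mon \<gamma> (\<ominus>\<^bsub>KA \<gamma>\<^esub> x) n) \<oplus>\<^bsub>RA \<gamma>\<^esub> RC \<gamma> (mon \<gamma> x n) = \<zero>\<^bsub>RA \<gamma>\<^esub>"
      using neg by (simp add: RC_add RC_zero P.l_neg)
    then have "RC \<gamma> (mon \<gamma> (\<ominus>\<^bsub>KA \<gamma>\<^esub> x) n) = \<ominus>\<^bsub>RA \<gamma>\<^esub> RC \<gamma> (mon \<gamma> x n)"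
      using neg by (intro RR.minus_equality[symmetric]) (simp_all add: RC_closed mon_closed)
    then show ?case using RR.subgroup_neg[OF S] neg by simp
  next
    case zero
    then show ?case using RR.subgroup_zero[OF S] by (simp add: RC_zero)
  qed
  have "RC \<gamma> p \<in> S" if "p \<in> carrier (UK \<gamma>)" for p
    using KA_ring that
  proof (induction rule: UP_induct)
    case (monom a n)
    then show ?case by (rule monS)
  next
    case (add p q)
    then show ?case using RR.subgroup_add_closed[OF S] by (simp add: RC_add[symmetric])
  qed
  then have "carrier (RA \<gamma>) \<subseteq> S" by (auto simp: RA_carrier)
  then show ?thesis using hc by (intro gring.intro RA_ring) (simp_all add: S_def)
qed

end


section \<open>Induction preserves the lifting property\<close>

text \<open>An element of the Hom module is only a finite sum of homogeneous maps. The linear maps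
  form a subgroup of all functions that contains the homogeneous ones, so linearity is
  inherited.\<close>

lemma hom_module_linear:
  assumes h: "h \<in> carrier (hom_module B M UB UA)" and UA: "graded_module A UA" and UB: "graded_module B UB"
    and M: "graded_module B M"
    and [simp]: "carrier UB = carrier UA" "ring.add UB = ring.add UA" "\<zero>\<^bsub>UB\<^esub> = \<zero>\<^bsub>UA\<^esub>"
  shows "m \<in> carrier M \<Longrightarrow> h m \<in> carrier UA"
    and "m \<in> carrier M \<Longrightarrow> m' \<in> carrier M \<Longrightarrow> h (m \<oplus>\<^bsub>M\<^esub> m') = h m \<oplus>\<^bsub>UA\<^esub> h m'"
    and "b \<in> carrier B \<Longrightarrow> m \<in> carrier M \<Longrightarrow> h (b \<odot>\<^bsub>M\<^esub> m) = b \<odot>\<^bsub>UB\<^esub> h m"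
proof -
  interpret UA: gmodule A UA by (rule gmoduleI) fact
  interpret UB: gmodule B UB by (rule gmoduleI) fact
  interpret M: gmodule B M by (rule gmoduleI) fact
  let ?H = "\<lambda>d. graded_hom B M (graded_shift (- d) UB)"
  let ?F = "fun_module (carrier M) UA ?H"
  interpret F: left_module A ?F by (rule left_module_fun_module) (rule UA.left_module_axioms)
  have negB: "\<ominus>\<^bsub>UB\<^esub> u = \<ominus>\<^bsub>UA\<^esub> u" if "u \<in> carrier UA" for u
    using that UB.a_inv_closed[of u] UB.l_neg[of u] UA.minus_equality[of "\<ominus>\<^bsub>UB\<^esub> u" u] by simp
  define lin where "lin h \<longleftrightarrow> h \<in> carrier ?F \<and> (\<forall>m\<in>carrier M. \<forall>m'\<in>carrier M. h (m \<oplus>\<^bsub>M\<^esub> m') = h m \<oplus>\<^bsub>UA\<^esub> h m') \<and>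
    (\<forall>b\<in>carrier B. \<forall>m\<in>carrier M. h (b \<odot>\<^bsub>M\<^esub> m) = b \<odot>\<^bsub>UB\<^esub> h m)" for h
  have linc: "h m \<in> carrier UA" if "lin h" "m \<in> carrier M" for h m
    using that by (auto simp: lin_def intro: PiE_mem)
  have "subgroup {h. lin h} (add_monoid ?F)"
  proof (rule F.subgroupI')
    show "{h. lin h} \<subseteq> carrier ?F" by (auto simp: lin_def)
    show "\<zero>\<^bsub>?F\<^esub> \<in> {h. lin h}" using UB.smult_zero by (auto simp: lin_def M.smult_closed)
    show "h \<oplus>\<^bsub>?F\<^esub> k \<in> {h. lin h}" if "h \<in> {h. lin h}" "k \<in> {h. lin h}" for h k
    proof -
      have hk: "lin h" "lin k" using that by auto
      note c = linc[OF hk(1)] linc[OF hk(2)]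
      have "b \<odot>\<^bsub>UB\<^esub> (h m \<oplus>\<^bsub>UA\<^esub> k m) = b \<odot>\<^bsub>UB\<^esub> h m \<oplus>\<^bsub>UA\<^esub> b \<odot>\<^bsub>UB\<^esub> k m"
        if "b \<in> carrier B" "m \<in> carrier M" for b m
        using UB.smult_r_distr[of b "h m" "k m"] that c by simp
      then show ?thesis
        using c hk by (simp add: lin_def M.smult_closed UA.a_ac)
    qed
    show "\<ominus>\<^bsub>?F\<^esub> h \<in> {h. lin h}" if "h \<in> {h. lin h}" for h
    proof -
      have h: "lin h" using that by auto
      note c = linc[OF h]
      have n: "\<ominus>\<^bsub>?F\<^esub> h = (\<lambda>m\<in>carrier M. \<ominus>\<^bsub>UA\<^esub> h m)"
      proof (rule F.minus_equality)
        show "(\<lambda>m\<in>carrier M. \<ominus>\<^bsub>UA\<^esub> h m) \<oplus>\<^bsub>?F\<^esub> h = \<zero>\<^bsub>?F\<^esub>"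
          using c by (auto simp: UA.l_neg intro!: restrict_ext)
      qed (use h c in \<open>simp_all add: lin_def\<close>)
      have "b \<odot>\<^bsub>UB\<^esub> (\<ominus>\<^bsub>UA\<^esub> h m) = \<ominus>\<^bsub>UA\<^esub> (b \<odot>\<^bsub>UB\<^esub> h m)" if "b \<in> carrier B" "m \<in> carrier M" for b m
        using UB.smult_neg[of b "h m"] UB.smult_closed[of b "h m"] that c by (simp add: negB)
      then show ?thesis
        using c h unfolding n by (simp add: lin_def M.smult_closed UA.minus_add)
    qed
  qed
  moreover have "(\<Union>d. ?H d) \<subseteq> {h. lin h}"
  proof
    fix h assume "h \<in> (\<Union>d. ?H d)"
    then obtain d where d: "h \<in> ?H d" by blast
    note hD = graded_homD(1)[OF d, simplified] graded_homD(2)[OF d] graded_homD(3,4)[OF d, simplified]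
    have "h \<in> carrier ?F" using hD(1,2) by (auto simp: PiE_iff extensional_def)
    then show "h \<in> {h. lin h}" using hD(3,4) by (simp add: lin_def)
  qed
  ultimately have "carrier (hom_module B M UB UA) \<subseteq> {h. lin h}"
    unfolding hom_module_def span_module_simps fun_module_simps(5) by (rule F.generate_least)
  then have h: "lin h" using h by blast
  show "m \<in> carrier M \<Longrightarrow> h m \<in> carrier UA" by (rule linc[OF h])
  show "m \<in> carrier M \<Longrightarrow> m' \<in> carrier M \<Longrightarrow> h (m \<oplus>\<^bsub>M\<^esub> m') = h m \<oplus>\<^bsub>UA\<^esub> h m'"
    "b \<in> carrier B \<Longrightarrow> m \<in> carrier M \<Longrightarrow> h (b \<odot>\<^bsub>M\<^esub> m) = b \<odot>\<^bsub>UB\<^esub> h m"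
    using h by (simp_all add: lin_def)
qed

lemma hom_module_simps:
  "ring.add (hom_module B M UB UA) f g = (\<lambda>m\<in>carrier M. f m \<oplus>\<^bsub>UA\<^esub> g m)"
  "module.smult (hom_module B M UB UA) a f = (\<lambda>m\<in>carrier M. a \<odot>\<^bsub>UA\<^esub> f m)"
  "homog (hom_module B M UB UA) d = graded_hom B M (graded_shift (- d) UB)"
  by (simp_all add: hom_module_def)

text \<open>The part e U of a C-module, viewed as a module over A through a ring map that sends the
  unit of A to e. This is restriction along a homomorphism that is not unital.\<close>

definition corner :: "('k, 'c) graded \<Rightarrow> 'c \<Rightarrow> ('a \<Rightarrow> 'c) \<Rightarrow> ('c, 'u) graded \<Rightarrow> ('a, 'u) graded" where
  "corner C e h U = sub_module U {u \<in> carrier U. e \<odot>\<^bsub>U\<^esub> u = u} (\<lambda>a u. h a \<odot>\<^bsub>U\<^esub> u)"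

lemma graded_module_corner:
  assumes A: "gring A" and C: "gring C" and U: "graded_module C U"
    and h: "\<And>a. a \<in> carrier A \<Longrightarrow> h a \<in> carrier C"
      "\<And>a b. a \<in> carrier A \<Longrightarrow> b \<in> carrier A \<Longrightarrow> h (a \<oplus>\<^bsub>A\<^esub> b) = h a \<oplus>\<^bsub>C\<^esub> h b"
      "\<And>a b. a \<in> carrier A \<Longrightarrow> b \<in> carrier A \<Longrightarrow> h (a \<otimes>\<^bsub>A\<^esub> b) = h a \<otimes>\<^bsub>C\<^esub> h b"
      "h \<one>\<^bsub>A\<^esub> = e" "\<And>a d. a \<in> homog A d \<Longrightarrow> h a \<in> homog C d"
    and e: "e \<in> homog C 0"
  shows "graded_module A (corner C e h U)"
proof -
  interpret A: gring A by fact
  interpret C: gring C by fact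
  interpret U: gmodule C U by (rule gmoduleI) fact
  let ?S = "{u \<in> carrier U. e \<odot>\<^bsub>U\<^esub> u = u}"
  have eC: "e \<in> carrier C" by (rule C.homog_carrier[OF e])
  have eh: "e \<otimes>\<^bsub>C\<^esub> h a = h a" if "a \<in> carrier A" for a
    using h(3)[of "\<one>\<^bsub>A\<^esub>" a] that h(4) by simp
  have ee: "e \<otimes>\<^bsub>C\<^esub> e = e" using eh[of "\<one>\<^bsub>A\<^esub>"] h(4) by simp
  have eu: "e \<odot>\<^bsub>U\<^esub> u \<in> ?S" if "u \<in> carrier U" for u
    using U.smult_closed[OF eC that] U.smult_assoc1[OF eC eC that] ee by simp
  have S: "subgroup ?S (add_monoid U)"
    by (rule U.subgroupI') (use eC in \<open>auto simp: U.smult_zero U.smult_r_distr U.smult_neg\<close>)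
  have closed: "h a \<odot>\<^bsub>U\<^esub> u \<in> ?S" if "a \<in> carrier A" "u \<in> ?S" for a u
    using that h(1) eh U.smult_closed eC U.smult_assoc1[of e "h a" u] by simp
  have span: "?S \<subseteq> generate (add_monoid U) (\<Union>d. ?S \<inter> homog U d)"
  proof
    have sub: "(\<Union>d. ?S \<inter> homog U d) \<subseteq> carrier U" by blast
    fix u assume u: "u \<in> ?S"
    then have "u \<in> carrier U" by simp
    then have "e \<odot>\<^bsub>U\<^esub> u \<in> generate (add_monoid U) (\<Union>d. ?S \<inter> homog U d)"
    proof (induction rule: U.induct)
      case (homog d x)
      have "e \<odot>\<^bsub>U\<^esub> x \<in> ?S \<inter> homog U d"
        using eu[OF U.homog_closed[OF homog]] U.smult_homog[OF e homog] by simp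
      then show ?case by (intro U.generate_gen) blast
    next
      case (add x y)
      then show ?case
        using U.subgroup_add_closed[OF U.generate_subgroup[OF sub]] eC by (simp add: U.smult_r_distr)
    qed
    then show "u \<in> generate (add_monoid U) (\<Union>d. ?S \<inter> homog U d)" using u by simp
  qed
  note gg = graded_group_sub[OF U.gg S span, of "\<lambda>a u. h a \<odot>\<^bsub>U\<^esub> u"]
  interpret N: ggroup "corner C e h U" unfolding corner_def by unfold_locales (rule gg)
  have "left_module A (corner C e h U)"
    using A.ring N.abelian_group_axioms
  proof (rule left_moduleI)
    fix a x assume "a \<in> carrier A" "x \<in> carrier (corner C e h U)"
    then show "a \<odot>\<^bsub>corner C e h U\<^esub> x \<in> carrier (corner C e h U)"
      using closed by (simp add: corner_def)
  qed (simp_all add: corner_def h(1-4) U.smult_l_distr U.smult_r_distr U.smult_assoc1)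
  then show ?thesis
  proof (rule graded_moduleI)
    show "graded_group (corner C e h U)" by (rule N.gg)
    fix d d' a m assume "a \<in> homog A d" "m \<in> homog (corner C e h U) d'"
    then show "a \<odot>\<^bsub>corner C e h U\<^esub> m \<in> homog (corner C e h U) (d + d')"
      using closed[OF A.homog_carrier] U.smult_homog[OF h(5)] by (simp add: corner_def)
  qed
qed

section \<open>The tensor functor of an idempotent and its right adjoint\<close>

locale tensor_ctx = A: gring A + B: gring B + C: gring C
  for A :: "('k, 'a) graded" and B :: "('k, 'b) graded" and C :: "('k, 'c) graded" +
  fixes left :: "'a \<Rightarrow> 'c" and right :: "'b \<Rightarrow> 'c" and e :: 'c
  assumes left: "\<And>a. a \<in> carrier A \<Longrightarrow> left a \<in> carrier C"
      "\<And>a a'. a \<in> carrier A \<Longrightarrow> a' \<in> carrier A \<Longrightarrow> left (a \<oplus>\<^bsub>A\<^esub> a') = left a \<oplus>\<^bsub>C\<^esub> left a'"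
      "\<And>a a'. a \<in> carrier A \<Longrightarrow> a' \<in> carrier A \<Longrightarrow> left (a \<otimes>\<^bsub>A\<^esub> a') = left a \<otimes>\<^bsub>C\<^esub> left a'"
      "left \<one>\<^bsub>A\<^esub> = e" "\<And>a d. a \<in> homog A d \<Longrightarrow> left a \<in> homog C d"
    and right: "\<And>b. b \<in> carrier B \<Longrightarrow> right b \<in> carrier C"
      "\<And>b b'. b \<in> carrier B \<Longrightarrow> b' \<in> carrier B \<Longrightarrow> right (b \<oplus>\<^bsub>B\<^esub> b') = right b \<oplus>\<^bsub>C\<^esub> right b'"
      "\<And>b b'. b \<in> carrier B \<Longrightarrow> b' \<in> carrier B \<Longrightarrow> right (b \<otimes>\<^bsub>B\<^esub> b') = right b \<otimes>\<^bsub>C\<^esub> right b'"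
      "right \<one>\<^bsub>B\<^esub> = e" "\<And>b d. b \<in> homog B d \<Longrightarrow> right b \<in> homog C d"
    and comm: "\<And>a b. a \<in> carrier A \<Longrightarrow> b \<in> carrier B \<Longrightarrow> left a \<otimes>\<^bsub>C\<^esub> right b = right b \<otimes>\<^bsub>C\<^esub> left a"
    and e: "e \<in> homog C 0"
begin

text \<open>The left module C e. It carries commuting right actions of A and B through
  \<open>left\<close> and \<open>right\<close>, whose common image of the unit is e.\<close>

definition EE :: "'c set" where "EE = {r \<otimes>\<^bsub>C\<^esub> e |r. r \<in> carrier C}"
abbreviation ac :: "'c \<Rightarrow> 'a \<Rightarrow> 'b \<Rightarrow> 'c" where "ac \<equiv> (\<lambda>r a b. r \<otimes>\<^bsub>C\<^esub> left a \<otimes>\<^bsub>C\<^esub> right b)"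

lemma eC: "e \<in> carrier C" by (rule C.homog_carrier[OF e])

lemma e_left: "a \<in> carrier A \<Longrightarrow> e \<otimes>\<^bsub>C\<^esub> left a = left a" "a \<in> carrier A \<Longrightarrow> left a \<otimes>\<^bsub>C\<^esub> e = left a"
  using left(3)[of "\<one>\<^bsub>A\<^esub>" a] left(3)[of a "\<one>\<^bsub>A\<^esub>"] left(4) by simp_all

lemma ee: "e \<otimes>\<^bsub>C\<^esub> e = e"
  using e_left(1)[of "\<one>\<^bsub>A\<^esub>"] left(4) by simp

lemma EE: "r \<in> EE \<Longrightarrow> r \<in> carrier C" "r \<in> EE \<Longrightarrow> r \<otimes>\<^bsub>C\<^esub> e = r"
  using eC ee by (auto simp: EE_def C.m_assoc)

lemma EE_I: "r \<in> carrier C \<Longrightarrow> r \<otimes>\<^bsub>C\<^esub> e = r \<Longrightarrow> r \<in> EE"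
  unfolding EE_def by force

lemma EE_e: "e \<in> EE" using EE_I[OF eC ee] .

lemma EE_smult: "c \<in> carrier C \<Longrightarrow> r \<in> EE \<Longrightarrow> c \<otimes>\<^bsub>C\<^esub> r \<in> EE"
  using EE[of r] eC by (intro EE_I) (simp_all add: C.m_assoc)

lemma EE_add: "r \<in> EE \<Longrightarrow> r' \<in> EE \<Longrightarrow> r \<oplus>\<^bsub>C\<^esub> r' \<in> EE"
  using EE[of r] EE[of r'] eC by (intro EE_I) (simp_all add: C.l_distr)

lemma EE_ac: "r \<in> EE \<Longrightarrow> a \<in> carrier A \<Longrightarrow> b \<in> carrier B \<Longrightarrow> ac r a b \<in> EE"
  using EE[of r] eC left(1) right(1) right(3)[of b "\<one>\<^bsub>B\<^esub>"] right(4)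
  by (intro EE_I) (simp_all add: C.m_assoc)

lemma corner_A: "graded_module C U \<Longrightarrow> graded_module A (corner C e left U)"
  by (rule graded_module_corner[OF A.gring_axioms C.gring_axioms _ left e])

lemma corner_B: "graded_module C U \<Longrightarrow> graded_module B (corner C e right U)"
  by (rule graded_module_corner[OF B.gring_axioms C.gring_axioms _ right e])

lemma corner_simps:
  "carrier (corner C e h U) = {u \<in> carrier U. e \<odot>\<^bsub>U\<^esub> u = u}"
  "ring.add (corner C e h U) = ring.add U" "\<zero>\<^bsub>corner C e h U\<^esub> = \<zero>\<^bsub>U\<^esub>"
  "a \<odot>\<^bsub>corner C e h U\<^esub> u = h a \<odot>\<^bsub>U\<^esub> u"
  "homog (corner C e h U) d = {u \<in> carrier U. e \<odot>\<^bsub>U\<^esub> u = u} \<inter> homog U d"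
  by (simp_all add: corner_def)

text \<open>Hom over B from M to e U, as an A-module. As a functor of U this is right adjoint to the
  functor that sends P to the tensor product of C e with P and M.\<close>

abbreviation HM :: "('b, 'm) graded \<Rightarrow> ('c, 'u) graded \<Rightarrow> ('a, 'm \<Rightarrow> 'u) graded" where
  "HM M U \<equiv> hom_module B M (corner C e right U) (corner C e left U)"

lemma corner_homog: "homog (corner C e right U) = homog (corner C e left U)"
  by (rule ext) (simp add: corner_simps)

lemma HM_module:
  assumes U: "graded_module C U" and M: "graded_module B M"
  shows "graded_module A (HM M U)"
proof (rule graded_module_hom_module[OF A.gring_axioms B.gring_axioms corner_A[OF U] corner_B[OF U] M])
  interpret U: gmodule C U by (rule gmoduleI) fact
  fix a b u assume ab: "a \<in> carrier A" "b \<in> carrier B" and "u \<in> carrier (corner C e left U)"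
  then have u: "u \<in> carrier U" by (simp add: corner_simps)
  show "a \<odot>\<^bsub>corner C e left U\<^esub> (b \<odot>\<^bsub>corner C e right U\<^esub> u)
      = b \<odot>\<^bsub>corner C e right U\<^esub> (a \<odot>\<^bsub>corner C e left U\<^esub> u)"
    using U.smult_assoc1[OF left(1)[OF ab(1)] right(1)[OF ab(2)] u]
      U.smult_assoc1[OF right(1)[OF ab(2)] left(1)[OF ab(1)] u] comm[OF ab]
    by (simp add: corner_simps)
qed (simp_all add: corner_simps corner_homog)

lemmas HM_linear = hom_module_linear[where UA = "corner C e left _" and UB = "corner C e right _"]

lemma HM_D:
  assumes U: "graded_module C U" and M: "graded_module B M" and h: "h \<in> carrier (HM M U)"
  shows "m \<in> carrier M \<Longrightarrow> h m \<in> carrier U" "m \<in> carrier M \<Longrightarrow> e \<odot>\<^bsub>U\<^esub> h m = h m"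
    and "m \<in> carrier M \<Longrightarrow> m' \<in> carrier M \<Longrightarrow> h (m \<oplus>\<^bsub>M\<^esub> m') = h m \<oplus>\<^bsub>U\<^esub> h m'"
    and "b \<in> carrier B \<Longrightarrow> m \<in> carrier M \<Longrightarrow> h (b \<odot>\<^bsub>M\<^esub> m) = right b \<odot>\<^bsub>U\<^esub> h m"
  using hom_module_linear[OF h corner_A[OF U] corner_B[OF U] M] by (simp_all add: corner_simps)

text \<open>Exactness of the right adjoint. A surjection stays surjective on corners because e can
  be applied to a preimage. A homogeneous map from M is a degree 0 map into a shift of the corner,
  where the lifting property of M applies; sums of such maps follow.\<close>

lemma HM_surj:
  assumes U: "graded_module C U" and V: "graded_module C V" and M: "graded_module B M"
    and lift: "\<And>d. lifts B M (graded_shift d (corner C e right U)) (graded_shift d (corner C e right V))"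
    and g: "g \<in> graded_hom C U V" and surj: "g ` carrier U = carrier V"
  defines "G \<equiv> \<lambda>h\<in>carrier (HM M U). \<lambda>m\<in>carrier M. g (h m)"
  shows "G \<in> graded_hom A (HM M U) (HM M V)" and "G ` carrier (HM M U) = carrier (HM M V)"
proof -
  interpret U: gmodule C U by (rule gmoduleI) fact
  interpret V: gmodule C V by (rule gmoduleI) fact
  interpret M: gmodule B M by (rule gmoduleI) fact
  interpret HU: gmodule A "HM M U" by (rule gmoduleI[OF HM_module[OF U M]])
  interpret HV: gmodule A "HM M V" by (rule gmoduleI[OF HM_module[OF V M]])
  note HU_D = HM_D[OF U M] and HV_D = HM_D[OF V M]
  let ?UB = "corner C e right U" and ?VB = "corner C e right V"
  define gB where "gB = (\<lambda>u\<in>carrier ?UB. g u)"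
  have gB: "gB \<in> graded_hom B (graded_shift d ?UB) (graded_shift d ?VB)" for d
  proof (rule graded_homI)
    interpret UB: gmodule B ?UB by (rule gmoduleI[OF corner_B[OF U]])
    fix x assume x: "x \<in> carrier (graded_shift d ?UB)"
    then have xU: "x \<in> carrier U" "e \<odot>\<^bsub>U\<^esub> x = x" by (simp_all add: corner_simps)
    show "gB x \<in> carrier (graded_shift d ?VB)"
      using xU graded_homD(1)[OF g xU(1)] graded_homD(4)[OF g eC xU(1)] by (simp add: gB_def corner_simps)
    fix y assume y: "y \<in> carrier (graded_shift d ?UB)"
    then have yU: "y \<in> carrier U" "e \<odot>\<^bsub>U\<^esub> y = y" by (simp_all add: corner_simps)
    have "e \<odot>\<^bsub>U\<^esub> (x \<oplus>\<^bsub>U\<^esub> y) = x \<oplus>\<^bsub>U\<^esub> y" using xU yU eC by (simp add: U.smult_r_distr)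
    then show "gB (x \<oplus>\<^bsub>graded_shift d ?UB\<^esub> y) = gB x \<oplus>\<^bsub>graded_shift d ?VB\<^esub> gB y"
      using xU yU graded_homD(3)[OF g] by (simp add: gB_def corner_simps)
  next
    interpret UB: gmodule B ?UB by (rule gmoduleI[OF corner_B[OF U]])
    fix b x assume b: "b \<in> carrier B" and "x \<in> carrier (graded_shift d ?UB)"
    then have x: "x \<in> carrier ?UB" by simp
    have "b \<odot>\<^bsub>?UB\<^esub> x \<in> carrier ?UB" by (rule UB.smult_closed[OF b x])
    then show "gB (b \<odot>\<^bsub>graded_shift d ?UB\<^esub> x) = b \<odot>\<^bsub>graded_shift d ?VB\<^esub> gB x"
      using x graded_homD(4)[OF g right(1)[OF b], of x] by (simp add: gB_def corner_simps)
  next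
    fix d' x assume "x \<in> homog (graded_shift d ?UB) d'"
    then have x: "x \<in> homog U (d' - d)" "x \<in> carrier U" "e \<odot>\<^bsub>U\<^esub> x = x" by (simp_all add: corner_simps)
    show "gB x \<in> homog (graded_shift d ?VB) d'"
      using x graded_homD(5)[OF g x(1)] graded_homD(1)[OF g x(2)] graded_homD(4)[OF g eC x(2)]
      by (simp add: gB_def corner_simps)
  qed (simp add: gB_def)
  have gB_surj: "gB ` carrier (graded_shift d ?UB) = carrier (graded_shift d ?VB)" for d
  proof
    show "gB ` carrier (graded_shift d ?UB) \<subseteq> carrier (graded_shift d ?VB)"
      using graded_homD(1)[OF gB] by blast
    show "carrier (graded_shift d ?VB) \<subseteq> gB ` carrier (graded_shift d ?UB)"
    proof
      fix v assume "v \<in> carrier (graded_shift d ?VB)"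
      then have v: "v \<in> carrier V" "e \<odot>\<^bsub>V\<^esub> v = v" by (simp_all add: corner_simps)
      then obtain u where u: "u \<in> carrier U" "g u = v" using surj by (metis imageE)
      \<comment> \<open>An arbitrary preimage of v need not lie in the corner, but applying e puts
        it there and does not move v.\<close>
      have "e \<odot>\<^bsub>U\<^esub> u \<in> carrier ?UB"
        using u(1) eC U.smult_closed[OF eC u(1)] U.smult_assoc1[OF eC eC u(1)] ee by (simp add: corner_simps)
      moreover have "gB (e \<odot>\<^bsub>U\<^esub> u) = v"
        using calculation graded_homD(4)[OF g eC u(1)] u v by (simp add: gB_def)
      ultimately show "v \<in> gB ` carrier (graded_shift d ?UB)" by auto
    qed
  qed
  have Gh: "G h \<in> homog (HM M V) d" if "h \<in> homog (HM M U) d" for h d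
  proof -
    have h: "h \<in> graded_hom B M (graded_shift (- d) ?UB)" using that by (simp add: hom_module_simps)
    have "(\<lambda>m\<in>carrier M. gB (h m)) \<in> graded_hom B M (graded_shift (- d) ?VB)"
      by (rule graded_hom_compose[OF h gB M])
    moreover have "(\<lambda>m\<in>carrier M. gB (h m)) = (\<lambda>m\<in>carrier M. g (h m))"
      using graded_homD(1)[OF h] by (auto simp: gB_def intro!: restrict_ext)
    moreover have "h \<in> carrier (HM M U)" using HU.homog_closed[OF that] .
    ultimately show ?thesis by (simp add: G_def hom_module_simps)
  qed
  have Gadd: "G (h \<oplus>\<^bsub>HM M U\<^esub> k) = G h \<oplus>\<^bsub>HM M V\<^esub> G k" if "h \<in> carrier (HM M U)" "k \<in> carrier (HM M U)" for h k
    using HU.a_closed[OF that] that HU_D(1)[OF that(1)] HU_D(1)[OF that(2)] graded_homD(3)[OF g]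
    by (auto simp: G_def hom_module_simps corner_simps intro!: restrict_ext)
  have Gc: "G h \<in> carrier (HM M V)" if "h \<in> carrier (HM M U)" for h
    using that
  proof (induction rule: HU.induct)
    case (homog d h)
    then show ?case using HV.homog_closed[OF Gh] by blast
  next
    case (add x y)
    then show ?case by (simp add: Gadd)
  qed
  show "G \<in> graded_hom A (HM M U) (HM M V)"
  proof (rule graded_homI)
    fix a h assume a: "a \<in> carrier A" and h: "h \<in> carrier (HM M U)"
    have "g (left a \<odot>\<^bsub>U\<^esub> h m) = left a \<odot>\<^bsub>V\<^esub> g (h m)" if "m \<in> carrier M" for m
      by (rule graded_homD(4)[OF g left(1)[OF a] HU_D(1)[OF h that]])
    then show "G (a \<odot>\<^bsub>HM M U\<^esub> h) = a \<odot>\<^bsub>HM M V\<^esub> G h"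
      using HU.smult_closed[OF a h] h
      by (auto simp: G_def hom_module_simps corner_simps intro!: restrict_ext)
  qed (simp_all add: Gc Gadd Gh, simp add: G_def)
  show "G ` carrier (HM M U) = carrier (HM M V)"
  proof
    show "G ` carrier (HM M U) \<subseteq> carrier (HM M V)" using Gc by blast
    have "\<exists>h\<in>carrier (HM M U). G h = k" if "k \<in> carrier (HM M V)" for k
      using that
    proof (induction rule: HV.induct)
      case (homog d k)
      then have k: "k \<in> graded_hom B M (graded_shift (- d) ?VB)" by (simp add: hom_module_simps)
      \<comment> \<open>A map of degree d is lifted at the shift by - d, so the lifting property is
        required for all shifts.\<close>
      then obtain h where h: "h \<in> graded_hom B M (graded_shift (- d) ?UB)"
        and hk: "\<forall>m\<in>carrier M. gB (h m) = k m"
        using lift[of "- d"] gB gB_surj unfolding lifts_def by blast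
      have hH: "h \<in> carrier (HM M U)" using h HU.homog_closed[of h d] by (simp add: hom_module_simps)
      have "g (h m) = k m" if "m \<in> carrier M" for m
        using bspec[OF hk that] graded_homD(1)[OF h that] by (simp add: gB_def)
      then have "G h = k" using hH graded_homD(2)[OF k] by (auto simp: G_def restrict_def)
      then show ?case using hH by blast
    next
      case (add x y)
      then obtain h h' where "h \<in> carrier (HM M U)" "G h = x" "h' \<in> carrier (HM M U)" "G h' = y" by blast
      then show ?case by (intro bexI[of _ "h \<oplus>\<^bsub>HM M U\<^esub> h'"]) (simp_all add: Gadd)
    qed
    then show "carrier (HM M V) \<subseteq> G ` carrier (HM M U)" by blast
  qed
qed

end


lemma tensor_rels_intros:
  shows tensor_rels_r: "r \<in> E \<Longrightarrow> r' \<in> E \<Longrightarrow> p \<in> carrier P \<Longrightarrow> x \<in> carrier M \<Longrightarrow>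
      frag_of (r \<oplus>\<^bsub>C\<^esub> r', p, x) - frag_of (r, p, x) - frag_of (r', p, x) \<in> tensor_rels E C act A B P M"
    and tensor_rels_p: "r \<in> E \<Longrightarrow> p \<in> carrier P \<Longrightarrow> p' \<in> carrier P \<Longrightarrow> x \<in> carrier M \<Longrightarrow>
      frag_of (r, p \<oplus>\<^bsub>P\<^esub> p', x) - frag_of (r, p, x) - frag_of (r, p', x) \<in> tensor_rels E C act A B P M"
    and tensor_rels_m: "r \<in> E \<Longrightarrow> p \<in> carrier P \<Longrightarrow> x \<in> carrier M \<Longrightarrow> x' \<in> carrier M \<Longrightarrow>
      frag_of (r, p, x \<oplus>\<^bsub>M\<^esub> x') - frag_of (r, p, x) - frag_of (r, p, x') \<in> tensor_rels E C act A B P M"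
    and tensor_rels_ab: "r \<in> E \<Longrightarrow> a \<in> carrier A \<Longrightarrow> b \<in> carrier B \<Longrightarrow> p \<in> carrier P \<Longrightarrow> x \<in> carrier M \<Longrightarrow>
      frag_of (act r a b, p, x) - frag_of (r, a \<odot>\<^bsub>P\<^esub> p, b \<odot>\<^bsub>M\<^esub> x) \<in> tensor_rels E C act A B P M"
  unfolding tensor_rels_def
  by (rule UnI1, rule UnI1, rule UnI1, blast) (rule UnI1, rule UnI1, rule UnI2, blast, rule UnI1, rule UnI2, blast, rule UnI2, blast)

lemma hom_free_frag:
  assumes h: "h \<in> hom (free_Abelian_group S) (add_monoid U)" and U: "abelian_group U"
  shows "Poly_Mapping.keys x \<subseteq> S \<Longrightarrow> h x \<in> carrier U"
    and "Poly_Mapping.keys x \<subseteq> S \<Longrightarrow> Poly_Mapping.keys y \<subseteq> S \<Longrightarrow> h (x + y) = h x \<oplus>\<^bsub>U\<^esub> h y"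
    and "h 0 = \<zero>\<^bsub>U\<^esub>"
    and "Poly_Mapping.keys x \<subseteq> S \<Longrightarrow> Poly_Mapping.keys y \<subseteq> S \<Longrightarrow> h (x - y) = h x \<ominus>\<^bsub>U\<^esub> h y"
proof -
  interpret U: abelian_group U by fact
  show c: "Poly_Mapping.keys x \<subseteq> S \<Longrightarrow> h x \<in> carrier U" for x
    using h by (auto simp: hom_def)
  show a: "Poly_Mapping.keys x \<subseteq> S \<Longrightarrow> Poly_Mapping.keys y \<subseteq> S \<Longrightarrow> h (x + y) = h x \<oplus>\<^bsub>U\<^esub> h y" for x y
    using h by (auto simp: hom_def)
  have "h 0 \<oplus>\<^bsub>U\<^esub> h 0 = h 0" using a[of 0 0] by simp
  then show "h 0 = \<zero>\<^bsub>U\<^esub>" using c[of 0] U.add.l_cancel_one[of "h 0" "h 0"] by simp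
  assume x: "Poly_Mapping.keys x \<subseteq> S" and y: "Poly_Mapping.keys y \<subseteq> S"
  then have xy: "Poly_Mapping.keys (x - y) \<subseteq> S" using keys_diff[of x y] by blast
  have "h x = h (x - y) \<oplus>\<^bsub>U\<^esub> h y" using a[OF xy y] by simp
  moreover have "(h (x - y) \<oplus>\<^bsub>U\<^esub> h y) \<ominus>\<^bsub>U\<^esub> h y = h (x - y)"
    using c[OF xy] c[OF y] by (simp add: U.minus_eq U.a_assoc U.r_neg)
  ultimately show "h (x - y) = h x \<ominus>\<^bsub>U\<^esub> h y" by simp
qed

lemma keys_generate:
  assumes "x \<in> generate (free_Abelian_group S) R" "R \<subseteq> carrier (free_Abelian_group S)"
  shows "Poly_Mapping.keys x \<subseteq> S"
  using group.generate_in_carrier[OF group_free_Abelian_group assms(2,1)] by simp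

lemma hom_free_kills:
  assumes h: "h \<in> hom (free_Abelian_group S) (add_monoid U)" and U: "abelian_group U"
    and R: "R \<subseteq> carrier (free_Abelian_group S)" "\<And>r. r \<in> R \<Longrightarrow> h r = \<zero>\<^bsub>U\<^esub>"
    and x: "x \<in> generate (free_Abelian_group S) R"
  shows "h x = \<zero>\<^bsub>U\<^esub>"
proof -
  interpret U: abelian_group U by fact
  note hf = hom_free_frag[OF h U]
  show ?thesis using x
  proof (induction rule: generate.induct)
    case (inv r)
    then have k: "Poly_Mapping.keys r \<subseteq> S" using subsetD[OF R(1)] by simp
    have "h (0 - r) = \<zero>\<^bsub>U\<^esub>" using hf(4)[of 0 r] hf(3) k R(2)[OF inv] by (simp add: U.minus_self)
    then show ?case using k by simp
  next
    case (eng x y)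
    then show ?case using hf(2)[of x y] keys_generate[OF _ R(1)] by simp
  qed (simp_all add: R(2) hf(3))
qed

lemma hom_free_eqI:
  assumes h: "h \<in> hom (free_Abelian_group S) (add_monoid U)"
    and k: "k \<in> hom (free_Abelian_group S) (add_monoid U)" and U: "abelian_group U"
    and eq: "\<And>s. s \<in> S \<Longrightarrow> h (frag_of s) = k (frag_of s)" and x: "Poly_Mapping.keys x \<subseteq> S"
  shows "h x = k x"
proof -
  note hf = hom_free_frag[OF h U] and kf = hom_free_frag[OF k U]
  have "Poly_Mapping.keys x \<subseteq> S \<and> h x = k x"
    using x
  proof (induction rule: frag_induction)
    case (diff a b)
    then show ?case using hf(4)[of a b] kf(4)[of a b] keys_diff[of a b] by auto
  qed (simp_all add: hf(3) kf(3) eq)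
  then show ?thesis by blast
qed

context tensor_ctx
begin

text \<open>The free module before the relations are divided out. With a name for it, the tensor
  module is literally a \<open>quot\<close>, and the coset lemmas apply.\<close>

definition free_mod :: "('a, 'p) graded \<Rightarrow> ('b, 'm) graded \<Rightarrow> ('c, ('c \<times> 'p \<times> 'm) \<Rightarrow>\<^sub>0 int) graded" where
  "free_mod P M = (let G = free_Abelian_group (EE \<times> carrier P \<times> carrier M) in
     \<lparr>carrier = carrier G, monoid.mult = undefined, one = undefined, ring.zero = 0,
      ring.add = (+),
      module.smult = (\<lambda>c. frag_extend (\<lambda>(r, p, x). frag_of (c \<otimes>\<^bsub>C\<^esub> r, p, x))),
      homog = (\<lambda>d. {f \<in> carrier G. \<forall>(r, p, x)\<in>Poly_Mapping.keys f.
         \<exists>d1 d2 d3. r \<in> homog C d1 \<and> p \<in> homog P d2 \<and> x \<in> homog M d3 \<and> d1 + d2 + d3 = d})\<rparr>)"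

lemma tensor_module_eq:
  "tensor_module EE C ac A B P M = quot (free_mod P M)
     (generate (free_Abelian_group (EE \<times> carrier P \<times> carrier M)) (tensor_rels EE C ac A B P M))"
  by (simp add: tensor_module_def free_mod_def Let_def)

lemma free_mod_simps [simp]:
  "carrier (free_mod P M) = {f. Poly_Mapping.keys f \<subseteq> EE \<times> carrier P \<times> carrier M}"
  "f \<oplus>\<^bsub>free_mod P M\<^esub> g = f + g" "\<zero>\<^bsub>free_mod P M\<^esub> = 0"
  "c \<odot>\<^bsub>free_mod P M\<^esub> f = frag_extend (\<lambda>(r, p, x). frag_of (c \<otimes>\<^bsub>C\<^esub> r, p, x)) f"
  by (auto simp: free_mod_def Let_def)

lemma free_mod_abelian: "abelian_group (free_mod P M)"
proof (rule abelian_groupI)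
  fix x y assume "x \<in> carrier (free_mod P M)" "y \<in> carrier (free_mod P M)"
  then show "x \<oplus>\<^bsub>free_mod P M\<^esub> y \<in> carrier (free_mod P M)"
    using keys_add[of x y] by auto
next
  fix x assume "x \<in> carrier (free_mod P M)"
  then show "\<exists>y\<in>carrier (free_mod P M). y \<oplus>\<^bsub>free_mod P M\<^esub> x = \<zero>\<^bsub>free_mod P M\<^esub>"
    by (intro bexI[of _ "- x"]) auto
qed (auto simp: add.assoc add.commute)

text \<open>The adjunction, run in both directions. From f comes the map that sends p to the
  function m \<mapsto> f(e \<otimes> p \<otimes> m), from P to Hom over B from M to e V. It lifts to
  some h because P is projective and the adjoint preserves surjections. Then r \<otimes> p \<otimes>
  m \<mapsto> r h(p)(m) is the lift of f.\<close>

theorem tensor_lifts: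
  fixes P :: "('a, 'p) graded" and M :: "('b, 'm) graded" and Y :: "('c, 'y) graded"
  assumes P: "graded_projective A P" and M: "graded_module B M" and Y: "graded_module C Y"
    and iso: "graded_isomorphic C Y (tensor_module EE C ac A B P M)"
    and U: "graded_module C U" and V: "graded_module C V"
    and lift: "\<And>d. lifts B M (graded_shift d (corner C e right U)) (graded_shift d (corner C e right V))"
  shows "lifts C Y U V"
  unfolding lifts_def
proof (intro allI impI, elim conjE)
  fix g f
  assume g: "g \<in> graded_hom C U V" and surj: "g ` carrier U = carrier V" and f: "f \<in> graded_hom C Y V"
  have PP: "graded_module A P" using P by (simp add: graded_projective_def)
  interpret P: gmodule A P by (rule gmoduleI[OF PP])
  interpret M: gmodule B M by (rule gmoduleI[OF M])
  interpret U: gmodule C U by (rule gmoduleI[OF U])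
  interpret V: gmodule C V by (rule gmoduleI[OF V])
  interpret Y: gmodule C Y by (rule gmoduleI[OF Y])
  let ?S = "EE \<times> carrier P \<times> carrier M"
  let ?G = "free_Abelian_group ?S"
  let ?rel = "tensor_rels EE C ac A B P M"
  define N where "N = generate ?G ?rel"
  let ?W = "free_mod P M"
  interpret W: abelian_group ?W by (rule free_mod_abelian)
  have S: "s \<in> ?S \<Longrightarrow> Poly_Mapping.keys (frag_of s) \<subseteq> ?S" for s by simp
  have relG: "?rel \<subseteq> carrier ?G"
  proof
    fix x assume "x \<in> ?rel"
    then show "x \<in> carrier ?G"
      unfolding tensor_rels_def carrier_free_Abelian_group_iff
      by (auto dest!: subsetD[OF keys_diff] simp: EE_add EE_ac P.smult_closed M.smult_closed)
  qed
  have NS: "Poly_Mapping.keys x \<subseteq> ?S" if "x \<in> N" for x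
    using keys_generate[OF _ relG] that by (simp add: N_def)
  have N: "subgroup N (add_monoid ?W)"
  proof (rule W.subgroupI')
    have s: "subgroup N ?G" unfolding N_def by (rule group.generate_is_subgroup[OF group_free_Abelian_group relG])
    show "N \<subseteq> carrier ?W" using NS by auto
    show "\<zero>\<^bsub>?W\<^esub> \<in> N" using subgroup.one_closed[OF s] by simp
    show "x \<oplus>\<^bsub>?W\<^esub> y \<in> N" if "x \<in> N" "y \<in> N" for x y using subgroup.m_closed[OF s that] by simp
    show "\<ominus>\<^bsub>?W\<^esub> x \<in> N" if "x \<in> N" for x
    proof -
      have "\<ominus>\<^bsub>?W\<^esub> x = - x" using NS[OF that] by (intro W.minus_equality) auto
      then show ?thesis using subgroup.m_inv_closed[OF s that] NS[OF that] by simp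
    qed
  qed
  interpret W: ag_quot ?W N by (intro ag_quot.intro ag_quot_axioms.intro W.abelian_group_axioms N)
  let ?T = "quot ?W N"
  define sc :: "'c \<Rightarrow> (('c \<times> 'p \<times> 'm) \<Rightarrow>\<^sub>0 int) \<Rightarrow> (('c \<times> 'p \<times> 'm) \<Rightarrow>\<^sub>0 int)"
    where "sc c = frag_extend (\<lambda>(r, p, x). frag_of (c \<otimes>\<^bsub>C\<^esub> r, p, x))" for c
  have sc_of: "sc c (frag_of (r, p, x)) = frag_of (c \<otimes>\<^bsub>C\<^esub> r, p, x)" for c r and p :: 'p and x :: 'm
    by (simp add: sc_def)
  have sc_add: "sc c (x + y) = sc c x + sc c y" and sc_diff: "sc c (x - y) = sc c x - sc c y"
    and sc_minus: "sc c (- x) = - sc c x" for c and x y :: "('c \<times> 'p \<times> 'm) \<Rightarrow>\<^sub>0 int"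
    by (simp_all add: sc_def frag_extend_add frag_extend_diff frag_extend_minus)
  have sc_keys: "Poly_Mapping.keys (sc c x) \<subseteq> ?S" if c: "c \<in> carrier C" and x: "Poly_Mapping.keys x \<subseteq> ?S" for c x
    using x
  proof (induction rule: frag_induction)
    case (one s)
    obtain r p m where s: "s = (r, p, m)" by (metis prod_cases3)
    then show ?case using one EE_smult[OF c, of r] by (auto simp: sc_of)
  next
    case (diff a b)
    then show ?case using keys_diff[of "sc c a" "sc c b"] by (auto simp: sc_diff)
  qed (simp add: sc_def)
  \<comment> \<open>Multiplication by c from the left maps each of the four families of relations to
    itself, so N is a C-submodule.\<close>
  have sc_rel: "sc c x \<in> ?rel" if c: "c \<in> carrier C" and "x \<in> ?rel" for c x
    using that(2)[unfolded tensor_rels_def]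
  proof (elim UnE CollectE exE conjE)
    fix r r' p m assume *: "x = frag_of (r \<oplus>\<^bsub>C\<^esub> r', p, m) - frag_of (r, p, m) - frag_of (r', p, m)"
      "r \<in> EE" "r' \<in> EE" "p \<in> carrier P" "m \<in> carrier M"
    then have "sc c x = frag_of (c \<otimes>\<^bsub>C\<^esub> r \<oplus>\<^bsub>C\<^esub> c \<otimes>\<^bsub>C\<^esub> r', p, m) - frag_of (c \<otimes>\<^bsub>C\<^esub> r, p, m) - frag_of (c \<otimes>\<^bsub>C\<^esub> r', p, m)"
      using EE(1)[of r] EE(1)[of r'] c by (simp add: sc_diff sc_of C.r_distr)
    then show "sc c x \<in> ?rel" by (simp only:) (rule tensor_rels_r[OF EE_smult[OF c *(2)] EE_smult[OF c *(3)] *(4,5)])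
  next
    fix r p p' m assume *: "x = frag_of (r, p \<oplus>\<^bsub>P\<^esub> p', m) - frag_of (r, p, m) - frag_of (r, p', m)"
      "r \<in> EE" "p \<in> carrier P" "p' \<in> carrier P" "m \<in> carrier M"
    then have "sc c x = frag_of (c \<otimes>\<^bsub>C\<^esub> r, p \<oplus>\<^bsub>P\<^esub> p', m) - frag_of (c \<otimes>\<^bsub>C\<^esub> r, p, m) - frag_of (c \<otimes>\<^bsub>C\<^esub> r, p', m)"
      by (simp add: sc_diff sc_of)
    then show "sc c x \<in> ?rel" by (simp only:) (rule tensor_rels_p[OF EE_smult[OF c *(2)] *(3-5)])
  next
    fix r p m m' assume *: "x = frag_of (r, p, m \<oplus>\<^bsub>M\<^esub> m') - frag_of (r, p, m) - frag_of (r, p, m')"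
      "r \<in> EE" "p \<in> carrier P" "m \<in> carrier M" "m' \<in> carrier M"
    then have "sc c x = frag_of (c \<otimes>\<^bsub>C\<^esub> r, p, m \<oplus>\<^bsub>M\<^esub> m') - frag_of (c \<otimes>\<^bsub>C\<^esub> r, p, m) - frag_of (c \<otimes>\<^bsub>C\<^esub> r, p, m')"
      by (simp add: sc_diff sc_of)
    then show "sc c x \<in> ?rel" by (simp only:) (rule tensor_rels_m[OF EE_smult[OF c *(2)] *(3-5)])
  next
    fix r a b p m assume *: "x = frag_of (ac r a b, p, m) - frag_of (r, a \<odot>\<^bsub>P\<^esub> p, b \<odot>\<^bsub>M\<^esub> m)"
      "r \<in> EE" "a \<in> carrier A" "b \<in> carrier B" "p \<in> carrier P" "m \<in> carrier M"
    have "c \<otimes>\<^bsub>C\<^esub> ac r a b = ac (c \<otimes>\<^bsub>C\<^esub> r) a b"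
      using EE(1)[OF *(2)] c left(1)[OF *(3)] right(1)[OF *(4)] by (simp add: C.m_assoc)
    then have "sc c x = frag_of (ac (c \<otimes>\<^bsub>C\<^esub> r) a b, p, m) - frag_of (c \<otimes>\<^bsub>C\<^esub> r, a \<odot>\<^bsub>P\<^esub> p, b \<odot>\<^bsub>M\<^esub> m)"
      unfolding *(1) by (simp add: sc_diff sc_of)
    then show "sc c x \<in> ?rel" by (simp only:) (rule tensor_rels_ab[OF EE_smult[OF c *(2)] *(3-6), where act = ac])
  qed
  have sc_N: "sc c x \<in> N" if c: "c \<in> carrier C" and "x \<in> N" for c x
    using that(2) unfolding N_def
  proof (induction rule: generate.induct)
    case one
    show ?case using generate.one[of ?G ?rel] by (simp add: sc_def)
  next
    case (incl x)
    then show ?case using generate.incl[OF sc_rel[OF c]] by blast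
  next
    case (inv x)
    have "Poly_Mapping.keys x \<subseteq> ?S" "Poly_Mapping.keys (sc c x) \<subseteq> ?S"
      using subsetD[OF relG inv] subsetD[OF relG sc_rel[OF c inv]]
      by (simp_all only: carrier_free_Abelian_group_iff)
    then show ?case using generate.inv[OF sc_rel[OF c inv], of ?G] by (simp add: sc_minus)
  next
    case (eng x y)
    then show ?case using generate.eng[of "sc c x" ?G ?rel "sc c y"] by (simp add: sc_add)
  qed
  have T_smult: "c \<odot>\<^bsub>?T\<^esub> W.cl x = W.cl (sc c x)" if c: "c \<in> carrier C" and x: "Poly_Mapping.keys x \<subseteq> ?S" for c x
  proof -
    have "additive_map ?W ?W (\<lambda>x. c \<odot>\<^bsub>?W\<^esub> x)"
      by unfold_locales (use sc_keys[OF c] in \<open>simp_all add: sc_def[symmetric] sc_add\<close>)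
    then show ?thesis using W.quot_smult[of x c] sc_N[OF c] x by (simp add: sc_def[symmetric])
  qed
  obtain \<phi> where \<phi>: "\<phi> \<in> graded_hom C Y ?T" and bij: "bij_betw \<phi> (carrier Y) (carrier ?T)"
    and \<phi>h: "\<And>d. \<phi> ` homog Y d = homog ?T d"
    using iso unfolding graded_isomorphic_def tensor_module_eq N_def by blast
  define \<psi> where "\<psi> = inv_into (carrier Y) \<phi>"
  have \<psi>\<phi>: "\<psi> (\<phi> y) = y" if "y \<in> carrier Y" for y
    unfolding \<psi>_def using bij that by (simp add: bij_betw_def)
  have \<psi>c: "\<psi> t \<in> carrier Y" and \<phi>\<psi>: "\<phi> (\<psi> t) = t" if "t \<in> carrier ?T" for t
    unfolding \<psi>_def using bij that by (auto simp: bij_betw_def inv_into_into f_inv_into_f)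
  have Tc: "W.cl x \<in> carrier ?T" if "Poly_Mapping.keys x \<subseteq> ?S" for x
    using that by (auto simp: W.quot_carrier)
  \<comment> \<open>f, read on the free group through the identification \<psi> of the tensor module
    with Y. It vanishes on N, so every tensor relation becomes an identity for k.\<close>
  define k where "k x = f (\<psi> (W.cl x))" for x
  have kc: "k x \<in> carrier V" if "Poly_Mapping.keys x \<subseteq> ?S" for x
    unfolding k_def by (rule graded_homD(1)[OF f \<psi>c[OF Tc[OF that]]])
  have kadd: "k (x + y) = k x \<oplus>\<^bsub>V\<^esub> k y" if x: "Poly_Mapping.keys x \<subseteq> ?S" and y: "Poly_Mapping.keys y \<subseteq> ?S" for x y
  proof -
    have "\<psi> (W.cl (x + y)) = \<psi> (W.cl x) \<oplus>\<^bsub>Y\<^esub> \<psi> (W.cl y)"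
    proof -
      have "\<phi> (\<psi> (W.cl x) \<oplus>\<^bsub>Y\<^esub> \<psi> (W.cl y)) = W.cl (x + y)"
        using graded_homD(3)[OF \<phi> \<psi>c[OF Tc[OF x]] \<psi>c[OF Tc[OF y]]] \<phi>\<psi>[OF Tc[OF x]] \<phi>\<psi>[OF Tc[OF y]]
          W.quot_add[of x y] x y by simp
      then show ?thesis using \<psi>\<phi>[OF Y.a_closed[OF \<psi>c[OF Tc[OF x]] \<psi>c[OF Tc[OF y]]]] by simp
    qed
    then show ?thesis unfolding k_def using graded_homD(3)[OF f \<psi>c[OF Tc[OF x]] \<psi>c[OF Tc[OF y]]] by simp
  qed
  have ksc: "k (sc c x) = c \<odot>\<^bsub>V\<^esub> k x" if c: "c \<in> carrier C" and x: "Poly_Mapping.keys x \<subseteq> ?S" for c x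
  proof -
    have "\<phi> (c \<odot>\<^bsub>Y\<^esub> \<psi> (W.cl x)) = W.cl (sc c x)"
      using graded_homD(4)[OF \<phi> c \<psi>c[OF Tc[OF x]]] \<phi>\<psi>[OF Tc[OF x]] T_smult[OF c x] by simp
    then have "\<psi> (W.cl (sc c x)) = c \<odot>\<^bsub>Y\<^esub> \<psi> (W.cl x)"
      using \<psi>\<phi>[OF Y.smult_closed[OF c \<psi>c[OF Tc[OF x]]]] by simp
    then show ?thesis unfolding k_def using graded_homD(4)[OF f c \<psi>c[OF Tc[OF x]]] by simp
  qed
  have k_hom: "k \<in> hom ?G (add_monoid V)" using kc kadd by (auto simp: hom_def)
  note kf = hom_free_frag[OF k_hom V.abelian_group_axioms]
  have k_N: "k x = \<zero>\<^bsub>V\<^esub>" if "x \<in> N" for x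
  proof -
    have xk: "Poly_Mapping.keys x \<subseteq> ?S" using NS that by blast
    then have "W.cl x = W.cl 0" using that by (subst W.cl_eq_iff) (auto simp: W.minus_zero_right[unfolded free_mod_simps])
    then show ?thesis using kf(3) by (simp add: k_def)
  qed
  have k_rel: "k x = k y" if "x - y \<in> ?rel" "Poly_Mapping.keys x \<subseteq> ?S" "Poly_Mapping.keys y \<subseteq> ?S" for x y
  proof -
    have "k (x - y) = \<zero>\<^bsub>V\<^esub>" using k_N generate.incl[OF that(1), of ?G] by (simp add: N_def)
    then show ?thesis using kf(4)[OF that(2,3)] V.minus_eq_zero[OF kc[OF that(2)] kc[OF that(3)]] by simp
  qed
  define kk where "kk r p m = k (frag_of (r, p, m))" for r p m
  have kk_p: "kk r (p \<oplus>\<^bsub>P\<^esub> p') m = kk r p m \<oplus>\<^bsub>V\<^esub> kk r p' m"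
    if *: "r \<in> EE" "p \<in> carrier P" "p' \<in> carrier P" "m \<in> carrier M" for r p p' m
  proof -
    have "frag_of (r, p \<oplus>\<^bsub>P\<^esub> p', m) - (frag_of (r, p, m) + frag_of (r, p', m)) \<in> ?rel"
      unfolding diff_diff_eq[symmetric] by (rule tensor_rels_p[OF *])
    then show ?thesis
      unfolding kk_def using kadd[of "frag_of (r, p, m)" "frag_of (r, p', m)"] *
        keys_add[of "frag_of (r, p, m)" "frag_of (r, p', m)"]
      by (subst k_rel) auto
  qed
  have kk_m: "kk r p (m \<oplus>\<^bsub>M\<^esub> m') = kk r p m \<oplus>\<^bsub>V\<^esub> kk r p m'"
    if *: "r \<in> EE" "p \<in> carrier P" "m \<in> carrier M" "m' \<in> carrier M" for r p m m'
  proof -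
    have "frag_of (r, p, m \<oplus>\<^bsub>M\<^esub> m') - (frag_of (r, p, m) + frag_of (r, p, m')) \<in> ?rel"
      unfolding diff_diff_eq[symmetric] by (rule tensor_rels_m[OF *])
    then show ?thesis
      unfolding kk_def using kadd[of "frag_of (r, p, m)" "frag_of (r, p, m')"] *
        keys_add[of "frag_of (r, p, m)" "frag_of (r, p, m')"]
      by (subst k_rel) auto
  qed
  have kk_ab: "kk (ac r a b) p m = kk r (a \<odot>\<^bsub>P\<^esub> p) (b \<odot>\<^bsub>M\<^esub> m)"
    if *: "r \<in> EE" "a \<in> carrier A" "b \<in> carrier B" "p \<in> carrier P" "m \<in> carrier M" for r a b p m
  proof -
    have "frag_of (ac r a b, p, m) - frag_of (r, a \<odot>\<^bsub>P\<^esub> p, b \<odot>\<^bsub>M\<^esub> m) \<in> ?rel"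
      by (rule tensor_rels_ab[OF *, where act = ac])
    then show ?thesis unfolding kk_def
      using * EE_ac[OF *(1-3)] P.smult_closed[OF *(2,4)] M.smult_closed[OF *(3,5)] by (intro k_rel) auto
  qed
  have kk_c: "kk (c \<otimes>\<^bsub>C\<^esub> r) p m = c \<odot>\<^bsub>V\<^esub> kk r p m"
    if *: "c \<in> carrier C" "r \<in> EE" "p \<in> carrier P" "m \<in> carrier M" for c r p m
    using ksc[OF *(1), of "frag_of (r, p, m)"] * by (simp add: kk_def sc_of)
  have kkc: "kk r p m \<in> carrier V" if "r \<in> EE" "p \<in> carrier P" "m \<in> carrier M" for r p m
    unfolding kk_def using that by (intro kc) auto
  \<comment> \<open>As e has degree 0, the tensor e \<otimes> p \<otimes> m has the sum of the
    degrees of p and m. \<phi> maps each homogeneous part onto the part of the same degree, so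
    degrees can be read back in Y.\<close>
  have kk_h: "kk e p m \<in> homog V (d + d')" if p: "p \<in> homog P d" and m: "m \<in> homog M d'" for p m d d'
  proof -
    have s: "(e, p, m) \<in> ?S" using EE_e P.homog_closed[OF p] M.homog_closed[OF m] by auto
    have "\<exists>d1 d2 d3. e \<in> homog C d1 \<and> p \<in> homog P d2 \<and> m \<in> homog M d3 \<and> d1 + d2 + d3 = d + d'"
      by (rule exI[of _ 0], rule exI[of _ d], rule exI[of _ d']) (simp add: e p m)
    then have "frag_of (e, p, m) \<in> homog ?W (d + d')"
      using s unfolding free_mod_def Let_def by simp
    then have "W.cl (frag_of (e, p, m)) \<in> homog ?T (d + d')" by (simp add: W.quot_homog)
    then obtain y where y: "y \<in> homog Y (d + d')" "\<phi> y = W.cl (frag_of (e, p, m))"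
      using \<phi>h[of "d + d'"] by (metis imageE)
    then have "\<psi> (W.cl (frag_of (e, p, m))) = y" using \<psi>\<phi>[OF Y.homog_closed[OF y(1)]] by simp
    then show ?thesis using graded_homD(5)[OF f y(1)] by (simp add: kk_def k_def)
  qed
  have kk_e: "e \<odot>\<^bsub>V\<^esub> kk e p m = kk e p m" if "p \<in> carrier P" "m \<in> carrier M" for p m
    using kk_c[OF eC EE_e that] ee by simp
  interpret HU: gmodule A "HM M U" by (rule gmoduleI[OF HM_module[OF U M]])
  interpret HV: gmodule A "HM M V" by (rule gmoduleI[OF HM_module[OF V M]])
  \<comment> \<open>The adjoint of f: the value of f on e \<otimes> p \<otimes> m as a function of
    m.\<close>
  define f' where "f' = (\<lambda>p\<in>carrier P. \<lambda>m\<in>carrier M. kk e p m)"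
  \<comment> \<open>Balancing at r = e with a unit in the other factor: the right action of A or B
    on e becomes left multiplication in C. From this come the A-linearity of f' and the B-linearity
    of its values.\<close>
  have ac_left: "ac e a \<one>\<^bsub>B\<^esub> = left a \<otimes>\<^bsub>C\<^esub> e" if "a \<in> carrier A" for a
    using e_left[OF that] right(4) by simp
  have ac_right: "ac e \<one>\<^bsub>A\<^esub> b = right b \<otimes>\<^bsub>C\<^esub> e" if "b \<in> carrier B" for b
    using comm[OF A.one_closed that] left(4) ee by simp
  have f'_homog: "f' p \<in> homog (HM M V) d" if p: "p \<in> homog P d" for p d
  proof -
    have pc: "p \<in> carrier P" by (rule P.homog_closed[OF p])
    have "(\<lambda>m\<in>carrier M. kk e p m) \<in> graded_hom B M (graded_shift (- d) (corner C e right V))"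
    proof (rule graded_homI)
      fix m assume m: "m \<in> carrier M"
      then show "(\<lambda>m\<in>carrier M. kk e p m) m \<in> carrier (graded_shift (- d) (corner C e right V))"
        using kkc[OF EE_e pc m] kk_e[OF pc m] by (simp add: corner_simps)
    next
      fix b m assume b: "b \<in> carrier B" and m: "m \<in> carrier M"
      have "kk e p (b \<odot>\<^bsub>M\<^esub> m) = right b \<odot>\<^bsub>V\<^esub> kk e p m"
        using kk_ab[OF EE_e A.one_closed b pc m] kk_c[OF right(1)[OF b] EE_e pc m] ac_right[OF b]
          P.smult_one[OF pc] by simp
      then show "(\<lambda>m\<in>carrier M. kk e p m) (b \<odot>\<^bsub>M\<^esub> m)
          = b \<odot>\<^bsub>graded_shift (- d) (corner C e right V)\<^esub> (\<lambda>m\<in>carrier M. kk e p m) m"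
        using m M.smult_closed[OF b m] by (simp add: corner_simps)
    next
      fix d' m assume m: "m \<in> homog M d'"
      have "kk e p m \<in> homog V (d' + d)" using kk_h[OF p m] by (simp add: add.commute)
      then show "(\<lambda>m\<in>carrier M. kk e p m) m \<in> homog (graded_shift (- d) (corner C e right V)) d'"
        using M.homog_closed[OF m] kkc[OF EE_e pc] kk_e[OF pc] by (simp add: corner_simps)
    qed (simp_all add: kk_m[OF EE_e pc] corner_simps)
    then show ?thesis using pc by (simp add: f'_def hom_module_simps)
  qed
  have f'_add: "f' (p \<oplus>\<^bsub>P\<^esub> p') = f' p \<oplus>\<^bsub>HM M V\<^esub> f' p'" if "p \<in> carrier P" "p' \<in> carrier P" for p p'
    using that kk_p[OF EE_e that] by (auto simp: f'_def hom_module_simps corner_simps intro!: restrict_ext)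
  have f'c: "f' p \<in> carrier (HM M V)" if "p \<in> carrier P" for p
    using that
  proof (induction rule: P.induct)
    case (homog d h)
    then show ?case using HV.homog_closed[OF f'_homog] by blast
  next
    case (add x y)
    then show ?case by (simp add: f'_add)
  qed
  have f': "f' \<in> graded_hom A P (HM M V)"
  proof (rule graded_homI)
    fix a p assume a: "a \<in> carrier A" and p: "p \<in> carrier P"
    have "kk e (a \<odot>\<^bsub>P\<^esub> p) m = left a \<odot>\<^bsub>V\<^esub> kk e p m" if m: "m \<in> carrier M" for m
      using kk_ab[OF EE_e a B.one_closed p m] kk_c[OF left(1)[OF a] EE_e p m] ac_left[OF a]
        M.smult_one[OF m] by simp
    then show "f' (a \<odot>\<^bsub>P\<^esub> p) = a \<odot>\<^bsub>HM M V\<^esub> f' p"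
      using p P.smult_closed[OF a p]
      by (auto simp: f'_def hom_module_simps corner_simps intro!: restrict_ext)
  qed (simp_all add: f'c f'_add f'_homog, simp add: f'_def)
  note HUD = HM_D[OF U M]
  define GG where "GG = (\<lambda>h\<in>carrier (HM M U). \<lambda>m\<in>carrier M. g (h m))"
  note GGs = HM_surj[OF U V M lift g surj, folded GG_def]
  \<comment> \<open>The test modules here consist of functions on M, so projectivity of P is used in
    its extended form.\<close>
  obtain h where h: "h \<in> graded_hom A P (HM M U)" and hf: "\<forall>p\<in>carrier P. GG (h p) = f' p"
    using projective_lifts[OF A.gring_axioms P HM_module[OF U M] HM_module[OF V M]] GGs f'
    unfolding lifts_def by blast
  note hc = graded_homD(1)[OF h]
  have gh: "g (h p m) = kk e p m" if p: "p \<in> carrier P" and m: "m \<in> carrier M" for p m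
    using fun_cong[OF bspec[OF hf p], of m] hc[OF p] p m by (simp add: GG_def f'_def)
  \<comment> \<open>The adjunction in the other direction, on generators of the free group.\<close>
  define q where "q = (\<lambda>(r, p, m). r \<odot>\<^bsub>U\<^esub> h p m)"
  have qc: "q \<in> ?S \<rightarrow> carrier (add_monoid U)"
    using EE(1) HUD(1)[OF hc] U.smult_closed by (auto simp: q_def)
  have "q ` ?S \<subseteq> carrier (add_monoid U)" using qc by blast
  from comm_group.free_Abelian_group_universal[OF U.a_comm_group this]
  obtain H where H: "H \<in> hom ?G (add_monoid U)" and Hq: "\<And>s. s \<in> ?S \<Longrightarrow> H (frag_of s) = q s"
    by metis
  have Hs: "H (frag_of (r, p, m)) = r \<odot>\<^bsub>U\<^esub> h p m" if "r \<in> EE" "p \<in> carrier P" "m \<in> carrier M" for r p m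
    using Hq that by (simp add: q_def)
  note Hf = hom_free_frag[OF H U.abelian_group_axioms]
  have H3: "H (frag_of s - frag_of s' - frag_of s'') = \<zero>\<^bsub>U\<^esub>"
    if *: "s \<in> ?S" "s' \<in> ?S" "s'' \<in> ?S" and eq: "H (frag_of s) = H (frag_of s') \<oplus>\<^bsub>U\<^esub> H (frag_of s'')" for s s' s''
  proof -
    have k: "Poly_Mapping.keys (frag_of s - frag_of s') \<subseteq> ?S"
      using order_trans[OF keys_diff[of "frag_of s" "frag_of s'"]] S[OF *(1)] S[OF *(2)] by blast
    note c = Hf(1)[OF S[OF *(2)]] Hf(1)[OF S[OF *(3)]]
    have "H (frag_of s - frag_of s' - frag_of s'')
        = (H (frag_of s') \<oplus>\<^bsub>U\<^esub> H (frag_of s'')) \<ominus>\<^bsub>U\<^esub> H (frag_of s') \<ominus>\<^bsub>U\<^esub> H (frag_of s'')"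
      unfolding Hf(4)[OF k S[OF *(3)]] Hf(4)[OF S[OF *(1)] S[OF *(2)]] eq ..
    then show ?thesis using c by (simp add: U.minus_eq U.a_ac U.r_neg U.r_neg2)
  qed
  have hm: "h p m \<in> carrier U" if "p \<in> carrier P" "m \<in> carrier M" for p m
    by (rule HUD(1)[OF hc[OF that(1)] that(2)])
  \<comment> \<open>Additivity in r is a module axiom of U, additivity in p and in m comes from h
    and from h p, and balancing combines A-linearity of h with B-linearity of h p.\<close>
  have H_rel: "H x = \<zero>\<^bsub>U\<^esub>" if "x \<in> ?rel" for x
    using that unfolding tensor_rels_def
  proof (elim UnE CollectE exE conjE)
    fix r r' p m assume *: "x = frag_of (r \<oplus>\<^bsub>C\<^esub> r', p, m) - frag_of (r, p, m) - frag_of (r', p, m)"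
      "r \<in> EE" "r' \<in> EE" "p \<in> carrier P" "m \<in> carrier M"
    then show ?thesis
      using EE_add[OF *(2,3)] EE(1)[OF *(2)] EE(1)[OF *(3)] hm[OF *(4,5)] unfolding *(1)
      by (intro H3) (simp_all add: Hs U.smult_l_distr)
  next
    fix r p p' m assume *: "x = frag_of (r, p \<oplus>\<^bsub>P\<^esub> p', m) - frag_of (r, p, m) - frag_of (r, p', m)"
      "r \<in> EE" "p \<in> carrier P" "p' \<in> carrier P" "m \<in> carrier M"
    have "h (p \<oplus>\<^bsub>P\<^esub> p') m = h p m \<oplus>\<^bsub>U\<^esub> h p' m"
      using graded_homD(3)[OF h *(3,4)] *(5) by (simp add: hom_module_simps corner_simps)
    then show ?thesis
      using * EE(1)[OF *(2)] hm[OF *(3,5)] hm[OF *(4,5)] unfolding *(1)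
      by (intro H3) (simp_all add: Hs U.smult_r_distr)
  next
    fix r p m m' assume *: "x = frag_of (r, p, m \<oplus>\<^bsub>M\<^esub> m') - frag_of (r, p, m) - frag_of (r, p, m')"
      "r \<in> EE" "p \<in> carrier P" "m \<in> carrier M" "m' \<in> carrier M"
    have "h p (m \<oplus>\<^bsub>M\<^esub> m') = h p m \<oplus>\<^bsub>U\<^esub> h p m'" by (rule HUD(3)[OF hc[OF *(3)] *(4,5)])
    then show ?thesis
      using * EE(1)[OF *(2)] hm[OF *(3,4)] hm[OF *(3,5)] unfolding *(1)
      by (intro H3) (simp_all add: Hs U.smult_r_distr)
  next
    fix r a b p m assume *: "x = frag_of (ac r a b, p, m) - frag_of (r, a \<odot>\<^bsub>P\<^esub> p, b \<odot>\<^bsub>M\<^esub> m)"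
      "r \<in> EE" "a \<in> carrier A" "b \<in> carrier B" "p \<in> carrier P" "m \<in> carrier M"
    note ap = P.smult_closed[OF *(3,5)] and bm = M.smult_closed[OF *(4,6)]
    have "H x = H (frag_of (ac r a b, p, m)) \<ominus>\<^bsub>U\<^esub> H (frag_of (r, a \<odot>\<^bsub>P\<^esub> p, b \<odot>\<^bsub>M\<^esub> m))"
      unfolding *(1) using *(2-6) EE_ac[OF *(2-4)] ap bm by (subst Hf(4)) auto
    moreover have "h (a \<odot>\<^bsub>P\<^esub> p) (b \<odot>\<^bsub>M\<^esub> m) = left a \<odot>\<^bsub>U\<^esub> (right b \<odot>\<^bsub>U\<^esub> h p m)"
      using graded_homD(4)[OF h *(3,5)] bm HUD(4)[OF hc[OF *(5)] *(4,6)]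
      by (simp add: hom_module_simps corner_simps)
    moreover have "r \<odot>\<^bsub>U\<^esub> (left a \<odot>\<^bsub>U\<^esub> (right b \<odot>\<^bsub>U\<^esub> h p m)) = ac r a b \<odot>\<^bsub>U\<^esub> h p m"
      using EE(1)[OF *(2)] left(1)[OF *(3)] right(1)[OF *(4)] hm[OF *(5,6)]
      by (simp add: U.smult_assoc1 U.smult_closed)
    moreover have "ac r a b \<odot>\<^bsub>U\<^esub> h p m \<in> carrier U"
      using U.smult_closed[OF EE(1)[OF EE_ac[OF *(2-4)]] hm[OF *(5,6)]] .
    ultimately show ?thesis
      using Hs[OF EE_ac[OF *(2-4)] *(5,6)] Hs[OF *(2) ap bm] by (simp add: U.minus_self)
  qed
  have H_N: "H x = \<zero>\<^bsub>U\<^esub>" if "x \<in> N" for x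
    using hom_free_kills[OF H U.abelian_group_axioms relG H_rel] that by (simp add: N_def)
  have H_sc: "H (sc c x) = c \<odot>\<^bsub>U\<^esub> H x" if c: "c \<in> carrier C" and x: "Poly_Mapping.keys x \<subseteq> ?S" for c x
  proof (rule hom_free_eqI[OF _ _ U.abelian_group_axioms _ x])
    show "(\<lambda>x. H (sc c x)) \<in> hom ?G (add_monoid U)"
      using Hf(1)[OF sc_keys[OF c]] Hf(2)[OF sc_keys[OF c] sc_keys[OF c]] by (auto simp: hom_def sc_add)
    show "(\<lambda>x. c \<odot>\<^bsub>U\<^esub> H x) \<in> hom ?G (add_monoid U)"
      using Hf(1,2) c by (auto simp: hom_def U.smult_closed U.smult_r_distr)
    fix s assume "s \<in> ?S"
    then obtain r p m where s: "s = (r, p, m)" "r \<in> EE" "p \<in> carrier P" "m \<in> carrier M" by auto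
    show "H (sc c (frag_of s)) = c \<odot>\<^bsub>U\<^esub> H (frag_of s)"
      unfolding s(1) sc_of Hs[OF s(2-4)] Hs[OF EE_smult[OF c s(2)] s(3,4)]
      by (rule U.smult_assoc1[OF c EE(1)[OF s(2)] hm[OF s(3,4)]])
  qed
  \<comment> \<open>On generators this is \<open>kk r p m\<close> = r times \<open>kk e p m\<close>,
    which holds because r e = r in C e.\<close>
  have gH: "g (H x) = k x" if x: "Poly_Mapping.keys x \<subseteq> ?S" for x
  proof (rule hom_free_eqI[OF _ k_hom V.abelian_group_axioms _ x])
    show "(\<lambda>x. g (H x)) \<in> hom ?G (add_monoid V)"
      using Hf(1,2) by (auto simp: hom_def graded_homD(1,3)[OF g])
    fix s assume "s \<in> ?S"
    then obtain r p m where s: "s = (r, p, m)" "r \<in> EE" "p \<in> carrier P" "m \<in> carrier M" by auto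
    have "g (H (frag_of s)) = r \<odot>\<^bsub>V\<^esub> kk e p m"
      unfolding s(1) Hs[OF s(2-4)]
      using graded_homD(4)[OF g EE(1)[OF s(2)] hm[OF s(3,4)]] gh[OF s(3,4)] by simp
    also have "\<dots> = kk r p m" using kk_c[OF EE(1)[OF s(2)] EE_e s(3,4)] EE(2)[OF s(2)] by simp
    finally show "g (H (frag_of s)) = k (frag_of s)" by (simp add: kk_def s)
  qed
  have H_homog: "H x \<in> homog U d" if x: "x \<in> homog ?W d" for x d
  proof -
    let ?K = "{s \<in> ?S. H (frag_of s) \<in> homog U d}"
    have "Poly_Mapping.keys x \<subseteq> ?K"
    proof
      fix s assume s: "s \<in> Poly_Mapping.keys x"
      obtain r p m where rpm: "s = (r, p, m)" by (metis prod_cases3)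
      obtain d1 d2 d3 where dd: "r \<in> homog C d1" "p \<in> homog P d2" "m \<in> homog M d3" "d1 + d2 + d3 = d"
        using x s unfolding free_mod_def Let_def rpm by fastforce
      have sS: "s \<in> ?S" using x s unfolding free_mod_def Let_def by auto
      have "h p \<in> graded_hom B M (graded_shift (- d2) (corner C e right U))"
        using graded_homD(5)[OF h dd(2)] by (simp add: hom_module_simps)
      from graded_homD(5)[OF this dd(3)] have "h p m \<in> homog U (d3 + d2)" by (simp add: corner_simps)
      then have "r \<odot>\<^bsub>U\<^esub> h p m \<in> homog U (d1 + (d3 + d2))" by (rule U.smult_homog[OF dd(1)])
      moreover have "d1 + (d3 + d2) = d" using dd(4) by simp
      ultimately show "s \<in> ?K" using sS Hs[of r p m] by (simp add: rpm)
    qed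
    then have "Poly_Mapping.keys x \<subseteq> ?S \<and> H x \<in> homog U d"
    proof (induction rule: frag_induction)
      case zero
      then show ?case using Hf(3) U.homog_zero by simp
    next
      case (one s)
      then show ?case by simp
    next
      case (diff a b)
      then show ?case using Hf(4)[of a b] U.homog_minus[of "H a" d "H b"] keys_diff[of a b] by auto
    qed
    then show ?thesis by blast
  qed
  \<comment> \<open>H read on classes through a chosen representative; the choice does not matter
    because H vanishes on N.\<close>
  define HH where "HH t = H (SOME x. x \<in> t)" for t
  have HH_cl: "HH (W.cl x) = H x" if x: "Poly_Mapping.keys x \<subseteq> ?S" for x
  proof -
    have "(SOME y. y \<in> W.cl x) \<in> W.cl x" using W.cl_self[of x] x by (intro someI) simp
    then have y: "(SOME y. y \<in> W.cl x) \<in> W.cl x" (is "?y \<in> _") .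
    have yS: "Poly_Mapping.keys ?y \<subseteq> ?S" using subsetD[OF W.cl_subset y] x by simp
    have "W.cl ?y = W.cl x"
      using W.mem_cl_iff[of x ?y] y yS x W.cl_eq_iff[of ?y x] by simp
    have "?y \<ominus>\<^bsub>?W\<^esub> x \<in> N" using W.mem_cl_iff[of x ?y] y yS x by simp
    moreover have "?y \<ominus>\<^bsub>?W\<^esub> x = ?y - x"
    proof -
      have "\<ominus>\<^bsub>?W\<^esub> x = - x" using x by (intro W.minus_equality) auto
      then show ?thesis by (simp add: W.minus_eq)
    qed
    ultimately have "H (?y - x) = \<zero>\<^bsub>U\<^esub>" using H_N by simp
    then have "H ?y = H x" using Hf(4)[OF yS x] U.minus_eq_zero[OF Hf(1)[OF yS] Hf(1)[OF x]] by simp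
    then show ?thesis by (simp add: HH_def)
  qed
  define res where "res = (\<lambda>y\<in>carrier Y. HH (\<phi> y))"
  have rep: "\<exists>x. Poly_Mapping.keys x \<subseteq> ?S \<and> \<phi> y = W.cl x" if "y \<in> carrier Y" for y
    using graded_homD(1)[OF \<phi> that] by (auto simp: W.quot_carrier)
  have "res \<in> graded_hom C Y U"
  proof (rule graded_homI)
    fix y assume y: "y \<in> carrier Y"
    obtain x where x: "Poly_Mapping.keys x \<subseteq> ?S" "\<phi> y = W.cl x" using rep[OF y] by blast
    show "res y \<in> carrier U" using y x HH_cl[OF x(1)] Hf(1)[OF x(1)] by (simp add: res_def)
    fix y' assume y': "y' \<in> carrier Y"
    obtain x' where x': "Poly_Mapping.keys x' \<subseteq> ?S" "\<phi> y' = W.cl x'" using rep[OF y'] by blast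
    have "\<phi> (y \<oplus>\<^bsub>Y\<^esub> y') = W.cl (x + x')"
      using graded_homD(3)[OF \<phi> y y'] W.quot_add[of x x'] x x' by simp
    moreover have "Poly_Mapping.keys (x + x') \<subseteq> ?S" using keys_add[of x x'] x x' by blast
    ultimately show "res (y \<oplus>\<^bsub>Y\<^esub> y') = res y \<oplus>\<^bsub>U\<^esub> res y'"
      using y y' x x' HH_cl Hf(2)[OF x(1) x'(1)] by (simp add: res_def)
  next
    fix c y assume c: "c \<in> carrier C" and y: "y \<in> carrier Y"
    obtain x where x: "Poly_Mapping.keys x \<subseteq> ?S" "\<phi> y = W.cl x" using rep[OF y] by blast
    have "\<phi> (c \<odot>\<^bsub>Y\<^esub> y) = W.cl (sc c x)"
      using graded_homD(4)[OF \<phi> c y] T_smult[OF c x(1)] x by simp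
    then show "res (c \<odot>\<^bsub>Y\<^esub> y) = c \<odot>\<^bsub>U\<^esub> res y"
      using y Y.smult_closed[OF c y] x HH_cl[OF sc_keys[OF c x(1)]] HH_cl[OF x(1)] H_sc[OF c x(1)]
      by (simp add: res_def)
  next
    fix d y assume y: "y \<in> homog Y d"
    have "\<phi> y \<in> homog ?T d" using \<phi>h y by blast
    then obtain x where x: "x \<in> homog ?W d" "\<phi> y = W.cl x" by (auto simp: W.quot_homog)
    then have "Poly_Mapping.keys x \<subseteq> ?S" by (auto simp: free_mod_def Let_def)
    then show "res y \<in> homog U d"
      using Y.homog_closed[OF y] x HH_cl H_homog[OF x(1)] by (simp add: res_def)
  qed (simp add: res_def)
  moreover have "g (res y) = f y" if y: "y \<in> carrier Y" for y
  proof -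
    obtain x where x: "Poly_Mapping.keys x \<subseteq> ?S" "\<phi> y = W.cl x" using rep[OF y] by blast
    have "g (res y) = k x" using y x HH_cl[OF x(1)] gH[OF x(1)] by (simp add: res_def)
    also have "\<dots> = f y" unfolding k_def x(2)[symmetric] \<psi>\<phi>[OF y] ..
    finally show ?thesis .
  qed
  ultimately show "\<exists>h\<in>graded_hom C Y U. \<forall>x\<in>carrier Y. g (h x) = f x" by blast
qed

end


section \<open>The commuting embeddings of R(\<beta>) and R(\<gamma>) into R(\<beta> +
  \<gamma>)\<close>

context klr
begin

text \<open>Passing \<tau> through an idempotent swaps two letters, and a set of sequences stable
  under the swap is only permuted by it.\<close>

lemma comm_tau_sum:
  assumes S: "finite S" "S \<subseteq> seqs D \<delta>" and k: "k \<in> {1..<ht D \<delta>}"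
    and swap: "\<And>\<nu>. \<nu> \<in> S \<Longrightarrow> swap_pos k \<nu> \<in> S"
  shows "comm \<delta> (tau_gen k) (\<Sum>\<nu>\<in>S. e_gen \<nu>)"
proof -
  let ?\<tau> = "tau_gen k :: ('i, 'k) klr_free"
  have \<tau>F: "?\<tau> \<in> FC \<delta>" using k by (rule tau_FC)
  have "eqv \<delta> (\<Sum>\<nu>\<in>S. ?\<tau> * e_gen \<nu>) (\<Sum>\<nu>\<in>S. e_gen (swap_pos k \<nu>) * ?\<tau>)"
    using S(2) k by (intro eqv_sum eqv_rel klr_rels.tau_e FC_intros swap_pos_seqs) auto
  moreover have "(\<Sum>\<nu>\<in>S. e_gen (swap_pos k \<nu>) * ?\<tau>) = (\<Sum>\<nu>\<in>S. e_gen \<nu> * ?\<tau>)"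
  proof (rule sum.reindex_bij_witness[where i = "swap_pos k" and j = "swap_pos k"])
    fix \<nu> assume \<nu>: "\<nu> \<in> S"
    then have "\<nu> \<in> seqs D \<delta>" using S(2) by blast
    then show "swap_pos k (swap_pos k \<nu>) = \<nu>"
      using swap_pos_invol[of k \<nu>] length_seqs[of \<nu> \<delta>] k by auto
    then show "swap_pos k (swap_pos k \<nu>) = \<nu>" .
    show "swap_pos k \<nu> \<in> S" "swap_pos k \<nu> \<in> S" by (rule swap[OF \<nu>])+
  qed simp
  moreover have "(\<Sum>\<nu>\<in>S. e_gen \<nu>) \<in> FC \<delta>"
    using S(2) by (intro free_carrier_sum e_FC) blast
  ultimately show ?thesis
    using \<tau>F by (simp add: comm_def sum_distrib_left sum_distrib_right)
qed

lemma comm_e_e: "\<nu> \<in> seqs D \<delta> \<Longrightarrow> \<nu>' \<in> seqs D \<delta> \<Longrightarrow> comm \<delta> (e_gen \<nu>) (e_gen \<nu>')"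
proof -
  assume \<nu>: "\<nu> \<in> seqs D \<delta>" "\<nu>' \<in> seqs D \<delta>"
  have e: "eqv \<delta> (e_gen a * e_gen b) (if a = b then e_gen a else 0)"
    if "a \<in> seqs D \<delta>" "b \<in> seqs D \<delta>" for a b
    using that by (intro eqv_rel klr_rels.e_e FC_intros)
  show ?thesis
  proof (cases "\<nu> = \<nu>'")
    case False
    then have "eqv \<delta> (e_gen \<nu> * e_gen \<nu>') 0" "eqv \<delta> 0 (e_gen \<nu>' * e_gen \<nu>)"
      using e[OF \<nu>] eqv_sym[OF e[OF \<nu>(2,1)]] by simp_all
    then show ?thesis using \<nu> eqv_trans by (simp add: comm_def e_FC)
  qed (use \<nu> in \<open>simp add: comm_def e_FC eqv_refl free_carrier_mult\<close>)
qed

end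

context rz
begin

lemma RK_sum_zero:
  assumes "finite S" "\<And>t. t \<in> S \<Longrightarrow> f t \<in> FC \<delta>" "\<And>t. t \<in> S \<Longrightarrow> RK \<delta> (KC \<delta> (f t)) = \<zero>\<^bsub>RA \<delta>\<^esub>"
  shows "RK \<delta> (KC \<delta> (\<Sum>t\<in>S. f t)) = \<zero>\<^bsub>RA \<delta>\<^esub>"
  using assms
proof (induction S rule: finite_induct)
  case empty
  interpret RR: ring "RA \<delta>" by (rule RA_ring)
  have "RK \<delta> (KC \<delta> 0) \<oplus>\<^bsub>RA \<delta>\<^esub> RK \<delta> (KC \<delta> 0) = RK \<delta> (KC \<delta> 0)"
    using RK_add[of "KC \<delta> 0" \<delta> "KC \<delta> 0"] by (simp add: KC_closed free_carrier_zero KC_add)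
  then show ?case
    using RR.add.l_cancel_one[of "RK \<delta> (KC \<delta> 0)" "RK \<delta> (KC \<delta> 0)"]
    by (simp add: RK_closed KC_closed free_carrier_zero)
next
  case (insert t S)
  interpret RR: ring "RA \<delta>" by (rule RA_ring)
  have "(\<Sum>t\<in>S. f t) \<in> FC \<delta>" using insert by (intro free_carrier_sum) simp
  then show ?case
    using insert by (simp add: KC_add[symmetric] RK_add KC_closed)
qed

text \<open>Extends the identity "last x equals z" from a single \<open>e(\<nu>)\<close> to sums of
  idempotents, such as the images of \<open>e(\<nu>)\<close> under an embedding.\<close>

lemma RK_sum_x:
  assumes "finite S" "y \<in> FC \<delta>" "\<And>t. t \<in> S \<Longrightarrow> f t \<in> FC \<delta>"
    "\<And>t. t \<in> S \<Longrightarrow> RK \<delta> (KC \<delta> (y * f t)) = RZ \<delta> \<otimes>\<^bsub>RA \<delta>\<^esub> RK \<delta> (KC \<delta> (f t))"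
  shows "RK \<delta> (KC \<delta> (y * (\<Sum>t\<in>S. f t))) = RZ \<delta> \<otimes>\<^bsub>RA \<delta>\<^esub> RK \<delta> (KC \<delta> (\<Sum>t\<in>S. f t))"
  using assms(1,3,4)
proof (induction S rule: finite_induct)
  case empty
  interpret RR: ring "RA \<delta>" by (rule RA_ring)
  have "RK \<delta> (KC \<delta> 0) = \<zero>\<^bsub>RA \<delta>\<^esub>" using RK_sum_zero[of "{}" "\<lambda>_. 0"] by simp
  then show ?case by (simp add: RZ_closed)
next
  case (insert t S)
  interpret RR: ring "RA \<delta>" by (rule RA_ring)
  have s: "(\<Sum>t\<in>S. f t) \<in> FC \<delta>" "f t \<in> FC \<delta>" using insert by (auto intro: free_carrier_sum)
  then have "KC \<delta> (y * (\<Sum>t\<in>insert t S. f t)) = KC \<delta> (y * f t) \<oplus>\<^bsub>KA \<delta>\<^esub> KC \<delta> (y * (\<Sum>t\<in>S. f t))"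
    "KC \<delta> (\<Sum>t\<in>insert t S. f t) = KC \<delta> (f t) \<oplus>\<^bsub>KA \<delta>\<^esub> KC \<delta> (\<Sum>t\<in>S. f t)"
    using insert assms(2) by (simp_all add: KC_add free_carrier_mult distrib_left)
  then show ?case
    using insert s assms(2)
    by (simp add: RK_add KC_closed free_carrier_mult RR.r_distr RZ_closed RK_closed)
qed

end

locale klr_pair = rz D Q i
  for D :: "('i, 'p::ab_group_add) root_datum" and Q :: "('i, 'k::field) qparam" and i :: 'i +
  fixes \<beta> \<gamma> :: 'p
  assumes ne: "seqs D \<beta> \<noteq> {}" "seqs D \<gamma> \<noteq> {}"
begin

abbreviation \<delta> :: 'p where "\<delta> \<equiv> \<beta> + \<gamma>"

sublocale Lf: klr_emb D Q \<beta> "\<beta> + \<gamma>" "{[]} \<times> seqs D \<gamma>" 0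
  by unfold_locales (auto simp: finite_seqs seqs_append ht_add[OF ne])

sublocale Rt: klr_emb D Q \<gamma> "\<beta> + \<gamma>" "seqs D \<beta> \<times> {[]}" "ht D \<beta>"
  by unfold_locales (auto simp: finite_seqs seqs_append ht_add[OF ne] length_seqs)

lemma Lf_E: "Lf.E \<nu> = (\<Sum>\<nu>'\<in>seqs D \<gamma>. e_gen (\<nu> @ \<nu>'))"
  by (simp add: Lf.E_def sum.cartesian_product')

lemma Rt_E: "Rt.E \<nu>' = (\<Sum>\<nu>\<in>seqs D \<beta>. e_gen (\<nu> @ \<nu>'))"
  by (simp add: Rt.E_def sum.cartesian_product')

lemma u_eq: "Rt.u = Lf.u"
  unfolding Rt.u_def Lf.u_def Lf_E Rt_E by (rule sum.swap)

lemma klr_idem_eq: "klr_idem D Q \<beta> \<gamma> = KC \<delta> Lf.u"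
  by (simp add: klr_idem_def Lf.u_def Lf_E)

lemma klr_left_eq: "klr_left D Q \<beta> \<gamma> = Lf.emb"
proof -
  have "(\<lambda>g. KC \<delta> (case g of Gen_e \<nu> \<Rightarrow> (\<Sum>\<nu>'\<in>seqs D \<gamma>. e_gen (\<nu> @ \<nu>'))
      | Gen_x k \<Rightarrow> x_gen k | Gen_tau k \<Rightarrow> tau_gen k)) = (\<lambda>g. KC \<delta> (Lf.\<phi> g))"
    by (rule ext) (simp add: Lf.\<phi>_def Lf_E split: klr_gen.split)
  then show ?thesis
    by (intro ext) (simp add: klr_left_def Lf.emb_def klr_idem_eq)
qed

lemma klr_right_eq: "klr_right D Q \<beta> \<gamma> = Rt.emb"
proof -
  have "(\<lambda>g. KC \<delta> (case g of Gen_e \<nu>' \<Rightarrow> (\<Sum>\<nu>\<in>seqs D \<beta>. e_gen (\<nu> @ \<nu>'))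
      | Gen_x k \<Rightarrow> x_gen (ht D \<beta> + k) | Gen_tau k \<Rightarrow> tau_gen (ht D \<beta> + k))) = (\<lambda>g. KC \<delta> (Rt.\<phi> g))"
    by (rule ext) (simp add: Rt.\<phi>_def Rt_E split: klr_gen.split)
  then show ?thesis
    by (intro ext) (simp add: klr_right_def Rt.emb_def klr_idem_eq u_eq)
qed

lemma htd: "ht D \<delta> = ht D \<beta> + ht D \<gamma>" by (rule ht_add[OF ne])

text \<open>A crossing in the right block permutes the suffixes and leaves the prefix \<nu> alone,
  so the set of concatenations is stable.\<close>

lemma Lf_E_comm_tau:
  assumes "\<nu> \<in> seqs D \<beta>" "k \<in> {1..<ht D \<gamma>}"
  shows "comm \<delta> (tau_gen (ht D \<beta> + k)) (Lf.E \<nu>)"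
proof -
  let ?S = "(\<lambda>\<nu>'. \<nu> @ \<nu>') ` seqs D \<gamma>"
  have "comm \<delta> (tau_gen (ht D \<beta> + k)) (\<Sum>\<mu>\<in>?S. e_gen \<mu>)"
  proof (rule comm_tau_sum)
    fix \<mu> assume "\<mu> \<in> ?S"
    then obtain \<nu>' where \<nu>': "\<nu>' \<in> seqs D \<gamma>" "\<mu> = \<nu> @ \<nu>'" by blast
    have "swap_pos (ht D \<beta> + k) (\<nu> @ \<nu>') = \<nu> @ swap_pos k \<nu>'"
      using swap_pos_append[of k \<nu>' \<nu> "[]"] assms length_seqs[OF assms(1)] length_seqs[OF \<nu>'(1)] by simp
    then show "swap_pos (ht D \<beta> + k) \<mu> \<in> ?S" using \<nu>' swap_pos_seqs[OF \<nu>'(1) assms(2)] by simp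
  qed (use assms finite_seqs seqs_append htd in auto)
  then show ?thesis unfolding Lf_E by (simp add: sum.reindex inj_on_def)
qed

lemma Rt_E_comm_tau:
  assumes "\<nu>' \<in> seqs D \<gamma>" "k \<in> {1..<ht D \<beta>}"
  shows "comm \<delta> (tau_gen k) (Rt.E \<nu>')"
proof -
  let ?S = "(\<lambda>\<nu>. \<nu> @ \<nu>') ` seqs D \<beta>"
  have "comm \<delta> (tau_gen k) (\<Sum>\<mu>\<in>?S. e_gen \<mu>)"
  proof (rule comm_tau_sum)
    fix \<mu> assume "\<mu> \<in> ?S"
    then obtain \<nu> where \<nu>: "\<nu> \<in> seqs D \<beta>" "\<mu> = \<nu> @ \<nu>'" by blast
    have "swap_pos k (\<nu> @ \<nu>') = swap_pos k \<nu> @ \<nu>'"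
      using swap_pos_append[of k \<nu> "[]" \<nu>'] assms length_seqs[OF \<nu>(1)] by simp
    then show "swap_pos k \<mu> \<in> ?S" using \<nu> swap_pos_seqs[OF \<nu>(1) assms(2)] by simp
  qed (use assms finite_seqs seqs_append htd in auto)
  then show ?thesis unfolding Rt_E by (simp add: sum.reindex inj_on_def)
qed

text \<open>Nine cases, all true because the two letters concern disjoint blocks of positions.
  Crossings in the left block have index at most \<open>ht D \<beta>\<close> - 1, those in the right
  block at least \<open>ht D \<beta>\<close> + 1, so they are far enough apart for the commutation
  relation.\<close>

lemma phi_comm:
  assumes g: "g \<in> klr_gens D \<beta>" and h: "h \<in> klr_gens D \<gamma>"
  shows "comm \<delta> (Lf.\<phi> g) (Rt.\<phi> h)"
  using g
proof (cases rule: Lf.klr_gensE)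
  case (1 \<nu>)
  have L: "Lf.\<phi> g = Lf.E \<nu>" using 1 by (simp add: Lf.\<phi>_def)
  show ?thesis using h
  proof (cases rule: Rt.klr_gensE)
    case (1 \<nu>')
    then have R: "Rt.\<phi> h = Rt.E \<nu>'" by (simp add: Rt.\<phi>_def)
    have "comm \<delta> (e_gen (\<nu> @ a)) (Rt.E \<nu>')" if "a \<in> seqs D \<gamma>" for a
      unfolding Rt_E using 1 that \<open>\<nu> \<in> seqs D \<beta>\<close>
      by (intro comm_sym[OF comm_sum] comm_e_e seqs_append e_FC)
    then show ?thesis unfolding L R Lf_E by (intro comm_sum Rt.E_FC 1)
  next
    case (2 k)
    then have R: "Rt.\<phi> h = x_gen (ht D \<beta> + k)" by (simp add: Rt.\<phi>_def)
    show ?thesis unfolding L R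
      by (rule comm_sym[OF Lf.x_comm_E[OF \<open>\<nu> \<in> seqs D \<beta>\<close> Rt.range(1)[OF 2(2)]]])
  next
    case (3 k)
    then have R: "Rt.\<phi> h = tau_gen (ht D \<beta> + k)" by (simp add: Rt.\<phi>_def)
    show ?thesis unfolding L R
      by (rule comm_sym[OF Lf_E_comm_tau[OF \<open>\<nu> \<in> seqs D \<beta>\<close> 3(2)]])
  qed
next
  case (2 k)
  have L: "Lf.\<phi> g = x_gen k" using 2 by (simp add: Lf.\<phi>_def)
  have k: "k \<in> {1..ht D \<delta>}" using 2 htd by auto
  show ?thesis using h
  proof (cases rule: Rt.klr_gensE)
    case (1 \<nu>')
    then have R: "Rt.\<phi> h = Rt.E \<nu>'" by (simp add: Rt.\<phi>_def)
    show ?thesis unfolding L R by (rule Rt.x_comm_E[OF 1(2) k])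
  next
    case (2 l)
    then have R: "Rt.\<phi> h = x_gen (ht D \<beta> + l)" by (simp add: Rt.\<phi>_def)
    show ?thesis unfolding L R comm_def using k Rt.range(1)[OF 2(2)]
      by (intro conjI eqv_rel klr_rels.x_x FC_intros)
  next
    case (3 l)
    then have R: "Rt.\<phi> h = tau_gen (ht D \<beta> + l)" by (simp add: Rt.\<phi>_def)
    have "k \<noteq> ht D \<beta> + l" "k \<noteq> ht D \<beta> + l + 1" using \<open>k \<in> {1..ht D \<beta>}\<close> 3(2) by auto
    then show ?thesis unfolding L R comm_def using k Rt.range(2)[OF 3(2)]
      by (intro conjI eqv_rel klr_rels.x_tau FC_intros)
  qed
next
  case (3 k)
  have L: "Lf.\<phi> g = tau_gen k" using 3 by (simp add: Lf.\<phi>_def)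
  have k: "k \<in> {1..<ht D \<delta>}" using 3 htd by auto
  show ?thesis using h
  proof (cases rule: Rt.klr_gensE)
    case (1 \<nu>')
    then have R: "Rt.\<phi> h = Rt.E \<nu>'" by (simp add: Rt.\<phi>_def)
    show ?thesis unfolding L R by (rule Rt_E_comm_tau[OF 1(2) \<open>k \<in> {1..<ht D \<beta>}\<close>])
  next
    case (2 l)
    then have R: "Rt.\<phi> h = x_gen (ht D \<beta> + l)" by (simp add: Rt.\<phi>_def)
    have "ht D \<beta> + l \<noteq> k" "ht D \<beta> + l \<noteq> k + 1" using \<open>k \<in> {1..<ht D \<beta>}\<close> 2(2) by auto
    then have "comm \<delta> (x_gen (ht D \<beta> + l)) (tau_gen k)" unfolding comm_def using k Rt.range(1)[OF 2(2)]
      by (intro conjI eqv_rel klr_rels.x_tau FC_intros)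
    then show ?thesis unfolding L R by (rule comm_sym)
  next
    case (3 l)
    then have R: "Rt.\<phi> h = tau_gen (ht D \<beta> + l)" by (simp add: Rt.\<phi>_def)
    have "k + 2 \<le> ht D \<beta> + l \<or> ht D \<beta> + l + 2 \<le> k" using \<open>k \<in> {1..<ht D \<beta>}\<close> 3(2) by auto
    then show ?thesis unfolding L R comm_def using k Rt.range(2)[OF 3(2)]
      by (intro conjI eqv_rel klr_rels.tau_tau FC_intros)
  qed
qed

lemma L_comm:
  assumes "f \<in> FC \<beta>" "g \<in> FC \<gamma>"
  shows "comm \<delta> (Lf.L f) (Rt.L g)"
  by (intro Lf.comm_L assms Rt.L_FC comm_sym[OF Rt.comm_L] comm_sym[OF phi_comm] Lf.phi_FC)

lemma emb_comm:
  assumes "a \<in> carrier (KA \<beta>)" "b \<in> carrier (KA \<gamma>)"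
  shows "Lf.emb a \<otimes>\<^bsub>KA \<delta>\<^esub> Rt.emb b = Rt.emb b \<otimes>\<^bsub>KA \<delta>\<^esub> Lf.emb a"
proof -
  obtain f where f: "f \<in> FC \<beta>" "a = KC \<beta> f" using assms(1) by (rule KA_carrierE)
  obtain g where g: "g \<in> FC \<gamma>" "b = KC \<gamma> g" using assms(2) by (rule KA_carrierE)
  have fF: "Lf.L f \<in> FC \<delta>" and gF: "Rt.L g \<in> FC \<delta>" using f g by (simp_all add: Lf.L_FC Rt.L_FC)
  have uu: "comm \<delta> Lf.u Lf.u" using Lf.u_FC by (simp add: comm_def eqv_refl free_carrier_mult)
  have c1: "comm \<delta> (Lf.L f) (Rt.L g * Lf.u)"
    by (rule comm_sym[OF comm_mult[OF comm_sym[OF L_comm[OF f(1) g(1)]] comm_sym[OF Lf.L_comm_u[OF f(1)]]]])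
  have c2: "comm \<delta> Lf.u (Rt.L g * Lf.u)"
    using Rt.L_comm_u[OF g(1)] unfolding u_eq by (intro comm_sym[OF comm_mult] uu)
  have "comm \<delta> (Lf.L f * Lf.u) (Rt.L g * Lf.u)" by (rule comm_mult[OF c1 c2])
  then have "KC \<delta> ((Lf.L f * Lf.u) * (Rt.L g * Lf.u)) = KC \<delta> ((Rt.L g * Lf.u) * (Lf.L f * Lf.u))"
    by (intro eqv_KC) (simp add: comm_def)
  then show ?thesis
    using f g fF gF Lf.u_FC by (simp add: Lf.emb_KC Rt.emb_KC u_eq KC_mult free_carrier_mult)
qed

definition mp :: "(nat \<Rightarrow> ('i, 'k) klr_free set) \<Rightarrow> nat \<Rightarrow> ('i, 'k) klr_free set" where
  "mp p n = Rt.emb (p n)"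

lemma Rt_emb_zero: "Rt.emb \<zero>\<^bsub>KA \<gamma>\<^esub> = \<zero>\<^bsub>KA \<delta>\<^esub>"
  by (simp add: KC_zero Rt.emb_KC free_carrier_zero Rt.L_zero)

lemma mp_closed: "p \<in> carrier (UK \<gamma>) \<Longrightarrow> mp p \<in> carrier (UK \<delta>)"
proof (rule UP_memI)
  assume p: "p \<in> carrier (UK \<gamma>)"
  show "mp p n \<in> carrier (KA \<delta>)" for n unfolding mp_def by (rule Rt.emb_closed[OF UP_closed[OF p]])
  have "{k. mp p k \<noteq> \<zero>\<^bsub>KA \<delta>\<^esub>} \<subseteq> {k. p k \<noteq> \<zero>\<^bsub>KA \<gamma>\<^esub>}" using Rt_emb_zero by (auto simp: mp_def)
  then show "finite {k. mp p k \<noteq> \<zero>\<^bsub>KA \<delta>\<^esub>}" using UP_finite[OF p] finite_subset by blast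
qed

lemma mp_add:
  assumes "p \<in> carrier (UK \<gamma>)" "q \<in> carrier (UK \<gamma>)"
  shows "mp (p \<oplus>\<^bsub>UK \<gamma>\<^esub> q) = mp p \<oplus>\<^bsub>UK \<delta>\<^esub> mp q"
  by (rule ext)
    (simp add: mp_def UP_add[OF assms] UP_add[OF mp_closed[OF assms(1)] mp_closed[OF assms(2)]]
      Rt.emb_add UP_closed[OF assms(1)] UP_closed[OF assms(2)])

lemma mp_mon: "a \<in> carrier (KA \<gamma>) \<Longrightarrow> mp (mon \<gamma> a n) = mon \<delta> (Rt.emb a) n"
  by (rule ext) (simp add: mp_def UP_monom Rt.emb_closed Rt_emb_zero)

lemma mp_mult:
  assumes "p \<in> carrier (UK \<gamma>)" "q \<in> carrier (UK \<gamma>)"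
  shows "mp (p \<otimes>\<^bsub>UK \<gamma>\<^esub> q) = mp p \<otimes>\<^bsub>UK \<delta>\<^esub> mp q"
proof -
  interpret KG: ring "KP \<gamma>" by (rule KP_ring)
  interpret KD: ring "KP \<delta>" by (rule KP_ring)
  note G = KG.r_distr[simplified] KG.l_distr[simplified] KG.m_closed[simplified]
  note Dl = KD.r_distr[simplified] KD.l_distr[simplified]
  interpret A: ring "KA \<gamma>" by (rule KA_ring)
  show ?thesis using KA_ring assms(1)
  proof (induction rule: UP_induct)
    case (monom a n)
    show ?case using KA_ring assms(2)
    proof (induction rule: UP_induct)
      case (monom b m)
      then show ?case using \<open>a \<in> carrier (KA \<gamma>)\<close>
        by (simp add: mon_mult mp_mon Rt.emb_mult Rt.emb_closed)
    next
      case (add p q)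
      then show ?case using \<open>a \<in> carrier (KA \<gamma>)\<close>
        by (simp add: G Dl mp_add mp_closed mon_closed)
    qed
  next
    case (add p q')
    then show ?case using assms(2) by (simp add: G Dl mp_add mp_closed)
  qed
qed

lemma RC_zero_iff: "p \<in> carrier (UK \<mu>) \<Longrightarrow> RC \<mu> p = \<zero>\<^bsub>RA \<mu>\<^esub> \<longleftrightarrow> p \<in> CI \<mu>"
proof -
  interpret K: ring "KP \<mu>" by (rule KP_ring)
  assume p: "p \<in> carrier (UK \<mu>)"
  have "p \<ominus>\<^bsub>KP \<mu>\<^esub> \<zero>\<^bsub>KP \<mu>\<^esub> = p" using K.minus_zero_right[of p] p by simp
  then have "p \<ominus>\<^bsub>UK \<mu>\<^esub> \<zero>\<^bsub>UK \<mu>\<^esub> = p" using KP_minus[OF p, of "\<zero>\<^bsub>UK \<mu>\<^esub>"] K.zero_closed by simp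
  then show ?thesis using RC_eq[OF p, of "\<zero>\<^bsub>UK \<mu>\<^esub>"] K.zero_closed by (simp add: RC_zero)
qed

lemma RC_mp_additive: "additive_map (KP \<gamma>) (RA \<delta>) (\<lambda>p. RC \<delta> (mp p))"
proof -
  interpret KG: ring "KP \<gamma>" by (rule KP_ring)
  interpret RR: ring "RA \<delta>" by (rule RA_ring)
  show ?thesis by unfold_locales (simp_all add: RC_closed mp_closed mp_add RC_add)
qed

lemma emb_e: "\<nu> \<in> seqs D \<gamma> \<Longrightarrow> Rt.emb (KC \<gamma> (e_gen \<nu>)) = KC \<delta> (Rt.E \<nu>)"
  using eqv_KC[OF Rt.E_u(1)] by (simp add: Rt.emb_KC e_FC Rt.L_letters)

lemma emb_x_e:
  assumes "\<nu> \<in> seqs D \<gamma>" "k \<in> {1..ht D \<gamma>}"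
  shows "Rt.emb (KC \<gamma> (x_gen k * e_gen \<nu>)) = KC \<delta> (x_gen (ht D \<beta> + k) * Rt.E \<nu>)"
proof -
  have "eqv \<delta> (x_gen (ht D \<beta> + k) * (Rt.E \<nu> * Rt.u)) (x_gen (ht D \<beta> + k) * Rt.E \<nu>)"
    by (rule eqv_mult_left[OF x_FC[OF Rt.range(1)[OF assms(2)]] Rt.E_u(1)[OF assms(1)]])
  then show ?thesis using assms eqv_KC
    by (simp add: Rt.emb_KC FC_intros Rt.L_letters Rt.L_mult mult.assoc)
qed

text \<open>The cyclotomic relations concern the last letter, and prepending a sequence does not
  change the last letter. So the embedding on the right carries them to sums of cyclotomic
  relations; if \<gamma> has height 0 there are none to check.\<close>

lemma mp_CI: assumes "p \<in> CI \<gamma>" shows "mp p \<in> CI \<delta>"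
proof -
  interpret KG: ring "KP \<gamma>" by (rule KP_ring)
  interpret RR: ring "RA \<delta>" by (rule RA_ring)
  interpret rr: additive_map "KP \<gamma>" "RA \<delta>" "\<lambda>p. RC \<delta> (mp p)" by (rule RC_mp_additive)
  \<comment> \<open>The kernel of a multiplicative and additive map, hence an ideal even though the
    map is not unital. It remains to see that it contains the generators.\<close>
  let ?J = "{p \<in> carrier (UK \<gamma>). RC \<delta> (mp p) = \<zero>\<^bsub>RA \<delta>\<^esub>}"
  have "ideal ?J (KP \<gamma>)"
  proof (rule idealI[OF KP_ring])
    show "subgroup ?J (add_monoid (KP \<gamma>))"
    proof (rule KG.subgroupI')
      show "\<zero>\<^bsub>KP \<gamma>\<^esub> \<in> ?J" using rr.zero KG.zero_closed by simp
      show "p \<oplus>\<^bsub>KP \<gamma>\<^esub> q \<in> ?J" if "p \<in> ?J" "q \<in> ?J" for p q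
        using that rr.add[of p q] KG.a_closed[of p q] by simp
      show "\<ominus>\<^bsub>KP \<gamma>\<^esub> p \<in> ?J" if "p \<in> ?J" for p
        using that rr.neg[of p] KG.a_inv_closed[of p] by simp
    qed auto
    fix a x assume a: "a \<in> ?J" and x: "x \<in> carrier (KP \<gamma>)"
    show "x \<otimes>\<^bsub>KP \<gamma>\<^esub> a \<in> ?J" "a \<otimes>\<^bsub>KP \<gamma>\<^esub> x \<in> ?J"
      using a x KG.m_closed[of x a] KG.m_closed[of a x]
      by (auto simp: mp_mult RC_mult[symmetric] mp_closed RC_closed)
  qed
  moreover have "cyc_gens \<gamma> \<subseteq> ?J"
  proof
    fix p assume p: "p \<in> cyc_gens \<gamma>"
    then have pc: "p \<in> carrier (UK \<gamma>)" using cyc_gens_sub by blast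
    from p consider \<nu> where "p = mon \<gamma> (KC \<gamma> (e_gen \<nu>)) 0" "\<nu> \<in> seqs D \<gamma>" "ht D \<gamma> \<ge> 1" "pos \<nu> (ht D \<gamma>) \<noteq> i"
      | \<nu> where "p = mon \<gamma> (KC \<gamma> (x_gen (ht D \<gamma>) * e_gen \<nu>)) 0 \<ominus>\<^bsub>UK \<gamma>\<^esub> mon \<gamma> (KC \<gamma> (e_gen \<nu>)) 1"
        "\<nu> \<in> seqs D \<gamma>" "ht D \<gamma> \<ge> 1" "pos \<nu> (ht D \<gamma>) = i"
      by (auto simp: cyc_gens_def)
    then have "RC \<delta> (mp p) = \<zero>\<^bsub>RA \<delta>\<^esub>"
    proof cases
      case (1 \<nu>)
      have p: "pos (fst t @ \<nu> @ snd t) (ht D \<delta>) \<noteq> i" if "t \<in> seqs D \<beta> \<times> {[]}" for t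
        using Rt.pos_T[OF that 1(2), of "ht D \<gamma>"] 1 htd by simp
      have "RK \<delta> (KC \<delta> (Rt.E \<nu>)) = \<zero>\<^bsub>RA \<delta>\<^esub>"
        unfolding Rt.E_def
        using Rt.T Rt.e_seqs[OF _ 1(2)] p 1(3) htd by (intro RK_sum_zero e_FC RK_e_zero) auto
      then show ?thesis unfolding 1(1) using 1(2)
        by (simp add: mp_mon KC_closed e_FC emb_e Rz_of_klr_def)
    next
      case (2 \<nu>)
      have p: "pos (fst t @ \<nu> @ snd t) (ht D \<delta>) = i" if "t \<in> seqs D \<beta> \<times> {[]}" for t
        using Rt.pos_T[OF that 2(2), of "ht D \<gamma>"] 2 htd by simp
      have xd: "x_gen (ht D \<delta>) \<in> FC \<delta>" using 2(3) htd by (intro x_FC) auto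
      have x: "RK \<delta> (KC \<delta> (x_gen (ht D \<delta>) * Rt.E \<nu>)) = RZ \<delta> \<otimes>\<^bsub>RA \<delta>\<^esub> RK \<delta> (KC \<delta> (Rt.E \<nu>))"
        unfolding Rt.E_def
        using Rt.T Rt.e_seqs[OF _ 2(2)] p 2(3) htd by (intro RK_sum_x xd e_FC RK_x) auto
      have c: "mon \<gamma> (KC \<gamma> (x_gen (ht D \<gamma>) * e_gen \<nu>)) 0 \<in> carrier (UK \<gamma>)"
        "mon \<gamma> (KC \<gamma> (e_gen \<nu>)) 1 \<in> carrier (UK \<gamma>)"
        using 2 by (auto intro!: mon_closed KC_closed free_carrier_mult e_FC last_x_FC)
      have "mp (mon \<gamma> (KC \<gamma> (x_gen (ht D \<gamma>) * e_gen \<nu>)) 0) = mon \<delta> (KC \<delta> (x_gen (ht D \<delta>) * Rt.E \<nu>)) 0"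
        using 2 emb_x_e[OF 2(2), of "ht D \<gamma>"] htd
        by (simp add: mp_mon KC_closed free_carrier_mult e_FC last_x_FC)
      moreover have "mp (mon \<gamma> (KC \<gamma> (e_gen \<nu>)) 1) = mon \<delta> (KC \<delta> (Rt.E \<nu>)) (Suc 0)"
        using 2 by (simp add: mp_mon KC_closed e_FC emb_e)
      ultimately have "RC \<delta> (mp (mon \<gamma> (KC \<gamma> (x_gen (ht D \<gamma>) * e_gen \<nu>)) 0)) = RC \<delta> (mp (mon \<gamma> (KC \<gamma> (e_gen \<nu>)) 1))"
        using x RC_monom_Suc[OF KC_closed[OF Rt.E_FC[OF 2(2)]], of 0] by (simp add: Rz_of_klr_def)
      then show ?thesis
        unfolding 2(1) using rr.minus[of "mon \<gamma> (KC \<gamma> (x_gen (ht D \<gamma>) * e_gen \<nu>)) 0" "mon \<gamma> (KC \<gamma> (e_gen \<nu>)) 1"]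
          c RC_closed[OF mp_closed[OF c(2)]] by (simp add: KP_minus RR.minus_self)
    qed
    then show "p \<in> ?J" using pc by simp
  qed
  ultimately have "p \<in> ?J" using CI_minimal assms by blast
  then show ?thesis using RC_zero_iff[OF mp_closed[of p]] by simp
qed

definition rgt :: "('i, 'k) rz \<Rightarrow> ('i, 'k) rz" where
  "rgt Y = (\<Union>p\<in>Y. RC \<delta> (\<lambda>n. klr_right D Q \<beta> \<gamma> (p n)))"

text \<open>The union over representatives is a single class because \<open>mp\<close> respects the
  cyclotomic ideals.\<close>

lemma rgt_RC: assumes "p \<in> carrier (UK \<gamma>)" shows "rgt (RC \<gamma> p) = RC \<delta> (mp p)"
proof -
  interpret KG: ring "KP \<gamma>" by (rule KP_ring)
  interpret rr: additive_map "KP \<gamma>" "RA \<delta>" "\<lambda>p. RC \<delta> (mp p)" by (rule RC_mp_additive)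
  have "RC \<delta> (\<lambda>n. klr_right D Q \<beta> \<gamma> (q n)) = RC \<delta> (mp p)" if "q \<in> RC \<gamma> p" for q
  proof -
    have q: "q \<in> carrier (UK \<gamma>)" "q \<ominus>\<^bsub>UK \<gamma>\<^esub> p \<in> CI \<gamma>" using RC_memD[OF assms that] by auto
    have "RC \<delta> (mp (q \<ominus>\<^bsub>KP \<gamma>\<^esub> p)) = \<zero>\<^bsub>RA \<delta>\<^esub>"
      using RC_KI[OF mp_CI[OF q(2)]] by (simp add: KP_minus q assms)
    then have "RC \<delta> (mp q) = RC \<delta> (mp p)"
      using rr.minus[of q p] q assms rr.N.minus_eq_zero[of "RC \<delta> (mp q)" "RC \<delta> (mp p)"]
      by (simp add: RC_closed mp_closed)
    moreover have "(\<lambda>n. klr_right D Q \<beta> \<gamma> (q n)) = mp q" by (rule ext) (simp add: mp_def klr_right_eq)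
    ultimately show ?thesis by simp
  qed
  then show ?thesis unfolding rgt_def using RC_mem[OF assms] by blast
qed

definition lft :: "('i, 'k) klr_free set \<Rightarrow> ('i, 'k) rz" where
  "lft y = RK \<delta> (klr_left D Q \<beta> \<gamma> y)"

text \<open>Identifies the data of \<open>F_div\<close> with the abstract situation: R(\<beta>) and
  \<open>R_z\<close> at \<gamma> act on the right of \<open>R_z\<close> at \<beta> + \<gamma>, cut
  down by the idempotent e(\<beta>, \<gamma>). The common unit image is this idempotent, whichever
  of the two embeddings is used.\<close>

sublocale tensor_ctx "KA \<beta>" "RA \<gamma>" "RA \<delta>" lft rgt "RK \<delta> (klr_idem D Q \<beta> \<gamma>)"
proof (intro tensor_ctx.intro KA_gring RA_gring tensor_ctx_axioms.intro)
  interpret KB: ring "KA \<beta>" by (rule KA_ring)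
  interpret KP\<gamma>: ring "KP \<gamma>" by (rule KP_ring)
  note l = lft_def klr_left_eq
  fix a a' d
  show "a \<in> carrier (KA \<beta>) \<Longrightarrow> lft a \<in> carrier (RA \<delta>)" by (simp add: l RK_closed Lf.emb_closed)
  show "a \<in> carrier (KA \<beta>) \<Longrightarrow> a' \<in> carrier (KA \<beta>) \<Longrightarrow> lft (a \<oplus>\<^bsub>KA \<beta>\<^esub> a') = lft a \<oplus>\<^bsub>RA \<delta>\<^esub> lft a'"
    by (simp add: l RK_add Lf.emb_closed Lf.emb_add)
  show "a \<in> carrier (KA \<beta>) \<Longrightarrow> a' \<in> carrier (KA \<beta>) \<Longrightarrow> lft (a \<otimes>\<^bsub>KA \<beta>\<^esub> a') = lft a \<otimes>\<^bsub>RA \<delta>\<^esub> lft a'"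
    by (simp add: l RK_mult Lf.emb_closed Lf.emb_mult)
  show "lft \<one>\<^bsub>KA \<beta>\<^esub> = RK \<delta> (klr_idem D Q \<beta> \<gamma>)" by (simp add: l Lf.emb_one klr_idem_eq)
  show "a \<in> homog (KA \<beta>) d \<Longrightarrow> lft a \<in> homog (RA \<delta>) d" by (simp add: l RK_homog Lf.emb_homog)
  fix b b' 
  show "b \<in> carrier (RA \<gamma>) \<Longrightarrow> rgt b \<in> carrier (RA \<delta>)"
    by (auto elim!: RA_carrierE simp: rgt_RC RC_closed mp_closed)
  show "b \<in> carrier (RA \<gamma>) \<Longrightarrow> b' \<in> carrier (RA \<gamma>) \<Longrightarrow> rgt (b \<oplus>\<^bsub>RA \<gamma>\<^esub> b') = rgt b \<oplus>\<^bsub>RA \<delta>\<^esub> rgt b'"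
    using KP\<gamma>.a_closed by (auto elim!: RA_carrierE simp: rgt_RC RC_add mp_closed mp_add)
  show "b \<in> carrier (RA \<gamma>) \<Longrightarrow> b' \<in> carrier (RA \<gamma>) \<Longrightarrow> rgt (b \<otimes>\<^bsub>RA \<gamma>\<^esub> b') = rgt b \<otimes>\<^bsub>RA \<delta>\<^esub> rgt b'"
    using KP\<gamma>.m_closed by (auto elim!: RA_carrierE simp: rgt_RC RC_mult mp_closed mp_mult)
  have "\<one>\<^bsub>UK \<gamma>\<^esub> = mon \<gamma> \<one>\<^bsub>KA \<gamma>\<^esub> 0" using UP_ring.monom_one[OF UKr, of \<gamma>] by simp
  moreover have "\<one>\<^bsub>KA \<gamma>\<^esub> \<in> carrier (KA \<gamma>)" by (rule ring.ring_simprules(6)[OF KA_ring])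
  ultimately show "rgt \<one>\<^bsub>RA \<gamma>\<^esub> = RK \<delta> (klr_idem D Q \<beta> \<gamma>)"
    by (simp add: RC_one rgt_RC mon_closed mp_mon Rt.emb_one klr_idem_eq u_eq Rz_of_klr_def)
  show "b \<in> homog (RA \<gamma>) d \<Longrightarrow> rgt b \<in> homog (RA \<delta>) d"
    unfolding RA_homog using Rt.emb_homog by (auto simp: rgt_RC mp_closed mp_def intro!: imageI)
  show "lft a \<otimes>\<^bsub>RA \<delta>\<^esub> rgt b = rgt b \<otimes>\<^bsub>RA \<delta>\<^esub> lft a" if a: "a \<in> carrier (KA \<beta>)" and b: "b \<in> carrier (RA \<gamma>)"
  proof -
    interpret KD: ring "KP \<delta>" by (rule KP_ring)
    note Dl = KD.r_distr[simplified] KD.l_distr[simplified]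
    obtain p where p: "p \<in> carrier (UK \<gamma>)" "b = RC \<gamma> p" using b by (rule RA_carrierE)
    have ea: "Lf.emb a \<in> carrier (KA \<delta>)" by (rule Lf.emb_closed[OF a])
    have "mon \<delta> (Lf.emb a) 0 \<otimes>\<^bsub>UK \<delta>\<^esub> mp p = mp p \<otimes>\<^bsub>UK \<delta>\<^esub> mon \<delta> (Lf.emb a) 0"
      using KA_ring p(1)
    proof (induction rule: UP_induct)
      case (monom c n)
      then show ?case using ea emb_comm[OF a] by (simp add: mp_mon mon_mult Rt.emb_closed)
    next
      case (add p q)
      then show ?case using mon_closed[OF ea, of 0] by (simp add: mp_add Dl mp_closed)
    qed
    then show ?thesis
      using p ea by (simp add: l rgt_RC Rz_of_klr_def RC_mult mon_closed mp_closed)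
  qed
  show "RK \<delta> (klr_idem D Q \<beta> \<gamma>) \<in> homog (RA \<delta>) 0"
    unfolding klr_idem_eq Lf.emb_one[symmetric] by (rule RK_homog[OF Lf.emb_homog[OF one_homog]])
qed

end

section \<open>The lifting property along a reduced word\<close>

lemma (in rdatum) coroot_refl_nonneg:
  assumes "reduced (k # ks)"
  shows "coroot D k (refl_word D ks (fund D i)) \<ge> 0"
proof (rule reduced_coroot_nonneg[OF assms])
  have "coroot D j (fund D i) = (if i = j then 1 else 0)" for j
    using D unfolding is_root_datum_def by blast
  then show "coroot D j (fund D i) \<ge> 0" for j by simp
qed

context rz
begin

text \<open>Nonnegativity of the coroot value makes \<open>int\<close> undo \<open>nat\<close>, so
  the weight really drops by the multiple of the simple root that occurs in the divided power. For
  reduced words it is provided by \<open>coroot_refl_nonneg\<close>.\<close>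

lemma word_defect_Cons:
  assumes "coroot D k (refl_word D ks (fund D i)) \<ge> 0"
  defines "a \<equiv> nat (coroot D k (refl_word D ks (fund D i)))"
  shows "word_defect D i (k # ks) = zscale (int a) (sroot D k) + word_defect D i ks"
  using assms by (simp add: word_defect_def simple_refl_def)

lemma seqs_zscale: "seqs D (zscale (int a) (sroot D k)) \<noteq> {}"
proof -
  have "replicate a k \<in> seqs D (zscale (int a) (sroot D k))"
    by (induction a) (simp_all add: seqs_def zscale_add_left)
  then show ?thesis by blast
qed

text \<open>Having a sequence is how membership in the positive cone of the root lattice is
  expressed. Each reflection adds a nonnegative multiple of a simple root.\<close>

lemma seqs_word_defect: "reduced ks \<Longrightarrow> seqs D (word_defect D i ks) \<noteq> {}"
proof (induction ks)
  case Nil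
  have "[] \<in> seqs D (word_defect D i [])" by (simp add: seqs_def word_defect_def)
  then show ?case by blast
next
  case (Cons k ks)
  then have "seqs D (word_defect D i ks) \<noteq> {}" using reduced_appendD(2)[of "[k]" ks] by simp
  then show ?case
    using word_defect_Cons[OF coroot_refl_nonneg[OF Cons.prems]] seqs_zscale seqs_append
    by (metis ex_in_conv)
qed

text \<open>The module is free on the element m of degree 0 that corresponds to the unit, so a map
  out of it is lifted by choosing a degree 0 preimage u of the image of m.\<close>

lemma regular_lifts:
  assumes M: "graded_module (RA \<gamma>) M" and iso: "graded_isomorphic (RA \<gamma>) M (regular_module (RA \<gamma>))"
    and U: "graded_module (RA \<gamma>) U" and V: "graded_module (RA \<gamma>) V"
  shows "lifts (RA \<gamma>) M U V"
  unfolding lifts_def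
proof (intro allI impI, elim conjE)
  fix g f assume g: "g \<in> graded_hom (RA \<gamma>) U V" and surj: "g ` carrier U = carrier V" and f: "f \<in> graded_hom (RA \<gamma>) M V"
  interpret M: gmodule "RA \<gamma>" M by (rule gmoduleI[OF M])
  interpret U: gmodule "RA \<gamma>" U by (rule gmoduleI[OF U])
  interpret V: gmodule "RA \<gamma>" V by (rule gmoduleI[OF V])
  interpret RR: gring "RA \<gamma>" by (rule RA_gring)
  let ?R = "regular_module (RA \<gamma>)"
  obtain \<psi> where \<psi>: "\<psi> \<in> graded_hom (RA \<gamma>) M ?R" "bij_betw \<psi> (carrier M) (carrier (RA \<gamma>))"
    "\<And>d. \<psi> ` homog M d = homog (RA \<gamma>) d"
    using iso unfolding graded_isomorphic_def by (auto simp: regular_module_def)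
  have one: "\<one>\<^bsub>RA \<gamma>\<^esub> \<in> homog (RA \<gamma>) 0" using RK_homog[OF one_homog] by (simp add: RK_one)
  then obtain m where m: "m \<in> homog M 0" "\<psi> m = \<one>\<^bsub>RA \<gamma>\<^esub>" using \<psi>(3)[of 0] by (metis imageE)
  have mc: "m \<in> carrier M" by (rule M.homog_closed[OF m(1)])
  have \<psi>c: "\<psi> x \<in> carrier (RA \<gamma>)" if "x \<in> carrier M" for x
    using graded_homD(1)[OF \<psi>(1) that] by (simp add: regular_module_def)
  have rep: "\<psi> x \<odot>\<^bsub>M\<^esub> m = x" if "x \<in> carrier M" for x
  proof -
    have "\<psi> (\<psi> x \<odot>\<^bsub>M\<^esub> m) = \<psi> x"
      using graded_homD(4)[OF \<psi>(1) \<psi>c[OF that] mc] m(2) \<psi>c[OF that] by (simp add: regular_module_def)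
    then show ?thesis
      using \<psi>(2) M.smult_closed[OF \<psi>c[OF that] mc] that by (auto simp: bij_betw_def dest: inj_onD)
  qed
  obtain u where u: "u \<in> homog U 0" "g u = f m"
    using graded_hom_lift_homog[OF U.gg V.gg g surj graded_homD(5)[OF f m(1)]] by blast
  have uc: "u \<in> carrier U" by (rule U.homog_closed[OF u(1)])
  have "(\<lambda>x\<in>carrier M. \<psi> x \<odot>\<^bsub>U\<^esub> u) \<in> graded_hom (RA \<gamma>) M U"
  proof (rule graded_homI)
    fix d x assume x: "x \<in> homog M d"
    have "\<psi> x \<in> homog (RA \<gamma>) d" using \<psi>(3) x by blast
    then show "(\<lambda>x\<in>carrier M. \<psi> x \<odot>\<^bsub>U\<^esub> u) x \<in> homog U d"
      using U.smult_homog[OF _ u(1)] M.homog_closed[OF x] by fastforce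
  next
    fix x y assume xy: "x \<in> carrier M" "y \<in> carrier M"
    have "\<psi> (x \<oplus>\<^bsub>M\<^esub> y) = \<psi> x \<oplus>\<^bsub>RA \<gamma>\<^esub> \<psi> y"
      using graded_homD(3)[OF \<psi>(1) xy] by (simp add: regular_module_def)
    then show "(\<lambda>x\<in>carrier M. \<psi> x \<odot>\<^bsub>U\<^esub> u) (x \<oplus>\<^bsub>M\<^esub> y)
        = (\<lambda>x\<in>carrier M. \<psi> x \<odot>\<^bsub>U\<^esub> u) x \<oplus>\<^bsub>U\<^esub> (\<lambda>x\<in>carrier M. \<psi> x \<odot>\<^bsub>U\<^esub> u) y"
      using xy U.smult_l_distr[OF \<psi>c[OF xy(1)] \<psi>c[OF xy(2)] uc] by simp
  next
    fix a x assume ax: "a \<in> carrier (RA \<gamma>)" "x \<in> carrier M"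
    have "\<psi> (a \<odot>\<^bsub>M\<^esub> x) = a \<otimes>\<^bsub>RA \<gamma>\<^esub> \<psi> x"
      using graded_homD(4)[OF \<psi>(1) ax] by (simp add: regular_module_def)
    then show "(\<lambda>x\<in>carrier M. \<psi> x \<odot>\<^bsub>U\<^esub> u) (a \<odot>\<^bsub>M\<^esub> x) = a \<odot>\<^bsub>U\<^esub> (\<lambda>x\<in>carrier M. \<psi> x \<odot>\<^bsub>U\<^esub> u) x"
      using ax U.smult_assoc1[OF ax(1) \<psi>c[OF ax(2)] uc] M.smult_closed[OF ax] by simp
  qed (simp_all add: \<psi>c uc U.smult_closed)
  moreover have "g (\<psi> x \<odot>\<^bsub>U\<^esub> u) = f x" if "x \<in> carrier M" for x
    using graded_homD(4)[OF g \<psi>c[OF that] uc] graded_homD(4)[OF f \<psi>c[OF that] mc] u(2) rep[OF that] by simp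
  ultimately show "\<exists>h\<in>graded_hom (RA \<gamma>) M U. \<forall>x\<in>carrier M. g (h x) = f x"
    by (intro bexI[of _ "\<lambda>x\<in>carrier M. \<psi> x \<odot>\<^bsub>U\<^esub> u"]) simp_all
qed

text \<open>At each letter the test modules for the shorter word are shifted corners of U and V.
  These live on the same types as U and V, so the induction hypothesis applies with the types fixed;
  modules of functions occur only when P is tested.\<close>

theorem det_hat_lifts:
  fixes P :: "'i \<Rightarrow> nat \<Rightarrow> (('i, 'k) klr_free set, 'c) graded"
    and U :: "(('i, 'k) rz, 'u) graded" and V :: "(('i, 'k) rz, 'v) graded"
  assumes P: "\<And>j n. graded_projective (KA (zscale (int n) (sroot D j))) (P j n)"
    and M: "det_hat D Q P i ks M" and red: "reduced ks"
    and U: "graded_module (RA (word_defect D i ks)) U" and V: "graded_module (RA (word_defect D i ks)) V"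
  shows "graded_module (RA (word_defect D i ks)) M \<and> lifts (RA (word_defect D i ks)) M U V"
  using M red U V
proof (induction arbitrary: U V rule: det_hat.induct)
  case (Nil M)
  have "word_defect D i [] = 0" by (simp add: word_defect_def)
  then show ?case using Nil regular_lifts by simp
next
  case (Cons ks M a k Y)
  have red: "reduced ks" using reduced_appendD(2)[of "[k]" ks] Cons.prems(1) by simp
  let ?\<beta> = "zscale (int a) (sroot D k)" and ?\<gamma> = "word_defect D i ks"
  have wd: "word_defect D i (k # ks) = ?\<beta> + ?\<gamma>"
    using word_defect_Cons[OF coroot_refl_nonneg[OF Cons.prems(1)]] Cons.hyps(2) by simp
  interpret klr_pair D Q i ?\<beta> ?\<gamma>
    by unfold_locales (rule seqs_zscale, rule seqs_word_defect[OF red])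
  have U: "graded_module (RA (?\<beta> + ?\<gamma>)) U" and V: "graded_module (RA (?\<beta> + ?\<gamma>)) V"
    and Y: "graded_module (RA (?\<beta> + ?\<gamma>)) Y"
    using Cons.prems(2,3) Cons.hyps(3) unfolding wd .
  \<comment> \<open>The induction hypothesis in exactly the form that \<open>tensor_lifts\<close>
    requires: lifting against the corners, in every shift.\<close>
  have IH: "graded_module (RA ?\<gamma>) M"
    "lifts (RA ?\<gamma>) M (graded_shift d (corner (RA (?\<beta> + ?\<gamma>)) e' rgt U)) (graded_shift d (corner (RA (?\<beta> + ?\<gamma>)) e' rgt V))"
    if "e' = RK (?\<beta> + ?\<gamma>) (klr_idem D Q ?\<beta> ?\<gamma>)" for d e'
    using Cons.IH[OF red graded_module_shift[OF corner_B[OF U]] graded_module_shift[OF corner_B[OF V]], of d d] that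
    by simp_all
  \<comment> \<open>The bimodule and the two actions in \<open>F_div\<close> are those of the
    abstract situation, by unfolding.\<close>
  have "F_div D Q i k a ?\<gamma> (P k a) M = tensor_module EE (RA (?\<beta> + ?\<gamma>)) ac (KA ?\<beta>) (RA ?\<gamma>) (P k a) M"
    by (simp add: F_div_def Let_def EE_def lft_def[abs_def] rgt_def[abs_def])
  then have "graded_isomorphic (RA (?\<beta> + ?\<gamma>)) Y (tensor_module EE (RA (?\<beta> + ?\<gamma>)) ac (KA ?\<beta>) (RA ?\<gamma>) (P k a) M)"
    using Cons.hyps(4) unfolding wd by simp
  from tensor_lifts[OF P IH(1)[OF refl] Y this U V IH(2)[OF refl]]
  show ?case unfolding wd using Y by blast
qed

end


text \<open>A version for maps that are not onto, such as the differentials of a resolution: if some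
  preimage exists, its component of the right degree is one as well.\<close>

lemma graded_hom_homog_preimage:
  assumes M: "graded_group M" and N: "graded_group N" and f: "f \<in> graded_hom A M N"
    and x: "x \<in> carrier M" "f x \<in> homog N d"
  shows "\<exists>u\<in>homog M d. f u = f x"
proof -
  interpret M: ggroup M by unfold_locales fact
  interpret N: ggroup N by unfold_locales fact
  interpret f: additive_map M N f
    by (rule graded_hom_additive[OF f M.abelian_group_axioms N.abelian_group_axioms])
  obtain h where h: "h \<in> homog M d" "x \<ominus>\<^bsub>M\<^esub> h \<in> offdeg M d" using M.component[OF x(1)] by blast
  have hc: "h \<in> carrier M" by (rule M.homog_closed[OF h(1)])
  have "f (x \<ominus>\<^bsub>M\<^esub> h) \<in> offdeg N d"
    using M.Un_homog_subset N.offdeg_subgroup _ h(2)[unfolded offdeg_def]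
  proof (rule f.generate_into)
    fix y assume "y \<in> (\<Union>e\<in>- {d}. homog M e)"
    then obtain e where "e \<noteq> d" "y \<in> homog M e" by auto
    then show "f y \<in> offdeg N d" using N.homog_offdeg[OF graded_homD(5)[OF f]] by simp
  qed
  moreover have "f (x \<ominus>\<^bsub>M\<^esub> h) = f x \<ominus>\<^bsub>N\<^esub> f h" by (rule f.minus[OF x(1) hc])
  ultimately have "f x \<ominus>\<^bsub>N\<^esub> f h = \<zero>\<^bsub>N\<^esub>"
    using N.homog_Int_offdeg N.homog_minus[OF x(2) graded_homD(5)[OF f h(1)]] by simp
  then have "f x = f h" using N.minus_eq_zero f.closed x(1) hc by simp
  then show ?thesis using h(1) by auto
qed

section \<open>Killing idempotents, and the extension of cocycles\<close>

definition ann_submodule :: "('k, 'a) graded \<Rightarrow> ('a, 'm) graded \<Rightarrow> 'a set \<Rightarrow> 'm set" where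
  "ann_submodule A M B = generate (add_monoid M) {a \<odot>\<^bsub>M\<^esub> (b \<odot>\<^bsub>M\<^esub> c) |a b c. a \<in> carrier A \<and> b \<in> B \<and> c \<in> carrier M}"

context gmodule
begin

lemma ann_gens_sub: "B \<subseteq> carrier A \<Longrightarrow>
  {a \<odot>\<^bsub>M\<^esub> (b \<odot>\<^bsub>M\<^esub> c) |a b c. a \<in> carrier A \<and> b \<in> B \<and> c \<in> carrier M} \<subseteq> carrier M"
  using smult_closed by blast

lemma ann_subgroup: "B \<subseteq> carrier A \<Longrightarrow> subgroup (ann_submodule A M B) (add_monoid M)"
  unfolding ann_submodule_def by (rule generate_subgroup[OF ann_gens_sub])

lemma ann_gen: "a \<in> carrier A \<Longrightarrow> b \<in> B \<Longrightarrow> c \<in> carrier M \<Longrightarrow> a \<odot>\<^bsub>M\<^esub> (b \<odot>\<^bsub>M\<^esub> c) \<in> ann_submodule A M B"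
  unfolding ann_submodule_def by (rule generate_gen) blast

text \<open>Because B sits in degree 0, a generator a (b c) with homogeneous a and c is homogeneous,
  and by additivity in a and c such generators span.\<close>

lemma graded_submodule_ann:
  assumes A: "gring A" and B: "B \<subseteq> homog A 0"
  shows "graded_submodule A M (ann_submodule A M B)"
proof -
  interpret A: gring A by fact
  let ?J = "ann_submodule A M B" and ?G = "{a \<odot>\<^bsub>M\<^esub> (b \<odot>\<^bsub>M\<^esub> c) |a b c. a \<in> carrier A \<and> b \<in> B \<and> c \<in> carrier M}"
  have Bc: "B \<subseteq> carrier A" using B A.homog_carrier by blast
  note J = ann_subgroup[OF Bc]
  have "a' \<odot>\<^bsub>M\<^esub> j \<in> ?J" if a': "a' \<in> carrier A" and j: "j \<in> ?J" for a' j
  proof -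
    interpret a': additive_map M M "\<lambda>x. a' \<odot>\<^bsub>M\<^esub> x" by (rule smult_additive[OF a'])
    show ?thesis
      using ann_gens_sub[OF Bc] J _ j[unfolded ann_submodule_def]
    proof (rule a'.generate_into)
      fix h assume "h \<in> ?G"
      then obtain a b c where h: "h = a \<odot>\<^bsub>M\<^esub> (b \<odot>\<^bsub>M\<^esub> c)" "a \<in> carrier A" "b \<in> B" "c \<in> carrier M" by blast
      have bc: "b \<odot>\<^bsub>M\<^esub> c \<in> carrier M" using smult_closed Bc h by blast
      have "a' \<odot>\<^bsub>M\<^esub> h = (a' \<otimes>\<^bsub>A\<^esub> a) \<odot>\<^bsub>M\<^esub> (b \<odot>\<^bsub>M\<^esub> c)" using h(1) smult_assoc1[OF a' h(2) bc] by simp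
      then show "a' \<odot>\<^bsub>M\<^esub> h \<in> ?J" using ann_gen[OF R.m_closed[OF a' h(2)] h(3,4)] by simp
    qed
  qed
  moreover have "?J = generate (add_monoid M) (\<Union>d. ?J \<inter> homog M d)" (is "_ = ?K")
  proof
    have sub: "(\<Union>d. ?J \<inter> homog M d) \<subseteq> carrier M" using homog_closed by blast
    note K = generate_subgroup[OF sub]
    show "?K \<subseteq> ?J" by (rule generate_least[OF J]) blast
    have "?G \<subseteq> ?K"
    proof
      fix h assume "h \<in> ?G"
      then obtain a b c where h: "h = a \<odot>\<^bsub>M\<^esub> (b \<odot>\<^bsub>M\<^esub> c)" "a \<in> carrier A" "b \<in> B" "c \<in> carrier M" by blast
      have b: "b \<in> carrier A" "b \<in> homog A 0" using h(3) Bc B by auto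
      have "a \<odot>\<^bsub>M\<^esub> (b \<odot>\<^bsub>M\<^esub> c) \<in> ?K" using h(4)
      proof (induction c rule: induct)
        case (homog e c)
        have c: "c \<in> carrier M" by (rule homog_closed[OF homog])
        have bc: "b \<odot>\<^bsub>M\<^esub> c \<in> carrier M" by (rule smult_closed[OF b(1) c])
        show ?case using h(2)
        proof (induction a rule: A.span_induct)
          case (homog d a)
          have "a \<odot>\<^bsub>M\<^esub> (b \<odot>\<^bsub>M\<^esub> c) \<in> homog M (d + (0 + e))"
            by (intro smult_homog homog b \<open>c \<in> homog M e\<close>)
          then show ?case using ann_gen[OF A.homog_carrier[OF homog] h(3) c] by (intro generate_gen) blast
        next
          case (add x y)
          then show ?case using subgroup_add_closed[OF K] bc by (simp add: smult_l_distr)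
        next
          case (neg x)
          then show ?case using subgroup_neg[OF K] bc by (simp add: smult_l_neg)
        next
          case zero
          show ?case using subgroup_zero[OF K] bc by (simp add: smult_l_zero)
        qed
      next
        case (add x y)
        have "a \<odot>\<^bsub>M\<^esub> (b \<odot>\<^bsub>M\<^esub> (x \<oplus>\<^bsub>M\<^esub> y)) = a \<odot>\<^bsub>M\<^esub> (b \<odot>\<^bsub>M\<^esub> x) \<oplus>\<^bsub>M\<^esub> a \<odot>\<^bsub>M\<^esub> (b \<odot>\<^bsub>M\<^esub> y)"
          using add(1,2) h(2) b(1) by (simp add: smult_r_distr smult_closed)
        then show ?case using subgroup_add_closed[OF K] add by simp
      qed
      then show "h \<in> ?K" using h(1) by simp
    qed
    then show "?J \<subseteq> ?K" unfolding ann_submodule_def by (rule generate_least[OF K[unfolded ann_submodule_def]])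
  qed
  ultimately show ?thesis using J unfolding graded_submodule_def by blast
qed

end

lemma quot_hom:
  assumes A: "gring A" and M: "graded_module A M" and J: "graded_submodule A M J"
  shows "(\<lambda>m\<in>carrier M. J +>\<^bsub>M\<^esub> m) \<in> graded_hom A M (quot M J)"
    and "a \<in> carrier A \<Longrightarrow> m \<in> carrier M \<Longrightarrow> a \<odot>\<^bsub>quot M J\<^esub> (J +>\<^bsub>M\<^esub> m) = J +>\<^bsub>M\<^esub> (a \<odot>\<^bsub>M\<^esub> m)"
proof -
  interpret gmodule A M by (rule gmoduleI[OF M])
  have J': "subgroup J (add_monoid M)" "\<And>a n. a \<in> carrier A \<Longrightarrow> n \<in> J \<Longrightarrow> a \<odot>\<^bsub>M\<^esub> n \<in> J"
    using J by (auto simp: graded_submodule_def)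
  interpret ag_quot M J by (intro ag_quot.intro ag_quot_axioms.intro abelian_group_axioms J')
  show sm: "a \<odot>\<^bsub>quot M J\<^esub> cl m = cl (a \<odot>\<^bsub>M\<^esub> m)" if "a \<in> carrier A" "m \<in> carrier M" for a m
    using quot_smult[OF that(2) smult_additive[OF that(1)] J'(2)[OF that(1)]] .
  show "(\<lambda>m\<in>carrier M. cl m) \<in> graded_hom A M (quot M J)"
    by (rule graded_homI) (auto simp: quot_carrier quot_add sm smult_closed quot_homog homog_closed)
qed

lemma quot_hom_factor:
  assumes A: "gring A" and M: "graded_module A M" and N: "graded_module A N" and J: "graded_submodule A M J"
    and f: "f \<in> graded_hom A M N" and fJ: "\<And>j. j \<in> J \<Longrightarrow> f j = \<zero>\<^bsub>N\<^esub>"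
  shows "\<exists>g\<in>graded_hom A (quot M J) N. \<forall>m\<in>carrier M. g (J +>\<^bsub>M\<^esub> m) = f m"
proof -
  interpret gmodule A M by (rule gmoduleI[OF M])
  interpret N: gmodule A N by (rule gmoduleI[OF N])
  have J': "subgroup J (add_monoid M)" using J by (simp add: graded_submodule_def)
  interpret ag_quot M J by (intro ag_quot.intro ag_quot_axioms.intro abelian_group_axioms J')
  interpret f: additive_map M N f
    by (rule graded_hom_additive[OF f abelian_group_axioms N.abelian_group_axioms])
  define g where "g = (\<lambda>C\<in>carrier (quot M J). f (SOME c. c \<in> C))"
  have g: "g (cl m) = f m" if m: "m \<in> carrier M" for m
  proof -
    have "(SOME c. c \<in> cl m) \<in> cl m" using cl_self[OF m] by (rule someI)
    then have c: "(SOME c. c \<in> cl m) \<in> carrier M" "(SOME c. c \<in> cl m) \<ominus>\<^bsub>M\<^esub> m \<in> J"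
      using cl_subset[OF m] mem_cl_iff[OF m] by auto
    have "f (SOME c. c \<in> cl m) = f m"
      using fJ[OF c(2)] f.minus[OF c(1) m] N.minus_eq_zero f.closed c(1) m by simp
    then show ?thesis using m by (simp add: g_def quot_carrier)
  qed
  have "g \<in> graded_hom A (quot M J) N"
  proof (rule graded_homI)
    show "x \<notin> carrier (quot M J) \<Longrightarrow> g x = undefined" for x by (simp add: g_def)
  qed (auto elim!: quot_carrierE simp: g f.closed quot_add f.add quot_hom(2)[OF A M J] smult_closed
      graded_homD(4)[OF f] quot_homog homog_closed graded_homD(5)[OF f])
  then show ?thesis using g by blast
qed

text \<open>A cocycle \<open>f\<close> vanishes on the preimage of the part \<open>J\<close> generated by idempotents \<open>b\<close> that kill
  the coefficients, so it extends along any section of \<open>\<epsilon>\<close> that is linear modulo \<open>J\<close>.\<close>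

lemma extend_cocycle:
  fixes M :: "('a, 'm) graded" and h :: "'m \<Rightarrow> 'c set"
  assumes A: "gring A" and C0: "graded_module A C0" and C1: "graded_module A C1"
    and M: "graded_module A M" and N: "graded_module A N"
    and \<delta>: "\<delta> \<in> graded_hom A C1 C0" and \<epsilon>: "\<epsilon> \<in> graded_hom A C0 M"
    and ex: "hom_kernel C0 M \<epsilon> = \<delta> ` carrier C1"
    and f: "f \<in> graded_hom A C1 N" and f0: "\<And>y. y \<in> carrier C1 \<Longrightarrow> \<delta> y = \<zero>\<^bsub>C0\<^esub> \<Longrightarrow> f y = \<zero>\<^bsub>N\<^esub>"
    and B: "B \<subseteq> homog A 0" and idem: "\<And>b. b \<in> B \<Longrightarrow> b \<otimes>\<^bsub>A\<^esub> b = b"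
    and BM: "\<And>b m. b \<in> B \<Longrightarrow> m \<in> carrier M \<Longrightarrow> b \<odot>\<^bsub>M\<^esub> m = \<zero>\<^bsub>M\<^esub>"
    and BN: "\<And>b n. b \<in> B \<Longrightarrow> n \<in> carrier N \<Longrightarrow> b \<odot>\<^bsub>N\<^esub> n = \<zero>\<^bsub>N\<^esub>"
    and h: "h \<in> graded_hom A M (quot C0 (ann_submodule A C0 B))"
    and \<epsilon>h: "\<And>m s. m \<in> carrier M \<Longrightarrow> s \<in> h m \<Longrightarrow> \<epsilon> s = m"
  shows "\<exists>g\<in>graded_hom A C0 N. \<forall>y\<in>carrier C1. g (\<delta> y) = f y"
proof -
  let ?J = "ann_submodule A C0 B"
  interpret A: gring A by fact
  interpret C0: gmodule A C0 by (rule gmoduleI[OF C0])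
  interpret C1: gmodule A C1 by (rule gmoduleI[OF C1])
  interpret M: gmodule A M by (rule gmoduleI[OF M])
  interpret N: gmodule A N by (rule gmoduleI[OF N])
  have Bc: "b \<in> carrier A" if "b \<in> B" for b using B that A.homog_carrier by blast
  then have Bs: "B \<subseteq> carrier A" by blast
  note J = C0.ann_subgroup[OF Bs] and Jg = C0.graded_submodule_ann[OF A B]
  interpret ag_quot C0 ?J by (intro ag_quot.intro ag_quot_axioms.intro C0.abelian_group_axioms J)
  interpret d: additive_map C1 C0 \<delta>
    by (rule graded_hom_additive[OF \<delta> C1.abelian_group_axioms C0.abelian_group_axioms])
  interpret e: additive_map C0 M \<epsilon>
    by (rule graded_hom_additive[OF \<epsilon> C0.abelian_group_axioms M.abelian_group_axioms])
  interpret f: additive_map C1 N f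
    by (rule graded_hom_additive[OF f C1.abelian_group_axioms N.abelian_group_axioms])
  have ker: "\<exists>y\<in>carrier C1. \<delta> y = c" if "c \<in> carrier C0" "\<epsilon> c = \<zero>\<^bsub>M\<^esub>" for c
  proof -
    have "c \<in> \<delta> ` carrier C1" unfolding ex[symmetric] using that by (simp add: hom_kernel_def)
    then show ?thesis by auto
  qed
  have f_eq: "f y = f y'" if "y \<in> carrier C1" "y' \<in> carrier C1" "\<delta> y = \<delta> y'" for y y'
  proof -
    have "\<delta> (y \<ominus>\<^bsub>C1\<^esub> y') = \<zero>\<^bsub>C0\<^esub>" using that by (simp add: d.minus C0.minus_self d.closed)
    then have "f y \<ominus>\<^bsub>N\<^esub> f y' = \<zero>\<^bsub>N\<^esub>" using f0[of "y \<ominus>\<^bsub>C1\<^esub> y'"] that by (simp add: f.minus)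
    then show ?thesis using N.minus_eq_zero that f.closed by simp
  qed
  \<comment> \<open>For a generator a (b c): b kills M, so b c lies in the kernel of \<epsilon> and
    equals \<delta> y for some y. Replacing y by b y keeps the image, as b is idempotent, and makes
    f vanish, as b kills N.\<close>
  have J_lift: "\<exists>y\<in>carrier C1. \<delta> y = j \<and> f y = \<zero>\<^bsub>N\<^esub>" if "j \<in> ?J" for j
    using that[unfolded ann_submodule_def] C0.ann_gens_sub[OF Bs]
  proof (induction j rule: C0.generate_induct)
    case zero
    show ?case using d.zero f.zero by (intro bexI[of _ "\<zero>\<^bsub>C1\<^esub>"]) auto
  next
    case (gen j)
    then obtain a b c where j: "j = a \<odot>\<^bsub>C0\<^esub> (b \<odot>\<^bsub>C0\<^esub> c)" "a \<in> carrier A" "b \<in> B" "c \<in> carrier C0" by blast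
    note b = Bc[OF j(3)]
    have bc: "b \<odot>\<^bsub>C0\<^esub> c \<in> carrier C0" by (rule C0.smult_closed[OF b j(4)])
    have "\<epsilon> (b \<odot>\<^bsub>C0\<^esub> c) = \<zero>\<^bsub>M\<^esub>" using graded_homD(4)[OF \<epsilon> b j(4)] BM[OF j(3) e.closed[OF j(4)]] by simp
    then obtain y where y: "y \<in> carrier C1" "\<delta> y = b \<odot>\<^bsub>C0\<^esub> c" using ker bc by blast
    have yb: "b \<odot>\<^bsub>C1\<^esub> y \<in> carrier C1" by (rule C1.smult_closed[OF b y(1)])
    let ?y = "a \<odot>\<^bsub>C1\<^esub> (b \<odot>\<^bsub>C1\<^esub> y)"
    have yc: "?y \<in> carrier C1" by (rule C1.smult_closed[OF j(2) yb])
    have dy: "\<delta> ?y = j"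
      using graded_homD(4)[OF \<delta> j(2) yb] graded_homD(4)[OF \<delta> b y(1)] y(2) C0.smult_assoc1[OF b b j(4)] idem[OF j(3)] j(1)
      by simp
    have fy: "f ?y = \<zero>\<^bsub>N\<^esub>"
      using graded_homD(4)[OF f j(2) yb] graded_homD(4)[OF f b y(1)] BN[OF j(3) f.closed[OF y(1)]] N.smult_zero[OF j(2)]
      by simp
    have "\<delta> (\<ominus>\<^bsub>C1\<^esub> ?y) = \<ominus>\<^bsub>C0\<^esub> j" "f (\<ominus>\<^bsub>C1\<^esub> ?y) = \<zero>\<^bsub>N\<^esub>" using d.neg[OF yc] f.neg[OF yc] dy fy by simp_all
    then show ?case using yc dy fy C1.a_inv_closed[OF yc] by blast
  next
    case (add x y)
    then obtain u v where "u \<in> carrier C1" "\<delta> u = x" "f u = \<zero>\<^bsub>N\<^esub>" "v \<in> carrier C1" "\<delta> v = y" "f v = \<zero>\<^bsub>N\<^esub>" by blast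
    then show ?case using d.add f.add by (intro bexI[of _ "u \<oplus>\<^bsub>C1\<^esub> v"]) auto
  qed
  \<comment> \<open>c is split as \<delta> y + s, where s represents the class h(\<epsilon> c). The
    extension is to send c to f y, so that it vanishes on the part coming from the section.\<close>
  define rel where "rel c s y \<longleftrightarrow> s \<in> carrier C0 \<and> s \<in> h (\<epsilon> c) \<and> y \<in> carrier C1 \<and> c = \<delta> y \<oplus>\<^bsub>C0\<^esub> s" for c s y
  have hcl: "\<exists>s\<in>carrier C0. h m = cl s" if "m \<in> carrier M" for m
    using graded_homD(1)[OF h that] by (auto simp: quot_carrier)
  have h_mem: "s \<in> h m \<longleftrightarrow> h m = cl s" if m: "m \<in> carrier M" and s: "s \<in> carrier C0" for m s
  proof -
    obtain t where t: "t \<in> carrier C0" "h m = cl t" using hcl[OF m] by blast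
    show ?thesis using t(2) mem_cl_iff[OF t(1) s] cl_eq_iff[OF s t(1)] by auto
  qed
  have ex_rel: "\<exists>y. rel c s y" if c: "c \<in> carrier C0" and s: "s \<in> carrier C0" "s \<in> h (\<epsilon> c)" for c s
  proof -
    have "\<epsilon> (c \<ominus>\<^bsub>C0\<^esub> s) = \<zero>\<^bsub>M\<^esub>"
      using e.minus[OF c s(1)] \<epsilon>h[OF e.closed[OF c] s(2)] M.minus_self[OF e.closed[OF c]] by simp
    then obtain y where "y \<in> carrier C1" "\<delta> y = c \<ominus>\<^bsub>C0\<^esub> s" using ker c s by (metis C0.minus_closed)
    then show ?thesis using C0.add_minus_cancel[OF c s(1)] s unfolding rel_def by auto
  qed
  \<comment> \<open>Two choices of s differ by an element of J, so the two values \<delta> y differ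
    by an element of J. By \<open>J_lift\<close> this difference has a preimage on which f vanishes,
    and f depends only on the image under \<delta>.\<close>
  have uniq: "f y = f y'" if c: "c \<in> carrier C0" and r: "rel c s y" "rel c s' y'" for c s s' y y'
  proof -
    have s: "s \<in> carrier C0" "s' \<in> carrier C0" "y \<in> carrier C1" "y' \<in> carrier C1" "c = \<delta> y \<oplus>\<^bsub>C0\<^esub> s" "c = \<delta> y' \<oplus>\<^bsub>C0\<^esub> s'"
      "s \<in> h (\<epsilon> c)" "s' \<in> h (\<epsilon> c)"
      using r unfolding rel_def by auto
    have "s' \<ominus>\<^bsub>C0\<^esub> s \<in> ?J" using h_mem[OF e.closed[OF c]] s cl_eq_iff by metis
    moreover have "\<delta> y \<ominus>\<^bsub>C0\<^esub> \<delta> y' = s' \<ominus>\<^bsub>C0\<^esub> s"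
    proof -
      have dc: "\<delta> y \<in> carrier C0" "\<delta> y' \<in> carrier C0" using d.closed s by auto
      have "\<delta> y = (\<delta> y' \<oplus>\<^bsub>C0\<^esub> s') \<ominus>\<^bsub>C0\<^esub> s"
        using s(5,6) dc s(1,2) by (metis C0.a_assoc C0.minus_eq C0.r_neg C0.r_zero C0.a_inv_closed)
      then have "\<delta> y = (s' \<ominus>\<^bsub>C0\<^esub> s) \<oplus>\<^bsub>C0\<^esub> \<delta> y'" using dc s(1,2) by (simp add: C0.minus_eq C0.a_ac)
      then show ?thesis using dc s(1,2) by (simp add: C0.minus_eq C0.a_assoc C0.r_neg)
    qed
    ultimately obtain w where w: "w \<in> carrier C1" "\<delta> w = \<delta> y \<ominus>\<^bsub>C0\<^esub> \<delta> y'" "f w = \<zero>\<^bsub>N\<^esub>" using J_lift by metis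
    have "f (y \<ominus>\<^bsub>C1\<^esub> y') = f w" using f_eq[of "y \<ominus>\<^bsub>C1\<^esub> y'" w] w s(3,4) by (simp add: d.minus)
    then show ?thesis using w(3) f.minus[OF s(3,4)] N.minus_eq_zero f.closed s(3,4) by simp
  qed
  have tot: "\<exists>s y. rel c s y" if c: "c \<in> carrier C0" for c
  proof -
    obtain s where s: "s \<in> carrier C0" "h (\<epsilon> c) = cl s" using hcl[OF e.closed[OF c]] by blast
    then have "s \<in> h (\<epsilon> c)" using cl_self[OF s(1)] by simp
    from ex_rel[OF c s(1) this] show ?thesis by blast
  qed
  define g where "g = (\<lambda>c\<in>carrier C0. f (SOME y. \<exists>s. rel c s y))"
  have g: "g c = f y" if c: "c \<in> carrier C0" and r: "rel c s y" for c s y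
  proof -
    have "\<exists>s. rel c s (SOME y. \<exists>s. rel c s y)" by (rule someI_ex) (use r in blast)
    then show ?thesis using uniq[OF c _ r] c by (auto simp: g_def)
  qed
  have "g \<in> graded_hom A C0 N"
  proof (rule graded_homI)
    fix c assume c: "c \<in> carrier C0"
    then obtain s y where r: "rel c s y" using tot by blast
    then have "y \<in> carrier C1" by (simp add: rel_def)
    then show "g c \<in> carrier N" using g[OF c r] f.closed by simp
  next
    show "c \<notin> carrier C0 \<Longrightarrow> g c = undefined" for c by (simp add: g_def)
  next
    fix c c' assume c: "c \<in> carrier C0" "c' \<in> carrier C0"
    then obtain s y s' y' where r: "rel c s y" "rel c' s' y'" using tot by blast
    then have s: "s \<in> carrier C0" "s' \<in> carrier C0" "y \<in> carrier C1" "y' \<in> carrier C1" "c = \<delta> y \<oplus>\<^bsub>C0\<^esub> s" "c' = \<delta> y' \<oplus>\<^bsub>C0\<^esub> s'"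
      "h (\<epsilon> c) = cl s" "h (\<epsilon> c') = cl s'"
      using h_mem e.closed c unfolding rel_def by auto
    have "h (\<epsilon> (c \<oplus>\<^bsub>C0\<^esub> c')) = cl (s \<oplus>\<^bsub>C0\<^esub> s')"
      using graded_homD(3)[OF h e.closed[OF c(1)] e.closed[OF c(2)]] e.add[OF c] s quot_add by simp
    moreover have "c \<oplus>\<^bsub>C0\<^esub> c' = \<delta> (y \<oplus>\<^bsub>C1\<^esub> y') \<oplus>\<^bsub>C0\<^esub> (s \<oplus>\<^bsub>C0\<^esub> s')"
      using s d.closed by (simp add: d.add C0.a_ac)
    ultimately have "rel (c \<oplus>\<^bsub>C0\<^esub> c') (s \<oplus>\<^bsub>C0\<^esub> s') (y \<oplus>\<^bsub>C1\<^esub> y')"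
      unfolding rel_def using s(1-4) cl_self by simp
    then have "g (c \<oplus>\<^bsub>C0\<^esub> c') = f (y \<oplus>\<^bsub>C1\<^esub> y')" by (rule g[OF C0.a_closed[OF c]])
    then show "g (c \<oplus>\<^bsub>C0\<^esub> c') = g c \<oplus>\<^bsub>N\<^esub> g c'" using g[OF c(1) r(1)] g[OF c(2) r(2)] f.add[OF s(3,4)] by simp
  next
    fix a c assume a: "a \<in> carrier A" and c: "c \<in> carrier C0"
    then obtain s y where r: "rel c s y" using tot by blast
    then have s: "s \<in> carrier C0" "y \<in> carrier C1" "c = \<delta> y \<oplus>\<^bsub>C0\<^esub> s" "h (\<epsilon> c) = cl s"
      using h_mem[OF e.closed[OF c]] unfolding rel_def by auto
    have as: "a \<odot>\<^bsub>C0\<^esub> s \<in> carrier C0" "a \<odot>\<^bsub>C1\<^esub> y \<in> carrier C1"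
      using C0.smult_closed[OF a s(1)] C1.smult_closed[OF a s(2)] .
    have "h (\<epsilon> (a \<odot>\<^bsub>C0\<^esub> c)) = cl (a \<odot>\<^bsub>C0\<^esub> s)"
      using graded_homD(4)[OF h a e.closed[OF c]] graded_homD(4)[OF \<epsilon> a c] s(4) quot_hom(2)[OF A C0 Jg a s(1)] by simp
    moreover have "a \<odot>\<^bsub>C0\<^esub> c = \<delta> (a \<odot>\<^bsub>C1\<^esub> y) \<oplus>\<^bsub>C0\<^esub> a \<odot>\<^bsub>C0\<^esub> s"
      using s(3) C0.smult_r_distr[OF a d.closed[OF s(2)] s(1)] graded_homD(4)[OF \<delta> a s(2)] by simp
    ultimately have "rel (a \<odot>\<^bsub>C0\<^esub> c) (a \<odot>\<^bsub>C0\<^esub> s) (a \<odot>\<^bsub>C1\<^esub> y)"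
      unfolding rel_def using as cl_self by simp
    then have "g (a \<odot>\<^bsub>C0\<^esub> c) = f (a \<odot>\<^bsub>C1\<^esub> y)" by (rule g[OF C0.smult_closed[OF a c]])
    then show "g (a \<odot>\<^bsub>C0\<^esub> c) = a \<odot>\<^bsub>N\<^esub> g c" using g[OF c r] graded_homD(4)[OF f a s(2)] by simp
  next
    \<comment> \<open>For homogeneous c the representative s can be taken homogeneous of the same
      degree, because h is graded. Then \<delta> y is homogeneous, and y can be replaced by a
      homogeneous preimage.\<close>
    fix d c assume ch: "c \<in> homog C0 d"
    have c: "c \<in> carrier C0" by (rule C0.homog_closed[OF ch])
    have "h (\<epsilon> c) \<in> cl ` homog C0 d"
      using graded_homD(5)[OF h graded_homD(5)[OF \<epsilon> ch]] by (simp add: quot_homog)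
    then obtain s where s: "s \<in> homog C0 d" "h (\<epsilon> c) = cl s" by blast
    have sc: "s \<in> carrier C0" by (rule C0.homog_closed[OF s(1)])
    have sh: "s \<in> h (\<epsilon> c)" using s(2) cl_self[OF sc] by simp
    obtain y where r: "rel c s y" using ex_rel[OF c sc sh] by blast
    have y: "y \<in> carrier C1" "c = \<delta> y \<oplus>\<^bsub>C0\<^esub> s" using r unfolding rel_def by auto
    have dy: "\<delta> y = c \<ominus>\<^bsub>C0\<^esub> s"
      using y sc d.closed[OF y(1)] by (simp add: C0.minus_eq C0.a_assoc C0.r_neg)
    have "\<delta> y \<in> homog C0 d" unfolding dy by (rule C0.homog_minus[OF ch s(1)])
    then obtain u where u: "u \<in> homog C1 d" "\<delta> u = \<delta> y"
      using graded_hom_homog_preimage[OF C1.gg C0.gg \<delta> y(1)] by blast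
    have "rel c s u" unfolding rel_def using u C1.homog_closed[OF u(1)] y(2) sc sh by simp
    then show "g c \<in> homog N d" using g[OF c] graded_homD(5)[OF f u(1)] by simp
  qed
  moreover have "g (\<delta> y) = f y" if y: "y \<in> carrier C1" for y
  proof -
    have c: "\<delta> y \<in> carrier C0" by (rule d.closed[OF y])
    have "\<delta> y \<in> hom_kernel C0 M \<epsilon>" unfolding ex using y by simp
    then have e0: "\<epsilon> (\<delta> y) = \<zero>\<^bsub>M\<^esub>" by (simp add: hom_kernel_def)
    obtain s y' where r: "rel (\<delta> y) s y'" using tot[OF c] by blast
    interpret h: additive_map M "quot C0 ?J" h
      by (rule graded_hom_additive[OF h M.abelian_group_axioms quot_abelian_group])
    \<comment> \<open>Since \<epsilon> \<delta> = 0, zero is an admissible representative, and the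
      splitting of \<delta> y is the trivial one.\<close>
    have "rel (\<delta> y) \<zero>\<^bsub>C0\<^esub> y"
      unfolding rel_def using y c e0 h.zero quot_zero cl_self[of "\<zero>\<^bsub>C0\<^esub>"] by simp
    then show ?thesis using g[OF c] by blast
  qed
  ultimately show ?thesis by blast
qed


section \<open>Modules over the deformed cyclotomic quotients\<close>

context rz
begin

text \<open>The polynomials that act by zero on all of U form an ideal. As it contains the
  cyclotomic generators it contains the cyclotomic ideal, so the action of a class may be defined
  through any representative.\<close>

lemma rz_module:
  assumes P: "poly_action (KA \<gamma>) U T" and T_homog: "\<And>d u. u \<in> homog U d \<Longrightarrow> T u \<in> homog U (d + dz)"
    and rel: "\<And>p u. p \<in> cyc_gens \<gamma> \<Longrightarrow> u \<in> carrier U \<Longrightarrow> poly_action.act (KA \<gamma>) U T p u = \<zero>\<^bsub>U\<^esub>"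
  defines "UR \<equiv> sub_module U (carrier U) (\<lambda>Y u. poly_action.act (KA \<gamma>) U T (SOME p. p \<in> Y) u)"
  shows "graded_module (RA \<gamma>) UR"
    and "p \<in> carrier (UK \<gamma>) \<Longrightarrow> u \<in> carrier U \<Longrightarrow> RC \<gamma> p \<odot>\<^bsub>UR\<^esub> u = poly_action.act (KA \<gamma>) U T p u"
proof -
  interpret poly_action "KA \<gamma>" U T by fact
  interpret KP: ring "KP \<gamma>" by (rule KP_ring)
  let ?J = "{p \<in> carrier (UK \<gamma>). \<forall>u\<in>carrier U. act p u = \<zero>\<^bsub>U\<^esub>}"
  have m: "p \<otimes>\<^bsub>UK \<gamma>\<^esub> q \<in> carrier (UK \<gamma>)" and a: "p \<oplus>\<^bsub>UK \<gamma>\<^esub> q \<in> carrier (UK \<gamma>)"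
    if "p \<in> carrier (UK \<gamma>)" "q \<in> carrier (UK \<gamma>)" for p q
    using that KP.m_closed[of p q] KP.a_closed[of p q] by simp_all
  have n: "\<ominus>\<^bsub>UK \<gamma>\<^esub> p \<in> carrier (UK \<gamma>)" if "p \<in> carrier (UK \<gamma>)" for p
    using that KP.a_inv_closed[of p] by (simp add: KP_neg)
  have "ideal ?J (KP \<gamma>)"
  proof (rule idealI[OF KP_ring])
    show "subgroup ?J (add_monoid (KP \<gamma>))"
      using KP.zero_closed by (intro KP.subgroupI') (auto simp: a n KP_neg act_add_left act_neg act_zero)
  qed (auto simp: m act_mult act_zero_right act_closed)
  then have CI: "CI \<gamma> \<subseteq> ?J"
    by (rule CI_minimal) (use rel cyc_gens_sub in blast)
  have eq: "RC \<gamma> p \<odot>\<^bsub>UR\<^esub> u = act p u" if p: "p \<in> carrier (UK \<gamma>)" and u: "u \<in> carrier U" for p u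
  proof -
    let ?q = "SOME q. q \<in> RC \<gamma> p"
    have "?q \<in> RC \<gamma> p" by (rule someI[of _ p]) (rule RC_mem[OF p])
    then have q: "?q \<in> carrier (UK \<gamma>)" "?q \<ominus>\<^bsub>UK \<gamma>\<^esub> p \<in> CI \<gamma>" using RC_memD[OF p] by auto
    have "act (?q \<oplus>\<^bsub>UK \<gamma>\<^esub> \<ominus>\<^bsub>UK \<gamma>\<^esub> p) u = \<zero>\<^bsub>U\<^esub>" using q(2) CI u by (auto simp: a_minus_def)
    then have "act ?q u \<ominus>\<^bsub>U\<^esub> act p u = \<zero>\<^bsub>U\<^esub>"
      using q(1) p n u by (simp add: act_add_left act_neg minus_eq)
    then show ?thesis using minus_eq_zero act_closed q(1) p u by (simp add: UR_def)
  qed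
  then show "p \<in> carrier (UK \<gamma>) \<Longrightarrow> u \<in> carrier U \<Longrightarrow> RC \<gamma> p \<odot>\<^bsub>UR\<^esub> u = act p u" .
  have UR: "carrier UR = carrier U" "ring.add UR = ring.add U" "\<zero>\<^bsub>UR\<^esub> = \<zero>\<^bsub>U\<^esub>" by (simp_all add: UR_def)
  have "graded_group UR" unfolding UR_def
    using carrier_eq homog_closed
    by (intro graded_group_sub[OF gg] subgroupI') (auto simp: Int_absorb1 subset_iff)
  moreover have "left_module (RA \<gamma>) UR"
    using \<open>graded_group UR\<close> KP.one_closed
    by (intro left_moduleI RA_ring)
      (auto elim!: RA_carrierE simp: UR eq act_closed RC_add a act_add_left act_add_right RC_mult m act_mult
        RC_one act_one graded_group_def)
  moreover have "Y \<odot>\<^bsub>UR\<^esub> u \<in> homog UR (d + e)" if Y: "Y \<in> homog (RA \<gamma>) d" and u: "u \<in> homog UR e" for Y u d e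
  proof -
    obtain p where p: "Y = RC \<gamma> p" "p \<in> carrier (UK \<gamma>)" "\<And>n. p n \<in> homog (KA \<gamma>) (d - int n * dz)"
      using Y by (auto simp: RA_homog)
    have u: "u \<in> carrier U" "u \<in> homog U e" using u by (auto simp: UR_def)
    have T: "(T ^^ k) u \<in> homog U (e + int k * dz)" for k
    proof (induction k)
      case (Suc k)
      then show ?case using T_homog[OF Suc] by (simp add: algebra_simps)
    qed (simp add: u)
    have "act p u \<in> homog U (d + e)"
      unfolding act_def
    proof (rule subgroup_finsum[OF homog_subgroup UP_finite[OF p(2)]])
      fix k
      show "p k \<odot>\<^bsub>U\<^esub> (T ^^ k) u \<in> homog U (d + e)" using smult_homog[OF p(3)[of k] T[of k]] by simp
    qed
    then show ?thesis using eq[OF p(2) u(1)] p(1) act_closed[OF p(2) u(1)] by (simp add: UR_def)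
  qed
  ultimately show "graded_module (RA \<gamma>) UR" by (intro graded_moduleI)
qed

lemma restrict_klr_simps [simp]:
  "carrier (restrict_klr D Q i \<gamma> M) = carrier M" "ring.add (restrict_klr D Q i \<gamma> M) = ring.add M"
  "\<zero>\<^bsub>restrict_klr D Q i \<gamma> M\<^esub> = \<zero>\<^bsub>M\<^esub>" "homog (restrict_klr D Q i \<gamma> M) = homog M"
  "a \<odot>\<^bsub>restrict_klr D Q i \<gamma> M\<^esub> m = RK \<gamma> a \<odot>\<^bsub>M\<^esub> m"
  by (simp_all add: restrict_klr_def)

lemma graded_module_restrict:
  assumes "graded_module (RA \<gamma>) M"
  shows "graded_module (KA \<gamma>) (restrict_klr D Q i \<gamma> M)"
proof (rule graded_moduleI)
  interpret M: gmodule "RA \<gamma>" M by (rule gmoduleI) fact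
  let ?M = "restrict_klr D Q i \<gamma> M"
  have ab: "abelian_group ?M"
    by (rule M.abelian_subgroup_restrict[of "carrier M"]) (auto intro!: M.subgroupI')
  show "graded_group ?M"
  proof -
    have [simp]: "carrier M \<inter> homog M d = homog M d" for d using M.homog_closed by blast
    have "graded_group (sub_module M (carrier M) (\<lambda>a x. RK \<gamma> a \<odot>\<^bsub>M\<^esub> x))"
      using M.carrier_eq by (intro graded_group_sub[OF M.gg] M.subgroupI') auto
    then show ?thesis using ab unfolding graded_group_def offdeg_def by simp
  qed
  interpret KA: ring "KA \<gamma>" by (rule KA_ring)
  show "left_module (KA \<gamma>) ?M"
    by (rule left_moduleI[OF KA_ring ab])
      (simp_all add: RK_closed M.smult_closed RK_add M.smult_l_distr M.smult_r_distr RK_mult M.smult_assoc1 RK_one M.smult_one)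
  show "a \<odot>\<^bsub>?M\<^esub> m \<in> homog ?M (d + e)" if "a \<in> homog (KA \<gamma>) d" "m \<in> homog ?M e" for d e a m
    using M.smult_homog[OF RK_homog[OF that(1)]] that(2) by simp
qed

text \<open>A lifting property over \<open>R\<^sub>z\<close> gives sections of surjections defined over \<open>R(\<gamma>)\<close> only, as soon as
  their source carries a compatible action of \<open>z\<close>.\<close>

lemma rz_section:
  assumes M: "graded_module (RA \<gamma>) M" and P: "poly_action (KA \<gamma>) U T"
    and T_homog: "\<And>d u. u \<in> homog U d \<Longrightarrow> T u \<in> homog U (d + dz)"
    and rel: "\<And>p u. p \<in> cyc_gens \<gamma> \<Longrightarrow> u \<in> carrier U \<Longrightarrow> poly_action.act (KA \<gamma>) U T p u = \<zero>\<^bsub>U\<^esub>"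
    and g: "g \<in> graded_hom (KA \<gamma>) U (restrict_klr D Q i \<gamma> M)" and surj: "g ` carrier U = carrier M"
    and gT: "\<And>u. u \<in> carrier U \<Longrightarrow> g (T u) = RZ \<gamma> \<odot>\<^bsub>M\<^esub> g u"
    and lift: "\<And>V :: (('i, 'k) rz, 'u) graded. graded_module (RA \<gamma>) V \<Longrightarrow> lifts (RA \<gamma>) M V M"
  shows "\<exists>h\<in>graded_hom (KA \<gamma>) (restrict_klr D Q i \<gamma> M) (U :: (('i, 'k) klr_free set, 'u) graded). \<forall>m\<in>carrier M. g (h m) = m"
proof -
  interpret poly_action "KA \<gamma>" U T by fact
  interpret M: gmodule "RA \<gamma>" M by (rule gmoduleI) fact
  interpret KA: ring "KA \<gamma>" by (rule KA_ring)
  define UR where "UR = sub_module U (carrier U) (\<lambda>Y u. act (SOME p. p \<in> Y) u)"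
  have UR: "graded_module (RA \<gamma>) UR"
    "\<And>p u. p \<in> carrier (UK \<gamma>) \<Longrightarrow> u \<in> carrier U \<Longrightarrow> RC \<gamma> p \<odot>\<^bsub>UR\<^esub> u = act p u"
    unfolding UR_def
    by (rule rz_module(1)[OF P], rule T_homog, assumption, rule rel, assumption+)
      (rule rz_module(2)[OF P], rule T_homog, assumption, rule rel, assumption+)
  have [simp]: "carrier UR = carrier U" "ring.add UR = ring.add U" "homog UR d = homog U d" for d
    using homog_closed[of _ d] by (auto simp: UR_def)
  have gc: "g u \<in> carrier M" if "u \<in> carrier U" for u using graded_homD(1)[OF g that] by simp
  \<comment> \<open>Linearity of g over R(\<gamma>) and compatibility with z give linearity for
    monomials, and by additivity for all polynomials.\<close>
  have mon: "g (a \<odot>\<^bsub>U\<^esub> (T ^^ n) u) = RC \<gamma> (mon \<gamma> a n) \<odot>\<^bsub>M\<^esub> g u"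
    if a: "a \<in> carrier (KA \<gamma>)" and u: "u \<in> carrier U" for a n u
  proof (induction n)
    case 0
    then show ?case using graded_homD(4)[OF g a u] by (simp add: Rz_of_klr_def)
  next
    case (Suc n)
    have Tn: "(T ^^ n) u \<in> carrier U" by (rule T_pow_closed[OF u])
    have c: "RC \<gamma> (mon \<gamma> a n) \<in> carrier (RA \<gamma>)" by (intro RC_closed mon_closed a)
    have "g (a \<odot>\<^bsub>U\<^esub> (T ^^ Suc n) u) = g (T (a \<odot>\<^bsub>U\<^esub> (T ^^ n) u))" using T_smult[OF a Tn] by simp
    also have "\<dots> = RZ \<gamma> \<odot>\<^bsub>M\<^esub> (RC \<gamma> (mon \<gamma> a n) \<odot>\<^bsub>M\<^esub> g u)" using gT smult_closed[OF a Tn] Suc by simp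
    also have "\<dots> = RC \<gamma> (mon \<gamma> a (Suc n)) \<odot>\<^bsub>M\<^esub> g u"
      using M.smult_assoc1[OF RZ_closed c gc[OF u]] by (simp add: RC_monom_Suc[OF a])
    finally show ?case .
  qed
  have act: "g (act p u) = RC \<gamma> p \<odot>\<^bsub>M\<^esub> g u" if p: "p \<in> carrier (UK \<gamma>)" and u: "u \<in> carrier U" for p u
    using KA_ring p
  proof (induction rule: UP_induct)
    case (monom a n)
    then show ?case using mon[OF monom u] act_monom[OF monom u] by simp
  next
    case (add p q)
    have "g (act (p \<oplus>\<^bsub>UK \<gamma>\<^esub> q) u) = g (act p u) \<oplus>\<^bsub>M\<^esub> g (act q u)"
      using graded_homD(3)[OF g act_closed[OF add(1) u] act_closed[OF add(2) u]] act_add_left[OF add(1,2) u] by simp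
    also have "\<dots> = RC \<gamma> (p \<oplus>\<^bsub>UK \<gamma>\<^esub> q) \<odot>\<^bsub>M\<^esub> g u"
      using add M.smult_l_distr[OF RC_closed[OF add(1)] RC_closed[OF add(2)] gc[OF u]] RC_add[OF add(1,2)] by simp
    finally show ?case .
  qed
  have "g \<in> graded_hom (RA \<gamma>) UR M"
  proof (rule graded_homI)
    fix Y u assume Y: "Y \<in> carrier (RA \<gamma>)" and u: "u \<in> carrier UR"
    obtain p where p: "p \<in> carrier (UK \<gamma>)" "Y = RC \<gamma> p" using Y by (rule RA_carrierE)
    show "g (Y \<odot>\<^bsub>UR\<^esub> u) = Y \<odot>\<^bsub>M\<^esub> g u" using act[OF p(1)] UR(2)[OF p(1)] p(2) u by simp
  next
    show "u \<notin> carrier UR \<Longrightarrow> g u = undefined" for u using graded_homD(2)[OF g] by simp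
    show "u \<in> homog UR d \<Longrightarrow> g u \<in> homog M d" for u d using graded_homD(5)[OF g] by simp
    show "u \<in> carrier UR \<Longrightarrow> v \<in> carrier UR \<Longrightarrow> g (u \<oplus>\<^bsub>UR\<^esub> v) = g u \<oplus>\<^bsub>M\<^esub> g v" for u v
      using graded_homD(3)[OF g] by simp
  qed (simp add: gc)
  moreover have "g ` carrier UR = carrier M" using surj by simp
  \<comment> \<open>The section is a lift of the identity of M.\<close>
  moreover have "(\<lambda>m\<in>carrier M. m) \<in> graded_hom (RA \<gamma>) M M"
    by (rule graded_homI) (simp_all add: M.homog_closed M.smult_closed)
  ultimately obtain h where h: "h \<in> graded_hom (RA \<gamma>) M UR" "\<forall>m\<in>carrier M. g (h m) = (\<lambda>m\<in>carrier M. m) m"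
    using lift[OF UR(1)] unfolding lifts_def by metis
  have hc: "h m \<in> carrier U" if "m \<in> carrier M" for m using graded_homD(1)[OF h(1) that] by simp
  have "h \<in> graded_hom (KA \<gamma>) (restrict_klr D Q i \<gamma> M) U"
  proof (rule graded_homI)
    fix a m assume a: "a \<in> carrier (KA \<gamma>)" and "m \<in> carrier (restrict_klr D Q i \<gamma> M)"
    then have m: "m \<in> carrier M" by simp
    have "h (RK \<gamma> a \<odot>\<^bsub>M\<^esub> m) = act (mon \<gamma> a 0) (h m)"
      using graded_homD(4)[OF h(1) RK_closed[OF a] m] UR(2)[OF mon_closed[OF a, of 0] hc[OF m]]
      by (simp add: Rz_of_klr_def)
    then show "h (a \<odot>\<^bsub>restrict_klr D Q i \<gamma> M\<^esub> m) = a \<odot>\<^bsub>U\<^esub> h m" using act_monom[OF a hc[OF m], of 0] by simp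
  next
    show "m \<notin> carrier (restrict_klr D Q i \<gamma> M) \<Longrightarrow> h m = undefined" for m using graded_homD(2)[OF h(1)] by simp
    show "m \<in> homog (restrict_klr D Q i \<gamma> M) d \<Longrightarrow> h m \<in> homog U d" for m d using graded_homD(5)[OF h(1)] by simp
    show "m \<in> carrier (restrict_klr D Q i \<gamma> M) \<Longrightarrow> n \<in> carrier (restrict_klr D Q i \<gamma> M) \<Longrightarrow>
        h (m \<oplus>\<^bsub>restrict_klr D Q i \<gamma> M\<^esub> n) = h m \<oplus>\<^bsub>U\<^esub> h n" for m n
      using graded_homD(3)[OF h(1)] by simp
  qed (simp add: hc)
  then show ?thesis using h(2) by (intro bexI[of _ h]) simp_all
qed

text \<open>The idempotents \<open>e(\<nu>)\<close> that vanish in \<open>R\<^sub>z\<close>: the last letter of \<open>\<nu>\<close> is not \<open>i\<close>, or both of its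
  last two letters are \<open>i\<close>.\<close>

definition bad :: "'p \<Rightarrow> ('i, 'k) klr_free set set" where
  "bad \<gamma> = {KC \<gamma> (e_gen \<nu>) |\<nu>. \<nu> \<in> seqs D \<gamma> \<and> ht D \<gamma> \<ge> 1 \<and>
     (pos \<nu> (ht D \<gamma>) = i \<longrightarrow> ht D \<gamma> \<ge> 2 \<and> pos \<nu> (ht D \<gamma> - 1) = i)}"

lemma bad_homog: "bad \<gamma> \<subseteq> homog (KA \<gamma>) 0"
proof -
  interpret KA: ring "KA \<gamma>" by (rule KA_ring)
  have "KC \<gamma> (e_gen \<nu>) \<in> homog (KA \<gamma>) 0" if "\<nu> \<in> seqs D \<gamma>" for \<nu>
    using e_homog_mult[OF one_homog that] KC_closed[OF e_FC[OF that]] by simp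
  then show ?thesis by (auto simp: bad_def)
qed

lemma e_idem: "\<nu> \<in> seqs D \<gamma> \<Longrightarrow> KC \<gamma> (e_gen \<nu> * e_gen \<nu>) = KC \<gamma> (e_gen \<nu>)"
  using KI_rel[OF klr_rels.e_e[of \<nu> D \<gamma> \<nu>]] by (subst KC_eq) (auto intro: free_carrier_mult e_FC)

lemma bad_idem: "b \<in> bad \<gamma> \<Longrightarrow> b \<otimes>\<^bsub>KA \<gamma>\<^esub> b = b"
  by (auto simp: bad_def KC_mult e_FC e_idem)

text \<open>A nil Hecke argument. In \<open>R_z\<close> the element x e equals z e with z central,
  so the relation \<tau> x e - y \<tau> e = e reads z \<tau> e = e + y \<tau> e. Multiplying by
  \<tau> on the right and using \<tau> e \<tau> = \<tau> \<tau> e = 0 gives e \<tau> = 0. Then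
  \<tau> e = 0, and the relation itself forces e = 0.\<close>

lemma RK_repeated_zero:
  assumes Q: "is_qparam D Q" and \<nu>: "\<nu> \<in> seqs D \<gamma>" and n: "ht D \<gamma> \<ge> 2" "pos \<nu> (ht D \<gamma>) = i" "pos \<nu> (ht D \<gamma> - 1) = i"
  shows "RK \<gamma> (KC \<gamma> (e_gen \<nu>)) = \<zero>\<^bsub>RA \<gamma>\<^esub>"
proof -
  interpret RR: ring "RA \<gamma>" by (rule RA_ring)
  define k where "k = ht D \<gamma> - 1"
  have k: "k \<in> {1..<ht D \<gamma>}" "k \<in> {1..ht D \<gamma>}" "k + 1 = ht D \<gamma>" "k + 1 \<in> {1..ht D \<gamma>}" using n(1) by (auto simp: k_def)
  have p: "pos \<nu> k = i" "pos \<nu> (k + 1) = i" using n k by (simp_all add: k_def)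
  define e :: "('i, 'k) klr_free" where "e = e_gen \<nu>"
  define t :: "('i, 'k) klr_free" where "t = tau_gen k"
  define x :: "('i, 'k) klr_free" where "x = x_gen (Suc k)"
  define y :: "('i, 'k) klr_free" where "y = x_gen k"
  have F: "e \<in> FC \<gamma>" "t \<in> FC \<gamma>" "x \<in> FC \<gamma>" "y \<in> FC \<gamma>"
    unfolding e_def t_def x_def y_def using e_FC[OF \<nu>] tau_FC[OF k(1)] x_FC[OF k(2)] x_FC[OF k(4)] by simp_all
  note FF = F free_carrier_mult free_carrier_diff free_carrier_zero
  have len: "length \<nu> = k + 1" using length_seqs[OF \<nu>] k(3) by simp
  have sw: "swap_pos k \<nu> = \<nu>"
    using p len k(1) unfolding swap_pos_def pos_def by (metis add_diff_cancel_right' list_update_id)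
  have r1: "KC \<gamma> ((t * x - y * t) * e) = KC \<gamma> e"
    using KI_rel[OF klr_rels.tau_x1[OF \<nu> k(1)]] p by (subst KC_eq) (simp_all add: FF e_def[symmetric] t_def[symmetric] x_def[symmetric] y_def[symmetric])
  have r2: "KC \<gamma> (t * e) = KC \<gamma> (e * t)"
    using KI_rel[OF klr_rels.tau_e[OF \<nu> k(1)]] sw by (subst KC_eq) (simp_all add: FF e_def[symmetric] t_def[symmetric])
  have "Q i i = 0" using Q by (simp add: is_qparam_def)
  then have r3: "KC \<gamma> (t * t * e) = KC \<gamma> 0"
    using KI_rel[OF klr_rels.tau_sq[OF \<nu> k(1)]] p by (subst KC_eq) (simp_all add: FF q_eval_def e_def[symmetric] t_def[symmetric])
  have r4: "KC \<gamma> (e * e) = KC \<gamma> e" using e_idem[OF \<nu>] by (simp add: e_def)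
  define K where "K f = RK \<gamma> (KC \<gamma> f)" for f
  have Kc: "K f \<in> carrier (RA \<gamma>)" if "f \<in> FC \<gamma>" for f unfolding K_def by (intro RK_closed KC_closed that)
  have Km: "K (f * g) = K f \<otimes>\<^bsub>RA \<gamma>\<^esub> K g" if "f \<in> FC \<gamma>" "g \<in> FC \<gamma>" for f g
    using that by (simp add: K_def KC_mult[symmetric] RK_mult KC_closed)
  have Ka: "K (f + g) = K f \<oplus>\<^bsub>RA \<gamma>\<^esub> K g" if "f \<in> FC \<gamma>" "g \<in> FC \<gamma>" for f g
    using that by (simp add: K_def KC_add[symmetric] RK_add KC_closed)
  have K0: "K 0 = \<zero>\<^bsub>RA \<gamma>\<^esub>" using Ka[of 0 0] Kc[of 0] by (simp add: FF)
  have xe: "K (x * e) = RZ \<gamma> \<otimes>\<^bsub>RA \<gamma>\<^esub> K e"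
    using RK_x[OF \<nu>] n k(3)[symmetric] by (simp add: K_def x_def e_def)
  have te0: "K (t * e * t) = \<zero>\<^bsub>RA \<gamma>\<^esub>"
  proof -
    have "K (t * e * t) = K t \<otimes>\<^bsub>RA \<gamma>\<^esub> K (e * t)" using Km[of t "e * t"] by (simp add: FF mult.assoc)
    also have "\<dots> = K t \<otimes>\<^bsub>RA \<gamma>\<^esub> K (t * e)" using r2 by (simp add: K_def)
    also have "\<dots> = K (t * t * e)" using Km[of t "t * e"] by (simp add: FF mult.assoc)
    finally show ?thesis using r3 K0 by (simp add: K_def)
  qed
  have txe: "K (t * x * e) = RZ \<gamma> \<otimes>\<^bsub>RA \<gamma>\<^esub> K (t * e)"
  proof -
    have "K (t * x * e) = K t \<otimes>\<^bsub>RA \<gamma>\<^esub> (RZ \<gamma> \<otimes>\<^bsub>RA \<gamma>\<^esub> K e)" using Km[of t "x * e"] xe by (simp add: FF mult.assoc)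
    also have "\<dots> = RZ \<gamma> \<otimes>\<^bsub>RA \<gamma>\<^esub> K (t * e)"
      using RZ_central[OF Kc[OF F(2)]] RZ_closed Kc[OF F(1)] Kc[OF F(2)] Km[of t e]
      by (simp add: F RR.m_assoc[symmetric])
    finally show ?thesis .
  qed
  have eq: "K (t * x * e) = K e \<oplus>\<^bsub>RA \<gamma>\<^esub> K y \<otimes>\<^bsub>RA \<gamma>\<^esub> K (t * e)"
  proof -
    have "K (t * x * e) = K ((t * x - y * t) * e) \<oplus>\<^bsub>RA \<gamma>\<^esub> K (y * (t * e))"
      using Ka[of "(t * x - y * t) * e" "y * (t * e)"] by (simp add: FF algebra_simps)
    then show ?thesis using r1 Km[of y "t * e"] by (simp add: K_def FF)
  qed
  \<comment> \<open>Of the terms in the relation only e t survives multiplication by t from the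
    right.\<close>
  have "K (t * x * e) \<otimes>\<^bsub>RA \<gamma>\<^esub> K t = \<zero>\<^bsub>RA \<gamma>\<^esub>"
    using txe te0 Km[of "t * e" t] RZ_closed Kc by (simp add: FF RR.m_assoc)
  moreover have "K (t * x * e) \<otimes>\<^bsub>RA \<gamma>\<^esub> K t = K e \<otimes>\<^bsub>RA \<gamma>\<^esub> K t"
    using eq te0 Km[of "t * e" t] Kc by (simp add: FF RR.m_assoc RR.l_distr)
  ultimately have "K (e * t) = \<zero>\<^bsub>RA \<gamma>\<^esub>" using Km[of e t] F by simp
  then have "K (t * e) = \<zero>\<^bsub>RA \<gamma>\<^esub>" using r2 by (simp add: K_def)
  then have "K e = \<zero>\<^bsub>RA \<gamma>\<^esub>" using eq txe RZ_closed Kc F by simp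
  then show ?thesis by (simp add: K_def e_def)
qed

lemma RK_bad_zero: "is_qparam D Q \<Longrightarrow> b \<in> bad \<gamma> \<Longrightarrow> RK \<gamma> b = \<zero>\<^bsub>RA \<gamma>\<^esub>"
  using RK_repeated_zero RK_e_zero unfolding bad_def by blast

end


section \<open>Extensions\<close>

lemma cocycle_iff:
  assumes "\<delta> k \<in> graded_hom A (P (Suc k)) (P k)"
  shows "f \<in> cocycles A P \<delta> N k \<longleftrightarrow>
    f \<in> graded_hom A (P k) N \<and> (\<forall>y\<in>carrier (P (Suc k)). f (\<delta> k y) = \<zero>\<^bsub>N\<^esub>)"
proof -
  have "compose (carrier (P (Suc k))) f (\<delta> k) = (\<lambda>x\<in>carrier (P (Suc k)). \<zero>\<^bsub>N\<^esub>) \<longleftrightarrow>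
      (\<forall>y\<in>carrier (P (Suc k)). f (\<delta> k y) = \<zero>\<^bsub>N\<^esub>)"
    by (auto simp: compose_def restrict_def fun_eq_iff)
  then show ?thesis by (simp add: cocycles_def hom_group_def)
qed

text \<open>The work lies in seeing that cocycles form an abelian group under pointwise addition.
  The quotient of that group by itself has one coset.\<close>

lemma trivial_ext_group:
  assumes Pk: "graded_module A (P k)" and N: "graded_module A N" and \<delta>: "\<delta> k \<in> graded_hom A (P (Suc k)) (P k)"
    and eq: "coboundaries A P \<delta> N k = cocycles A P \<delta> N k"
  shows "trivial_group (ext_group A P \<delta> N k)"
proof -
  interpret P: gmodule A "P k" by (rule gmoduleI[OF Pk])
  interpret N: gmodule A N by (rule gmoduleI[OF N])
  let ?K = "cocycles A P \<delta> N k" and ?p = "\<lambda>f g. \<lambda>x\<in>carrier (P k). f x \<oplus>\<^bsub>N\<^esub> g x"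
  define G where "G = (hom_group A (P k) N)\<lparr>carrier := ?K\<rparr>"
  have G [simp]: "carrier G = ?K" "monoid.mult G = ?p" "\<one>\<^bsub>G\<^esub> = (\<lambda>x\<in>carrier (P k). \<zero>\<^bsub>N\<^esub>)"
    by (simp_all add: G_def hom_group_def)
  note K = cocycle_iff[of \<delta> k A P _ N, OF \<delta>]
  have KD: "f x \<in> carrier N" "f \<in> extensional (carrier (P k))" if "f \<in> ?K" "x \<in> carrier (P k)" for f x
    using that graded_homD(1,2)[of f A "P k" N] unfolding K extensional_def by auto
  note dc = graded_homD(1)[OF \<delta>]
  have "comm_group G"
  proof (rule comm_groupI)
    fix f g assume fg: "f \<in> carrier G" "g \<in> carrier G"
    then have f: "f \<in> graded_hom A (P k) N" and g: "g \<in> graded_hom A (P k) N" by (simp_all add: K)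
    interpret f: additive_map "P k" N f by (rule graded_hom_additive[OF f P.abelian_group_axioms N.abelian_group_axioms])
    interpret g: additive_map "P k" N g by (rule graded_hom_additive[OF g P.abelian_group_axioms N.abelian_group_axioms])
    have "?p f g \<in> graded_hom A (P k) N"
    proof (rule graded_homI)
      show "x \<in> homog (P k) d \<Longrightarrow> ?p f g x \<in> homog N d" for x d
        using P.homog_closed[of x d] N.homog_add graded_homD(5)[OF f] graded_homD(5)[OF g] by simp
      show "a \<in> carrier A \<Longrightarrow> x \<in> carrier (P k) \<Longrightarrow> ?p f g (a \<odot>\<^bsub>P k\<^esub> x) = a \<odot>\<^bsub>N\<^esub> ?p f g x" for a x
        using graded_homD(4)[OF f] graded_homD(4)[OF g] N.smult_r_distr f.closed g.closed P.smult_closed by simp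
      show "x \<in> carrier (P k) \<Longrightarrow> y \<in> carrier (P k) \<Longrightarrow> ?p f g (x \<oplus>\<^bsub>P k\<^esub> y) = ?p f g x \<oplus>\<^bsub>N\<^esub> ?p f g y" for x y
        using f.closed g.closed by (simp add: f.add g.add N.a_ac)
    qed (simp_all add: f.closed g.closed)
    then show "f \<otimes>\<^bsub>G\<^esub> g \<in> carrier G" using fg dc by (simp add: K)
    show "f \<otimes>\<^bsub>G\<^esub> g = g \<otimes>\<^bsub>G\<^esub> f" using f.closed g.closed by (auto intro!: restrict_ext N.a_comm)
    show "f \<otimes>\<^bsub>G\<^esub> g \<otimes>\<^bsub>G\<^esub> h = f \<otimes>\<^bsub>G\<^esub> (g \<otimes>\<^bsub>G\<^esub> h)" if "h \<in> carrier G" for h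
      using f.closed g.closed KD(1)[of h] that by (auto intro!: restrict_ext simp: N.a_assoc)
  next
    have "(\<lambda>x\<in>carrier (P k). \<zero>\<^bsub>N\<^esub>) \<in> graded_hom A (P k) N"
      by (rule graded_homI) (simp_all add: P.smult_closed N.smult_zero P.homog_closed N.homog_zero)
    then show "\<one>\<^bsub>G\<^esub> \<in> carrier G" using dc by (simp add: K)
  next
    fix f assume fK: "f \<in> carrier G"
    then have f: "f \<in> graded_hom A (P k) N" by (simp add: K)
    interpret f: additive_map "P k" N f by (rule graded_hom_additive[OF f P.abelian_group_axioms N.abelian_group_axioms])
    show "\<one>\<^bsub>G\<^esub> \<otimes>\<^bsub>G\<^esub> f = f" using f.closed graded_homD(2)[OF f] by (auto simp: restrict_def)
    let ?n = "\<lambda>x\<in>carrier (P k). \<ominus>\<^bsub>N\<^esub> f x"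
    have "?n \<in> graded_hom A (P k) N"
    proof (rule graded_homI)
      show "x \<in> homog (P k) d \<Longrightarrow> ?n x \<in> homog N d" for x d
        using P.homog_closed[of x d] N.homog_neg graded_homD(5)[OF f] by simp
      show "a \<in> carrier A \<Longrightarrow> x \<in> carrier (P k) \<Longrightarrow> ?n (a \<odot>\<^bsub>P k\<^esub> x) = a \<odot>\<^bsub>N\<^esub> ?n x" for a x
        using graded_homD(4)[OF f] N.smult_neg f.closed P.smult_closed by simp
    qed (simp_all add: f.closed f.add N.minus_add)
    then have "?n \<in> carrier G" using fK dc by (simp add: K)
    moreover have "?n \<otimes>\<^bsub>G\<^esub> f = \<one>\<^bsub>G\<^esub>" using f.closed by (auto intro!: restrict_ext simp: N.l_neg)
    ultimately show "\<exists>g\<in>carrier G. g \<otimes>\<^bsub>G\<^esub> f = \<one>\<^bsub>G\<^esub>" by blast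
  qed
  then interpret G: comm_group G .
  have "subgroup ?K G" using G.subgroup_self by simp
  then interpret n: normal ?K G by (simp add: G.normal_iff_subgroup)
  have "carrier (G Mod ?K) = {?K}"
    using G.coset_join2[OF _ \<open>subgroup ?K G\<close>] G.one_closed by (auto simp: FactGroup_def RCOSETS_def)
  then have "trivial_group (G Mod ?K)"
    using n.factorgroup_is_group by (simp add: trivial_group_def FactGroup_def)
  then show ?thesis by (simp add: ext_group_def eq G_def)
qed

lemma trivial_sum_group:
  assumes "\<And>i. i \<in> I \<Longrightarrow> trivial_group (G i)"
  shows "trivial_group (sum_group I G)"
proof -
  have g: "group (G i)" and c: "carrier (G i) = {\<one>\<^bsub>G i\<^esub>}" if "i \<in> I" for i
    using assms[OF that] by (simp_all add: trivial_group_def)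
  interpret S: group "sum_group I G" by (rule sum_group) (rule g)
  have "x = \<one>\<^bsub>sum_group I G\<^esub>" if "x \<in> carrier (sum_group I G)" for x
    using that c by (auto simp: carrier_sum_group g PiE_iff extensional_def fun_eq_iff)
  then show ?thesis using S.trivial_group_subset by blast
qed

section \<open>The action of the last x on modules killed by the bad idempotents\<close>

context rz
begin

text \<open>As the idempotents sum to 1, f u is the sum of the elements f \<open>e(\<nu>)\<close> u.
  A statement closed under sums may thus be checked for one sequence at a time.\<close>

lemma e_decompose:
  assumes U: "graded_module (KA \<gamma>) U" and f: "f \<in> FC \<gamma>" and u: "u \<in> carrier U"
    and S: "subgroup S (add_monoid U)" and e: "\<And>\<nu>. \<nu> \<in> seqs D \<gamma> \<Longrightarrow> KC \<gamma> (f * e_gen \<nu>) \<odot>\<^bsub>U\<^esub> u \<in> S"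
  shows "KC \<gamma> f \<odot>\<^bsub>U\<^esub> u \<in> S"
proof -
  interpret U: gmodule "KA \<gamma>" U by (rule gmoduleI[OF U])
  have F: "f * e_gen \<nu> * 1 \<in> FC \<gamma>" if "\<nu> \<in> seqs D \<gamma>" for \<nu> using f that by (intro FC_intros)
  have "KC \<gamma> (\<Sum>\<nu>\<in>T. f * e_gen \<nu> * 1) \<odot>\<^bsub>U\<^esub> u \<in> S" if "finite T" "T \<subseteq> seqs D \<gamma>" for T
    using that
  proof (induction T rule: finite_induct)
    case empty
    then show ?case using U.smult_l_zero[OF u] U.subgroup_zero[OF S] by (simp add: KC_zero)
  next
    case (insert \<nu> T)
    have a: "f * e_gen \<nu> * 1 \<in> FC \<gamma>" "(\<Sum>\<nu>\<in>T. f * e_gen \<nu> * 1) \<in> FC \<gamma>"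
      using insert.prems F by (auto intro!: free_carrier_sum simp del: mult_1_right)
    have "KC \<gamma> (\<Sum>\<nu>\<in>insert \<nu> T. f * e_gen \<nu> * 1) \<odot>\<^bsub>U\<^esub> u
        = KC \<gamma> (f * e_gen \<nu> * 1) \<odot>\<^bsub>U\<^esub> u \<oplus>\<^bsub>U\<^esub> KC \<gamma> (\<Sum>\<nu>\<in>T. f * e_gen \<nu> * 1) \<odot>\<^bsub>U\<^esub> u"
      using insert.hyps U.smult_l_distr[OF KC_closed[OF a(1)] KC_closed[OF a(2)] u] KC_add[OF a] by simp
    then show ?case using U.subgroup_add_closed[OF S] insert e by simp
  qed
  from this[OF finite_seqs subset_refl] show ?thesis using insert_e[OF f free_carrier_one] by simp
qed

context
  fixes \<gamma> :: 'p and U :: "(('i, 'k) klr_free set, 'u) graded"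
  assumes U: "graded_module (KA \<gamma>) U" and ht: "ht D \<gamma> \<ge> 1"
    and bad_U: "\<And>b u. b \<in> bad \<gamma> \<Longrightarrow> u \<in> carrier U \<Longrightarrow> b \<odot>\<^bsub>U\<^esub> u = \<zero>\<^bsub>U\<^esub>"
begin

interpretation U: gmodule "KA \<gamma>" U by (rule gmoduleI[OF U])

lemma last_x_FC': "x_gen (ht D \<gamma>) \<in> FC \<gamma>" using ht by (intro x_FC) simp

lemma KC_smult_mult:
  "f \<in> FC \<gamma> \<Longrightarrow> g \<in> FC \<gamma> \<Longrightarrow> u \<in> carrier U \<Longrightarrow> KC \<gamma> (f * g) \<odot>\<^bsub>U\<^esub> u = KC \<gamma> f \<odot>\<^bsub>U\<^esub> (KC \<gamma> g \<odot>\<^bsub>U\<^esub> u)"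
  using U.smult_assoc1[OF KC_closed KC_closed] by (simp add: KC_mult)

lemma bad_mult:
  assumes "f \<in> FC \<gamma>" "\<nu> \<in> seqs D \<gamma>" "u \<in> carrier U"
    and "pos \<nu> (ht D \<gamma>) = i \<longrightarrow> ht D \<gamma> \<ge> 2 \<and> pos \<nu> (ht D \<gamma> - 1) = i"
  shows "KC \<gamma> (f * e_gen \<nu>) \<odot>\<^bsub>U\<^esub> u = \<zero>\<^bsub>U\<^esub>"
proof -
  have "KC \<gamma> (e_gen \<nu>) \<in> bad \<gamma>" using assms ht by (auto simp: bad_def)
  then show ?thesis
    using assms KC_smult_mult e_FC bad_U U.smult_zero[OF KC_closed[OF assms(1)]] by simp
qed

text \<open>The sequences that survive end in j i with j \<noteq> i. The last \<tau> takes such an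
  idempotent to the one ending in i j, and that one is killed.\<close>

lemma last_tau_zero:
  assumes n: "ht D \<gamma> \<ge> 2" and u: "u \<in> carrier U"
  shows "KC \<gamma> (tau_gen (ht D \<gamma> - 1)) \<odot>\<^bsub>U\<^esub> u = \<zero>\<^bsub>U\<^esub>"
proof -
  define k where "k = ht D \<gamma> - 1"
  have k: "k \<in> {1..<ht D \<gamma>}" "k + 1 = ht D \<gamma>" using n by (auto simp: k_def)
  note t = tau_FC[OF k(1)]
  have S: "subgroup {\<zero>\<^bsub>U\<^esub>} (add_monoid U)" by (rule U.subgroupI') auto
  have "KC \<gamma> (tau_gen k * e_gen \<nu>) \<odot>\<^bsub>U\<^esub> u = \<zero>\<^bsub>U\<^esub>" if \<nu>: "\<nu> \<in> seqs D \<gamma>" for \<nu>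
  proof (cases "pos \<nu> (ht D \<gamma>) = i \<and> pos \<nu> k \<noteq> i")
    case False
    then show ?thesis using bad_mult[OF t \<nu> u] n by (auto simp: k_def)
  next
    case True
    \<comment> \<open>After the swap the last letter is the former letter before it, which is not i
      here, so the new idempotent is bad.\<close>
    have s: "swap_pos k \<nu> \<in> seqs D \<gamma>" by (rule swap_pos_seqs[OF \<nu> k(1)])
    have "length \<nu> = k + 1" using length_seqs[OF \<nu>] k(2) by simp
    then have p: "pos (swap_pos k \<nu>) (ht D \<gamma>) \<noteq> i"
      using True k(2)[symmetric] by (simp add: swap_pos_def pos_def)
    have "KC \<gamma> (tau_gen k * e_gen \<nu>) = KC \<gamma> (e_gen (swap_pos k \<nu>) * tau_gen k)"
      using KI_rel[OF klr_rels.tau_e[OF \<nu> k(1)]] by (subst KC_eq) (auto intro!: free_carrier_mult e_FC s \<nu> t)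
    then show ?thesis
      using bad_mult[OF free_carrier_one s, of "KC \<gamma> (tau_gen k) \<odot>\<^bsub>U\<^esub> u"] p KC_smult_mult[OF e_FC[OF s] t u]
        U.smult_closed[OF KC_closed[OF t] u] by simp
  qed
  then show ?thesis using e_decompose[OF U t u S] by (simp add: k_def)
qed

text \<open>Of all generators only the last \<tau> fails to commute with the last x in R(\<gamma>),
  and on U it acts by zero. The property passes to products and sums, hence to the whole
  algebra.\<close>

lemma last_x_commute:
  assumes a: "a \<in> carrier (KA \<gamma>)" and u: "u \<in> carrier U"
  shows "KC \<gamma> (x_gen (ht D \<gamma>)) \<odot>\<^bsub>U\<^esub> (a \<odot>\<^bsub>U\<^esub> u) = a \<odot>\<^bsub>U\<^esub> (KC \<gamma> (x_gen (ht D \<gamma>)) \<odot>\<^bsub>U\<^esub> u)"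
proof -
  let ?x = "x_gen (ht D \<gamma>) :: ('i, 'k) klr_free"
  note xF = last_x_FC'
  note xC = KC_closed[OF xF]
  define c where "c f \<longleftrightarrow> (\<forall>u\<in>carrier U. KC \<gamma> ?x \<odot>\<^bsub>U\<^esub> (KC \<gamma> f \<odot>\<^bsub>U\<^esub> u) = KC \<gamma> f \<odot>\<^bsub>U\<^esub> (KC \<gamma> ?x \<odot>\<^bsub>U\<^esub> u))" for f
  have crel: "c f" if f: "f \<in> FC \<gamma>" and r: "KC \<gamma> (?x * f) = KC \<gamma> (f * ?x)" for f
    unfolding c_def using KC_smult_mult[OF xF f] KC_smult_mult[OF f xF] r by simp
  have cmult: "c (f * g)" if "f \<in> FC \<gamma>" "g \<in> FC \<gamma>" "c f" "c g" for f g
    using that U.smult_closed[OF KC_closed] U.smult_closed[OF xC] unfolding c_def by (simp add: KC_smult_mult)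
  have cgen: "c (nc_gen l)" if l: "l \<in> klr_gens D \<gamma>" for l
  proof -
    have lF: "nc_gen l \<in> FC \<gamma>" by (rule free_carrier_gen[OF l])
    note eq = KC_eq[OF free_carrier_mult[OF xF lF] free_carrier_mult[OF lF xF]]
    have h: "ht D \<gamma> \<in> {1..ht D \<gamma>}" using ht by simp
    \<comment> \<open>The last \<tau> is separated from the other crossings; for these the last x
      sits at a position that they do not touch.\<close>
    consider (e) \<nu> where "l = Gen_e \<nu>" "\<nu> \<in> seqs D \<gamma>" | (x) k where "l = Gen_x k" "k \<in> {1..ht D \<gamma>}"
      | (t) k where "l = Gen_tau k" "k \<in> {1..<ht D \<gamma>}" "k \<noteq> ht D \<gamma> - 1"
      | (t') "l = Gen_tau (ht D \<gamma> - 1)" "ht D \<gamma> \<ge> 2"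
      using l by (fastforce simp: klr_gens_def)
    then show ?thesis
    proof cases
      case e
      then show ?thesis using crel[OF lF] eq KI_rel[OF klr_rels.x_e[OF e(2) h]] by simp
    next
      case x
      then show ?thesis using crel[OF lF] eq KI_rel[OF klr_rels.x_x[OF h x(2)]] by simp
    next
      case t
      have "ht D \<gamma> \<noteq> k" "ht D \<gamma> \<noteq> k + 1" using t by auto
      then show ?thesis using crel[OF lF] eq KI_rel[OF klr_rels.x_tau[OF t(2) h]] t by simp
    next
      case t'
      then show ?thesis
        unfolding c_def using last_tau_zero[OF t'(2)] U.smult_closed[OF xC] U.smult_zero[OF xC] by simp
    qed
  qed
  have cconst: "c (nc_const k)" for k
    by (rule crel) (simp_all add: free_carrier_const nc_const_comm)
  have word: "c (Poly_Mapping.single w k) \<and> Poly_Mapping.single w k \<in> FC \<gamma>" if "set w \<subseteq> klr_gens D \<gamma>" for w k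
    using that
  proof (induction w)
    case Nil
    show ?case using cconst[of k] free_carrier_const[of k] by (simp add: nc_const_def)
  next
    case (Cons g w)
    have "Poly_Mapping.single (g # w) k = nc_gen g * Poly_Mapping.single w k"
      by (simp add: nc_gen_def mult_single plus_list_def)
    moreover have "(nc_gen g :: ('i, 'k) klr_free) \<in> FC \<gamma>" using Cons.prems by (intro free_carrier_gen) simp
    moreover have "c (Poly_Mapping.single w k)" "Poly_Mapping.single w k \<in> FC \<gamma>" "c (nc_gen g)"
      using Cons cgen[of g] by auto
    ultimately show ?case using cmult[of "nc_gen g" "Poly_Mapping.single w k"] free_carrier_mult by simp
  qed
  obtain f where f: "f \<in> FC \<gamma>" "a = KC \<gamma> f" using a by (rule KA_carrierE)
  have "Poly_Mapping.keys f \<subseteq> {w. set w \<subseteq> klr_gens D \<gamma>}" using f(1) by (auto simp: free_carrier_def)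
  then have "c f"
  proof (induction f rule: poly_mapping_keys_induct)
    case zero
    show ?case by (rule crel) (simp_all add: free_carrier_zero)
  next
    case (single w k)
    then show ?case using word by simp
  next
    case (add f g)
    have fg: "f \<in> FC \<gamma>" "g \<in> FC \<gamma>" using add by (auto simp: free_carrier_def)
    show ?case
      using add(3,4) U.smult_closed[OF KC_closed[OF fg(1)]] U.smult_closed[OF KC_closed[OF fg(2)]]
        U.smult_closed[OF xC] U.smult_r_distr[OF xC]
      unfolding c_def by (simp add: KC_add[OF fg, symmetric] U.smult_l_distr[OF KC_closed[OF fg(1)] KC_closed[OF fg(2)]])
  qed
  then show ?thesis using f u by (simp add: c_def)
qed

text \<open>In R(\<gamma>) the last x is not homogeneous, as its degree on \<open>e(\<nu>)\<close>
  depends on the last letter. On U only the sequences ending in i count, and there the degree is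
  that of z.\<close>

lemma last_x_homog:
  assumes u: "u \<in> homog U d"
  shows "KC \<gamma> (x_gen (ht D \<gamma>)) \<odot>\<^bsub>U\<^esub> u \<in> homog U (d + dz)"
proof (rule e_decompose[OF U last_x_FC' U.homog_closed[OF u] U.homog_subgroup])
  fix \<nu> assume \<nu>: "\<nu> \<in> seqs D \<gamma>"
  interpret KA: ring "KA \<gamma>" by (rule KA_ring)
  show "KC \<gamma> (x_gen (ht D \<gamma>) * e_gen \<nu>) \<odot>\<^bsub>U\<^esub> u \<in> homog U (d + dz)"
  proof (cases "pos \<nu> (ht D \<gamma>) = i")
    case True
    have "KC \<gamma> (x_gen (ht D \<gamma>) * e_gen \<nu>) \<in> homog (KA \<gamma>) dz"
      using x_homog_mult[OF one_homog \<nu>, of "ht D \<gamma>"] ht True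
        KC_closed[OF free_carrier_mult[OF last_x_FC' e_FC[OF \<nu>]]] by simp
    from U.smult_homog[OF this u] show ?thesis by (simp add: add.commute)
  next
    case False
    then show ?thesis using bad_mult[OF last_x_FC' \<nu> U.homog_closed[OF u]] U.homog_zero by simp
  qed
qed

lemma last_x_action: "poly_action (KA \<gamma>) U (\<lambda>u. KC \<gamma> (x_gen (ht D \<gamma>)) \<odot>\<^bsub>U\<^esub> u)"
  using KC_closed[OF last_x_FC']
  by unfold_locales (simp_all add: U.smult_closed U.smult_r_distr last_x_commute)

text \<open>The generators of the first kind are bad idempotents. In those of the second kind z acts
  as the last x, so they compare x \<open>e(\<nu>)\<close> with \<open>e(\<nu>)\<close> x, and x
  commutes with everything on U.\<close>

lemma last_x_rel:
  assumes p: "p \<in> cyc_gens \<gamma>" and u: "u \<in> carrier U"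
  shows "poly_action.act (KA \<gamma>) U (\<lambda>u. KC \<gamma> (x_gen (ht D \<gamma>)) \<odot>\<^bsub>U\<^esub> u) p u = \<zero>\<^bsub>U\<^esub>"
proof -
  let ?x = "x_gen (ht D \<gamma>) :: ('i, 'k) klr_free"
  interpret poly_action "KA \<gamma>" U "\<lambda>u. KC \<gamma> ?x \<odot>\<^bsub>U\<^esub> u" by (rule last_x_action)
  interpret KP: ring "KP \<gamma>" by (rule KP_ring)
  consider (1) \<nu> where "p = mon \<gamma> (KC \<gamma> (e_gen \<nu>)) 0" "\<nu> \<in> seqs D \<gamma>" "pos \<nu> (ht D \<gamma>) \<noteq> i"
    | (2) \<nu> where "p = mon \<gamma> (KC \<gamma> (?x * e_gen \<nu>)) 0 \<ominus>\<^bsub>UK \<gamma>\<^esub> mon \<gamma> (KC \<gamma> (e_gen \<nu>)) 1" "\<nu> \<in> seqs D \<gamma>"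
    using p by (auto simp: cyc_gens_def)
  then show ?thesis
  proof cases
    case 1
    then show ?thesis using bad_mult[OF free_carrier_one 1(2) u] act_monom[OF KC_closed[OF e_FC[OF 1(2)]] u, of 0] by simp
  next
    case 2
    note e = e_FC[OF 2(2)] and xF = last_x_FC'
    note c = KC_closed[OF free_carrier_mult[OF xF e]] KC_closed[OF e]
    have m: "mon \<gamma> (KC \<gamma> (?x * e_gen \<nu>)) 0 \<in> carrier (UK \<gamma>)" "mon \<gamma> (KC \<gamma> (e_gen \<nu>)) 1 \<in> carrier (UK \<gamma>)"
      using c by (auto intro: mon_closed)
    have "\<ominus>\<^bsub>UK \<gamma>\<^esub> mon \<gamma> (KC \<gamma> (e_gen \<nu>)) 1 \<in> carrier (UK \<gamma>)"
      using KP.a_inv_closed[of "mon \<gamma> (KC \<gamma> (e_gen \<nu>)) 1"] m by (simp add: KP_neg)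
    then have "act p u = KC \<gamma> (?x * e_gen \<nu>) \<odot>\<^bsub>U\<^esub> u \<ominus>\<^bsub>U\<^esub> KC \<gamma> (e_gen \<nu>) \<odot>\<^bsub>U\<^esub> (KC \<gamma> ?x \<odot>\<^bsub>U\<^esub> u)"
      using act_add_left[OF m(1) _ u] act_neg[OF m(2) u] act_monom[OF c(1) u, of 0] act_monom[OF c(2) u, of 1]
      by (simp add: 2(1) a_minus_def)
    then show ?thesis
      using KC_smult_mult[OF xF e u] last_x_commute[OF c(2) u] U.minus_self[OF U.smult_closed[OF c(1) u]] by simp
  qed
qed

end

end


section \<open>Extension of cocycles over R(\<beta>) and the vanishing of Ext\<close>

context rz
begin

text \<open>Checked on each \<open>e(\<nu>)\<close>: either the last letter is i and the cyclotomic
  relation applies, or the idempotent is zero in \<open>R_z\<close>. It ensures that a map to M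
  which is linear over R(\<gamma>) is compatible with z when z acts on the source as the last
  x.\<close>

lemma RK_last_x:
  assumes Q: "is_qparam D Q" and M: "graded_module (RA \<gamma>) M" and ht: "ht D \<gamma> \<ge> 1" and m: "m \<in> carrier M"
  shows "RK \<gamma> (KC \<gamma> (x_gen (ht D \<gamma>))) \<odot>\<^bsub>M\<^esub> m = RZ \<gamma> \<odot>\<^bsub>M\<^esub> m"
proof -
  let ?R = "restrict_klr D Q i \<gamma> M" and ?x = "x_gen (ht D \<gamma>) :: ('i, 'k) klr_free"
  have R: "graded_module (KA \<gamma>) ?R" by (rule graded_module_restrict[OF M])
  interpret M: gmodule "RA \<gamma>" M by (rule gmoduleI[OF M])
  interpret R: gmodule "KA \<gamma>" ?R by (rule gmoduleI[OF R])
  have xF: "?x \<in> FC \<gamma>" using ht by (rule last_x_FC)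
  note xC = KC_closed[OF xF]
  interpret z: additive_map ?R ?R "\<lambda>m. RZ \<gamma> \<odot>\<^bsub>M\<^esub> m"
    by unfold_locales (simp_all add: M.smult_closed RZ_closed M.smult_r_distr)
  interpret x: additive_map ?R ?R "\<lambda>m. KC \<gamma> ?x \<odot>\<^bsub>?R\<^esub> m" by (rule R.smult_additive[OF xC])
  let ?S = "{m \<in> carrier ?R. KC \<gamma> ?x \<odot>\<^bsub>?R\<^esub> m = RZ \<gamma> \<odot>\<^bsub>M\<^esub> m}"
  have S: "subgroup ?S (add_monoid ?R)"
  proof (rule R.subgroupI')
    show "\<zero>\<^bsub>?R\<^esub> \<in> ?S" using x.zero z.zero R.zero_closed by simp
    show "a \<oplus>\<^bsub>?R\<^esub> b \<in> ?S" if "a \<in> ?S" "b \<in> ?S" for a b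
      using that x.add[of a b] z.add[of a b] R.a_closed[of a b] by simp
    show "\<ominus>\<^bsub>?R\<^esub> a \<in> ?S" if "a \<in> ?S" for a
      using that x.neg[of a] z.neg[of a] R.a_inv_closed[of a] by simp
  qed auto
  have "KC \<gamma> 1 \<odot>\<^bsub>?R\<^esub> m \<in> ?S"
  proof (rule e_decompose[OF R free_carrier_one _ S])
    show "m \<in> carrier ?R" using m by simp
    fix \<nu> assume \<nu>: "\<nu> \<in> seqs D \<gamma>"
    have eR: "RK \<gamma> (KC \<gamma> (e_gen \<nu>)) \<in> carrier (RA \<gamma>)" by (intro RK_closed KC_closed e_FC \<nu>)
    have em: "RK \<gamma> (KC \<gamma> (e_gen \<nu>)) \<odot>\<^bsub>M\<^esub> m \<in> carrier M" by (rule M.smult_closed[OF eR m])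
    have "RK \<gamma> (KC \<gamma> ?x) \<odot>\<^bsub>M\<^esub> (RK \<gamma> (KC \<gamma> (e_gen \<nu>)) \<odot>\<^bsub>M\<^esub> m) = RZ \<gamma> \<odot>\<^bsub>M\<^esub> (RK \<gamma> (KC \<gamma> (e_gen \<nu>)) \<odot>\<^bsub>M\<^esub> m)"
    proof (cases "pos \<nu> (ht D \<gamma>) = i")
      case True
      have "RK \<gamma> (KC \<gamma> ?x) \<otimes>\<^bsub>RA \<gamma>\<^esub> RK \<gamma> (KC \<gamma> (e_gen \<nu>)) = RZ \<gamma> \<otimes>\<^bsub>RA \<gamma>\<^esub> RK \<gamma> (KC \<gamma> (e_gen \<nu>))"
        using RK_x[OF \<nu> ht True] RK_mult[OF xC KC_closed[OF e_FC[OF \<nu>]]] KC_mult[OF xF e_FC[OF \<nu>]] by simp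
      then show ?thesis
        using M.smult_assoc1[OF RK_closed[OF xC] eR m] M.smult_assoc1[OF RZ_closed eR m] by simp
    next
      case False
      then show ?thesis
        using RK_e_zero[OF \<nu> ht] M.smult_l_zero[OF m] M.smult_zero[OF RK_closed[OF xC]] M.smult_zero[OF RZ_closed] by simp
    qed
    then show "KC \<gamma> (1 * e_gen \<nu>) \<odot>\<^bsub>?R\<^esub> m \<in> ?S" using em by simp
  qed
  then show ?thesis using R.smult_one[of m] m by (simp add: KC_one)
qed

text \<open>Lifting is assumed on two types because the section goes to the quotient of
  \<open>C 0\<close> by J, on type \<open>'r set\<close>, if there is a last x, and to
  \<open>C 0\<close> itself if the height is 0.\<close>

lemma cocycle_extends:
  fixes M :: "(('i, 'k) rz, 'x) graded" and C :: "nat \<Rightarrow> (('i, 'k) klr_free set, 'r) graded"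
  assumes Q: "is_qparam D Q" and M: "graded_module (RA \<gamma>) M"
    and lift: "\<And>V :: (('i, 'k) rz, 'r) graded. graded_module (RA \<gamma>) V \<Longrightarrow> lifts (RA \<gamma>) M V M"
    and lift': "\<And>V :: (('i, 'k) rz, 'r set) graded. graded_module (RA \<gamma>) V \<Longrightarrow> lifts (RA \<gamma>) M V M"
    and res: "projective_resolution (KA \<gamma>) (restrict_klr D Q i \<gamma> M) C \<delta> \<epsilon>"
    and NN: "graded_module (KA \<gamma>) N" and bad_N: "\<And>b n. b \<in> bad \<gamma> \<Longrightarrow> n \<in> carrier N \<Longrightarrow> b \<odot>\<^bsub>N\<^esub> n = \<zero>\<^bsub>N\<^esub>"
    and f: "f \<in> graded_hom (KA \<gamma>) (C 1) N" and f0: "\<And>y. y \<in> carrier (C 2) \<Longrightarrow> f (\<delta> 1 y) = \<zero>\<^bsub>N\<^esub>"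
  shows "\<exists>g\<in>graded_hom (KA \<gamma>) (C 0) N. \<forall>y\<in>carrier (C 1). g (\<delta> 0 y) = f y"
proof -
  let ?R = "restrict_klr D Q i \<gamma> M" and ?J = "ann_submodule (KA \<gamma>) (C 0) (bad \<gamma>)"
  have proj: "graded_projective (KA \<gamma>) (C n)" and \<delta>: "\<delta> n \<in> graded_hom (KA \<gamma>) (C (Suc n)) (C n)"
    and \<epsilon>: "\<epsilon> \<in> graded_hom (KA \<gamma>) (C 0) ?R" and \<epsilon>_surj: "\<epsilon> ` carrier (C 0) = carrier M"
    and ex0: "hom_kernel (C 0) ?R \<epsilon> = \<delta> 0 ` carrier (C 1)"
    and ex1: "hom_kernel (C 1) (C 0) (\<delta> 0) = \<delta> 1 ` carrier (C 2)" for n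
    using res unfolding projective_resolution_def numeral_2_eq_2 One_nat_def by simp_all
  have C: "graded_module (KA \<gamma>) (C n)" for n using proj by (simp add: graded_projective_def)
  have R: "graded_module (KA \<gamma>) ?R" by (rule graded_module_restrict[OF M])
  interpret KA: gring "KA \<gamma>" by (rule KA_gring)
  interpret M: gmodule "RA \<gamma>" M by (rule gmoduleI[OF M])
  interpret R: gmodule "KA \<gamma>" ?R by (rule gmoduleI[OF R])
  interpret C0: gmodule "KA \<gamma>" "C 0" by (rule gmoduleI[OF C])
  have bc: "b \<in> carrier (KA \<gamma>)" if "b \<in> bad \<gamma>" for b using that bad_homog KA.homog_carrier by blast
  then have bs: "bad \<gamma> \<subseteq> carrier (KA \<gamma>)" by blast
  note Jg = C0.graded_submodule_ann[OF KA_gring bad_homog[of \<gamma>]]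
  have bad_R: "b \<odot>\<^bsub>?R\<^esub> m = \<zero>\<^bsub>?R\<^esub>" if "b \<in> bad \<gamma>" "m \<in> carrier ?R" for b m
    using RK_bad_zero[OF Q that(1)] M.smult_l_zero that(2) by simp
  interpret e: additive_map "C 0" ?R \<epsilon>
    by (rule graded_hom_additive[OF \<epsilon> C0.abelian_group_axioms R.abelian_group_axioms])
  interpret ag_quot "C 0" ?J
    by (intro ag_quot.intro ag_quot_axioms.intro C0.abelian_group_axioms C0.ann_subgroup[OF bs])
  \<comment> \<open>The bad idempotents vanish in \<open>R_z\<close> and so kill M. Hence \<epsilon>
    vanishes on J and factors through the quotient.\<close>
  have "\<epsilon> j \<in> {\<zero>\<^bsub>?R\<^esub>}" if "j \<in> ?J" for j
    using C0.ann_gens_sub[OF bs] _ _ that[unfolded ann_submodule_def]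
  proof (rule e.generate_into)
    show "subgroup {\<zero>\<^bsub>?R\<^esub>} (add_monoid ?R)" by (rule R.subgroupI') (auto simp del: restrict_klr_simps)
    fix h assume "h \<in> {a \<odot>\<^bsub>C 0\<^esub> (b \<odot>\<^bsub>C 0\<^esub> c) |a b c. a \<in> carrier (KA \<gamma>) \<and> b \<in> bad \<gamma> \<and> c \<in> carrier (C 0)}"
    then obtain a b c where h: "h = a \<odot>\<^bsub>C 0\<^esub> (b \<odot>\<^bsub>C 0\<^esub> c)" "a \<in> carrier (KA \<gamma>)" "b \<in> bad \<gamma>" "c \<in> carrier (C 0)"
      by blast
    have "\<epsilon> h = a \<odot>\<^bsub>?R\<^esub> (b \<odot>\<^bsub>?R\<^esub> \<epsilon> c)"
      unfolding h(1)
      using graded_homD(4)[OF \<epsilon> h(2) C0.smult_closed[OF bc[OF h(3)] h(4)]] graded_homD(4)[OF \<epsilon> bc[OF h(3)] h(4)]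
      by (simp del: restrict_klr_simps)
    then show "\<epsilon> h \<in> {\<zero>\<^bsub>?R\<^esub>}" using bad_R[OF h(3) e.closed[OF h(4)]] R.smult_zero[OF h(2)] by simp
  qed
  then have \<epsilon>J: "\<epsilon> j = \<zero>\<^bsub>?R\<^esub>" if "j \<in> ?J" for j using that by blast
  obtain \<epsilon>' where \<epsilon>': "\<epsilon>' \<in> graded_hom (KA \<gamma>) (quot (C 0) ?J) ?R" "\<And>c. c \<in> carrier (C 0) \<Longrightarrow> \<epsilon>' (cl c) = \<epsilon> c"
    using quot_hom_factor[OF KA_gring C R Jg \<epsilon> \<epsilon>J] by blast
  have U: "graded_module (KA \<gamma>) (quot (C 0) ?J)" by (rule graded_module_quot[OF KA_gring C Jg])
  interpret U: gmodule "KA \<gamma>" "quot (C 0) ?J" by (rule gmoduleI[OF U])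
  have "\<exists>h\<in>graded_hom (KA \<gamma>) ?R (quot (C 0) ?J). \<forall>m\<in>carrier M. \<epsilon>' (h m) = m"
  proof (cases "ht D \<gamma> \<ge> 1")
    case True
    let ?T = "\<lambda>u. KC \<gamma> (x_gen (ht D \<gamma>)) \<odot>\<^bsub>quot (C 0) ?J\<^esub> u"
    have xC: "KC \<gamma> (x_gen (ht D \<gamma>)) \<in> carrier (KA \<gamma>)" by (rule KC_closed[OF last_x_FC[OF True]])
    have bad_U: "b \<odot>\<^bsub>quot (C 0) ?J\<^esub> u = \<zero>\<^bsub>quot (C 0) ?J\<^esub>" if b: "b \<in> bad \<gamma>" and u: "u \<in> carrier (quot (C 0) ?J)" for b u
    proof -
      obtain c where c: "c \<in> carrier (C 0)" "u = cl c" using u by (rule quot_carrierE)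
      have bcc: "b \<odot>\<^bsub>C 0\<^esub> c \<in> carrier (C 0)" by (rule C0.smult_closed[OF bc[OF b] c(1)])
      \<comment> \<open>A generator of J with a = 1; the quotient by J is killed by the bad
        idempotents for this reason.\<close>
      have "\<one>\<^bsub>KA \<gamma>\<^esub> \<odot>\<^bsub>C 0\<^esub> (b \<odot>\<^bsub>C 0\<^esub> c) \<in> ?J" using c(1) b KC_closed[OF free_carrier_one] by (intro C0.ann_gen) (simp_all add: KC_one)
      then have "b \<odot>\<^bsub>C 0\<^esub> c \<ominus>\<^bsub>C 0\<^esub> \<zero>\<^bsub>C 0\<^esub> \<in> ?J" using C0.smult_one[OF bcc] C0.minus_zero_right[OF bcc] by simp
      then have "cl (b \<odot>\<^bsub>C 0\<^esub> c) = cl \<zero>\<^bsub>C 0\<^esub>" by (subst cl_eq_iff) (simp_all add: bcc)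
      then show ?thesis using quot_hom(2)[OF KA_gring C Jg bc[OF b] c(1)] c(2) quot_zero by simp
    qed
    show ?thesis
    proof (rule rz_section[OF M, where T = ?T])
      show "poly_action (KA \<gamma>) (quot (C 0) ?J) ?T" by (rule last_x_action[OF U True bad_U])
      show "?T u \<in> homog (quot (C 0) ?J) (d + dz)" if "u \<in> homog (quot (C 0) ?J) d" for d u
        by (rule last_x_homog[OF U True bad_U that])
      show "poly_action.act (KA \<gamma>) (quot (C 0) ?J) ?T p u = \<zero>\<^bsub>quot (C 0) ?J\<^esub>"
        if "p \<in> cyc_gens \<gamma>" "u \<in> carrier (quot (C 0) ?J)" for p u
        by (rule last_x_rel[OF U True bad_U that])
      show "\<epsilon>' \<in> graded_hom (KA \<gamma>) (quot (C 0) ?J) ?R" by (rule \<epsilon>'(1))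
      have "\<epsilon>' ` cl ` carrier (C 0) = \<epsilon> ` carrier (C 0)" unfolding image_image using \<epsilon>'(2) by (rule image_cong[OF refl])
      then show "\<epsilon>' ` carrier (quot (C 0) ?J) = carrier M" using \<epsilon>_surj by (simp add: quot_carrier)
      show "\<epsilon>' (?T u) = RZ \<gamma> \<odot>\<^bsub>M\<^esub> \<epsilon>' u" if u: "u \<in> carrier (quot (C 0) ?J)" for u
        using graded_homD(4)[OF \<epsilon>'(1) xC u] RK_last_x[OF Q M True] graded_homD(1)[OF \<epsilon>'(1) u] by simp
    qed (rule lift')
  next
    case False
    have zM: "RZ \<gamma> \<odot>\<^bsub>M\<^esub> m \<in> carrier M" if "m \<in> carrier M" for m by (rule M.smult_closed[OF RZ_closed that])
    have ec: "\<epsilon> c \<in> carrier M" if "c \<in> carrier (C 0)" for c using e.closed[OF that] by simp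
    \<comment> \<open>There is no last x to play the part of z. The shift turns multiplication by z,
      which has degree \<open>dz\<close>, into a degree 0 map, so that z \<epsilon> can be lifted
      through \<epsilon> by projectivity of \<open>C 0\<close>.\<close>
    have shU: "graded_module (KA \<gamma>) (graded_shift (- dz) (C 0))" by (rule graded_module_shift[OF C])
    have shV: "graded_module (KA \<gamma>) (graded_shift (- dz) ?R)" by (rule graded_module_shift[OF R])
    have "\<epsilon> \<in> graded_hom (KA \<gamma>) (graded_shift (- dz) (C 0)) (graded_shift (- dz) ?R)"
      using graded_homD[OF \<epsilon>] by (intro graded_homI) simp_all
    moreover have "\<epsilon> ` carrier (graded_shift (- dz) (C 0)) = carrier (graded_shift (- dz) ?R)" using \<epsilon>_surj by simp
    moreover have "(\<lambda>c\<in>carrier (C 0). RZ \<gamma> \<odot>\<^bsub>M\<^esub> \<epsilon> c) \<in> graded_hom (KA \<gamma>) (C 0) (graded_shift (- dz) ?R)"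
    proof (rule graded_homI)
      fix d c assume c: "c \<in> homog (C 0) d"
      have "RZ \<gamma> \<odot>\<^bsub>M\<^esub> \<epsilon> c \<in> homog M (dz + d)"
        using M.smult_homog[OF RZ_homog] graded_homD(5)[OF \<epsilon> c] by simp
      then show "(\<lambda>c\<in>carrier (C 0). RZ \<gamma> \<odot>\<^bsub>M\<^esub> \<epsilon> c) c \<in> homog (graded_shift (- dz) ?R) d"
        using C0.homog_closed[OF c] by (simp add: add.commute)
    next
      fix a c assume a: "a \<in> carrier (KA \<gamma>)" and c: "c \<in> carrier (C 0)"
      have "RZ \<gamma> \<odot>\<^bsub>M\<^esub> (RK \<gamma> a \<odot>\<^bsub>M\<^esub> \<epsilon> c) = RK \<gamma> a \<odot>\<^bsub>M\<^esub> (RZ \<gamma> \<odot>\<^bsub>M\<^esub> \<epsilon> c)"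
        using M.smult_assoc1[OF RZ_closed RK_closed[OF a] ec[OF c]] M.smult_assoc1[OF RK_closed[OF a] RZ_closed ec[OF c]]
          RZ_central[OF RK_closed[OF a]] by simp
      then show "(\<lambda>c\<in>carrier (C 0). RZ \<gamma> \<odot>\<^bsub>M\<^esub> \<epsilon> c) (a \<odot>\<^bsub>C 0\<^esub> c)
          = a \<odot>\<^bsub>graded_shift (- dz) ?R\<^esub> (\<lambda>c\<in>carrier (C 0). RZ \<gamma> \<odot>\<^bsub>M\<^esub> \<epsilon> c) c"
        using graded_homD(4)[OF \<epsilon> a c] c C0.smult_closed[OF a c] by simp
    next
      fix c c' assume c: "c \<in> carrier (C 0)" "c' \<in> carrier (C 0)"
      show "(\<lambda>c\<in>carrier (C 0). RZ \<gamma> \<odot>\<^bsub>M\<^esub> \<epsilon> c) (c \<oplus>\<^bsub>C 0\<^esub> c') = (\<lambda>c\<in>carrier (C 0). RZ \<gamma> \<odot>\<^bsub>M\<^esub> \<epsilon> c) c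
          \<oplus>\<^bsub>graded_shift (- dz) ?R\<^esub> (\<lambda>c\<in>carrier (C 0). RZ \<gamma> \<odot>\<^bsub>M\<^esub> \<epsilon> c) c'"
        using c e.add[OF c] M.smult_r_distr[OF RZ_closed ec[OF c(1)] ec[OF c(2)]] by simp
    qed (simp_all add: ec zM)
    \<comment> \<open>T is an operator on \<open>C 0\<close> over the action of z on M. It is linear
      over R(\<gamma>), and this is all that an action of polynomials requires.\<close>
    ultimately obtain T where T: "T \<in> graded_hom (KA \<gamma>) (C 0) (graded_shift (- dz) (C 0))"
      "\<forall>c\<in>carrier (C 0). \<epsilon> (T c) = (\<lambda>c\<in>carrier (C 0). RZ \<gamma> \<odot>\<^bsub>M\<^esub> \<epsilon> c) c"
      using projective_lifts[OF KA_gring proj shU shV, of 0] unfolding lifts_def by blast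
    have Pa: "poly_action (KA \<gamma>) (C 0) T"
      using graded_homD(1,3,4)[OF T(1)] by unfold_locales simp_all
    have "\<exists>h\<in>graded_hom (KA \<gamma>) ?R (C 0). \<forall>m\<in>carrier M. \<epsilon> (h m) = m"
    proof (rule rz_section[OF M Pa])
      show "T u \<in> homog (C 0) (d + dz)" if "u \<in> homog (C 0) d" for d u using graded_homD(5)[OF T(1) that] by simp
      \<comment> \<open>In height 0 there are no cyclotomic generators, so nothing has to be
        checked.\<close>
      show "poly_action.act (KA \<gamma>) (C 0) T p u = \<zero>\<^bsub>C 0\<^esub>" if "p \<in> cyc_gens \<gamma>" for p u
        using that False by (auto simp: cyc_gens_def)
      show "\<epsilon> (T u) = RZ \<gamma> \<odot>\<^bsub>M\<^esub> \<epsilon> u" if "u \<in> carrier (C 0)" for u using T(2) that by simp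
    qed (rule \<epsilon> \<epsilon>_surj lift, assumption?)+
    then obtain h where h: "h \<in> graded_hom (KA \<gamma>) ?R (C 0)" "\<forall>m\<in>carrier M. \<epsilon> (h m) = m" by blast
    have hc: "h m \<in> carrier (C 0)" if "m \<in> carrier M" for m using graded_homD(1)[OF h(1)] that by simp
    \<comment> \<open>The section into \<open>C 0\<close> is composed with the projection to the
      quotient, to match the form reached in the other case.\<close>
    show ?thesis
      using graded_hom_compose[OF h(1) quot_hom(1)[OF KA_gring C Jg] R] \<epsilon>'(2) h(2) hc
      by (intro bexI[of _ "\<lambda>m\<in>carrier ?R. (\<lambda>c\<in>carrier (C 0). cl c) (h m)"]) simp_all
  qed
  then obtain h where h: "h \<in> graded_hom (KA \<gamma>) ?R (quot (C 0) ?J)" "\<And>m. m \<in> carrier M \<Longrightarrow> \<epsilon>' (h m) = m" by blast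
  \<comment> \<open>h m is a coset in \<open>C 0\<close>; every representative of it lies over m
    because \<epsilon> vanishes on J.\<close>
  have \<epsilon>h: "\<epsilon> s = m" if m: "m \<in> carrier ?R" and s: "s \<in> h m" for m s
  proof -
    obtain c where c: "c \<in> carrier (C 0)" "h m = cl c" using graded_homD(1)[OF h(1) m] by (rule quot_carrierE)
    have sc: "s \<in> carrier (C 0)" using s c cl_subset by blast
    have "s \<ominus>\<^bsub>C 0\<^esub> c \<in> ?J" using s mem_cl_iff[OF c(1) sc] c(2) by simp
    then have "cl s = h m" using cl_eq_iff[OF sc c(1)] c(2) by simp
    then show ?thesis using \<epsilon>'(2)[OF sc] h(2)[of m] m by simp
  qed
  have fk: "f y = \<zero>\<^bsub>N\<^esub>" if "y \<in> carrier (C 1)" "\<delta> 0 y = \<zero>\<^bsub>C 0\<^esub>" for y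
  proof -
    have "y \<in> \<delta> 1 ` carrier (C 2)" unfolding ex1[symmetric] using that by (simp add: hom_kernel_def)
    then show ?thesis using f0 by auto
  qed
  have \<delta>0: "\<delta> 0 \<in> graded_hom (KA \<gamma>) (C 1) (C 0)" using \<delta>[of 0] by simp
  show ?thesis
    by (rule extend_cocycle[OF KA_gring C C R NN \<delta>0 \<epsilon> ex0 f _ bad_homog[of \<gamma>]])
      (rule fk bad_idem bad_R bad_N h(1) \<epsilon>h; assumption)+
qed

lemma mod_z_quot: "mod_z D Q i \<gamma> M = quot (restrict_klr D Q i \<gamma> M) ((\<lambda>x. RZ \<gamma> \<odot>\<^bsub>M\<^esub> x) ` carrier M)"
  by (simp add: mod_z_def)

text \<open>z is central, so its image is a submodule, and z is homogeneous, so the image is spanned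
  by the multiples of homogeneous elements.\<close>

lemma graded_submodule_z:
  assumes M: "graded_module (RA \<gamma>) M"
  shows "graded_submodule (KA \<gamma>) (restrict_klr D Q i \<gamma> M) ((\<lambda>x. RZ \<gamma> \<odot>\<^bsub>M\<^esub> x) ` carrier M)"
proof -
  let ?R = "restrict_klr D Q i \<gamma> M" and ?Z = "(\<lambda>x. RZ \<gamma> \<odot>\<^bsub>M\<^esub> x) ` carrier M"
  interpret M: gmodule "RA \<gamma>" M by (rule gmoduleI[OF M])
  interpret R: gmodule "KA \<gamma>" ?R by (rule gmoduleI[OF graded_module_restrict[OF M]])
  interpret z: additive_map ?R ?R "\<lambda>m. RZ \<gamma> \<odot>\<^bsub>M\<^esub> m"
    by unfold_locales (simp_all add: M.smult_closed RZ_closed M.smult_r_distr)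
  have Z: "subgroup ?Z (add_monoid ?R)"
  proof (rule R.subgroupI')
    show "?Z \<subseteq> carrier ?R" using z.closed by auto
    show "\<zero>\<^bsub>?R\<^esub> \<in> ?Z" using z.zero R.zero_closed by (intro image_eqI[of _ _ "\<zero>\<^bsub>?R\<^esub>"]) simp_all
    show "a \<oplus>\<^bsub>?R\<^esub> b \<in> ?Z" if ab: "a \<in> ?Z" "b \<in> ?Z" for a b
    proof -
      obtain x y where xy: "x \<in> carrier ?R" "y \<in> carrier ?R" "a = RZ \<gamma> \<odot>\<^bsub>M\<^esub> x" "b = RZ \<gamma> \<odot>\<^bsub>M\<^esub> y" using ab by auto
      then show ?thesis using z.add[OF xy(1,2)] R.a_closed[OF xy(1,2)] by (intro image_eqI[of _ _ "x \<oplus>\<^bsub>?R\<^esub> y"]) simp_all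
    qed
    show "\<ominus>\<^bsub>?R\<^esub> a \<in> ?Z" if a: "a \<in> ?Z" for a
    proof -
      obtain x where x: "x \<in> carrier ?R" "a = RZ \<gamma> \<odot>\<^bsub>M\<^esub> x" using a by auto
      then show ?thesis using z.neg[OF x(1)] R.a_inv_closed[OF x(1)] by (intro image_eqI[of _ _ "\<ominus>\<^bsub>?R\<^esub> x"]) simp_all
    qed
  qed
  moreover have "a \<odot>\<^bsub>?R\<^esub> n \<in> ?Z" if a: "a \<in> carrier (KA \<gamma>)" and n: "n \<in> ?Z" for a n
  proof -
    obtain x where x: "x \<in> carrier M" "n = RZ \<gamma> \<odot>\<^bsub>M\<^esub> x" using n by auto
    have "RK \<gamma> a \<odot>\<^bsub>M\<^esub> n = RZ \<gamma> \<odot>\<^bsub>M\<^esub> (RK \<gamma> a \<odot>\<^bsub>M\<^esub> x)"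
      using M.smult_assoc1[OF RZ_closed RK_closed[OF a] x(1)] M.smult_assoc1[OF RK_closed[OF a] RZ_closed x(1)]
        RZ_central[OF RK_closed[OF a]] x(2) by simp
    then show ?thesis using M.smult_closed[OF RK_closed[OF a] x(1)] by simp
  qed
  moreover have "?Z = generate (add_monoid ?R) (\<Union>d. ?Z \<inter> homog ?R d)" (is "_ = ?G")
  proof
    have sub: "(\<Union>d. ?Z \<inter> homog ?R d) \<subseteq> carrier ?R" using R.homog_closed by blast
    note G = R.generate_subgroup[OF sub]
    show "?G \<subseteq> ?Z" by (rule R.generate_least[OF Z]) blast
    have "RZ \<gamma> \<odot>\<^bsub>M\<^esub> x \<in> ?G" if "x \<in> carrier ?R" for x
      using that
    proof (induction x rule: R.induct)
      case (homog d h)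
      have "RZ \<gamma> \<odot>\<^bsub>M\<^esub> h \<in> ?Z \<inter> homog ?R (dz + d)"
        using M.smult_homog[OF RZ_homog] homog R.homog_closed[OF homog] by simp
      then show ?case by (intro R.generate_gen) blast
    next
      case (add x y)
      then show ?case using R.subgroup_add_closed[OF G add(3,4)] z.add[OF add(1,2)] by simp
    qed
    then show "?Z \<subseteq> ?G" by auto
  qed
  ultimately show ?thesis unfolding graded_submodule_def by blast
qed

lemma graded_module_mod_z: "graded_module (RA \<gamma>) M \<Longrightarrow> graded_module (KA \<gamma>) (mod_z D Q i \<gamma> M)"
  unfolding mod_z_quot by (rule graded_module_quot[OF KA_gring graded_module_restrict graded_submodule_z])

end


context rz
begin

lemma bad_mod_z:
  assumes Q: "is_qparam D Q" and M: "graded_module (RA \<gamma>) M" and b: "b \<in> bad \<gamma>" and n: "n \<in> carrier (mod_z D Q i \<gamma> M)"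
  shows "b \<odot>\<^bsub>mod_z D Q i \<gamma> M\<^esub> n = \<zero>\<^bsub>mod_z D Q i \<gamma> M\<^esub>"
proof -
  let ?R = "restrict_klr D Q i \<gamma> M" and ?Z = "(\<lambda>x. RZ \<gamma> \<odot>\<^bsub>M\<^esub> x) ` carrier M"
  note R = graded_module_restrict[OF M] and Z = graded_submodule_z[OF M]
  interpret M: gmodule "RA \<gamma>" M by (rule gmoduleI[OF M])
  interpret R: gmodule "KA \<gamma>" ?R by (rule gmoduleI[OF R])
  interpret ag_quot ?R ?Z
    by (intro ag_quot.intro ag_quot_axioms.intro R.abelian_group_axioms conjunct1[OF Z[unfolded graded_submodule_def]])
  have bc: "b \<in> carrier (KA \<gamma>)" by (rule gring.homog_carrier[OF KA_gring subsetD[OF bad_homog b]])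
  obtain m where m: "m \<in> carrier ?R" "n = cl m" using n unfolding mod_z_quot by (rule quot_carrierE)
  have "b \<odot>\<^bsub>?R\<^esub> m = \<zero>\<^bsub>?R\<^esub>" using RK_bad_zero[OF Q b] M.smult_l_zero m(1) by simp
  then show ?thesis unfolding mod_z_quot m(2) quot_hom(2)[OF KA_gring R Z bc m(1)] quot_zero by simp
qed

text \<open>The sum is treated degree by degree. In degree d the shift is moved from the resolution
  to the coefficients, where the bad idempotents still act by zero, so one extension lemma for the
  given resolution covers all degrees.\<close>

theorem trivial_Ext_mod_z:
  fixes M :: "(('i, 'k) rz, 'x) graded" and C :: "nat \<Rightarrow> (('i, 'k) klr_free set, 'r) graded"
  assumes Q: "is_qparam D Q" and M: "graded_module (RA \<gamma>) M"
    and lift: "\<And>V :: (('i, 'k) rz, 'r) graded. graded_module (RA \<gamma>) V \<Longrightarrow> lifts (RA \<gamma>) M V M"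
    and lift': "\<And>V :: (('i, 'k) rz, 'r set) graded. graded_module (RA \<gamma>) V \<Longrightarrow> lifts (RA \<gamma>) M V M"
    and res: "projective_resolution (KA \<gamma>) (restrict_klr D Q i \<gamma> M) C \<delta> \<epsilon>"
  shows "trivial_group (Ext_group (KA \<gamma>) C \<delta> (mod_z D Q i \<gamma> M) 1)"
  unfolding Ext_group_def
proof (rule trivial_sum_group)
  fix d :: int
  let ?N = "mod_z D Q i \<gamma> M" and ?C = "\<lambda>n. graded_shift d (C n)"
  have proj: "graded_projective (KA \<gamma>) (C n)" and \<delta>: "\<delta> n \<in> graded_hom (KA \<gamma>) (C (Suc n)) (C n)"
    and ex1: "hom_kernel (C 1) (C 0) (\<delta> 0) = \<delta> 1 ` carrier (C 2)" for n
    using res unfolding projective_resolution_def numeral_2_eq_2 One_nat_def by simp_all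
  have C: "graded_module (KA \<gamma>) (?C n)" for n using proj[of n] graded_module_shift[of "KA \<gamma>" "C n" d] by (simp add: graded_projective_def)
  have N: "graded_module (KA \<gamma>) ?N" by (rule graded_module_mod_z[OF M])
  have \<delta>': "\<delta> n \<in> graded_hom (KA \<gamma>) (?C (Suc n)) (?C n)" for n
    using graded_homD[OF \<delta>[of n]] by (intro graded_homI) simp_all
  have dd: "\<delta> 0 (\<delta> 1 y) = \<zero>\<^bsub>C 0\<^esub>" if "y \<in> carrier (C 2)" for y
  proof -
    have "\<delta> 1 y \<in> hom_kernel (C 1) (C 0) (\<delta> 0)" unfolding ex1 using that by simp
    then show ?thesis by (simp add: hom_kernel_def)
  qed
  have iff: "f \<in> cocycles (KA \<gamma>) ?C \<delta> ?N 1 \<longleftrightarrow>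
      f \<in> graded_hom (KA \<gamma>) (?C 1) ?N \<and> (\<forall>y\<in>carrier (C 2). f (\<delta> 1 y) = \<zero>\<^bsub>?N\<^esub>)" for f
    using cocycle_iff[of \<delta> 1 "KA \<gamma>" ?C f ?N, OF \<delta>'] by (simp add: numeral_2_eq_2)
  have "coboundaries (KA \<gamma>) ?C \<delta> ?N 1 = cocycles (KA \<gamma>) ?C \<delta> ?N 1" (is "?B = ?Z")
  proof
    show "?B \<subseteq> ?Z"
    proof
      fix f assume "f \<in> ?B"
      then obtain g where g: "g \<in> graded_hom (KA \<gamma>) (?C 0) ?N" "f = (\<lambda>x\<in>carrier (?C 1). g (\<delta> 0 x))"
        by (auto simp: coboundaries_def compose_def)
      interpret C0: gmodule "KA \<gamma>" "?C 0" by (rule gmoduleI[OF C])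
      interpret N: gmodule "KA \<gamma>" ?N by (rule gmoduleI[OF N])
      interpret g: additive_map "?C 0" ?N g
        by (rule graded_hom_additive[OF g(1) C0.abelian_group_axioms N.abelian_group_axioms])
      have "f \<in> graded_hom (KA \<gamma>) (?C 1) ?N"
        unfolding g(2) using \<delta>'[of 0] g(1) C[of 1] by (intro graded_hom_compose) simp_all
      moreover have "f (\<delta> 1 y) = \<zero>\<^bsub>?N\<^esub>" if y: "y \<in> carrier (C 2)" for y
        using graded_homD(1)[OF \<delta>[of 1]] y dd[OF y] g.zero by (simp add: g(2) numeral_2_eq_2)
      ultimately show "f \<in> ?Z" using iff by blast
    qed
    show "?Z \<subseteq> ?B"
    proof
      fix f assume "f \<in> ?Z"
      then have f: "f \<in> graded_hom (KA \<gamma>) (?C 1) ?N" "\<And>y. y \<in> carrier (C 2) \<Longrightarrow> f (\<delta> 1 y) = \<zero>\<^bsub>?N\<^esub>"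
        using iff by blast+
      \<comment> \<open>From here the cocycle on the shifted resolution is regarded as one on the
        original resolution with values in N shifted by - d; the extension found there is moved back
        at the end.\<close>
      have N': "graded_module (KA \<gamma>) (graded_shift (- d) ?N)" by (rule graded_module_shift[OF N])
      have f': "f \<in> graded_hom (KA \<gamma>) (C 1) (graded_shift (- d) ?N)" using f(1) unfolding graded_hom_shift .
      have bad': "b \<odot>\<^bsub>graded_shift (- d) ?N\<^esub> n = \<zero>\<^bsub>graded_shift (- d) ?N\<^esub>"
        if "b \<in> bad \<gamma>" "n \<in> carrier (graded_shift (- d) ?N)" for b n
        using bad_mod_z[OF Q M that(1)] that(2) by simp
      have f0': "f (\<delta> 1 y) = \<zero>\<^bsub>graded_shift (- d) ?N\<^esub>" if "y \<in> carrier (C 2)" for y using f(2)[OF that] by simp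
      have "\<exists>g\<in>graded_hom (KA \<gamma>) (C 0) (graded_shift (- d) ?N). \<forall>y\<in>carrier (C 1). g (\<delta> 0 y) = f y"
        by (rule cocycle_extends[OF Q M _ _ res N' _ f']) (rule lift lift' bad' f0'; assumption)+
      then obtain g where g: "g \<in> graded_hom (KA \<gamma>) (C 0) (graded_shift (- d) ?N)" "\<forall>y\<in>carrier (C 1). g (\<delta> 0 y) = f y"
        by blast
      have "f = compose (carrier (?C 1)) g (\<delta> 0)"
        using g(2) graded_homD(2)[OF f'] by (auto simp: compose_def restrict_def fun_eq_iff)
      moreover have "g \<in> graded_hom (KA \<gamma>) (?C 0) ?N" using g(1) unfolding graded_hom_shift .
      ultimately show "f \<in> ?B" by (auto simp: coboundaries_def)
    qed
  qed
  then show "trivial_group (ext_group (KA \<gamma>) ?C \<delta> ?N 1)"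
    by (rule trivial_ext_group[where P = ?C, OF C N \<delta>'])
qed

end

theorem proposition1p5:
  fixes D :: "('i, 'p::ab_group_add) root_datum"
    and Q :: "('i, 'k::field) qparam"
    and L :: "'i \<Rightarrow> nat \<Rightarrow> (('i, 'k) klr_free set, 'l) graded"
    and P :: "'i \<Rightarrow> nat \<Rightarrow> (('i, 'k) klr_free set, 'c) graded"
    and x :: "'p \<Rightarrow> 'p" and i :: 'i and ks :: "'i list" and \<beta> :: 'p
    and Mhat :: "(('i, 'k) rz, 'x) graded"
    and C :: "nat \<Rightarrow> (('i, 'k) klr_free set, 'r) graded"
    and \<delta> :: "nat \<Rightarrow> 'r \<Rightarrow> 'r" and \<epsilon> :: "'r \<Rightarrow> 'x"
  assumes "is_root_datum D" and "is_qparam D Q"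
    and "\<And>j n. graded_simple (klr_algebra D Q (zscale (int n) (sroot D j))) (L j n)"
    and "\<And>j n. self_dual (klr_algebra D Q (zscale (int n) (sroot D j))) (L j n)"
    and "\<And>j n. projective_cover (klr_algebra D Q (zscale (int n) (sroot D j))) (P j n) (L j n)"
    and "x \<in> weyl_group D" and "reduced_expression D x ks"
    and "\<beta> = fund D i - x (fund D i)"
    and "det_hat D Q P i ks Mhat"
    and "projective_resolution (klr_algebra D Q \<beta>) (restrict_klr D Q i \<beta> Mhat) C \<delta> \<epsilon>"
  shows "trivial_group (Ext_group (klr_algebra D Q \<beta>) C \<delta> (mod_z D Q i \<beta> Mhat) 1)"
proof -
  interpret rz D Q i by unfold_locales (rule assms(1))
  have P: "graded_projective (KA (zscale (int n) (sroot D j))) (P j n)" for j n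
    using assms(5) by (simp add: projective_cover_def)
  have ks: "x = refl_word D ks" "reduced ks" using assms(7) by (simp_all add: reduced_expression_def reduced_def)
  have \<beta>: "\<beta> = word_defect D i ks" using assms(8) ks(1) by (simp add: word_defect_def)
  have M: "graded_module (RA \<beta>) Mhat"
    using assms(9) unfolding \<beta> by cases (simp_all add: word_defect_def refl_word_def)
  show ?thesis
    \<comment> \<open>Both lifting premises are instances of \<open>det_hat_lifts\<close>, with the
      source once on the type \<open>'r\<close> of the resolution and once on \<open>'r set\<close>
      for its quotient; the target is \<open>Mhat\<close> both times.\<close>
    by (rule trivial_Ext_mod_z[OF assms(2) M _ _ assms(10)]) (use det_hat_lifts[OF P assms(9) ks(2), folded \<beta>, OF _ M] in blast)+
qed

end
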